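(* Let $n,n'\ge 5$ and $p,p'$ be integers with $1\le p<\frac n2-1$ and $1\le p'<\frac{n'}2-1$. The Sierpiński carpets $F_{n,p}$ and $F_{n',p'}$ are quasisymmetrically equivalent (there is a quasisymmetric homeomorphism from $F_{n,p}$ onto $F_{n',p'}$) if and only if $(n,p)=(n',p')$.
   Context: Construction of $F_{n,p}$ ($n\ge5$, $1\le p<\frac n2-1$ integers): Let $Q^{(0)}_{n,p}=[0,1]\times[0,1]\subset\mathbb{R}^2$. Subdivide it into $n^2$ closed subsquares of side length $1/n$ and remove the interiors of the four subsquares $[a,a+\frac1n]\times[b,b+\frac1n]$ with $a,b\in\{\frac pn,\,1-\frac{p+1}{n}\}$ (each is at distance $\sqrt2\,p/n$ from one of the four corners of the unit square). The result is $Q^{(1)}_{n,p}$, a union of $n^2-4$ squares of side length $1/n$. Inductively, $Q^{(k+1)}_{n,p}$ is obtained from $Q^{(k)}_{n,p}$ by applying the same (scaled) subdivision and removal to each of the remaining squares of side length $1/n^k$. Then $F_{n,p}=\bigcap_{k\ge0}Q^{(k)}_{n,p}$, with the Euclidean metric (bi-Lipschitz equivalent on $F_{n,p}$ to the spherical metric). A homeomorphism $f:X\to Y$ of metric spaces is quasisymmetric if there is a homeomorphism $\eta:[0,\infty)\to[0,\infty)$ with $\frac{d_Y(f(x),f(y))}{d_Y(f(x),f(z))}\le\eta\left(\frac{d_X(x,y)}{d_X(x,z)}\right)$ for all $x,y,z\in X$, $x\ne z$. *)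

theory Defs
  imports "HOL-Analysis.Analysis"
begin

definition square :: "real \<times> real \<Rightarrow> real \<Rightarrow> (real \<times> real) set" where
  "square c s = cbox c (c + (s, s))"

text \<open>Squares are represented by their lower left corners.  The next two functions give the corners
  of all \<open>n\<^sup>2\<close> subsquares, and of the four removed subsquares, of \<open>square c s\<close>.\<close>

definition sub_corners :: "nat \<Rightarrow> real \<times> real \<Rightarrow> real \<Rightarrow> (real \<times> real) set" where
  "sub_corners n c s =
     {c + s *\<^sub>R (real i / real n, real j / real n) | i j. i < n \<and> j < n}"

definition hole_corners :: "nat \<Rightarrow> nat \<Rightarrow> real \<times> real \<Rightarrow> real \<Rightarrow> (real \<times> real) set" where
  "hole_corners n p c s =
     {c + s *\<^sub>R (a, b) | a b.
        a \<in> {real p / real n, 1 - (real p + 1) / real n} \<and>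
        b \<in> {real p / real n, 1 - (real p + 1) / real n}}"

text \<open>The corners of the squares of side length \<open>1 / n ^ k\<close> remaining after \<open>k\<close> steps.\<close>

primrec carpet_corners :: "nat \<Rightarrow> nat \<Rightarrow> nat \<Rightarrow> (real \<times> real) set" where
  "carpet_corners n p 0 = {(0, 0)}"
| "carpet_corners n p (Suc k) =
     (\<Union>c \<in> carpet_corners n p k.
        sub_corners n c (1 / real n ^ k) - hole_corners n p c (1 / real n ^ k))"

primrec carpet_stage :: "nat \<Rightarrow> nat \<Rightarrow> nat \<Rightarrow> (real \<times> real) set" where
  "carpet_stage n p 0 = {0..1} \<times> {0..1}"
| "carpet_stage n p (Suc k) =
     (\<Union>c \<in> carpet_corners n p k.
        square c (1 / real n ^ k) -
        (\<Union>h \<in> hole_corners n p c (1 / real n ^ k). interior (square h (1 / real n ^ Suc k))))"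

definition carpet :: "nat \<Rightarrow> nat \<Rightarrow> (real \<times> real) set" where
  "carpet n p = (\<Inter>k. carpet_stage n p k)"

text \<open>A homeomorphism \<open>\<eta>\<close> of the half-line onto itself is automatically increasing with \<open>\<eta> 0 = 0\<close>.\<close>

definition quasisymmetric ::
    "'a::metric_space set \<Rightarrow> 'b::metric_space set \<Rightarrow> ('a \<Rightarrow> 'b) \<Rightarrow> bool" where
  "quasisymmetric X Y f \<longleftrightarrow>
     (\<exists>g. homeomorphism X Y f g) \<and>
     (\<exists>(\<eta> :: real \<Rightarrow> real) \<theta>. homeomorphism {0..} {0..} \<eta> \<theta> \<and>
        (\<forall>x\<in>X. \<forall>y\<in>X. \<forall>z\<in>X. x \<noteq> z \<longrightarrow>
           dist (f x) (f y) / dist (f x) (f z) \<le> \<eta> (dist x y / dist x z)))"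

definition quasisymmetrically_equivalent ::
    "'a::metric_space set \<Rightarrow> 'b::metric_space set \<Rightarrow> bool" where
  "quasisymmetrically_equivalent X Y \<longleftrightarrow> (\<exists>f. quasisymmetric X Y f)"

end

theory Submission
  imports Defs
begin

text \<open>
The peripheral circles of a carpet are its nonseparating Jordan curves, so homeomorphisms permute them, and the energy
\<open>\<Sum> (osc g C)\<^sup>2\<close> of a function \<open>g\<close>, summed over all peripheral circles \<open>C\<close>, is a topological invariant. It is a discrete
version of transboundary modulus once \<open>g\<close> is restricted to \<^emph>\<open>tame\<close> functions, those whose squared oscillations over separated
families of small balls have small sum. Quasisymmetries preserve tameness, and Lipschitz functions are tame because the carpet
has area zero. Hence the capacity of a pair of peripheral circles, the infimum of the energy over tame functions that are 0 on
one circle and 1 on the other, is a quasisymmetry invariant.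

Transplanting functions by folding the carpet into a subsquare shows that the pairs formed by the outer circle and a
first-level circle have maximal capacity: in any other pair, apart from siblings, a transplanted minimising sequence would be
constant near some circles, which contradicts the first variation along a strip of cells between an affected and an unaffected
circle. Together with polarization with respect to the reflections of the square, the same strip argument shows that, up to
symmetries, a quasisymmetry preserves the outer circle, each of the four first-level circles and the four corners.

Finally, a tame function that grows by 1 from the left to the right side satisfies \<open>\<Sum> side C * osc g C \<ge> 1\<close>. Applied to the
pullback of a coordinate this gives \<open>\<Sum> side C * side (f C) \<ge> 1\<close>, whereas the squares of the sides of all holes add up to at most 1.
Equality in the Cauchy-Schwarz inequality yields \<open>side (f C) = side C\<close>, so \<open>n = n'\<close>; the same inequality on the row of cells to the
left of a first-level circle yields \<open>p' \<le> p\<close>, and symmetry does the rest.\<close>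

text \<open>Energy alone cannot give a useful capacity: collapsing all peripheral circles yields a
  sphere, so there are nonconstant continuous functions that are constant on every circle. Tameness
  excludes them, because it makes the variation over deep cells negligible along an averaged line.
  It contains uniform continuity (one-ball families) but not Lipschitz continuity, which
  quasisymmetries destroy. No convergence of minimising sequences on the carpet itself is available;
  only the vectors of oscillations converge, in l2, to some rho. So a minimiser is replaced by
  statements about eventually or frequently all k, and unique continuation by a quantitative first
  variation along a row of squares. Its cutoff error must be of smaller order than the square of the
  truncation level, so the cutoff is squared and only circles with small positive rho enter it. A
  further obstacle: a quasisymmetry conjugates a reflection of one carpet to an involution of the
  other that need not be isometric nor commute with its symmetries. Averaging over iterates makes a
  minimising sequence nearly antisymmetric for both.\<close>

type_synonym pt = "real \<times> real"

section \<open>Oscillation and tame functions\<close>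

definition osc :: "('a => real) => 'a set => real" where
 "osc g A = diameter (g ` A)"

lemma osc_nonneg: "bounded (g ` A) ==> 0 <= osc g A"
 unfolding osc_def by (rule diameter_ge_0)

lemma osc_bound:
 assumes "bounded (g ` A)" "x \<in> A" "y \<in> A"
 shows "\<bar>g x - g y\<bar> <= osc g A"
 using diameter_bounded_bound[OF assms(1), of "g x" "g y"] assms(2,3)
 by (simp add: osc_def dist_real_def)

lemma osc_le:
 assumes "0 <= c" "!!x y. x \<in> A ==> y \<in> A ==> g x - g y <= c"
 shows "osc g A <= c"
 unfolding osc_def
proof (rule diameter_le)
 show "g ` A ~= {} | 0 <= c" using assms(1) by simp
 fix s t assume "s \<in> g ` A" "t \<in> g ` A"
 then obtain x y where "x \<in> A" "s = g x" "y \<in> A" "t = g y" by auto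
 thus "norm (s - t) <= c" using assms(2)[of x y] assms(2)[of y x] by auto
qed

lemma osc_mono:
 assumes "bounded (g ` B)" "A \<subseteq> B"
 shows "osc g A <= osc g B"
 unfolding osc_def by (rule diameter_subset) (use assms in auto)

lemma osc_cong: "(!!x. x \<in> A ==> f x = g x) ==> osc f A = osc g A"
 unfolding osc_def by (metis image_cong)

lemma osc_const: "(!!x. x \<in> A ==> g x = c) ==> osc g A = 0"
proof -
 assume *: "!!x. x \<in> A ==> g x = c"
 have "g ` A \<subseteq> {c}" using * by auto
 hence "g ` A = {} | g ` A = {c}" by auto
 thus ?thesis unfolding osc_def by auto
qed

lemma osc_comp: "osc (g \<circ> f) A = osc g (f ` A)"
 by (simp add: osc_def image_comp)

lemma osc_le_comb:
 assumes "bounded (f ` A)" "bounded (g ` A)" "0 <= K"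
  and "!!x y. x \<in> A ==> y \<in> A ==> \<bar>h x - h y\<bar> <= K * (\<bar>f x - f y\<bar> + \<bar>g x - g y\<bar>)"
 shows "osc h A <= K * (osc f A + osc g A)"
proof (rule osc_le)
 show "0 <= K * (osc f A + osc g A)" by (intro mult_nonneg_nonneg add_nonneg_nonneg osc_nonneg assms)
 fix x y assume xy: "x \<in> A" "y \<in> A"
 have "h x - h y <= K * (\<bar>f x - f y\<bar> + \<bar>g x - g y\<bar>)" using assms(4)[OF xy] by simp
 also have "... <= K * (osc f A + osc g A)"
  by (intro mult_left_mono add_mono osc_bound assms xy)
 finally show "h x - h y <= K * (osc f A + osc g A)" .
qed

text \<open>Disjointness of balls in a form that quasisymmetries respect: after shrinking by a
  factor depending on \<open>L\<close> the balls are disjoint, and control of distance ratios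
  carries the condition over with another \<open>L\<close>. Since both orders of a pair are
  compared, nonnegative radii force distinct centres.\<close>

definition sep :: "real => ('a::metric_space \<times> real) set => bool" where
 "sep L S \<longleftrightarrow> (\<forall>(x,r)\<in>S. \<forall>(y,s)\<in>S. (x,r) ~= (y,s) --> r <= L * dist x y)"

lemma sepD: "sep L S ==> (x,r) \<in> S ==> (y,s) \<in> S ==> (x,r) ~= (y,s) ==> r <= L * dist x y"
 unfolding sep_def by fast

lemma sepI: "(!!x r y s. (x,r) \<in> S ==> (y,s) \<in> S ==> (x,r) ~= (y,s) ==> r <= L * dist x y) ==> sep L S"
 unfolding sep_def by fast

lemma sep_subset: "sep L S ==> T \<subseteq> S ==> sep L T"
 by (rule sepI) (erule sepD, auto)

text \<open>The square sums must tend to 0 with the mesh m, for every separation constant. A family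
  with a single ball shows that this includes uniform continuity; for Lipschitz functions it follows
  once the square sums of the radii tend to 0, which \<open>sep_area\<close> derives from zero
  area.\<close>

definition tame :: "'a::metric_space set => ('a => real) => bool" where
 "tame X g \<longleftrightarrow> bounded (g ` X) &
   (\<forall>L. \<forall>dl>0. \<exists>m>0. \<forall>S. finite S & S \<subseteq> X \<times> {0..m} & sep L S -->
    (\<Sum>(x,r)\<in>S. (osc g (X \<inter> cball x r))^2) <= dl)"

lemma tame_bounded: "tame X g ==> bounded (g ` X)"
 unfolding tame_def by blast

lemma tame_bounded_sub: "tame X g ==> A \<subseteq> X ==> bounded (g ` A)"
 by (meson bounded_subset image_mono tame_bounded)

lemma tameE:
 assumes "tame X g" "dl > 0"
 obtains m where "m > 0" "!!S. finite S ==> S \<subseteq> X \<times> {0..m} ==> sep L S ==>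
    (\<Sum>(x,r)\<in>S. (osc g (X \<inter> cball x r))^2) <= dl"
 using assms unfolding tame_def by metis

text \<open>Common source of the closure properties: only oscillations on small balls are compared,
  so \<open>h\<close> need not vary pointwise less than \<open>f\<close> and \<open>g\<close>.
  Transplanted and polarized functions require this generality.\<close>

lemma tame_dom:
 assumes g: "tame X f" "tame X g" and K: "0 <= K" and b: "bounded (h ` X)"
  and r0: "0 < r0"
  and d: "!!x r. x \<in> X ==> 0 <= r ==> r <= r0 ==>
    osc h (X \<inter> cball x r) <= K * (osc f (X \<inter> cball x r) + osc g (X \<inter> cball x r))"
 shows "tame X h"
 unfolding tame_def
proof (intro conjI allI impI b)
 fix L dl :: real assume "dl > 0"
 \<comment> \<open>The squares cost 2 * K^2 * (eps + eps); the added 1 covers K = 0.\<close>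
 define eps where "eps = dl / (4 * (K^2 + 1))"
 have e: "eps > 0" unfolding eps_def using \<open>dl > 0\<close> by (simp add: add_nonneg_pos)
 obtain m1 where m1: "m1 > 0" "!!S. finite S ==> S \<subseteq> X \<times> {0..m1} ==> sep L S ==>
    (\<Sum>(x,r)\<in>S. (osc f (X \<inter> cball x r))^2) <= eps" using tameE[OF g(1) e] by metis
 obtain m2 where m2: "m2 > 0" "!!S. finite S ==> S \<subseteq> X \<times> {0..m2} ==> sep L S ==>
    (\<Sum>(x,r)\<in>S. (osc g (X \<inter> cball x r))^2) <= eps" using tameE[OF g(2) e] by metis
 define m where "m = min r0 (min m1 m2)"
 have "(\<Sum>(x,r)\<in>S. (osc h (X \<inter> cball x r))^2) <= dl" if S: "finite S" "S \<subseteq> X \<times> {0..m}" "sep L S" for S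
 proof -
  have S1: "S \<subseteq> X \<times> {0..m1}" and S2: "S \<subseteq> X \<times> {0..m2}" using S(2) unfolding m_def by auto
  have "(\<Sum>(x,r)\<in>S. (osc h (X \<inter> cball x r))^2) \<le>
    (\<Sum>z\<in>S. 2 * K^2 * ((osc f (X \<inter> cball (fst z) (snd z)))^2 + (osc g (X \<inter> cball (fst z) (snd z)))^2))"
  proof (rule sum_mono)
   fix z assume z: "z \<in> S"
   define B where "B = X \<inter> cball (fst z) (snd z)"
   have "osc h B <= K * (osc f B + osc g B)" unfolding B_def
    using d[of "fst z" "snd z"] z S(2) unfolding m_def by auto
   moreover have "0 <= osc h B" using bounded_subset[OF b] osc_nonneg unfolding B_def
    by (metis image_mono inf_le1)
   ultimately have "(osc h B)^2 <= (K * (osc f B + osc g B))^2" by (rule power_mono)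
   also have "... = K^2 * (osc f B + osc g B)^2" by (simp add: power_mult_distrib)
   also have "... <= K^2 * (2 * ((osc f B)^2 + (osc g B)^2))"
    using sum_squares_bound[of "osc f B" "osc g B"] by (intro mult_left_mono) (auto simp: power2_sum)
   also have "... = 2 * K^2 * ((osc f B)^2 + (osc g B)^2)" by simp
   finally show "(case z of (x, r) => (osc h (X \<inter> cball x r))\<^sup>2) \<le>
     2 * K^2 * ((osc f (X \<inter> cball (fst z) (snd z)))^2 + (osc g (X \<inter> cball (fst z) (snd z)))^2)"
    unfolding B_def by (simp add: case_prod_beta)
  qed
  also have "... = 2 * K^2 * ((\<Sum>(x,r)\<in>S. (osc f (X \<inter> cball x r))^2) + (\<Sum>(x,r)\<in>S. (osc g (X \<inter> cball x r))^2))"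
   by (simp add: sum_distrib_left[symmetric] sum.distrib[symmetric] case_prod_beta)
  also have "... <= 2 * K^2 * (eps + eps)"
   by (intro mult_left_mono add_mono m1(2) m2(2) S S1 S2) auto
  also have "... <= dl" unfolding eps_def using \<open>dl > 0\<close>
   by (simp add: divide_simps) (simp add: algebra_simps add_pos_nonneg)
  finally show ?thesis .
 qed
 moreover have "m > 0" unfolding m_def using r0 m1 m2 by simp
 ultimately show "\<exists>m>0. \<forall>S. finite S & S \<subseteq> X \<times> {0..m} & sep L S -->
    (\<Sum>(x,r)\<in>S. (osc h (X \<inter> cball x r))^2) <= dl" by blast
qed

lemma tame_comb:
 assumes g: "tame X f" "tame X g" and K: "0 <= K"
  and d: "!!x y. x \<in> X ==> y \<in> X ==> \<bar>h x - h y\<bar> <= K * (\<bar>f x - f y\<bar> + \<bar>g x - g y\<bar>)"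
 shows "tame X h"
proof (rule tame_dom[OF g K])
 note bf = tame_bounded[OF g(1)] and bg = tame_bounded[OF g(2)]
 show "bounded (h ` X)"
 proof (cases "X = {}")
  case False
  then obtain a where a: "a \<in> X" by auto
  have "norm z <= \<bar>h a\<bar> + K * (osc f X + osc g X)" if "z \<in> h ` X" for z
  proof -
   obtain x where x: "x \<in> X" "z = h x" using \<open>z \<in> h ` X\<close> by auto
   have "\<bar>h x - h a\<bar> <= K * (osc f X + osc g X)"
    by (rule order_trans[OF d[OF x(1) a]]) (intro mult_left_mono add_mono osc_bound bf bg x a K)
   thus ?thesis using x by auto
  qed
  thus ?thesis unfolding bounded_iff by blast
 qed auto
 show "(0::real) < 1" by simp
 fix x :: 'a and r :: real
 show "osc h (X \<inter> cball x r) <= K * (osc f (X \<inter> cball x r) + osc g (X \<inter> cball x r))"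
  by (rule osc_le_comb) (use d K bounded_subset[OF bf] bounded_subset[OF bg] in "auto simp: image_mono")
qed

lemma tame_lip:
 assumes "tame X f" "0 <= K" "!!x y. x \<in> X ==> y \<in> X ==> \<bar>h x - h y\<bar> <= K * \<bar>f x - f y\<bar>"
 shows "tame X h"
 by (rule tame_comb[OF assms(1,1), of K]) (use assms in "force simp: distrib_left intro: add_increasing2")+

lemma tame_cong: "tame X f ==> (!!x. x \<in> X ==> f x = g x) ==> tame X g"
 by (rule tame_lip[of X f 1]) auto

lemma tame_add: "tame X f ==> tame X g ==> tame X (%x. f x + g x)"
 by (rule tame_comb[of X f g 1]) auto

lemma tame_affine: "tame X f ==> tame X (%x. a + b * f x)"
proof (rule tame_lip[of X f "\<bar>b\<bar>"])
 fix x y show "\<bar>a + b * f x - (a + b * f y)\<bar> <= \<bar>b\<bar> * \<bar>f x - f y\<bar>"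
  by (simp add: abs_mult[symmetric] right_diff_distrib)
qed auto

lemma tame_max: "tame X f ==> tame X (%x. max c (f x))"
 by (rule tame_lip[of X f 1]) auto

lemma tame_min: "tame X f ==> tame X (%x. min c (f x))"
 by (rule tame_lip[of X f 1]) auto

lemma tame_mult:
 assumes "tame X f" "tame X g"
 shows "tame X (%x. f x * g x)"
proof -
 obtain a where a: "!!x. x \<in> X ==> \<bar>f x\<bar> <= a" using tame_bounded[OF assms(1)] unfolding bounded_iff by auto
 obtain b where b: "!!x. x \<in> X ==> \<bar>g x\<bar> <= b" using tame_bounded[OF assms(2)] unfolding bounded_iff by auto
 define K where "K = \<bar>a\<bar> + \<bar>b\<bar>"
 show ?thesis
 proof (rule tame_comb[OF assms, of K])
  show "0 <= K" unfolding K_def by simp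
  fix x y assume x: "x \<in> X" and y: "y \<in> X"
  have "f x * g x - f y * g y = g x * (f x - f y) + f y * (g x - g y)" by (simp add: algebra_simps)
  hence "\<bar>f x * g x - f y * g y\<bar> <= \<bar>g x\<bar> * \<bar>f x - f y\<bar> + \<bar>f y\<bar> * \<bar>g x - g y\<bar>"
   by (metis abs_mult abs_triangle_ineq)
  also have "... <= K * \<bar>f x - f y\<bar> + K * \<bar>g x - g y\<bar>"
   by (intro add_mono mult_right_mono) (use a[OF y] b[OF x] in "auto simp: K_def")
  finally show "\<bar>f x * g x - f y * g y\<bar> <= K * (\<bar>f x - f y\<bar> + \<bar>g x - g y\<bar>)" by (simp add: distrib_left)
 qed
qed

lemma sum_UNION_le_nonneg:
 fixes f :: "'b => real"
 assumes "finite I" "!!i. i \<in> I ==> finite (T i)" "!!x. 0 <= f x"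
 shows "sum f (\<Union>i\<in>I. T i) <= (\<Sum>i\<in>I. sum f (T i))"
 using assms(1,2)
proof (induction rule: finite_induct)
 case (insert i I)
 have "sum f (T i \<union> (\<Union>i\<in>I. T i)) <= sum f (T i) + sum f (\<Union>i\<in>I. T i)"
  using insert assms(3) by (simp add: sum_Un sum_nonneg)
 thus ?case using insert by auto
qed simp

text \<open>Each ball is replaced by the smallest ball around the image of its centre that contains
  its image; the ratio bound makes the new family separated. The pieces \<open>P i\<close> serve
  folding maps, which control ratios only when x and z lie in the same square, while y may leave
  it.\<close>

lemma tame_pullback:
 fixes phi :: "'a::metric_space => 'b::metric_space"
 assumes g: "tame Y g" and into: "phi ` X \<subseteq> Y" and uc: "uniformly_continuous_on X phi"
  and I: "finite I" and cov: "X \<subseteq> (\<Union>i\<in>I. P i)"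
  and rat: "!!L. \<exists>L'. \<forall>i\<in>I. \<forall>x\<in>X \<inter> P i. \<forall>z\<in>X \<inter> P i. \<forall>y\<in>X. dist x y <= L * dist x z -->
     dist (phi x) (phi y) <= L' * dist (phi x) (phi z)"
 shows "tame X (g \<circ> phi)"
 unfolding tame_def
proof (intro conjI allI impI)
 have b: "bounded ((g \<circ> phi) ` X)"
  using bounded_subset[OF tame_bounded[OF g]] into by (metis image_comp image_mono)
 thus "bounded ((g \<circ> phi) ` X)" .
 fix L dl :: real assume d: "dl > 0"
 obtain L' where L0: "\<forall>i\<in>I. \<forall>x\<in>X \<inter> P i. \<forall>z\<in>X \<inter> P i. \<forall>y\<in>X. dist x y <= L * dist x z -->
     dist (phi x) (phi y) <= L' * dist (phi x) (phi z)" using rat[of L] by blast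
 have L': "dist (phi x) (phi y) <= L' * dist (phi x) (phi z)" if "i \<in> I" "x \<in> X" "x \<in> P i" "z \<in> X"
   "z \<in> P i" "y \<in> X" "dist x y <= L * dist x z" for i x y z using L0 that by blast
 define eps where "eps = dl / (card I + 1)"
 have e: "eps > 0" unfolding eps_def using d by simp
 obtain m' where m': "m' > 0" "!!S. finite S ==> S \<subseteq> Y \<times> {0..m'} ==> sep L' S ==>
    (\<Sum>(x,r)\<in>S. (osc g (Y \<inter> cball x r))^2) <= eps" using tameE[OF g e] by metis
 obtain m0 where m0: "m0 > 0" "\<forall>x\<in>X. \<forall>y\<in>X. dist y x < m0 --> dist (phi y) (phi x) < m'"
  using uc m'(1) unfolding uniformly_continuous_on_def by blast
 have m0: "m0 > 0" "!!x y. x \<in> X ==> y \<in> X ==> dist x y < m0 ==> dist (phi x) (phi y) < m'"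
  using m0 by auto
 define m where "m = m0 / 2"
 have m: "m > 0" "m < m0" unfolding m_def using m0 by auto
 define R where "R = (%(x,r). SUP y\<in>X \<inter> cball x r. dist (phi x) (phi y))"
 have R_ub: "dist (phi x) (phi y) <= R (x,r)" if "x \<in> X" "r <= m" "y \<in> X" "dist x y <= r" for x r y
 proof -
  have "bdd_above ((%y. dist (phi x) (phi y)) ` (X \<inter> cball x r))"
   by (rule bdd_aboveI2[of _ _ m']) (use m0(2)[OF that(1)] that(2) m in "auto intro!: less_imp_le")
  thus ?thesis unfolding R_def using that by (auto intro!: cSUP_upper)
 qed
 have R_le: "R (x,r) <= c" if "x \<in> X" "0 <= r" "!!y. y \<in> X ==> dist x y <= r ==> dist (phi x) (phi y) <= c" for x r c
  unfolding R_def using that by (auto intro!: cSUP_least)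
 have piece: "(\<Sum>(x,r)\<in>T. (osc (g \<circ> phi) (X \<inter> cball x r))^2) <= eps"
  if T: "finite T" "T \<subseteq> X \<times> {0..m}" "sep L T" "i \<in> I" "fst ` T \<subseteq> P i" for T i
 proof -
  \<comment> \<open>Balls with a one-point image contribute nothing, and without them distinct balls
    have distinct image centres.\<close>
  define T' where "T' = {z \<in> T. R z > 0}"
  define F where "F = (%z. (phi (fst z), R z))"
  have Tx: "fst z \<in> X" "0 <= snd z" "snd z <= m" "fst z \<in> P i" if "z \<in> T" for z
   using subsetD[OF T(2) that] subsetD[OF T(5) imageI[OF that]] by (cases z; auto)+
  have Rsep: "R z <= L' * dist (phi (fst z)) (phi (fst w))" if "z \<in> T" "w \<in> T" "z ~= w" for z w
  proof -
   have "snd z <= L * dist (fst z) (fst w)" using sepD[OF T(3), of "fst z" "snd z" "fst w" "snd w"] that by simp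
   hence "R (fst z, snd z) <= L' * dist (phi (fst z)) (phi (fst w))"
    by (intro R_le Tx that) (rule L'[OF T(4)], use Tx that in auto)
   thus ?thesis by simp
  qed
  have inj: "inj_on F T'"
  proof (rule inj_onI)
   fix z w assume zw: "z \<in> T'" "w \<in> T'" "F z = F w"
   show "z = w"
   proof (rule ccontr)
    assume "z ~= w"
    hence "R z <= 0" using Rsep[of z w] zw unfolding T'_def F_def by auto
    thus False using zw unfolding T'_def by auto
   qed
  qed
  have step: "(osc (g \<circ> phi) (X \<inter> cball (fst z) (snd z))) <= osc g (Y \<inter> cball (fst (F z)) (snd (F z)))"
   if "z \<in> T" for z
  proof -
   have sub: "phi ` (X \<inter> cball (fst z) (snd z)) \<subseteq> Y \<inter> cball (fst (F z)) (snd (F z))"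
    using into R_ub[of "fst z" "snd z"] Tx[OF that] unfolding F_def by auto
   show ?thesis unfolding osc_comp
    by (rule osc_mono[OF _ sub]) (meson bounded_subset g image_mono inf_le1 tame_bounded)
  qed
  have zero: "(osc (g \<circ> phi) (X \<inter> cball (fst z) (snd z))) = 0" if "z \<in> T - T'" for z
  proof (rule osc_const)
   fix y assume y: "y \<in> X \<inter> cball (fst z) (snd z)"
   have "dist (phi (fst z)) (phi y) <= R z" using R_ub[of "fst z" "snd z" y] Tx that y by auto
   also have "... <= 0" using that unfolding T'_def by auto
   finally show "(g \<circ> phi) y = g (phi (fst z))" by simp
  qed
  have nn: "0 <= osc (g \<circ> phi) (X \<inter> B)" for B
   by (rule osc_nonneg) (meson b bounded_subset image_mono inf_le1)
  have "(\<Sum>(x,r)\<in>T. (osc (g \<circ> phi) (X \<inter> cball x r))^2) = (\<Sum>(x,r)\<in>T'. (osc (g \<circ> phi) (X \<inter> cball x r))^2)"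
   by (rule sum.mono_neutral_right) (use T(1) zero in "auto simp: T'_def case_prod_beta")
  also have "... <= (\<Sum>z\<in>T'. (%(x,r). (osc g (Y \<inter> cball x r))^2) (F z))"
   by (rule sum_mono) (auto simp: case_prod_beta T'_def intro!: power_mono step nn)
  also have "... = (\<Sum>(x,r)\<in>F ` T'. (osc g (Y \<inter> cball x r))^2)"
   by (simp add: sum.reindex[OF inj])
  also have "... <= eps"
  proof (rule m'(2))
   show "finite (F ` T')" unfolding T'_def using T by simp
   show "F ` T' \<subseteq> Y \<times> {0..m'}"
   proof
    fix c assume "c \<in> F ` T'"
    then obtain x r where z: "(x,r) \<in> T" "0 < R (x,r)" "c = (phi x, R (x,r))" unfolding F_def T'_def by auto
    hence x: "x \<in> X" "0 <= r" "r <= m" using T by auto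
    have "R (x,r) <= m'" by (rule R_le) (use x m m0(2) in "auto intro!: less_imp_le")
    thus "c \<in> Y \<times> {0..m'}" using x into z by auto
   qed
   show "sep L' (F ` T')"
   proof (rule sepI)
    fix x r y s assume *: "(x,r) \<in> F ` T'" "(y,s) \<in> F ` T'" "(x,r) ~= (y,s)"
    obtain z where z: "z \<in> T'" "(x,r) = F z" using *(1) by (rule imageE)
    obtain w where w: "w \<in> T'" "(y,s) = F w" using *(2) by (rule imageE)
    have "z ~= w" using *(3) z w by auto
    hence "R z <= L' * dist (phi (fst z)) (phi (fst w))" using z(1) w(1) by (intro Rsep) (simp_all add: T'_def)
    thus "r <= L' * dist x y" using z(2) w(2) unfolding F_def by simp
   qed
  qed
  finally show ?thesis .
 qed
 have main: "(\<Sum>(x,r)\<in>S. (osc (g \<circ> phi) (X \<inter> cball x r))^2) <= dl"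
  if S: "finite S" "S \<subseteq> X \<times> {0..m}" "sep L S" for S
 proof -
  define T where "T = (%i. {z \<in> S. fst z \<in> P i})"
  have "(\<Sum>z\<in>S. (osc (g \<circ> phi) (X \<inter> cball (fst z) (snd z)))^2) \<le>
    (\<Sum>z\<in>(\<Union>i\<in>I. T i). (osc (g \<circ> phi) (X \<inter> cball (fst z) (snd z)))^2)"
  proof (rule sum_mono2)
   show "S \<subseteq> (\<Union>i\<in>I. T i)" using S(2) cov unfolding T_def by fastforce
  qed (use I S in "auto simp: T_def")
  also have "... <= (\<Sum>i\<in>I. \<Sum>z\<in>T i. (osc (g \<circ> phi) (X \<inter> cball (fst z) (snd z)))^2)"
   by (rule sum_UNION_le_nonneg) (use I S in "auto simp: T_def")
  also have "... <= (\<Sum>i\<in>I. eps)"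
  proof (rule sum_mono)
   fix i assume "i \<in> I"
   moreover have "finite (T i)" "T i \<subseteq> X \<times> {0..m}" "sep L (T i)" "fst ` T i \<subseteq> P i"
    using S sep_subset[OF S(3), of "T i"] unfolding T_def by auto
   ultimately show "(\<Sum>z\<in>T i. (osc (g \<circ> phi) (X \<inter> cball (fst z) (snd z)))^2) <= eps"
    using piece[of "T i" i] by (simp add: case_prod_beta)
  qed
  also have "... = card I * eps" by simp
  also have "... <= dl" unfolding eps_def using d by (simp add: field_simps)
  finally show ?thesis by (simp add: case_prod_beta)
 qed
 show "\<exists>m>0. \<forall>S. finite S & S \<subseteq> X \<times> {0..m} & sep L S -->
    (\<Sum>(x,r)\<in>S. (osc (g \<circ> phi) (X \<inter> cball x r))^2) <= dl" using m(1) main by blast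
qed

section \<open>Square-summable families\<close>

definition l2 :: "'e set => ('e => real) => bool" where
 "l2 A f \<longleftrightarrow> (%x. (f x)^2) summable_on A"

definition ns :: "'e set => ('e => real) => real" where
 "ns A f = infsum (%x. (f x)^2) A"

lemma summable_on_real_dom:
 fixes f g :: "'e => real"
 assumes "g summable_on A" "!!x. x \<in> A ==> \<bar>f x\<bar> <= g x"
 shows "f summable_on A"
 by (rule abs_summable_summable, rule summable_on_comparison_test[OF assms(1)]) (use assms(2) in auto)

lemma ns_nonneg: "0 <= ns A f"
 unfolding ns_def by (rule infsum_nonneg) simp

lemma l2_mono: "l2 A g ==> (!!x. x \<in> A ==> \<bar>f x\<bar> <= \<bar>g x\<bar>) ==> l2 A f"
 unfolding l2_def by (rule summable_on_real_dom) (auto simp: abs_le_square_iff)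

lemma l2_subset: "l2 A f ==> B \<subseteq> A ==> l2 B f"
 unfolding l2_def by (rule summable_on_subset_banach)

lemma l2_cmult: "l2 A f ==> l2 A (%x. c * f x)"
 unfolding l2_def by (simp add: power_mult_distrib summable_on_cmult_right)

lemma l2_add: assumes "l2 A f" "l2 A g" shows "l2 A (%x. f x + g x)"
 unfolding l2_def
proof (rule summable_on_real_dom)
 show "(%x. 2 * (f x)^2 + 2 * (g x)^2) summable_on A"
  using assms unfolding l2_def by (intro summable_on_add summable_on_cmult_right)
 fix x show "\<bar>(f x + g x)\<^sup>2\<bar> <= 2 * (f x)^2 + 2 * (g x)^2"
  using sum_squares_bound[of "f x" "g x"] by (subst abs_of_nonneg) (simp, simp add: power2_sum)
qed

lemma l2_diff: assumes "l2 A f" "l2 A g" shows "l2 A (%x. f x - g x)"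
 using l2_add[OF assms(1) l2_cmult[OF assms(2), of "-1"]] by simp

lemma l2_abs: "l2 A f ==> l2 A (%x. \<bar>f x\<bar>)"
 unfolding l2_def by simp

lemma l2_mult: assumes "l2 A f" "l2 A g" shows "(%x. f x * g x) summable_on A"
proof (rule summable_on_real_dom)
 show "(%x. (f x)^2 + (g x)^2) summable_on A"
  using assms unfolding l2_def by (rule summable_on_add)
 fix x show "\<bar>f x * g x\<bar> <= (f x)^2 + (g x)^2"
 proof -
  have "2 * (\<bar>f x\<bar> * \<bar>g x\<bar>) <= (f x)^2 + (g x)^2"
   using sum_squares_bound[of "\<bar>f x\<bar>" "\<bar>g x\<bar>"] by (simp add: mult.assoc)
  moreover have "0 <= \<bar>f x\<bar> * \<bar>g x\<bar>" by simp
  ultimately have "\<bar>f x\<bar> * \<bar>g x\<bar> <= (f x)^2 + (g x)^2" by linarith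
  thus ?thesis by (simp add: abs_mult)
 qed
qed

lemma sum_le_ns: "l2 A f ==> finite S ==> S \<subseteq> A ==> (\<Sum>x\<in>S. (f x)^2) <= ns A f"
 unfolding l2_def ns_def by (rule finite_sum_le_infsum) auto

lemma point_le_ns: "l2 A f ==> x \<in> A ==> (f x)\<^sup>2 <= ns A f"
 using sum_le_ns[of A f "{x}"] by simp

lemma point_le_sqrt_ns: "l2 A f ==> x \<in> A ==> \<bar>f x\<bar> <= sqrt (ns A f)"
 by (rule real_le_rsqrt) (simp add: point_le_ns)

lemma ns_le: "l2 A f ==> (!!S. finite S ==> S \<subseteq> A ==> (\<Sum>x\<in>S. (f x)^2) <= c) ==> ns A f <= c"
 unfolding l2_def ns_def by (rule infsum_le_finite_sums) auto

lemma l2I: "(!!S. finite S ==> S \<subseteq> A ==> (\<Sum>x\<in>S. (f x)^2) <= c) ==> l2 A f"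
 unfolding l2_def by (rule nonneg_bdd_above_summable_on) (auto intro!: bdd_aboveI2)

lemma ns_mono: "l2 A g ==> (!!x. x \<in> A ==> \<bar>f x\<bar> <= \<bar>g x\<bar>) ==> ns A f <= ns A g"
 using l2_mono[of A g f] unfolding ns_def l2_def by (intro infsum_mono) (auto simp: abs_le_square_iff)

lemma ns_cmult: "ns A (%x. c * f x) = c^2 * ns A f"
 unfolding ns_def by (simp add: power_mult_distrib infsum_cmult_right')

lemma l2_cs_abs:
 assumes "l2 A f" "l2 A g"
 shows "infsum (%x. \<bar>f x\<bar> * \<bar>g x\<bar>) A <= sqrt (ns A f) * sqrt (ns A g)"
proof (rule infsum_le_finite_sums)
 show "(%x. \<bar>f x\<bar> * \<bar>g x\<bar>) summable_on A" by (intro l2_mult l2_abs assms)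
 fix S assume S: "finite S" "S \<subseteq> A"
 have "(\<Sum>x\<in>S. \<bar>f x\<bar> * \<bar>g x\<bar>) <= L2_set f S * L2_set g S" by (rule L2_set_mult_ineq)
 also have "... <= sqrt (ns A f) * sqrt (ns A g)" unfolding L2_set_def
  by (intro mult_mono real_sqrt_le_mono sum_le_ns assms S) (auto intro: sum_nonneg ns_nonneg)
 finally show "(\<Sum>x\<in>S. \<bar>f x\<bar> * \<bar>g x\<bar>) <= sqrt (ns A f) * sqrt (ns A g)" .
qed

lemma l2_cs:
 assumes "l2 A f" "l2 A g"
 shows "\<bar>infsum (%x. f x * g x) A\<bar> <= sqrt (ns A f) * sqrt (ns A g)"
proof -
 have s: "(%x. \<bar>f x\<bar> * \<bar>g x\<bar>) summable_on A" by (intro l2_mult l2_abs assms)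
 have "\<bar>infsum (%x. f x * g x) A\<bar> <= infsum (%x. \<bar>f x\<bar> * \<bar>g x\<bar>) A"
  using norm_infsum_bound[of "%x. f x * g x" A] s by (simp add: abs_mult)
 thus ?thesis using l2_cs_abs[OF assms] by linarith
qed

lemma ns_add_expand:
 assumes "l2 A f" "l2 A g"
 shows "ns A (%x. f x + g x) = ns A f + 2 * infsum (%x. f x * g x) A + ns A g"
proof -
 have "(%x. (f x + g x)^2) = (%x. ((f x)^2 + 2 * (f x * g x)) + (g x)^2)"
  by (auto simp: power2_sum)
 moreover have "infsum (%x. ((f x)^2 + 2 * (f x * g x)) + (g x)^2) A
   = (ns A f + 2 * infsum (%x. f x * g x) A) + ns A g"
  using assms l2_mult[OF assms] unfolding ns_def l2_def
  by (simp add: infsum_add summable_on_add summable_on_cmult_right infsum_cmult_right')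
 ultimately show ?thesis unfolding ns_def by simp
qed

lemma ns_parallelogram:
 assumes "l2 A f" "l2 A g"
 shows "ns A (%x. f x - g x) + ns A (%x. f x + g x) = 2 * ns A f + 2 * ns A g"
proof -
 have "ns A (%x. f x + (-1) * g x) = ns A f + 2 * infsum (%x. f x * ((-1) * g x)) A + ns A (%x. (-1) * g x)"
  by (rule ns_add_expand[OF assms(1) l2_cmult[OF assms(2)]])
 moreover have "infsum (%x. f x * ((-1) * g x)) A = - infsum (%x. f x * g x) A"
  by (simp add: infsum_uminus)
 moreover have "ns A (%x. (-1) * g x) = ns A g" using ns_cmult[of A "-1" g] by simp
 ultimately show ?thesis using ns_add_expand[OF assms] by simp
qed

lemma ns_convex:
 assumes "l2 A f" "l2 A g" "0 <= t" "t <= 1"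
 shows "ns A (%x. (1 - t) * f x + t * g x) <= (1 - t) * ns A f + t * ns A g"
proof -
 have l: "l2 A (%x. (1 - t) * f x + t * g x)" by (intro l2_add l2_cmult assms)
 have "ns A (%x. (1 - t) * f x + t * g x) <= infsum (%x. (1 - t) * (f x)^2 + t * (g x)^2) A"
  unfolding ns_def
 proof (rule infsum_mono)
  show "(%x. ((1 - t) * f x + t * g x)^2) summable_on A" using l unfolding l2_def .
  show "(%x. (1 - t) * (f x)^2 + t * (g x)^2) summable_on A"
   using assms unfolding l2_def by (intro summable_on_add summable_on_cmult_right)
  fix x
  have "(1 - t) * (f x)^2 + t * (g x)^2 - ((1 - t) * f x + t * g x)^2 = t * (1 - t) * (f x - g x)^2"
   by (simp add: power2_eq_square algebra_simps)
  moreover have "0 <= t * (1 - t) * (f x - g x)^2" using assms by simp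
  ultimately show "((1 - t) * f x + t * g x)^2 <= (1 - t) * (f x)^2 + t * (g x)^2" by linarith
 qed
 also have "... = (1 - t) * ns A f + t * ns A g"
  using assms unfolding l2_def ns_def
  by (simp add: infsum_add summable_on_cmult_right infsum_cmult_right')
 finally show ?thesis .
qed

text \<open>Completeness of \<open>\<ell>\<^sup>2\<close>, for sequences that are Cauchy with the explicit rate \<open>c j + c k\<close>.\<close>

lemma l2_complete:
 fixes e :: "nat => 'e => real"
 assumes l: "!!k. l2 A (e k)" and c: "c \<longlonglongrightarrow> 0"
  and cau: "!!j k. ns A (%x. e j x - e k x) <= c j + c k"
 obtains rho where "l2 A rho" "(%k. ns A (%x. e k x - rho x)) \<longlonglongrightarrow> 0" "!!x. x \<in> A ==> (%k. e k x) \<longlonglongrightarrow> rho x"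
proof -
 have conv: "convergent (%k. e k x)" if "x \<in> A" for x
 proof (rule Cauchy_convergent, rule metric_CauchyI)
  fix eps :: real assume eps: "eps > 0"
  have "\<forall>\<^sub>F k in sequentially. c k < eps^2 / 2" using eps by (intro order_tendstoD(2)[OF c]) simp
  then obtain N where N: "!!k. k >= N ==> c k < eps^2 / 2" unfolding eventually_sequentially by auto
  have "dist (e j x) (e k x) < eps" if "j >= N" "k >= N" for j k
  using point_le_ns[OF l2_diff[OF l[of j] l[of k]] \<open>x \<in> A\<close>] cau[of j k] N[OF that(1)] N[OF that(2)] eps power2_less_imp_less[of "\<bar>e j x - e k x\<bar>" eps]
   by (simp add: dist_real_def)
  thus "\<exists>M. \<forall>m\<ge>M. \<forall>n\<ge>M. dist (e m x) (e n x) < eps" by blast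
 qed
 define rho where "rho = (%x. lim (%k. e k x))"
 have lim: "(%k. e k x) \<longlonglongrightarrow> rho x" if "x \<in> A" for x
  using conv[OF that] unfolding rho_def by (simp add: convergent_LIMSEQ_iff)
 have fin: "(\<Sum>x\<in>S. (e k x - rho x)^2) <= c k" if S: "finite S" "S \<subseteq> A" for S k
 proof (rule LIMSEQ_le)
  show "(%j. \<Sum>x\<in>S. (e j x - e k x)^2) \<longlonglongrightarrow> (\<Sum>x\<in>S. (e k x - rho x)^2)"
  proof -
   have "(%j. \<Sum>x\<in>S. (e j x - e k x)^2) \<longlonglongrightarrow> (\<Sum>x\<in>S. (rho x - e k x)^2)"
    using S lim by (intro tendsto_intros) auto
   thus ?thesis by (simp add: power2_commute)
  qed
  show "(%j. c j + c k) \<longlonglongrightarrow> c k" using tendsto_add[OF c tendsto_const[of "c k"]] by simp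
  show "\<exists>N. \<forall>j\<ge>N. (\<Sum>x\<in>S. (e j x - e k x)^2) <= c j + c k"
   using sum_le_ns[OF l2_diff[OF l l] S] cau by (meson order_trans)
 qed
 have ld: "l2 A (%x. e k x - rho x)" for k by (rule l2I[of A _ "c k"]) (rule fin)
 have "l2 A rho" using l2_diff[OF l[of 0] ld[of 0]] by simp
 moreover have "(%k. ns A (%x. e k x - rho x)) \<longlonglongrightarrow> 0"
 proof (rule tendsto_sandwich[OF _ _ tendsto_const c])
  show "\<forall>\<^sub>F k in sequentially. ns A (%x. e k x - rho x) <= c k"
   using ns_le[OF ld fin] by simp
 qed (simp add: ns_nonneg)
 ultimately show ?thesis using that lim by blast
qed

section \<open>Quasisymmetries, peripheral circles and capacity\<close>

lemma infsum_diff: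
 fixes f g :: "'e => real"
 assumes "f summable_on A" "g summable_on A"
 shows "infsum (%x. f x - g x) A = infsum f A - infsum g A"
 using infsum_add[OF assms(1) summable_on_uminus[THEN iffD2, OF assms(2)]] by (simp add: infsum_uminus)

text \<open>All that quasisymmetry is used for. Quantifying over \<open>L\<close> instead of naming
  a control function makes composition immediate, and \<open>qsi\<close> carries the inverse along
  so that it is treated only once.\<close>

definition ratio :: "'a::metric_space set => ('a => 'b::metric_space) => bool" where
 "ratio X f \<longleftrightarrow> (\<forall>L. \<exists>L'. \<forall>x\<in>X. \<forall>y\<in>X. \<forall>z\<in>X.
   dist x y <= L * dist x z --> dist (f x) (f y) <= L' * dist (f x) (f z))"

definition qsi :: "'a::metric_space set => 'b::metric_space set => ('a => 'b) => ('b => 'a) => bool" where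
 "qsi X Y f g \<longleftrightarrow> homeomorphism X Y f g & ratio X f & ratio Y g"

lemma qsi_homeo: "qsi X Y f g ==> homeomorphism X Y f g"
 unfolding qsi_def by simp

lemma qsi_sym: "qsi X Y f g ==> qsi Y X g f"
 unfolding qsi_def by (auto dest: homeomorphism_symD)

lemma ratio_comp:
 assumes "ratio X f" "ratio Y h" "f ` X \<subseteq> Y"
 shows "ratio X (h \<circ> f)"
 unfolding ratio_def
proof
 fix L
 obtain L1 where L1: "!!x y z. x \<in> X ==> y \<in> X ==> z \<in> X ==>
   dist x y <= L * dist x z ==> dist (f x) (f y) <= L1 * dist (f x) (f z)"
  using assms(1) unfolding ratio_def by blast
 obtain L2 where L2: "!!x y z. x \<in> Y ==> y \<in> Y ==> z \<in> Y ==>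
   dist x y <= L1 * dist x z ==> dist (h x) (h y) <= L2 * dist (h x) (h z)"
  using assms(2) unfolding ratio_def by blast
 show "\<exists>L'. \<forall>x\<in>X. \<forall>y\<in>X. \<forall>z\<in>X.
   dist x y <= L * dist x z --> dist ((h \<circ> f) x) ((h \<circ> f) y) <= L' * dist ((h \<circ> f) x) ((h \<circ> f) z)"
  using L1 L2 assms(3) by (intro exI[of _ L2]) (auto simp: image_subset_iff)
qed

lemma qsi_trans:
 assumes "qsi X Y f g" "qsi Y Z h k"
 shows "qsi X Z (h \<circ> f) (g \<circ> k)"
proof -
 have "f ` X = Y" "k ` Z = Y" using assms unfolding qsi_def homeomorphism_def by auto
 thus ?thesis using assms unfolding qsi_def
  by (auto intro!: homeomorphism_compose ratio_comp[of _ _ Y])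
qed

lemma qsi_isometry:
 assumes "f ` X = Y" "g ` Y = X" "!!x. x \<in> X ==> g (f x) = x"
  and iso: "!!x y. x \<in> X ==> y \<in> X ==> dist (f x) (f y) = dist x y"
 shows "qsi X Y f g"
proof -
 have inv: "f (g y) = y" if "y \<in> Y" for y using assms that by (metis imageE)
 have iso': "dist (g x) (g y) = dist x y" if "x \<in> Y" "y \<in> Y" for x y
  using iso[of "g x" "g y"] inv that assms(2) by force
 have "continuous_on X f" "continuous_on Y g"
  unfolding continuous_on_iff using iso iso' by metis+
 moreover have "ratio X f" "ratio Y g" unfolding ratio_def using iso iso' by metis+
 ultimately show ?thesis unfolding qsi_def homeomorphism_def using assms inv by auto
qed

text \<open>Removing 0 leaves the half-line connected, whereas removing an inner point does
  not.\<close>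

lemma homeo_halfline_0:
 fixes eta tht :: "real => real"
 assumes "homeomorphism {0..} {0..} eta tht"
 shows "eta 0 = 0"
proof (rule ccontr)
 assume n0: "eta 0 ~= 0"
 have c: "continuous_on {0..} eta" and im: "eta ` {0..} = {0..}" and inj: "inj_on eta {0..}"
  using assms unfolding homeomorphism_def by (auto intro: inj_on_inverseI)
 have p: "0 <= eta 0" using im by force
 have "{0..} - {0} = {0::real<..}" by auto
 hence "connected (eta ` ({0..} - {0}))" by (intro connected_continuous_image continuous_on_subset[OF c]) auto
 also have "eta ` ({0..} - {0}) = {0..} - {eta 0}" using inj_on_image_set_diff[OF inj, of "{0..}" "{0}"] im by simp
 finally have "eta 0 \<in> {0..} - {eta 0}" using p n0 by (elim connectedD_interval[of _ 0 "eta 0 + 1"]) auto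
 thus False by simp
qed

text \<open>For \<open>f\<close> the constant is a bound of the control function on the compact
  interval from 0 to \<bar>L\<bar>. For the inverse it comes from continuity of the control function
  at 0: a ratio below d in X would give a ratio below 1 / (\<bar>L\<bar> + 1) in Y.\<close>

lemma quasisymmetric_imp_qsi:
 assumes "quasisymmetric X Y f"
 shows "\<exists>g. qsi X Y f g"
proof -
 obtain g where g: "homeomorphism X Y f g" using assms unfolding quasisymmetric_def by auto
 obtain eta tht :: "real => real" where h: "homeomorphism {0..} {0..} eta tht"
  and q: "!!x y z. x \<in> X ==> y \<in> X ==> z \<in> X ==> x ~= z ==>
    dist (f x) (f y) / dist (f x) (f z) <= eta (dist x y / dist x z)"
  using assms unfolding quasisymmetric_def by blast
 have c: "continuous_on {0..} eta" using h unfolding homeomorphism_def by auto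
 have inj: "f x ~= f z" if "x \<in> X" "z \<in> X" "x ~= z" for x z
  using g that unfolding homeomorphism_def by metis
 have r1: "ratio X f"
  unfolding ratio_def
 proof
  fix L :: real
  have "compact (eta ` {0..\<bar>L\<bar>})"
   by (intro compact_continuous_image continuous_on_subset[OF c]) auto
  hence "bounded (eta ` {0..\<bar>L\<bar>})" by (rule compact_imp_bounded)
  then obtain M where M0: "\<forall>s\<in>eta ` {0..\<bar>L\<bar>}. norm s <= M" unfolding bounded_iff by blast
  have M: "eta t <= M" if "0 <= t" "t <= \<bar>L\<bar>" for t using M0 that by (auto dest!: bspec[of _ _ t])
  show "\<exists>L'. \<forall>x\<in>X. \<forall>y\<in>X. \<forall>z\<in>X.
    dist x y <= L * dist x z --> dist (f x) (f y) <= L' * dist (f x) (f z)"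
  proof (intro exI[of _ M] ballI impI)
   fix x y z assume xyz: "x \<in> X" "y \<in> X" "z \<in> X" and d: "dist x y <= L * dist x z"
   show "dist (f x) (f y) <= M * dist (f x) (f z)"
   proof (cases "x = z")
    case True thus ?thesis using d by simp
   next
    case False
    hence "dist x y / dist x z <= L" using d by (simp add: divide_le_eq)
    hence "eta (dist x y / dist x z) <= M" by (intro M) auto
    hence "dist (f x) (f y) / dist (f x) (f z) <= M" using q[OF xyz False] by simp
    thus ?thesis using inj[OF xyz(1,3) False] by (simp add: divide_le_eq)
   qed
  qed
 qed
 have r2: "ratio Y g"
  unfolding ratio_def
 proof
  fix L :: real
  have "\<forall>e>0. \<exists>d>0. \<forall>x'\<in>{0..}. dist x' 0 < d --> dist (eta x') (eta 0) < e"
   using c unfolding continuous_on_iff by (meson atLeast_iff order_refl)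
  moreover have "1 / (\<bar>L\<bar> + 1) > 0" by simp
  ultimately obtain d where d0: "d > 0" "\<forall>x'\<in>{0..}. dist x' 0 < d --> dist (eta x') (eta 0) < 1 / (\<bar>L\<bar> + 1)"
   by blast
  have d: "d > 0" "!!t. 0 <= t ==> t < d ==> eta t < 1 / (\<bar>L\<bar> + 1)"
   using d0 homeo_halfline_0[OF h] by (auto simp: dist_real_def dest!: bspec)
  show "\<exists>L'. \<forall>x\<in>Y. \<forall>y\<in>Y. \<forall>z\<in>Y.
    dist x y <= L * dist x z --> dist (g x) (g y) <= L' * dist (g x) (g z)"
  proof (intro exI[of _ "1 / d"] ballI impI)
   fix a b c assume abc: "a \<in> Y" "b \<in> Y" "c \<in> Y" and L: "dist a b <= L * dist a c"
   have gX: "g a \<in> X" "g b \<in> X" "g c \<in> X" and fg: "f (g a) = a" "f (g b) = b" "f (g c) = c"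
    using g abc unfolding homeomorphism_def by auto
   show "dist (g a) (g b) <= 1 / d * dist (g a) (g c)"
   proof (cases "a = b")
    case True thus ?thesis using d(1) by simp
   next
    case False
    hence ne: "g a ~= g b" using fg by metis
    have "dist (g a) (g c) / dist (g a) (g b) >= d"
    proof (rule ccontr)
     assume "~ ?thesis"
     hence "eta (dist (g a) (g c) / dist (g a) (g b)) < 1 / (\<bar>L\<bar> + 1)" by (intro d(2)) auto
     hence "dist a c / dist a b < 1 / (\<bar>L\<bar> + 1)" using q[OF gX(1,3,2) ne] fg by simp
     hence "dist a c * (\<bar>L\<bar> + 1) < dist a b" using False by (simp add: field_simps)
     moreover have "L * dist a c <= \<bar>L\<bar> * dist a c" by (intro mult_right_mono) auto
     moreover have "0 <= dist a c" by simp
     ultimately show False using L by (simp add: algebra_simps)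
    qed
    thus ?thesis using d(1) ne by (simp add: field_simps)
   qed
  qed
 qed
 show ?thesis using g r1 r2 unfolding qsi_def by blast
qed

lemma tame_qsi:
 assumes q: "qsi X Y f g" and X: "compact X" and h: "tame Y h"
 shows "tame X (h \<circ> f)"
proof (rule tame_pullback[where P = "%_. X" and I = "{()}", OF h])
 show "f ` X \<subseteq> Y" using q unfolding qsi_def homeomorphism_def by auto
 show "uniformly_continuous_on X f"
  using q X unfolding qsi_def homeomorphism_def by (auto intro: compact_uniformly_continuous)
 fix L
 show "\<exists>L'. \<forall>i\<in>{()}. \<forall>x\<in>X \<inter> X. \<forall>z\<in>X \<inter> X. \<forall>y\<in>X. dist x y <= L * dist x z -->
     dist (f x) (f y) <= L' * dist (f x) (f z)"
  using q unfolding qsi_def ratio_def by blast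
qed auto

text \<open>Peripheral circles are singled out topologically, as the nonseparating simple closed curves, so
 that homeomorphisms preserve them.\<close>

definition circles :: "'a::metric_space set => 'a set set" where
 "circles X = {C. C \<subseteq> X & C homeomorphic (sphere (0::pt) 1) & connected (X - C)}"

lemma circles_sub: "C \<in> circles X ==> C \<subseteq> X"
 unfolding circles_def by simp

lemma circles_homeo:
 assumes h: "homeomorphism X Y f g" and C: "C \<in> circles X"
 shows "f ` C \<in> circles Y"
proof -
 have CX: "C \<subseteq> X" using C by (rule circles_sub)
 have inj: "inj_on f X" using h unfolding homeomorphism_def by (metis inj_onI)
 have "homeomorphism C (f ` C) f g" by (rule homeomorphism_of_subsets[OF h CX subset_refl refl])
 hence "homeomorphism (f ` C) C g f" by (rule homeomorphism_symD)
 hence "(f ` C) homeomorphic C" unfolding homeomorphic_def by blast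
 hence 1: "f ` C homeomorphic (sphere (0::pt) 1)"
  using C unfolding circles_def by (auto intro: homeomorphic_trans)
 have "Y - f ` C = f ` (X - C)" using h CX inj unfolding homeomorphism_def by (auto simp: inj_on_image_set_diff)
 moreover have "connected (f ` (X - C))"
  using C h unfolding circles_def homeomorphism_def
  by (auto intro!: connected_continuous_image intro: continuous_on_subset)
 ultimately show ?thesis using 1 CX h unfolding circles_def homeomorphism_def by auto
qed

lemma homeomorphism_image_inv:
 assumes "homeomorphism X Y f g" "C \<subseteq> X"
 shows "g ` f ` C = C"
proof -
 have "g (f x) = x" if "x \<in> C" for x using assms that unfolding homeomorphism_def by blast
 thus ?thesis by (simp add: image_image)
qed

lemma circles_bij:
 assumes h: "homeomorphism X Y f g"
 shows "bij_betw ((`) f) (circles X) (circles Y)"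
proof (rule bij_betwI[where g = "(`) g"])
 show "(`) f \<in> circles X \<rightarrow> circles Y" using circles_homeo[OF h] by auto
 show "(`) g \<in> circles Y \<rightarrow> circles X" using circles_homeo[OF homeomorphism_symD[OF h]] by auto
 fix C assume "C \<in> circles X"
 hence "C \<subseteq> X" by (rule circles_sub)
 thus "g ` f ` C = C" by (rule homeomorphism_image_inv[OF h])
next
 fix C assume "C \<in> circles Y"
 hence "C \<subseteq> Y" by (rule circles_sub)
 thus "f ` g ` C = C" by (rule homeomorphism_image_inv[OF homeomorphism_symD[OF h]])
qed

section \<open>Capacity of a pair of sets\<close>

definition adm :: "'a::metric_space set => 'a set => 'a set => ('a => real) => bool" where
 "adm X C D g \<longleftrightarrow> tame X g & l2 (circles X) (osc g) & (\<forall>x\<in>C. g x = 0) & (\<forall>x\<in>D. g x = 1)"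

definition en :: "'a::metric_space set => ('a => real) => real" where
 "en X g = ns (circles X) (osc g)"

text \<open>\<open>Inf\<close> of the empty set is unspecified, so lower bounds on
  \<open>cap\<close> carry an admissible witness; for distinct peripheral circles of the carpet one
  is built in \<open>adm_exists\<close>.\<close>

definition cap :: "'a::metric_space set => 'a set => 'a set => real" where
 "cap X C D = Inf (en X ` {g. adm X C D g})"

lemma admD:
 assumes "adm X C D g"
 shows "tame X g" "l2 (circles X) (osc g)" "!!x. x \<in> C ==> g x = 0" "!!x. x \<in> D ==> g x = 1"
 using assms unfolding adm_def by auto

lemma en_nonneg: "0 <= en X g"
 unfolding en_def by (rule ns_nonneg)

lemma cap_le: "adm X C D g ==> cap X C D <= en X g"
 unfolding cap_def by (rule cInf_lower) (auto intro!: bdd_belowI2[of _ 0] en_nonneg)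

lemma cap_ge: "adm X C D g0 ==> (!!g. adm X C D g ==> c <= en X g) ==> c <= cap X C D"
 unfolding cap_def by (rule cInf_greatest) auto

lemma cap_nonneg: "adm X C D g0 ==> 0 <= cap X C D"
 by (rule cap_ge) (auto intro: en_nonneg)

lemma osc_circle_nonneg: "tame X g ==> C \<in> circles X ==> 0 <= osc g C"
 by (intro osc_nonneg tame_bounded_sub) (auto dest: circles_sub)

text \<open>A homeomorphism permutes the peripheral circles, so the sum is merely reindexed.\<close>

lemma l2_osc_qsi:
 assumes "homeomorphism X Y f g" "l2 (circles Y) (osc h)"
 shows "l2 (circles X) (osc (h \<circ> f))" "en X (h \<circ> f) = en Y h"
 using summable_on_reindex_bij_betw[OF circles_bij[OF assms(1)], of "%C. (osc h C)^2"]
  infsum_reindex_bij_betw[OF circles_bij[OF assms(1)], of "%C. (osc h C)^2"] assms(2)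
 unfolding l2_def en_def ns_def by (simp_all add: osc_comp)

lemma adm_qsi:
 assumes q: "qsi X Y f g" and X: "compact X" and h: "adm Y (f ` C) (f ` D) h"
 shows "adm X C D (h \<circ> f)"
 using tame_qsi[OF q X] l2_osc_qsi(1)[OF qsi_homeo[OF q]] h unfolding adm_def by auto

lemma cap_qsi_ge:
 assumes q: "qsi X Y f g" and X: "compact X" and h: "adm Y (f ` C) (f ` D) h"
 shows "cap X C D <= cap Y (f ` C) (f ` D)"
proof (rule cap_ge[OF h])
 fix k assume k: "adm Y (f ` C) (f ` D) k"
 show "cap X C D <= en Y k"
  using cap_le[OF adm_qsi[OF q X k]] l2_osc_qsi(2)[OF qsi_homeo[OF q] admD(2)[OF k]] by simp
qed

lemma cap_qsi:
 assumes q: "qsi X Y f g" and X: "compact X" "compact Y" and h: "adm X C D h" and sub: "C \<subseteq> X" "D \<subseteq> X"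
 shows "cap Y (f ` C) (f ` D) = cap X C D"
 by (smt (verit) adm_qsi X cap_qsi_ge h homeomorphism_image_inv q qsi_homeo qsi_sym sub)

lemma osc_comb_le:
 assumes "tame X u" "tame X w" "C \<in> circles X" "0 <= t" "t <= 1"
 shows "osc (%x. (1 - t) * u x + t * w x) C <= (1 - t) * osc u C + t * osc w C"
proof (rule osc_le)
 have b: "bounded (u ` C)" "bounded (w ` C)"
  using assms(1,2) circles_sub[OF assms(3)] by (auto intro: tame_bounded_sub)
 show "0 <= (1 - t) * osc u C + t * osc w C"
  using assms osc_nonneg[OF b(1)] osc_nonneg[OF b(2)] by simp
 fix x y assume xy: "x \<in> C" "y \<in> C"
 have "((1 - t) * u x + t * w x) - ((1 - t) * u y + t * w y) = (1 - t) * (u x - u y) + t * (w x - w y)"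
  by (simp add: algebra_simps)
 also have "... <= (1 - t) * osc u C + t * osc w C"
  using osc_bound[OF b(1) xy] osc_bound[OF b(2) xy] assms by (intro add_mono mult_left_mono) auto
 finally show "((1 - t) * u x + t * w x) - ((1 - t) * u y + t * w y) <= (1 - t) * osc u C + t * osc w C" .
qed

lemma adm_convex:
 assumes u: "adm X C D u" and w: "adm X C D w" and t: "0 <= t" "t <= 1"
 shows "adm X C D (%x. (1 - t) * u x + t * w x)"
  and "en X (%x. (1 - t) * u x + t * w x) <= ns (circles X) (%C. (1 - t) * osc u C + t * osc w C)"
  and "en X (%x. (1 - t) * u x + t * w x) <= (1 - t) * en X u + t * en X w"
proof -
 let ?h = "%x. (1 - t) * u x + t * w x"
 have tm: "tame X ?h"
  using tame_add[OF tame_affine[OF admD(1)[OF u], of 0 "1 - t"] tame_affine[OF admD(1)[OF w], of 0 t]] by simp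
 have l: "l2 (circles X) (%C. (1 - t) * osc u C + t * osc w C)"
  by (intro l2_add l2_cmult admD(2)[OF u] admD(2)[OF w])
 have le: "\<bar>osc ?h E\<bar> <= \<bar>(1 - t) * osc u E + t * osc w E\<bar>" if "E \<in> circles X" for E
  using osc_comb_le[OF admD(1)[OF u] admD(1)[OF w] that t] osc_circle_nonneg[OF tm that] by linarith
 have l2h: "l2 (circles X) (osc ?h)" by (rule l2_mono[OF l le])
 show "adm X C D ?h" unfolding adm_def using tm l2h admD[OF u] admD[OF w] by auto
 show 1: "en X ?h <= ns (circles X) (%C. (1 - t) * osc u C + t * osc w C)"
  unfolding en_def by (rule ns_mono[OF l le])
 show "en X ?h <= (1 - t) * en X u + t * en X w"
  using 1 ns_convex[OF admD(2)[OF u] admD(2)[OF w] t] unfolding en_def by linarith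
qed

text \<open>The midpoint of two admissible functions is admissible and oscillates at most by the
  mean, so the mean vector has square norm at least the capacity. The parallelogram identity then
  bounds the distance of the two oscillation vectors: along a minimising sequence these are Cauchy
  in l2, whatever the functions do.\<close>

lemma adm_parallelogram:
 assumes u: "adm X C D u" and w: "adm X C D w"
 shows "ns (circles X) (%E. osc u E - osc w E) <= 2 * (en X u - cap X C D) + 2 * (en X w - cap X C D)"
proof -
 have "cap X C D <= en X (%x. (1 - 1/2) * u x + 1/2 * w x)"
  by (rule cap_le, rule adm_convex[OF u w]) auto
 also have "... <= ns (circles X) (%E. (1 - 1/2) * osc u E + 1/2 * osc w E)"
  by (rule adm_convex[OF u w]) auto
 also have "... = ns (circles X) (%E. 1/2 * (osc u E + osc w E))"
  by (rule arg_cong[where f = "ns (circles X)"]) (auto simp: algebra_simps)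
 also have "... = 1/4 * ns (circles X) (%E. osc u E + osc w E)"
  by (subst ns_cmult) (simp add: power2_eq_square)
 finally show ?thesis
  using ns_parallelogram[OF admD(2)[OF u] admD(2)[OF w]] unfolding en_def by simp
qed

section \<open>Minimising sequences and their limit oscillations\<close>

definition minseq :: "'a::metric_space set => 'a set => 'a set => (nat => 'a => real) => bool" where
 "minseq X C D u \<longleftrightarrow> (\<forall>k. adm X C D (u k)) & (\<forall>k. \<forall>x\<in>X. 0 <= u k x & u k x <= 1) &
   (%k. en X (u k)) \<longlonglongrightarrow> cap X C D"

lemma minseqD:
 assumes "minseq X C D u"
 shows "adm X C D (u k)" "x \<in> X ==> 0 <= u k x" "x \<in> X ==> u k x <= 1" "(%k. en X (u k)) \<longlonglongrightarrow> cap X C D"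
 using assms unfolding minseq_def by auto

lemma minseq_subseq: "minseq X C D u ==> strict_mono r ==> minseq X C D (u \<circ> r)"
 using LIMSEQ_subseq_LIMSEQ[of "%k. en X (u k)" "cap X C D" r] unfolding minseq_def comp_def by auto

lemma minseqI:
 assumes "!!k. adm X C D (u k)" "!!k x. x \<in> X ==> 0 <= u k x" "!!k x. x \<in> X ==> u k x <= 1"
  and "!!k. en X (u k) <= cap X C D + c k" "c \<longlonglongrightarrow> 0"
 shows "minseq X C D u"
 unfolding minseq_def
proof (intro conjI allI ballI assms(1,2,3))
 show "(%k. en X (u k)) \<longlonglongrightarrow> cap X C D"
 proof (rule tendsto_sandwich[OF _ _ tendsto_const])
  show "(%k. cap X C D + c k) \<longlonglongrightarrow> cap X C D" using tendsto_add[OF tendsto_const assms(5), of "cap X C D"] by simp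
  show "\<forall>\<^sub>F k in sequentially. cap X C D <= en X (u k)" using cap_le[OF assms(1)] by simp
  show "\<forall>\<^sub>F k in sequentially. en X (u k) <= cap X C D + c k" using assms(4) by simp
 qed
qed

lemma osc_lip1:
 assumes "bounded (g ` A)" "!!x y. x \<in> A ==> y \<in> A ==> \<bar>h x - h y\<bar> <= \<bar>g x - g y\<bar>"
 shows "osc h A <= osc g A"
proof (rule osc_le)
 show "0 <= osc g A" by (rule osc_nonneg[OF assms(1)])
 fix x y assume "x \<in> A" "y \<in> A"
 thus "h x - h y <= osc g A" using assms(2)[of x y] osc_bound[OF assms(1), of x y] by simp
qed

lemma adm_lip1:
 assumes u: "adm X C D u" and h: "!!x y. x \<in> X ==> y \<in> X ==> \<bar>h x - h y\<bar> <= \<bar>u x - u y\<bar>"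
  and bd: "!!x. x \<in> C ==> h x = 0" "!!x. x \<in> D ==> h x = 1"
 shows "adm X C D h" "en X h <= en X u"
proof -
 have tm: "tame X h" by (rule tame_lip[OF admD(1)[OF u], of 1]) (use h in auto)
 have le: "\<bar>osc h E\<bar> <= \<bar>osc u E\<bar>" if E: "E \<in> circles X" for E
 proof -
  have "osc h E <= osc u E"
   by (rule osc_lip1[OF tame_bounded_sub[OF admD(1)[OF u] circles_sub[OF E]]]) (use h circles_sub[OF E] in auto)
  thus ?thesis using osc_circle_nonneg[OF tm E] by simp
 qed
 show "adm X C D h" unfolding adm_def using tm bd l2_mono[OF admD(2)[OF u] le] by auto
 show "en X h <= en X u" unfolding en_def by (rule ns_mono[OF admD(2)[OF u] le])
qed

lemma minseq_exists:
 assumes "adm X C D g0"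
 obtains u where "minseq X C D u"
proof -
 have "\<exists>g. adm X C D g & en X g < cap X C D + 1 / real (Suc k)" for k
 proof (rule ccontr)
  assume "~ ?thesis"
  hence "cap X C D + 1 / real (Suc k) <= cap X C D"
   by (intro cap_ge[OF assms]) (auto simp: not_less)
  moreover have "0 < 1 / real (Suc k)" by simp
  ultimately show False by linarith
 qed
 then obtain g where g: "!!k. adm X C D (g k)" "!!k. en X (g k) < cap X C D + 1 / real (Suc k)" by metis
 define u where "u = (%k x. max 0 (min 1 (g k x)))"
 have u: "adm X C D (u k)" "en X (u k) <= en X (g k)" for k
  by (rule adm_lip1[OF g(1)[of k]]; use admD[OF g(1)[of k]] in "auto simp: u_def")+
 have "minseq X C D u"
 proof (rule minseqI[OF u(1)])
  show "(%k. 1 / real (Suc k)) \<longlonglongrightarrow> 0" by (rule LIMSEQ_Suc[OF lim_1_over_n])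
  show "en X (u k) <= cap X C D + 1 / real (Suc k)" for k using u(2)[of k] g(2)[of k] by simp
 qed (auto simp: u_def)
 thus ?thesis by (rule that)
qed

text \<open>\<open>rho\<close> is the l2 limit of the oscillation vectors; it is not claimed to be
  the oscillation of any function.\<close>

definition mlim :: "'a::metric_space set => 'a set => 'a set => (nat => 'a => real) => ('a set => real) => bool" where
 "mlim X C D u rho \<longleftrightarrow> minseq X C D u & l2 (circles X) rho & (\<forall>E\<in>circles X. 0 <= rho E) &
   (%k. ns (circles X) (%E. osc (u k) E - rho E)) \<longlonglongrightarrow> 0"

lemma mlimD:
 assumes "mlim X C D u rho"
 shows "minseq X C D u" "l2 (circles X) rho" "E \<in> circles X ==> 0 <= rho E"
  "(%k. ns (circles X) (%E. osc (u k) E - rho E)) \<longlonglongrightarrow> 0"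
 using assms unfolding mlim_def by auto

lemma mlim_exists:
 assumes "minseq X C D u"
 obtains rho where "mlim X C D u rho"
proof -
 have l: "!!k. l2 (circles X) (osc (u k))" by (rule admD(2)[OF minseqD(1)[OF assms]])
 have c: "(%k. 2 * (en X (u k) - cap X C D)) \<longlonglongrightarrow> 0"
  using tendsto_mult[OF tendsto_const[of 2] tendsto_diff[OF minseqD(4)[OF assms] tendsto_const[of "cap X C D"]]] by simp
 obtain rho where r: "l2 (circles X) rho" "(%k. ns (circles X) (%E. osc (u k) E - rho E)) \<longlonglongrightarrow> 0"
   "!!E. E \<in> circles X ==> (%k. osc (u k) E) \<longlonglongrightarrow> rho E"
  by (rule l2_complete[OF l c]) (rule adm_parallelogram[OF minseqD(1)[OF assms] minseqD(1)[OF assms]], blast)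
 have "0 <= rho E" if "E \<in> circles X" for E
  by (rule LIMSEQ_le_const[OF r(3)[OF that]])
   (use osc_circle_nonneg[OF admD(1)[OF minseqD(1)[OF assms]] that] in auto)
 hence "mlim X C D u rho" unfolding mlim_def using assms r by auto
 thus ?thesis by (rule that)
qed

lemma mlim_point:
 assumes "mlim X C D u rho" "E \<in> circles X"
 shows "(%k. osc (u k) E) \<longlonglongrightarrow> rho E"
proof -
 note m = minseqD(1)[OF mlimD(1)[OF assms(1)]]
 have "(%k. osc (u k) E - rho E) \<longlonglongrightarrow> 0"
 proof (rule Lim_null_comparison)
  show "\<forall>\<^sub>F k in sequentially. norm (osc (u k) E - rho E) <= sqrt (ns (circles X) (%E. osc (u k) E - rho E))"
   using point_le_sqrt_ns[OF l2_diff[OF admD(2)[OF m] mlimD(2)[OF assms(1)]] assms(2)] by simp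
  show "(%k. sqrt (ns (circles X) (%E. osc (u k) E - rho E))) \<longlonglongrightarrow> 0"
   using tendsto_real_sqrt[OF mlimD(4)[OF assms(1)]] by simp
 qed
 thus ?thesis by (simp add: LIM_zero_iff)
qed

lemma mlim_ns:
 assumes "mlim X C D u rho"
 shows "ns (circles X) rho = cap X C D"
proof -
 let ?A = "circles X"
 note m = minseqD(1)[OF mlimD(1)[OF assms]]
 note l = admD(2)[OF m] and lr = mlimD(2)[OF assms]
 define d where "d = (%k. ns ?A (%E. osc (u k) E - rho E))"
 have d: "d \<longlonglongrightarrow> 0" unfolding d_def by (rule mlimD(4)[OF assms])
 have ex: "en X (u k) = ns ?A rho + 2 * infsum (%E. rho E * (osc (u k) E - rho E)) ?A + d k" for k
  using ns_add_expand[OF lr l2_diff[OF l[of k] lr]] unfolding en_def d_def by simp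
 have i0: "(%k. infsum (%E. rho E * (osc (u k) E - rho E)) ?A) \<longlonglongrightarrow> 0"
 proof (rule Lim_null_comparison)
  show "\<forall>\<^sub>F k in sequentially. norm (infsum (%E. rho E * (osc (u k) E - rho E)) ?A) <= sqrt (ns ?A rho) * sqrt (d k)"
   using l2_cs[OF lr l2_diff[OF l lr]] unfolding d_def by simp
  show "(%k. sqrt (ns ?A rho) * sqrt (d k)) \<longlonglongrightarrow> 0"
   using tendsto_mult[OF tendsto_const tendsto_real_sqrt[OF d]] by simp
 qed
 have "(%k. en X (u k)) \<longlonglongrightarrow> ns ?A rho + 2 * 0 + 0"
  unfolding ex by (intro tendsto_intros i0 d)
 thus ?thesis using LIMSEQ_unique minseqD(4)[OF mlimD(1)[OF assms]] by fastforce
qed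

text \<open>First variation: \<open>rho\<close> minimises the linear functional \<open>g \<mapsto> \<Sum> rho * osc g\<close> on admissible functions.\<close>

lemma first_variation:
 assumes ml: "mlim X C D u rho" and g: "adm X C D g"
 shows "cap X C D <= infsum (%E. rho E * osc g E) (circles X)"
proof -
 let ?A = "circles X"
 note m = minseqD(1)[OF mlimD(1)[OF ml]]
 note l = admD(2)[OF m] and lr = mlimD(2)[OF ml] and lg = admD(2)[OF g]
 define c where "c = cap X C D"
 define I where "I = infsum (%E. rho E * osc g E) ?A"
 have Ik: "(%k. infsum (%E. osc (u k) E * osc g E) ?A) \<longlonglongrightarrow> I"
 proof -
  have eq: "infsum (%E. osc (u k) E * osc g E) ?A - I = infsum (%E. (osc (u k) E - rho E) * osc g E) ?A" for k
   unfolding I_def by (subst infsum_diff[symmetric]) (auto intro: l2_mult l lr lg simp: algebra_simps)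
  have "(%k. infsum (%E. (osc (u k) E - rho E) * osc g E) ?A) \<longlonglongrightarrow> 0"
  proof (rule Lim_null_comparison)
   show "\<forall>\<^sub>F k in sequentially. norm (infsum (%E. (osc (u k) E - rho E) * osc g E) ?A)
     <= sqrt (ns ?A (%E. osc (u k) E - rho E)) * sqrt (en X g)"
    using l2_cs[OF l2_diff[OF l lr] lg] unfolding en_def by simp
   show "(%k. sqrt (ns ?A (%E. osc (u k) E - rho E)) * sqrt (en X g)) \<longlonglongrightarrow> 0"
    using tendsto_mult[OF tendsto_real_sqrt[OF mlimD(4)[OF ml]] tendsto_const] by simp
  qed
  hence "(%k. infsum (%E. osc (u k) E * osc g E) ?A - I) \<longlonglongrightarrow> 0" by (simp add: eq)
  thus ?thesis by (simp add: LIM_zero_iff)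
 qed
 \<comment> \<open>The competitor is (1 - t) * u k + t * g. The limit in k is taken for fixed t;
   afterwards one factor t cancels and t = 1 / (k + 2) tends to 0.\<close>
 have ineq: "(2 * t - t^2) * c <= 2 * (t * (1 - t) * I) + t^2 * en X g" if t: "0 < t" "t < 1" for t
 proof -
  have "c <= (1 - t)^2 * en X (u k) + 2 * (t * (1 - t) * infsum (%E. osc (u k) E * osc g E) ?A) + t^2 * en X g" for k
  proof -
   have "c <= en X (%x. (1 - t) * u k x + t * g x)"
    unfolding c_def by (rule cap_le, rule adm_convex[OF m g]) (use t in auto)
   also have "... <= ns ?A (%E. (1 - t) * osc (u k) E + t * osc g E)"
    by (rule adm_convex[OF m g]) (use t in auto)
   also have "... = ns ?A (%E. (1 - t) * osc (u k) E) +
     2 * infsum (%E. ((1 - t) * osc (u k) E) * (t * osc g E)) ?A + ns ?A (%E. t * osc g E)"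
    by (rule ns_add_expand[OF l2_cmult[OF l] l2_cmult[OF lg]])
   also have "infsum (%E. ((1 - t) * osc (u k) E) * (t * osc g E)) ?A
     = infsum (%E. (t * (1 - t)) * (osc (u k) E * osc g E)) ?A"
    by (rule infsum_cong) (simp add: algebra_simps)
   also have "... = t * (1 - t) * infsum (%E. osc (u k) E * osc g E) ?A"
    by (rule infsum_cmult_right')
   finally show ?thesis by (simp add: ns_cmult en_def)
  qed
  hence "c <= (1 - t)^2 * c + 2 * (t * (1 - t) * I) + t^2 * en X g"
   by (intro LIMSEQ_le_const[of "%k. (1 - t)^2 * en X (u k) + 2 * (t * (1 - t) * infsum (%E. osc (u k) E * osc g E) ?A) + t^2 * en X g"]
     tendsto_intros Ik) (use minseqD(4)[OF mlimD(1)[OF ml]] in "auto simp: c_def")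
  thus ?thesis by (simp add: power2_eq_square algebra_simps)
 qed
 have lim: "(2 - t) * c <= 2 * (1 - t) * I + t * en X g" if t: "0 < t" "t < 1" for t
 proof -
  have "t * ((2 - t) * c) <= t * (2 * (1 - t) * I + t * en X g)"
   using ineq[OF t] by (simp add: power2_eq_square algebra_simps)
  thus ?thesis using t by (simp add: mult_le_cancel_left_pos)
 qed
 have "2 * c <= 2 * I"
 proof (rule LIMSEQ_le)
  have h: "(%k. 1 / real (k + 2)) \<longlonglongrightarrow> 0"
   using LIMSEQ_ignore_initial_segment[OF lim_1_over_n, of 2] by simp
  show "(%k. (2 - 1 / real (k + 2)) * c) \<longlonglongrightarrow> 2 * c"
   using tendsto_mult[OF tendsto_diff[OF tendsto_const[of 2] h] tendsto_const[of c]] by simp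
  show "(%k. 2 * (1 - 1 / real (k + 2)) * I + 1 / real (k + 2) * en X g) \<longlonglongrightarrow> 2 * I"
   using tendsto_add[OF tendsto_mult[OF tendsto_mult[OF tendsto_const[of 2] tendsto_diff[OF tendsto_const[of 1] h]] tendsto_const[of I]]
     tendsto_mult[OF h tendsto_const[of "en X g"]]] by simp
  show "\<exists>N. \<forall>k\<ge>N. (2 - 1 / real (k + 2)) * c <= 2 * (1 - 1 / real (k + 2)) * I + 1 / real (k + 2) * en X g"
   by (intro exI allI impI lim) auto
 qed
 thus ?thesis unfolding c_def I_def by simp
qed

text \<open>The form in which the first variation is applied: replacing \<open>u k\<close> by an
  admissible \<open>g\<close> cannot lower the \<open>rho\<close>-weighted oscillation by more than
  an error that vanishes with k.\<close>

lemma variation_bound: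
 assumes ml: "mlim X C D u rho" and g: "adm X C D g"
 shows "infsum (%E. rho E * (osc (u k) E - osc g E)) (circles X)
   <= sqrt (cap X C D) * sqrt (ns (circles X) (%E. osc (u k) E - rho E))"
proof -
 let ?A = "circles X"
 note l = admD(2)[OF minseqD(1)[OF mlimD(1)[OF ml]]] and lr = mlimD(2)[OF ml] and lg = admD(2)[OF g]
 have "infsum (%E. rho E * (osc (u k) E - osc g E)) ?A =
   infsum (%E. rho E * osc (u k) E) ?A - infsum (%E. rho E * osc g E) ?A"
  by (subst infsum_diff[symmetric]) (auto intro: l2_mult l lr lg simp: algebra_simps)
 also have "... <= infsum (%E. rho E * osc (u k) E) ?A - ns ?A rho"
  using first_variation[OF ml g] mlim_ns[OF ml] by simp
 also have "... = infsum (%E. rho E * (osc (u k) E - rho E)) ?A"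
  unfolding ns_def by (subst infsum_diff[symmetric])
   (use l2_mult[OF lr lr] in "auto intro: l2_mult l lr simp: algebra_simps power2_eq_square")
 also have "... <= sqrt (ns ?A rho) * sqrt (ns ?A (%E. osc (u k) E - rho E))"
  using l2_cs[OF lr l2_diff[OF l[of k] lr]] by simp
 finally show ?thesis by (simp add: mlim_ns[OF ml])
qed

section \<open>Grid squares of the carpet\<close>

text \<open>Subdivision becomes arithmetic of base n digits: \<open>i div n\<close> is the index of
  the parent and \<open>i mod n\<close> the position in it. A subsquare is removed when both
  positions are hole digits.\<close>

definition hdig :: "nat => nat => nat => bool" where
 "hdig n p a \<longleftrightarrow> a = p | a = n - 1 - p"

text \<open>The grid square \<open>(k, i, j)\<close> has lower left corner \<open>(i / n^k, j / n^k)\<close> and side \<open>1 / n^k\<close>;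
 \<open>cell\<close> singles out the squares left after \<open>k\<close> steps, \<open>hole\<close> those removed in step \<open>k\<close>.\<close>

fun cell :: "nat => nat => nat => nat => nat => bool" where
 "cell n p 0 i j \<longleftrightarrow> i = 0 & j = 0"
| "cell n p (Suc k) i j \<longleftrightarrow> cell n p k (i div n) (j div n) & ~ (hdig n p (i mod n) & hdig n p (j mod n))"

fun hole :: "nat => nat => nat => nat => nat => bool" where
 "hole n p 0 i j \<longleftrightarrow> False"
| "hole n p (Suc k) i j \<longleftrightarrow> cell n p k (i div n) (j div n) & hdig n p (i mod n) & hdig n p (j mod n)"

definition gsq :: "nat => nat => nat => nat => pt set" where
 "gsq n k i j = {z. real i <= fst z * real n ^ k & fst z * real n ^ k <= real i + 1 &
           real j <= snd z * real n ^ k & snd z * real n ^ k <= real j + 1}"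

definition gbx :: "nat => nat => nat => nat => pt set" where
 "gbx n k i j = {z. real i < fst z * real n ^ k & fst z * real n ^ k < real i + 1 &
           real j < snd z * real n ^ k & snd z * real n ^ k < real j + 1}"

definition circ :: "nat => nat => nat => nat => pt set" where
 "circ n k i j = gsq n k i j - gbx n k i j"

lemma gbx_sub: "gbx n k i j \<subseteq> gsq n k i j"
 unfolding gbx_def gsq_def by auto

locale carpet_params =
 fixes n p :: nat
 assumes n5: "5 <= n" and p1: "1 <= p" and p2: "2 * p + 2 < n"
begin

abbreviation F where "F \<equiv> carpet n p"

abbreviation cl where "cl \<equiv> cell n p"
abbreviation hl where "hl \<equiv> hole n p"
abbreviation pw where "pw k \<equiv> real n ^ k"
abbreviation gs where "gs == gsq n"
abbreviation gb where "gb \<equiv> gbx n"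
abbreviation cr where "cr \<equiv> circ n"

lemma n_pos [simp]: "0 < n" "n > Suc 0" using n5 by auto
lemma nR: "real n > 0" "real n >= 5" using n5 by auto
lemma npow_pos [simp]: "0 < real n ^ k" using nR by simp
lemma npow_pos' [simp]: "0 < n ^ k" by simp
lemma npow_ge1: "1 <= real n ^ k" using n5 by (simp add: one_le_power)

lemma hdig_bounds: "hdig n p a ==> 1 <= a & a + 2 <= n"
 using p1 p2 unfolding hdig_def by auto

lemma hdig_nbr: "hdig n p a ==> ~ hdig n p (a - 1) & ~ hdig n p (a + 1)"
 using p1 p2 unfolding hdig_def by auto

text \<open>Here p < n / 2 - 1 enters: the hole digits p and n - 1 - p differ by at least 2, so
  sibling holes are never adjacent. Disjointness of the peripheral circles and the free blocks
  around holes rest on this.\<close>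

lemma hdig_close: "hdig n p a ==> hdig n p b ==> a <= b + 1 ==> b <= a + 1 ==> a = b"
 using p1 p2 unfolding hdig_def by auto

lemma idx_close:
 assumes "hdig n p (a mod n)" "hdig n p (b mod n)" "a div n = b div n" "a <= b + 1" "b <= a + 1"
 shows "a = b"
proof -
 have "a = n * (b div n) + a mod n" "b = n * (b div n) + b mod n" using assms(3) by (metis mult_div_mod_eq)+
 hence "a mod n <= b mod n + 1" "b mod n <= a mod n + 1" using assms(4,5) by linarith+
 hence "a mod n = b mod n" using hdig_close assms(1,2) by blast
 thus ?thesis using assms(3) by (metis mult_div_mod_eq)
qed

lemma hdig_0: "~ hdig n p 0" "~ hdig n p (n - 1)"
 using p1 p2 unfolding hdig_def by auto

lemma cell_bound: "cl k i j ==> i < n ^ k & j < n ^ k"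
proof (induction k arbitrary: i j)
 case (Suc k)
 hence "i div n < n ^ k" "j div n < n ^ k" by auto
 thus ?case by (simp add: div_less_iff_less_mult mult.commute)
qed simp

lemma hole_bound: "hl k i j ==> i < n ^ k & j < n ^ k"
proof (cases k)
 case (Suc m)
 assume "hl k i j"
 hence "i div n < n ^ m" "j div n < n ^ m" using cell_bound Suc by auto
 thus ?thesis by (simp add: Suc div_less_iff_less_mult mult.commute)
qed simp

lemma cell_prefix: "cl (k + m) i j ==> cl k (i div n ^ m) (j div n ^ m)"
proof (induction m arbitrary: i j)
 case (Suc m)
 hence "cl k (i div n div n ^ m) (j div n div n ^ m)" by simp
 thus ?case by (simp add: div_mult2_eq)
qed simp

lemma hole_prefix: "hl (k + Suc m) i j ==> cl k (i div n ^ Suc m) (j div n ^ Suc m)"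
 using cell_prefix[of k m "i div n" "j div n"] by (simp add: div_mult2_eq)

lemma hole_not_cell: "hl k i j ==> ~ cl k i j"
 by (cases k) auto

text \<open>The first ancestor that is not a cell was removed in its own step; m counts the levels
  below it.\<close>

lemma noncell_in_hole:
 assumes "i < n ^ k" "j < n ^ k" "~ cl k i j"
 shows "\<exists>l m. k = l + m & hl l (i div n ^ m) (j div n ^ m)"
 using assms
proof (induction k arbitrary: i j)
 case (Suc k)
 show ?case
 proof (cases "cl k (i div n) (j div n)")
  case True
  hence "hl (Suc k) i j" using Suc.prems by simp
  thus ?thesis by (intro exI[of _ "Suc k"] exI[of _ 0]) simp
 next
  case False
  have "i div n < n ^ k" "j div n < n ^ k"
   using Suc.prems by (simp_all add: div_less_iff_less_mult mult.commute)
  then obtain l m where "k = l + m" "hl l (i div n div n ^ m) (j div n div n ^ m)"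
   using Suc.IH False by blast
  thus ?thesis by (intro exI[of _ l] exI[of _ "Suc m"]) (simp add: div_mult2_eq)
 qed
qed simp

lemma div_real: "real (i div n ^ m) * real n ^ m <= real i" "real i + 1 <= (real (i div n ^ m) + 1) * real n ^ m"
proof -
 have "(i div n ^ m) * n ^ m <= i" "i + 1 <= (i div n ^ m + 1) * n ^ m"
  using div_times_less_eq_dividend[of i "n ^ m"] dividend_less_div_times[of "n ^ m" i] by (simp_all add: algebra_simps)
 hence "real ((i div n ^ m) * n ^ m) <= real i" "real (i + 1) <= real ((i div n ^ m + 1) * n ^ m)" by (simp_all only: of_nat_le_iff)
 thus "real (i div n ^ m) * real n ^ m <= real i" "real i + 1 <= (real (i div n ^ m) + 1) * real n ^ m" by (simp_all add: distrib_right)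
qed

lemma div_scale:
 assumes "real i <= x * real n ^ (k + m)" "x * real n ^ (k + m) <= real i + 1"
 shows "real (i div n ^ m) <= x * real n ^ k & x * real n ^ k <= real (i div n ^ m) + 1"
proof -
 have "real (i div n ^ m) * real n ^ m <= (x * real n ^ k) * real n ^ m" "(x * real n ^ k) * real n ^ m <= (real (i div n ^ m) + 1) * real n ^ m"
  using assms div_real[of i m] unfolding power_add mult.assoc[symmetric] by linarith+
 thus ?thesis unfolding mult_le_cancel_right_pos[OF npow_pos] by blast
qed

lemma gsq_nest: "gsq n (k + m) i j \<subseteq> gsq n k (i div n ^ m) (j div n ^ m)"
 unfolding gsq_def using div_scale by auto

lemma idx_unique:
 fixes t :: real
 assumes "real i < t" "t < real i + 1" "real i' <= t" "t <= real i' + 1"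
 shows "i' = i"
 using assms by (metis add.commute antisym_conv3 leD le_less_trans less_le_trans not_less_eq of_nat_Suc of_nat_less_iff less_Suc_eq)

lemma div_scale_strict:
 assumes "real i < x * real n ^ (k + m)" "x * real n ^ (k + m) < real i + 1"
 shows "real (i div n ^ m) < x * real n ^ k & x * real n ^ k < real (i div n ^ m) + 1"
proof -
 have "real (i div n ^ m) * real n ^ m < (x * real n ^ k) * real n ^ m" "(x * real n ^ k) * real n ^ m < (real (i div n ^ m) + 1) * real n ^ m"
  using assms div_real[of i m] unfolding power_add mult.assoc[symmetric] by linarith+
 thus ?thesis unfolding mult_less_cancel_right_pos[OF npow_pos] by blast
qed

lemma gbx_nest: "gbx n (k + m) i j \<subseteq> gbx n k (i div n ^ m) (j div n ^ m)"
 unfolding gbx_def using div_scale_strict by auto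

lemma gbx_gsq_idx:
 assumes "z \<in> gbx n (k + m) i j" "z \<in> gsq n k i' j'"
 shows "i' = i div n ^ m" "j' = j div n ^ m"
 using gbx_nest[of k m i j] assms idx_unique unfolding gbx_def gsq_def by blast+

lemma gsq_gbx_idx:
 assumes "z \<in> gsq n (k + m) i j" "z \<in> gbx n k i' j'"
 shows "i div n ^ m = i'" "j div n ^ m = j'"
 using gsq_nest[of k m i j] assms idx_unique unfolding gbx_def gsq_def by blast+

text \<open>Hole digits lie between 1 and n - 2, so a hole does not touch the boundary of its
  parent.\<close>

lemma hole_inside:
 assumes "hl (k + Suc m) i j"
 shows "gsq n (k + Suc m) i j \<subseteq> gbx n k (i div n ^ Suc m) (j div n ^ Suc m)"
proof -
 have h: "hdig n p (i mod n)" "hdig n p (j mod n)" using assms by auto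
 have one: "real (q div n) < t / real n & t / real n < real (q div n) + 1"
  if "hdig n p (q mod n)" "real q <= t" "t <= real q + 1" for q t
 proof -
  have b: "1 <= q mod n" "q mod n + 2 <= n" using hdig_bounds[OF that(1)] by auto
  have q: "q = q div n * n + q mod n" by simp
  have "q div n * n < q" using b q by linarith
  hence "real (q div n) * real n < t" using that(2) by (metis less_le_trans of_nat_less_iff of_nat_mult)
  moreover have "q + 1 < (q div n + 1) * n"
  proof -
   have "q + 1 < q div n * n + n" using b q by linarith
   thus ?thesis by simp
  qed
  hence "t < (real (q div n) + 1) * real n" using that(3)
   by (metis le_less_trans of_nat_1 of_nat_add of_nat_less_iff of_nat_mult)
  ultimately show ?thesis using nR by (simp add: divide_simps)
 qed
 have "gsq n (k + Suc m) i j \<subseteq> gbx n (k + m) (i div n) (j div n)"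
 proof
  fix z assume z: "z \<in> gsq n (k + Suc m) i j"
  have e: "x * real n ^ (k + m) = (x * real n ^ (k + Suc m)) / real n" for x using nR by simp
  show "z \<in> gbx n (k + m) (i div n) (j div n)"
   using one[OF h(1), of "fst z * real n ^ (k + Suc m)"] one[OF h(2), of "snd z * real n ^ (k + Suc m)"] z
   unfolding gsq_def gbx_def mem_Collect_eq e by blast
 qed
 also have "... \<subseteq> gbx n k (i div n div n ^ m) (j div n div n ^ m)" by (rule gbx_nest)
 finally show ?thesis by (simp add: div_mult2_eq)
qed

lemma gsq_cbox: "gs k i j = cbox (real i / pw k, real j / pw k)
  ((real i + 1) / pw k, (real j + 1) / pw k)"
 unfolding gsq_def cbox_Pair_eq by (auto simp: pos_divide_le_eq pos_le_divide_eq)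

lemma gbx_Times: "gb k i j = {real i / pw k <..< (real i + 1) / pw k} \<times>
  {real j / pw k <..< (real j + 1) / pw k}"
 unfolding gbx_def by (auto simp: pos_divide_less_eq pos_less_divide_eq)

lemma gbx_interior: "gb k i j = interior (gs k i j)"
 unfolding gsq_cbox gbx_Times cbox_Pair_eq by (simp add: interior_Times)

text \<open>Closed subintervals share endpoints. If the point is an endpoint of a subinterval with a
  hole digit, the neighbouring digit, which is not a hole digit, is chosen instead; so a hole digit
  is returned only when the point is in the open subinterval.\<close>

lemma split_dim:
 assumes "real i <= x * pw k" "x * pw k <= real i + 1"
 shows "\<exists>a<n. real (n * i + a) <= x * pw (Suc k) & x * pw (Suc k) <= real (n * i + a) + 1 &
   (hdig n p a --> real (n * i + a) < x * pw (Suc k) & x * pw (Suc k) < real (n * i + a) + 1)"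
proof -
 define T where "T = x * pw (Suc k) - real n * real i"
 have e: "x * pw (Suc k) = real n * (x * pw k)" by simp
 have "real n * real i <= real n * (x * pw k)" "real n * (x * pw k) <= real n * (real i + 1)"
  using assms nR by (auto intro!: mult_left_mono)
 hence T: "0 <= T" "T <= real n" unfolding T_def e by (simp_all add: distrib_left)
 have "\<exists>a<n. real a <= T & T <= real a + 1"
 proof (cases "T = real n")
  case True thus ?thesis using n5 by (intro exI[of _ "n - 1"]) (auto simp: of_nat_diff)
 next
  case False
  hence "nat \<lfloor>T\<rfloor> < n" using T by (simp add: nat_less_iff floor_less_iff)
  moreover have "real (nat \<lfloor>T\<rfloor>) <= T" "T <= real (nat \<lfloor>T\<rfloor>) + 1" using T by auto
  ultimately show ?thesis by blast
 qed
 then obtain a where a: "a < n" "real a <= T" "T <= real a + 1" by blast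
 have "\<exists>a<n. real a <= T & T <= real a + 1 & (hdig n p a --> real a < T & T < real a + 1)"
 proof (cases "hdig n p a")
  case False thus ?thesis using a by blast
 next
  case True
  note b = hdig_bounds[OF True] and nb = hdig_nbr[OF True]
  consider "T = real a" | "T = real a + 1" | "real a < T" "T < real a + 1" using a by linarith
  thus ?thesis
  proof cases
   case 1 thus ?thesis using b nb a by (intro exI[of _ "a - 1"]) (auto simp: of_nat_diff)
  next
   case 2 thus ?thesis using b nb a by (intro exI[of _ "a + 1"]) auto
  next
   case 3 thus ?thesis using a by blast
  qed
 qed
 then obtain a where a: "a < n" "real a <= T" "T <= real a + 1" "hdig n p a --> real a < T & T < real a + 1" by blast
 have "x * pw (Suc k) = T + real n * real i" unfolding T_def by simp
 moreover have "real (n * i + a) = real a + real n * real i" by simp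
 ultimately show ?thesis using a by (intro exI[of _ a]) linarith
qed

lemma split_cell:
 assumes "cl k i j" "z \<in> gs k i j"
 shows "(\<exists>i' j'. cl (Suc k) i' j' & i' div n = i & j' div n = j & z \<in> gs (Suc k) i' j') |
  (\<exists>i' j'. hl (Suc k) i' j' & i' div n = i & j' div n = j & z \<in> gb (Suc k) i' j')"
proof -
 obtain a where a: "a < n" "real (n * i + a) <= fst z * pw (Suc k)" "fst z * pw (Suc k) <= real (n * i + a) + 1"
   "hdig n p a ==> real (n * i + a) < fst z * pw (Suc k) & fst z * pw (Suc k) < real (n * i + a) + 1"
  using split_dim[of i "fst z" k] assms(2) unfolding gsq_def by blast
 obtain b where b: "b < n" "real (n * j + b) <= snd z * pw (Suc k)" "snd z * pw (Suc k) <= real (n * j + b) + 1"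
   "hdig n p b ==> real (n * j + b) < snd z * pw (Suc k) & snd z * pw (Suc k) < real (n * j + b) + 1"
  using split_dim[of j "snd z" k] assms(2) unfolding gsq_def by blast
 have d: "(n * i + a) div n = i" "(n * j + b) div n = j" "(n * i + a) mod n = a" "(n * j + b) mod n = b"
  using a(1) b(1) by auto
 show ?thesis
 proof (cases "hdig n p a & hdig n p b")
  case True
  hence "hl (Suc k) (n * i + a) (n * j + b)" using assms(1) d by simp
  moreover have "z \<in> gb (Suc k) (n * i + a) (n * j + b)" using a b True unfolding gbx_def by blast
  ultimately show ?thesis using d by blast
 next
  case False
  hence "cl (Suc k) (n * i + a) (n * j + b)" using assms(1) d by simp
  moreover have "z \<in> gs (Suc k) (n * i + a) (n * j + b)" using a b unfolding gsq_def by blast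
  ultimately show ?thesis using d by blast
 qed
qed

lemma sub_corner_eq:
 "(real i / pw k, real j / pw k) + (1 / pw k) *\<^sub>R (real a / real n, real b / real n)
  = (real (n * i + a) / pw (Suc k), real (n * j + b) / pw (Suc k))"
 using nR by (simp add: field_simps)

lemma corner_inj:
 "(real i / pw k, real j / pw k) = (real i' / pw k, real j' / pw k) \<longleftrightarrow> i = i' & j = j'"
 using nR by simp

lemma hdig_real: "{real p / real n, 1 - (real p + 1) / real n} = {real a / real n | a. hdig n p a}"
proof -
 have "1 - (real p + 1) / real n = real (n - 1 - p) / real n"
  using p2 nR by (simp add: of_nat_diff field_simps)
 thus ?thesis unfolding hdig_def by auto
qed

lemma hole_corners_eq:
 "hole_corners n p (real i / pw k, real j / pw k) (1 / pw k) =
  {(real (n * i + a) / pw (Suc k), real (n * j + b) / pw (Suc k)) | a b. hdig n p a & hdig n p b}"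
 unfolding hole_corners_def hdig_real sub_corner_eq[symmetric] by blast

lemma sub_corners_eq:
 "sub_corners n (real i / pw k, real j / pw k) (1 / pw k) =
  {(real (n * i + a) / pw (Suc k), real (n * j + b) / pw (Suc k)) | a b. a < n & b < n}"
 unfolding sub_corners_def sub_corner_eq[symmetric] by blast

lemma carpet_corners_eq:
 "carpet_corners n p k = {(real i / pw k, real j / pw k) | i j. cl k i j}"
proof (induction k)
 case 0 show ?case by simp
next
 case (Suc k)
 have "carpet_corners n p (Suc k) = (\<Union>c \<in> {(real i / pw k, real j / pw k) | i j. cl k i j}.
    sub_corners n c (1 / pw k) - hole_corners n p c (1 / pw k))"
  by (simp only: carpet_corners.simps Suc.IH)
 also have "... = {(real i / pw (Suc k), real j / pw (Suc k)) | i j. cl (Suc k) i j}" (is "?A = ?B")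
 proof (intro subset_antisym subsetI)
  fix z assume "z \<in> ?A"
  then obtain i j where ij: "cl k i j"
   "z \<in> sub_corners n (real i / pw k, real j / pw k) (1 / pw k)"
   "z \<notin> hole_corners n p (real i / pw k, real j / pw k) (1 / pw k)" by blast
  then obtain a b where ab: "a < n" "b < n" "z = (real (n * i + a) / pw (Suc k), real (n * j + b) / pw (Suc k))"
   unfolding sub_corners_eq by blast
  have "~ (hdig n p a & hdig n p b)" using ij(3) ab(3) unfolding hole_corners_eq by blast
  hence "cl (Suc k) (n * i + a) (n * j + b)" using ij(1) ab(1,2) by simp
  thus "z \<in> ?B" using ab(3) by blast
 next
  fix z assume "z \<in> ?B"
  then obtain i j where ij: "cl (Suc k) i j" "z = (real i / pw (Suc k), real j / pw (Suc k))" by blast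
  define i0 j0 a b where "i0 = i div n" and "j0 = j div n" and "a = i mod n" and "b = j mod n"
  have e: "i = n * i0 + a" "j = n * j0 + b" "a < n" "b < n" unfolding i0_def j0_def a_def b_def by auto
  have c0: "cl k i0 j0" "~ (hdig n p a & hdig n p b)" using ij(1) unfolding i0_def j0_def a_def b_def by auto
  have "z \<in> sub_corners n (real i0 / pw k, real j0 / pw k) (1 / pw k)"
   unfolding sub_corners_eq using ij(2) e by blast
  moreover have "z \<notin> hole_corners n p (real i0 / pw k, real j0 / pw k) (1 / pw k)"
  using hole_corners_eq ij(2) corner_inj[of i "Suc k" j] e c0 by simp
  ultimately show "z \<in> ?A" using c0(1) by blast
 qed
 finally show ?case .
qed

lemma square_gsq: "square (real i / pw k, real j / pw k) (1 / pw k) = gs k i j"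
 unfolding square_def gsq_cbox by (simp add: add_divide_distrib)

lemma unit_gsq: "{0..1} \<times> {0..1} = gs 0 0 0"
 unfolding gsq_def by auto

text \<open>A stage deletes open holes, whereas the right side unites closed cells. The boundary of
  a hole is covered by surrounding cells by \<open>split_cell\<close>, and an open grid square meets
  no other closed one of its level.\<close>

lemma stage_eq: "carpet_stage n p k = {z. \<exists>i j. cl k i j & z \<in> gs k i j}"
proof (cases k)
 case 0 thus ?thesis using unit_gsq by simp
next
 case (Suc m)
 have B: "(\<Union>h \<in> hole_corners n p (real i / pw m, real j / pw m) (1 / pw m). interior (square h (1 / pw (Suc m))))
   = {z. \<exists>a b. hdig n p a & hdig n p b & z \<in> gb (Suc m) (n * i + a) (n * j + b)}" for i j
  unfolding hole_corners_eq gbx_interior square_gsq[symmetric] by blast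
 have A: "z \<in> carpet_stage n p (Suc m) \<longleftrightarrow> (\<exists>i j. cl m i j & z \<in> gs m i j &
   (\<forall>a b. hdig n p a & hdig n p b --> z \<notin> gb (Suc m) (n * i + a) (n * j + b)))" for z
 proof -
  have "carpet_stage n p (Suc m) = (\<Union>(i,j)\<in>{(i,j). cl m i j}. gs m i j -
    {z. \<exists>a b. hdig n p a & hdig n p b & z \<in> gb (Suc m) (n * i + a) (n * j + b)})"
   unfolding carpet_stage.simps carpet_corners_eq B[symmetric] square_gsq[symmetric] by blast
  thus ?thesis by blast
 qed
 show ?thesis unfolding Suc
 proof (intro subset_antisym subsetI)
  fix z assume "z \<in> carpet_stage n p (Suc m)"
  then obtain i j where ij: "cl m i j" "z \<in> gs m i j"
   and nh: "!!a b. hdig n p a ==> hdig n p b ==> z \<notin> gb (Suc m) (n * i + a) (n * j + b)" unfolding A by blast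
  from split_cell[OF ij] show "z \<in> {z. \<exists>i j. cl (Suc m) i j & z \<in> gs (Suc m) i j}"
  proof
   assume "\<exists>i' j'. hl (Suc m) i' j' & i' div n = i & j' div n = j & z \<in> gb (Suc m) i' j'"
   then obtain i' j' where h: "hl (Suc m) i' j'" "i' div n = i" "j' div n = j" "z \<in> gb (Suc m) i' j'" by blast
   have "n * i + i' mod n = i'" "n * j + j' mod n = j'" using h(2,3) by auto
   thus ?thesis using nh[of "i' mod n" "j' mod n"] h by auto
  qed blast
 next
  fix z assume "z \<in> {z. \<exists>i j. cl (Suc m) i j & z \<in> gs (Suc m) i j}"
  then obtain i j where ij: "cl (Suc m) i j" "z \<in> gs (Suc m) i j" by blast
  have "z \<in> gs m (i div n) (j div n)" using gsq_nest[of m 1 i j] ij(2) by auto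
  moreover have "z \<notin> gb (Suc m) (n * (i div n) + a) (n * (j div n) + b)" if "hdig n p a" "hdig n p b" for a b
  proof
   assume "z \<in> gb (Suc m) (n * (i div n) + a) (n * (j div n) + b)"
   hence "i = n * (i div n) + a" "j = n * (j div n) + b"
    using gbx_gsq_idx[of z "Suc m" 0] ij(2) by auto
   moreover have "a < n" "b < n" using hdig_bounds that by fastforce+
   ultimately have "i mod n = a" "j mod n = b" by (metis mod_less mod_mult_self4)+
   thus False using ij(1) that by simp
  qed
  ultimately show "z \<in> carpet_stage n p (Suc m)" unfolding A using ij(1) by auto
 qed
qed

lemma F_iff: "z \<in> F \<longleftrightarrow> (\<forall>k. \<exists>i j. cl k i j & z \<in> gs k i j)"
 unfolding carpet_def stage_eq by simp

lemma F_noncell: "z \<in> F ==> ~ cl k i j ==> z \<notin> gb k i j"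
 using gbx_gsq_idx[of z k 0 i j] unfolding F_iff by fastforce

lemma F_hole: "z \<in> F ==> hl k i j ==> z \<notin> gb k i j"
 using F_noncell hole_not_cell by blast

text \<open>At the first stage that loses the point, it lies in a hole removed in that very
  step.\<close>

lemma not_F_hole:
 assumes "z \<in> gs 0 0 0" "z \<notin> F"
 shows "\<exists>k i j. hl k i j & z \<in> gb k i j"
proof -
 define P where "P = (%k. \<exists>i j. cl k i j & z \<in> gs k i j)"
 have "P 0" unfolding P_def using assms(1) by simp
 have ex: "\<exists>k. ~ P k" using assms(2) unfolding F_iff P_def by blast
 define k where "k = (LEAST k. ~ P k)"
 have k: "~ P k" "!!l. l < k ==> P l" using LeastI_ex[OF ex] not_less_Least unfolding k_def by blast+
 then obtain m where m: "k = Suc m" using \<open>P 0\<close> by (cases k) auto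
 hence "P m" using k by simp
 then obtain i j where "cl m i j" "z \<in> gs m i j" unfolding P_def by blast
 from split_cell[OF this] show ?thesis using k(1) m unfolding P_def by blast
qed

lemma F_unit: "F \<subseteq> gs 0 0 0"
proof
 fix z assume "z \<in> F"
 then obtain i j where "cl 0 i j" "z \<in> gs 0 i j" unfolding F_iff by blast
 thus "z \<in> gs 0 0 0" by simp
qed

lemma gsq_unit: "i < n ^ k ==> j < n ^ k ==> gs k i j \<subseteq> gs 0 0 0"
 using gsq_nest[of 0 k i j] by simp

lemma level_cases: obtains (le) m where "(l::nat) = k + m" | (gt) m where "k = l + Suc m"
 by (metis le_Suc_ex less_imp_Suc_add not_less add_Suc_right)

text \<open>A point outside F lies in an open hole. Comparing levels, that hole would lie in the
  open square, which the boundary avoids, or be an ancestor of it, although ancestors of cells and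
  holes are cells.\<close>

lemma circ_in_F:
 assumes "cl k i j | hl k i j"
 shows "cr k i j \<subseteq> F"
proof
 fix z assume z: "z \<in> cr k i j"
 have b: "i < n ^ k" "j < n ^ k" using assms cell_bound hole_bound by blast+
 show "z \<in> F"
 proof (rule ccontr)
  assume "z \<notin> F"
  then obtain l i' j' where h: "hl l i' j'" "z \<in> gb l i' j'"
   using not_F_hole z gsq_unit[OF b] unfolding circ_def by blast
  show False
  proof (cases rule: level_cases[of l k])
   case (le m)
   hence "i = i' div n ^ m" "j = j' div n ^ m" using gbx_gsq_idx[of z k m i' j' i j] h z unfolding circ_def by auto
   thus False using gbx_nest[of k m i' j'] le h z unfolding circ_def by auto
  next
   case (gt m)
   hence e: "i div n ^ Suc m = i'" "j div n ^ Suc m = j'"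
    using gsq_gbx_idx[of z l "Suc m" i j i' j'] h z unfolding circ_def by auto
   have "cl l i' j'"
    using assms cell_prefix[of l "Suc m" i j] hole_prefix[of l m i j] gt e by auto
   thus False using h(1) hole_not_cell by blast
  qed
 qed
qed

lemma circ_disjoint:
 assumes "hl k i j | (k = 0 & i = 0 & j = 0)" "hl l i' j' | (l = 0 & i' = 0 & j' = 0)"
  and z: "z \<in> cr k i j" "z \<in> cr l i' j'"
 shows "k = l & i = i' & j = j'"
proof -
 have less: False if h: "hl (k + Suc m) i j" and h': "hl k i' j' | (k = 0 & i' = 0 & j' = 0)"
   and z: "z \<in> cr (k + Suc m) i j" "z \<in> cr k i' j'" for k m i j i' j'
 using hole_inside[OF h] z(1) gbx_gsq_idx[of z k 0] z(2) by (fastforce simp: circ_def)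
 have eq: "i = i' & j = j'" if h: "hl k i j" "hl k i' j'" and z: "z \<in> gs k i j" "z \<in> gs k i' j'" for k i j i' j'
 proof -
  obtain m where m: "k = Suc m" using h(1) by (cases k) auto
  have g: "z \<in> gb m (i div n) (j div n)" "z \<in> gb m (i' div n) (j' div n)"
   using hole_inside[of m 0 i j] hole_inside[of m 0 i' j'] h z unfolding m by auto
  have d: "i div n = i' div n" "j div n = j' div n"
   using gbx_gsq_idx[of z m 0 "i' div n" "j' div n" "i div n" "j div n"] g subsetD[OF gbx_sub g(1)] by simp_all
  have one: "a <= b + 1" if "real a <= t" "t <= real b + 1" for a b t using that by linarith
  have "i <= i' + 1" "i' <= i + 1" "j <= j' + 1" "j' <= j + 1" using z unfolding gsq_def by (auto intro: one)
  thus ?thesis using idx_close[of i i'] idx_close[of j j'] d h unfolding m by auto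
 qed
 consider "k = l" | m where "l = k + Suc m" | m where "k = l + Suc m"
  by (metis less_imp_Suc_add linorder_neqE_nat add_Suc_right)
 thus ?thesis
 proof cases
  case 1
  thus ?thesis using assms eq[of k i j i' j'] unfolding circ_def by auto
 next
  case 2
  thus ?thesis using less[of k m i' j' i j] assms by auto
 next
  case 3
  thus ?thesis using less[of l m i j i' j'] assms by auto
 qed
qed

lemma finite_cells: "finite {(i, j). cl k i j}"
 by (rule finite_subset[of _ "{..<n^k} \<times> {..<n^k}"]) (use cell_bound in auto)

lemma compact_F: "compact F"
proof -
 have "closed (carpet_stage n p k)" for k
 proof -
  have "carpet_stage n p k = (\<Union>(i,j)\<in>{(i, j). cl k i j}. gs k i j)" unfolding stage_eq by auto
  thus ?thesis using finite_cells[of k] by (auto simp: gsq_cbox intro!: closed_UN)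
 qed
 hence "closed F" unfolding carpet_def by (intro closed_INT) auto
 moreover have "bounded F" using F_unit bounded_subset[OF bounded_cbox] unfolding gsq_cbox by blast
 ultimately show ?thesis using compact_eq_bounded_closed by blast
qed

section \<open>Peripheral circles of the carpet\<close>

text \<open>\<open>hole\<close> has no instance at level 0, so (0, 0, 0) is free to index the outer
  circle.\<close>

definition ixs :: "(nat \<times> nat \<times> nat) set" where
 "ixs = insert (0, 0, 0) {(k, i, j). hl k i j}"

abbreviation circ_of where "circ_of \<equiv> (%(k, i, j). cr k i j)"

lemma ixs_bound: "(k, i, j) \<in> ixs ==> i < n ^ k & j < n ^ k"
 unfolding ixs_def using hole_bound by auto

lemma circ_ix_in_F: "(k, i, j) \<in> ixs ==> cr k i j \<subseteq> F"
 using circ_in_F[of k i j] unfolding ixs_def by auto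

lemma gsq_center: "((real i + 1/2) / pw k, (real j + 1/2) / pw k) \<in> gb k i j"
 using nR unfolding gbx_def by simp

lemma closure_gbx: "closure (gb k i j) = gs k i j"
proof -
 have "(real i) / pw k < (real i + 1) / pw k" for i by (simp add: divide_strict_right_mono)
 thus ?thesis unfolding gbx_Times gsq_cbox cbox_Pair_eq by (simp add: closure_Times)
qed

lemma open_gbx: "open (gb k i j)"
 unfolding gbx_interior by simp

lemma convex_gsq: "convex (gs k i j)" unfolding gsq_cbox by (rule convex_box)
lemma convex_gbx: "convex (gb k i j)" unfolding gbx_interior by (rule convex_interior[OF convex_gsq])
lemma bounded_gsq: "bounded (gs k i j)" unfolding gsq_cbox by (rule bounded_cbox)
lemma closed_gsq: "closed (gs k i j)" unfolding gsq_cbox by (rule closed_cbox)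

lemma frontier_gbx: "frontier (gb k i j) = cr k i j"
 unfolding frontier_def closure_gbx circ_def by (simp add: interior_open[OF open_gbx])

lemma frontier_gsq: "frontier (gs k i j) = cr k i j"
 unfolding frontier_def circ_def gbx_interior by (simp add: closure_closed[OF closed_gsq])

lemma circ_homeomorphic: "cr k i j homeomorphic (sphere (0::pt) 1)"
proof -
 have ne: "interior (gs k i j) ~= {}" using gsq_center gbx_interior by blast
 have ne': "interior (cball (0::pt) 1) ~= {}" by simp
 have "rel_frontier (gs k i j) homeomorphic rel_frontier (cball (0::pt) 1)"
  by (rule homeomorphic_rel_frontiers_convex_bounded_sets[OF convex_gsq bounded_gsq])
    (use ne ne' in "auto simp: aff_dim_nonempty_interior")
 thus ?thesis
  unfolding rel_frontier_nonempty_interior[OF ne] rel_frontier_nonempty_interior[OF ne'] frontier_gsq by simp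
qed

lemma connected_circ: "connected (cr k i j)"
 using homeomorphic_connectedness[OF circ_homeomorphic] connected_sphere[of "0::pt" 1] by simp

text \<open>A connected set that avoids F cannot leave a removed square or the exterior once it
  meets it, since the boundary lies in F. The same argument with the roles exchanged gives
  equality.\<close>

lemma complement_component:
 assumes T: "connected T" "T \<inter> F = {}" "T ~= {}" "frontier T \<subseteq> F"
 shows "\<exists>c\<in>ixs. frontier T = circ_of c"
proof -
 obtain z where z: "z \<in> T" using T by auto
 have key: "frontier T = frontier U" if U: "connected U" "U \<inter> F = {}" "z \<in> U" "frontier U \<subseteq> F" for U
 proof -
  have "T \<subseteq> U" using connected_Int_frontier[OF T(1), of U] z U T by auto
  moreover have "U \<subseteq> T" using connected_Int_frontier[OF U(1), of T] z U T by auto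
  ultimately show ?thesis by simp
 qed
 show ?thesis
 proof (cases "z \<in> gs 0 0 0")
  case False
  have "frontier T = frontier (- gs 0 0 0)"
  proof (rule key)
   show "connected (- gs 0 0 0)" by (rule connected_complement_bounded_convex[OF bounded_gsq convex_gsq]) simp
   show "frontier (- gs 0 0 0) \<subseteq> F" using circ_in_F[of 0 0 0] by (simp add: frontier_complement frontier_gsq)
  qed (use F_unit False in auto)
  thus ?thesis by (intro bexI[of _ "(0,0,0)"]) (auto simp: frontier_complement frontier_gsq ixs_def)
 next
  case True
  then obtain k i j where h: "hl k i j" "z \<in> gb k i j" using not_F_hole[OF True] z T by auto
  have "frontier T = frontier (gb k i j)"
  using key convex_connected[OF convex_gbx] circ_in_F[of k i j] h frontier_gbx F_hole by blast
  thus ?thesis using h by (intro bexI[of _ "(k,i,j)"]) (auto simp: frontier_gbx ixs_def)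
 qed
qed

text \<open>A Jordan curve J separates the plane, and the connected set F - J lies in one component
  at most. Another component misses F and has J as its frontier, which identifies J.\<close>

lemma circles_F_sub: "circles F \<subseteq> circ_of ` ixs"
proof
 fix J assume "J \<in> circles F"
 hence J: "J \<subseteq> F" "J homeomorphic (sphere (0::pt) 1)" "connected (F - J)" unfolding circles_def by auto
 have nc: "~ connected (- J)" by (rule Jordan_Brouwer_separation[OF J(2)]) simp
 then obtain T T' where T: "T \<in> components (- J)" "T' \<in> components (- J)" "T ~= T'"
  unfolding connected_eq_connected_components_eq by blast
 have disj: "T \<inter> T' = {}" using T components_nonoverlap by blast
 have "T \<inter> F = {} | T' \<inter> F = {}"
 using T in_components_subset components_maximal[OF T(1) J(3)] disj by auto
 then obtain S where S: "S \<in> components (- J)" "S \<inter> F = {}" using T by blast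
 have fr: "frontier S = J" by (rule Jordan_Brouwer_frontier[OF J(2) S(1)]) simp
 have "\<exists>c\<in>ixs. frontier S = circ_of c"
  using S J(1) fr in_components_connected in_components_nonempty by (intro complement_component) auto
 thus "J \<in> circ_of ` ixs" using fr by auto
qed

text \<open>Skeleton along which the carpet is connected: the grid lines inside a cell bound the
  squares of the next level but never enter them, and the holes of all deeper levels lie in those
  squares.\<close>

definition glines :: "nat => nat => nat => pt set" where
 "glines k i j = {z \<in> gs k i j. \<exists>a. 1 <= a & a < n &
   (fst z * pw (Suc k) = real (n * i + a) | snd z * pw (Suc k) = real (n * j + a))}"

lemma glines_not_gbx: "z \<in> glines k i j ==> z \<notin> gb (Suc k) i' j'"
 unfolding glines_def gbx_def by (auto) (metis of_nat_1 of_nat_add of_nat_less_iff not_less_eq add.commute plus_1_eq_Suc of_nat_mult)+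

lemma glines_in_F: "cl k i j ==> glines k i j \<subseteq> F"
proof
 fix z assume c: "cl k i j" and z: "z \<in> glines k i j"
 have "z \<in> gs k i j" using z unfolding glines_def by blast
 from split_cell[OF c this] obtain i' j' where "cl (Suc k) i' j'" "z \<in> gs (Suc k) i' j'"
  using glines_not_gbx[OF z] by blast
 hence "z \<in> cr (Suc k) i' j'" "cl (Suc k) i' j'" using glines_not_gbx[OF z] unfolding circ_def by auto
 thus "z \<in> F" using circ_in_F by blast
qed

end

section \<open>A peripheral circle does not separate the carpet\<close>

locale carpet_circle = carpet_params +
 fixes l ci cj :: nat
 assumes C_ix: "(l, ci, cj) \<in> ixs"
begin

definition C where "C = cr l ci cj"

text \<open>The one cell in whose interior the grid lines can be obstructed by C, since C bounds one
  of its own four holes.\<close>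

definition parent :: "nat => nat => nat => bool" where
 "parent k i j \<longleftrightarrow> l = Suc k & ci div n = i & cj div n = j"

lemma C_not_parent:
 assumes c: "cl k i j" and np: "~ parent k i j" and z: "z \<in> glines k i j" "z \<in> C"
 shows "z \<notin> gb k i j"
proof
 assume zb: "z \<in> gb k i j"
 have zs: "z \<in> gs l ci cj" "z \<notin> gb l ci cj" using z(2) unfolding C_def circ_def by auto
 show False
 proof (cases rule: level_cases[of k l])
  case (le m)
  hence e: "ci = i div n ^ m" "cj = j div n ^ m" using gbx_gsq_idx[of z l m i j] zb zs by auto
  show False
  using cell_prefix[of l m i j] c le e hole_not_cell C_ix gbx_nest[of 0 k i j] cell_bound[OF c] zb zs by (auto simp: ixs_def)
 next
  case (gt m)
  have "l ~= 0" using gt by simp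
  hence h: "hl l ci cj" using C_ix unfolding ixs_def by auto
  show False
  proof (cases m)
   case 0
   hence "z \<in> gb k (ci div n) (cj div n)" using hole_inside[of k 0 ci cj] h gt zs by auto
   hence "ci div n = i & cj div n = j" using gbx_gsq_idx[of z k 0 _ _ i j] zb gbx_sub by fastforce
   thus False using np gt 0 unfolding parent_def by simp
  next
   case (Suc m')
   have "l = Suc k + Suc m'" using gt Suc by simp
   hence "z \<in> gb (Suc k) (ci div n ^ Suc m') (cj div n ^ Suc m')"
    using hole_inside[of "Suc k" m' ci cj] h zs by auto
   thus False using glines_not_gbx[OF z(1)] by blast
  qed
 qed
qed

abbreviation R where "R \<equiv> connected_component (F - C)"

lemma R_sym: "R x y ==> R y x" by (rule connected_component_sym)
lemma R_trans: "R x y ==> R y z ==> R x z" by (rule connected_component_trans)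

lemma R_vert:
 assumes "!!t. t \<in> {min s s'..max s s'} ==> (x, t) \<in> F - C"
 shows "R (x, s) (x, s')"
proof (rule connected_componentI)
 show "connected ({x} \<times> {min s s'..max s s'})" by (intro connected_Times) auto
qed (use assms in auto)

lemma R_hori:
 assumes "!!t. t \<in> {min s s'..max s s'} ==> (t, y) \<in> F - C"
 shows "R (s, y) (s', y)"
proof (rule connected_componentI)
 show "connected ({min s s'..max s s'} \<times> {y})" by (intro connected_Times) auto
qed (use assms in auto)

definition hub :: "nat => nat => nat => pt" where
 "hub k i j = (real (n * i + 1) / pw (Suc k), real (n * j + 1) / pw (Suc k))"

lemma scale_in:
 assumes "1 <= a" "a < n"
 shows "real i < (real (n * i + a) / pw (Suc k)) * pw k &
  (real (n * i + a) / pw (Suc k)) * pw k < real i + 1"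
 using assms nR by (simp add: field_simps)

lemma hub_in: "hub k i j \<in> glines k i j" "hub k i j \<in> gb k i j"
proof -
 show "hub k i j \<in> gb k i j"
  using scale_in[of 1 i k] scale_in[of 1 j k] n5 unfolding hub_def gbx_def fst_conv snd_conv by auto
 hence "hub k i j \<in> gs k i j" using gbx_sub by blast
 thus "hub k i j \<in> glines k i j" unfolding glines_def using n5 nR
  by (auto simp: hub_def intro!: exI[of _ 1])
qed

lemma between_strict:
 fixes s s' t :: real
 assumes "t \<in> {min s s'..max s s'}" "t ~= s" "a <= s" "s <= b" "a < s'" "s' < b"
 shows "a < t & t < b"
 using assms by (auto simp: min_def max_def split: if_splits)

text \<open>From z along its own grid line until level with the hub, then straight to the hub. Only
  the starting point may lie on the boundary of the cell, where C could pass.\<close>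

lemma R_glines:
 assumes c: "cl k i j" and np: "~ parent k i j" and z: "z \<in> glines k i j" "z \<notin> C"
 shows "R z (hub k i j)"
proof -
 define N where "N = pw k"
 have N: "N > 0" unfolding N_def by simp
 define hx hy where "hx = fst (hub k i j)" and "hy = snd (hub k i j)"
 have h: "real i < hx * N" "hx * N < real i + 1" "real j < hy * N" "hy * N < real j + 1"
  using hub_in(2) unfolding gbx_def hx_def hy_def N_def by auto
 have hI: "hx * pw (Suc k) = real (n * i + 1)" "hy * pw (Suc k) = real (n * j + 1)"
  unfolding hx_def hy_def hub_def using nR by auto
 obtain x y where xy: "z = (x, y)" by (cases z)
 have zg: "real i <= x * N" "x * N <= real i + 1" "real j <= y * N" "y * N <= real j + 1"
  using z(1) unfolding glines_def gsq_def xy N_def by auto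
 have scale: "t * N \<in> {min (s * N) (s' * N)..max (s * N) (s' * N)}" if "t \<in> {min s s'..max s s'}" for t s s'
  using that N by (auto simp: min_def max_def mult_right_mono split: if_splits)
 have inF: "(X, Y) \<in> F - C"
  if "real i <= X * N" "X * N <= real i + 1" "real j <= Y * N" "Y * N <= real j + 1"
   "\<exists>a. 1 <= a & a < n & (X * pw (Suc k) = real (n * i + a) | Y * pw (Suc k) = real (n * j + a))"
   "(X, Y) = z | (real i < X * N & X * N < real i + 1 & real j < Y * N & Y * N < real j + 1)" for X Y
 proof -
  have g: "(X, Y) \<in> glines k i j" using that unfolding glines_def gsq_def N_def by simp
  have "(X, Y) \<notin> C"
  using C_not_parent[OF c np g] z(2) that by (auto simp: gbx_def N_def)
  thus ?thesis using glines_in_F[OF c] g by blast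
 qed
 have one: "1 < n" using n5 by simp
 obtain a where a: "1 <= a" "a < n" "x * pw (Suc k) = real (n * i + a) | y * pw (Suc k) = real (n * j + a)"
  using z(1) unfolding glines_def xy by auto
 from a(3) show ?thesis
 proof
  assume v: "x * pw (Suc k) = real (n * i + a)"
  have x': "x = real (n * i + a) / pw (Suc k)" using v nR by (simp add: field_simps)
  have xs: "real i < x * N" "x * N < real i + 1" unfolding x' N_def using scale_in[OF a(1,2)] by blast+
  have "R (x, y) (x, hy)"
  proof (rule R_vert, rule inF)
   fix t assume t: "t \<in> {min y hy..max y hy}"
   have tt: "t * N \<in> {min (y * N) (hy * N)..max (y * N) (hy * N)}" by (rule scale[OF t])
   show "real j <= t * N" "t * N <= real j + 1" using tt zg h by (auto simp: min_def max_def split: if_splits)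
   show "\<exists>a. 1 <= a & a < n & (x * pw (Suc k) = real (n * i + a) | t * pw (Suc k) = real (n * j + a))"
    using v a by blast
   show "(x, t) = z | (real i < x * N & x * N < real i + 1 & real j < t * N & t * N < real j + 1)"
    using between_strict[OF tt _ zg(3,4) h(3,4)] xs N xy by (cases "t = y") auto
  qed (use zg in auto)
  moreover have "R (x, hy) (hx, hy)"
  proof (rule R_hori, rule inF)
   fix t assume t: "t \<in> {min x hx..max x hx}"
   have tt: "t * N \<in> {min (x * N) (hx * N)..max (x * N) (hx * N)}" by (rule scale[OF t])
   have ts: "real i < t * N" "t * N < real i + 1" using tt xs h by (auto simp: min_def max_def split: if_splits)
   show "real i <= t * N" "t * N <= real i + 1" using ts by auto
   show "\<exists>a. 1 <= a & a < n & (t * pw (Suc k) = real (n * i + a) | hy * pw (Suc k) = real (n * j + a))"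
    using hI one by (intro exI[of _ 1]) auto
   show "(t, hy) = z | (real i < t * N & t * N < real i + 1 & real j < hy * N & hy * N < real j + 1)"
    using ts h by auto
  qed (use h in auto)
  ultimately show ?thesis unfolding xy using R_trans hx_def hy_def by (metis prod.collapse)
 next
  assume v: "y * pw (Suc k) = real (n * j + a)"
  have y': "y = real (n * j + a) / pw (Suc k)" using v nR by (simp add: field_simps)
  have ys: "real j < y * N" "y * N < real j + 1" unfolding y' N_def using scale_in[OF a(1,2)] by blast+
  have "R (x, y) (hx, y)"
  proof (rule R_hori, rule inF)
   fix t assume t: "t \<in> {min x hx..max x hx}"
   have tt: "t * N \<in> {min (x * N) (hx * N)..max (x * N) (hx * N)}" by (rule scale[OF t])
   show "real i <= t * N" "t * N <= real i + 1" using tt zg h by (auto simp: min_def max_def split: if_splits)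
   show "\<exists>a. 1 <= a & a < n & (t * pw (Suc k) = real (n * i + a) | y * pw (Suc k) = real (n * j + a))"
    using v a by blast
   show "(t, y) = z | (real i < t * N & t * N < real i + 1 & real j < y * N & y * N < real j + 1)"
    using between_strict[OF tt _ zg(1,2) h(1,2)] ys N xy by (cases "t = x") auto
  qed (use zg in auto)
  moreover have "R (hx, y) (hx, hy)"
  proof (rule R_vert, rule inF)
   fix t assume t: "t \<in> {min y hy..max y hy}"
   have tt: "t * N \<in> {min (y * N) (hy * N)..max (y * N) (hy * N)}" by (rule scale[OF t])
   have ts: "real j < t * N" "t * N < real j + 1" using tt ys h by (auto simp: min_def max_def split: if_splits)
   show "real j <= t * N" "t * N <= real j + 1" using ts by auto
   show "\<exists>a. 1 <= a & a < n & (hx * pw (Suc k) = real (n * i + a) | t * pw (Suc k) = real (n * j + a))"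
    using hI one by (intro exI[of _ 1]) auto
   show "(hx, t) = z | (real i < hx * N & hx * N < real i + 1 & real j < t * N & t * N < real j + 1)"
    using ts h by auto
  qed (use h in auto)
  ultimately show ?thesis unfolding xy using R_trans hx_def hy_def by (metis prod.collapse)
 qed
qed

end

lemma (in carpet_params) dist_gsq:
 assumes "z \<in> gs k i j" "w \<in> gs k i j"
 shows "dist z w <= 2 / pw k"
proof -
 have a: "\<bar>s - t\<bar> <= 1 / pw k"
  if "real i <= s * pw k" "s * pw k <= real i + 1" "real i <= t * pw k" "t * pw k <= real i + 1" for s t i
 proof -
  have "\<bar>s - t\<bar> * pw k = \<bar>s * pw k - t * pw k\<bar>" by (simp add: abs_mult left_diff_distrib[symmetric])
  also have "... <= 1" using that by linarith
  finally show ?thesis by (simp add: field_simps)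
 qed
 have "dist z w <= \<bar>fst z - fst w\<bar> + \<bar>snd z - snd w\<bar>"
  unfolding dist_prod_def dist_real_def by (rule sqrt_sum_squares_le_sum) auto
 also have "... <= 1 / pw k + 1 / pw k"
  using assms unfolding gsq_def by (intro add_mono a) auto
 finally show ?thesis by simp
qed

context carpet_circle begin

lemma gsq_bot: "(real i / pw k, real j / pw k) \<in> cr k i j"
 unfolding circ_def gsq_def gbx_def by simp

text \<open>Here a grid line may run along C, so z moves outwards to the boundary of the cell
  instead of to the hub. A grid line meets C in a convex set, hence one of the two directions is
  free; the boundary of the cell is connected and misses C.\<close>

lemma R_parent:
 assumes c: "cl k i j" and pr: "parent k i j" and z: "z \<in> glines k i j \<union> cr k i j" "z \<notin> C"
 shows "R z (real i / pw k, real j / pw k)"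
proof -
 define N M where "N = pw k" and "M = pw (Suc k)"
 have N: "N > 0" "M > 0" "M = real n * N" unfolding N_def M_def using nR by auto
 have l: "l = Suc k" "ci div n = i" "cj div n = j" using pr unfolding parent_def by auto
 have h: "hl (Suc k) ci cj" using C_ix l unfolding ixs_def by auto
 have Cin: "C \<subseteq> gb k i j" using hole_inside[of k 0 ci cj] h l unfolding C_def circ_def by auto
 have cF: "cr k i j \<subseteq> F - C" using circ_in_F[of k i j] c Cin unfolding circ_def by auto
 have Rc: "R w (real i / pw k, real j / pw k)" if "w \<in> cr k i j" for w
  by (rule connected_componentI[OF connected_circ cF that gsq_bot])
 obtain x y where xy: "z = (x, y)" by (cases z)
 show ?thesis
 proof (cases "z \<in> cr k i j")
  case True thus ?thesis by (rule Rc)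
 next
  case False
  hence zg: "z \<in> glines k i j" using z by auto
  hence zi: "real i <= x * N" "x * N <= real i + 1" "real j <= y * N" "y * N <= real j + 1"
   unfolding glines_def gsq_def xy N_def by auto
  have inC: "(s, t) \<in> C ==> real ci <= s * M & s * M <= real ci + 1 & real cj <= t * M & t * M <= real cj + 1" for s t
   unfolding C_def circ_def gsq_def M_def by (simp add: l(1))
  have inC': "(s, t) \<in> C" if "real ci <= s * M" "s * M <= real ci + 1" "real cj <= t * M" "t * M <= real cj + 1"
   "s * M \<in> {real ci, real ci + 1} | t * M \<in> {real cj, real cj + 1}" for s t
   using that unfolding C_def circ_def gsq_def gbx_def M_def by (auto simp: l(1))
  have int_dich: "r \<in> {real q, real q + 1} | r < real q | real q + 1 < r" if "r = real m" for r q m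
   using that by auto
  obtain a where a: "1 <= a" "a < n" "x * M = real (n * i + a) | y * M = real (n * j + a)"
   using zg unfolding glines_def xy M_def by auto
  have fin: ?thesis if zy: "z = phi y" and line: "!!s t. (!!r. r \<in> {min s t..max s t} ==> phi r \<in> F - C) ==> R (phi s) (phi t)"
   and y: "q <= y * N" "y * N <= q + 1" and mem: "!!t. q <= t * N ==> t * N <= q + 1 ==> phi t \<in> F"
   and ends: "phi (q / N) \<in> cr k i j" "phi ((q + 1) / N) \<in> cr k i j"
   and conv: "!!t t'. t <= y ==> y <= t' ==> phi t \<in> C ==> phi t' \<in> C ==> phi y \<in> C" for phi :: "real => pt" and y q
  proof -
   have le: "q / N <= y" "y <= (q + 1) / N" using y N by (auto simp: field_simps)
   have "(\<forall>t\<le>y. phi t \<notin> C) | (\<forall>t\<ge>y. phi t \<notin> C)" using conv z(2) zy by blast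
   then obtain e where e: "e = q / N | e = (q + 1) / N" "\<forall>t\<in>{min y e..max y e}. phi t \<notin> C"
    using le by (elim disjE) (rule that[of "q / N"] that[of "(q + 1) / N"]; force)+
   have "R (phi y) (phi e)"
   proof (rule line)
    fix t assume t: "t \<in> {min y e..max y e}"
    hence "q / N <= t" "t <= (q + 1) / N" using le e(1) by auto
    hence "q <= t * N" "t * N <= q + 1" using N(1) by (simp_all add: pos_divide_le_eq pos_le_divide_eq)
    thus "phi t \<in> F - C" using mem e(2) t by blast
   qed
   thus ?thesis using R_trans Rc ends e(1) zy by blast
  qed
  have e: "(real q / N) * N = real q" "((real q + 1) / N) * N = real q + 1" for q using N by auto
  from a(3) show ?thesis
  proof
   assume v: "x * M = real (n * i + a)"
   show ?thesis
   proof (rule fin[of "%t. (x, t)" y "real j"])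
    show "R (x, s) (x, t)" if "!!r. r \<in> {min s t..max s t} ==> (x, r) \<in> F - C" for s t by (rule R_vert) (rule that)
    show "(x, t) \<in> F" if "real j <= t * N" "t * N <= real j + 1" for t
     using glines_in_F[OF c] that zi v a(1,2) unfolding glines_def gsq_def N_def M_def by fastforce
    fix t t' assume t: "t <= y" "y <= t'" "(x, t) \<in> C" "(x, t') \<in> C"
    have "x * M \<in> {real ci, real ci + 1}" using int_dich[OF v, of ci] inC[OF t(3)] by auto
    moreover have "t * M <= y * M" "y * M <= t' * M" using t N by auto
    ultimately show "(x, y) \<in> C" using inC[OF t(3)] inC[OF t(4)] by (intro inC') auto
   qed (use zi e[of j] xy in "auto simp: circ_def gsq_def gbx_def N_def")
  next
   assume v: "y * M = real (n * j + a)"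
   show ?thesis
   proof (rule fin[of "%t. (t, y)" x "real i"])
    show "R (s, y) (t, y)" if "!!r. r \<in> {min s t..max s t} ==> (r, y) \<in> F - C" for s t by (rule R_hori) (rule that)
    show "(t, y) \<in> F" if "real i <= t * N" "t * N <= real i + 1" for t
     using glines_in_F[OF c] that zi v a(1,2) unfolding glines_def gsq_def N_def M_def by fastforce
    fix t t' assume t: "t <= x" "x <= t'" "(t, y) \<in> C" "(t', y) \<in> C"
    have "y * M \<in> {real cj, real cj + 1}" using int_dich[OF v, of cj] inC[OF t(3)] by auto
    moreover have "t * M <= x * M" "x * M <= t' * M" using t N by auto
    ultimately show "(x, y) \<in> C" using inC[OF t(3)] inC[OF t(4)] by (intro inC') auto
   qed (use zi e[of i] xy in "auto simp: circ_def gsq_def gbx_def N_def")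
  qed
 qed
qed

definition rep :: "nat => nat => nat => pt" where
 "rep k i j = (if parent k i j then (real i / pw k, real j / pw k) else hub k i j)"

lemma R_rep: "cl k i j ==> z \<in> glines k i j ==> z \<notin> C ==> R z (rep k i j)"
 using R_parent[of k i j z] R_glines[of k i j z] unfolding rep_def by auto

lemma link_point:
 assumes c: "cl (Suc k) i j" and b: "b \<in> {j, j + 1}"
 defines "z \<equiv> (real (n * i + 1) / pw (Suc (Suc k)), real b / pw (Suc k))"
 shows "z \<in> glines (Suc k) i j" "fst z * pw (Suc k) \<in> {real i<..<real i + 1}"
  "snd z * pw (Suc k) = real b"
proof -
 show s: "snd z * pw (Suc k) = real b" unfolding z_def using nR by simp
 show f: "fst z * pw (Suc k) \<in> {real i<..<real i + 1}"
  unfolding z_def using scale_in[of 1 i "Suc k"] n5 by simp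
 have "fst z * pw (Suc (Suc k)) = real (n * i + 1)" unfolding z_def using nR by simp
 moreover have "z \<in> gs (Suc k) i j" using f s b unfolding gsq_def by auto
 ultimately show "z \<in> glines (Suc k) i j" unfolding glines_def using n5 by (auto intro!: exI[of _ 1])
qed

lemma child_gsq: "z \<in> gs (Suc k) i j ==> z \<in> gs k (i div n) (j div n)"
 using gsq_nest[of k 1 i j] by auto

text \<open>The child and its parent are joined through a point on the lower or upper edge of the
  child; such an edge lies on the grid or on the boundary of the parent.\<close>

lemma R_link:
 assumes c: "cl (Suc k) i j"
 shows "R (rep (Suc k) i j) (rep k (i div n) (j div n))"
proof -
 define I J where "I = i div n" and "J = j div n"
 have cI: "cl k I J" using c unfolding I_def J_def by simp
 have j: "j = n * J + j mod n" "j mod n < n" unfolding J_def by auto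
 have i: "i = n * I + i mod n" "i mod n < n" unfolding I_def by auto
 show ?thesis
 proof (cases "parent k I J")
  case False
  \<comment> \<open>If the lower edge of the child lies on the boundary of the parent, the upper
    edge is taken.\<close>
  define b where "b = (if j mod n = 0 then j + 1 else j)"
  define z where "z = (real (n * i + 1) / pw (Suc (Suc k)), real b / pw (Suc k))"
  have b: "b \<in> {j, j + 1}" unfolding b_def by auto
  note lp = link_point[OF c b, folded z_def]
  have z1: "z \<in> gs k I J" unfolding I_def J_def by (rule child_gsq) (use lp(1) in "auto simp: glines_def")
  obtain a where a: "b = n * J + a" "1 <= a" "a < n"
   using j n5 unfolding b_def by (cases "j mod n = 0") (auto intro: that[of 1] that[of "j mod n"])
  have z2: "z \<in> glines k I J" unfolding glines_def using z1 lp(3) a by auto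
  have "z \<in> gb k I J"
  proof -
   have e: "w * pw k = (w * pw (Suc k)) / real n" for w using nR by simp
   have "real I < fst z * pw k & fst z * pw k < real I + 1"
   proof -
    have "real n * real I <= real i" using i(1) by (metis le_add1 of_nat_le_iff of_nat_mult)
    moreover have "real i + 1 <= real n * (real I + 1)"
    proof -
     have "i + 1 <= n * I + n" using i by linarith
     hence "i + 1 <= n * (I + 1)" by simp
     thus ?thesis by (metis of_nat_1 of_nat_add of_nat_le_iff of_nat_mult)
    qed
    moreover have "real i < fst z * pw (Suc k)" "fst z * pw (Suc k) < real i + 1"
     using lp(2) unfolding greaterThanLessThan_iff by blast+
    ultimately have "real n * real I < fst z * pw (Suc k)" "fst z * pw (Suc k) < real n * (real I + 1)"
     by linarith+
    thus ?thesis unfolding e using nR by (simp add: divide_simps mult.commute)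
   qed
   moreover have "real J < snd z * pw k & snd z * pw k < real J + 1"
    unfolding e lp(3) a(1) using a nR by (simp add: divide_simps algebra_simps)
   ultimately show ?thesis unfolding gbx_def by simp
  qed
  hence "z \<notin> C" using C_not_parent[OF cI False z2] by blast
  thus ?thesis using R_rep[OF c lp(1)] R_rep[OF cI z2] R_sym R_trans unfolding I_def J_def by blast
 next
  case True
  have l: "l = Suc k" "ci div n = I" "cj div n = J" using True unfolding parent_def by auto
  have h: "hl (Suc k) ci cj" using C_ix l unfolding ixs_def by auto
  have hd: "hdig n p (ci mod n)" "hdig n p (cj mod n)" using h by auto
  have nh: "~ (hdig n p (i mod n) & hdig n p (j mod n))" using c by simp
  \<comment> \<open>With this choice the edge can lie at the height of a side of C only if the child
    is in the row of C; meeting C then forces the same column, and the child would be the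
    hole.\<close>
  define b where "b = (if j = cj | j = cj + 1 then j + 1 else j)"
  define z where "z = (real (n * i + 1) / pw (Suc (Suc k)), real b / pw (Suc k))"
  have b: "b \<in> {j, j + 1}" unfolding b_def by auto
  note lp = link_point[OF c b, folded z_def]
  have zC: "z \<notin> C"
  proof
   assume "z \<in> C"
   hence zc: "real ci <= fst z * pw (Suc k)" "fst z * pw (Suc k) <= real ci + 1"
    "real cj <= real b" "real b <= real cj + 1" unfolding lp(3)[symmetric] C_def circ_def gsq_def by (auto simp: l(1))
   have "ci = i" using idx_unique[of i "fst z * pw (Suc k)" ci] lp(2) zc by auto
   moreover have "b = cj | b = cj + 1" using zc(3,4) by linarith
   ultimately have "j = cj" unfolding b_def by (auto split: if_splits)
   thus False using nh hd \<open>ci = i\<close> by simp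
  qed
  have z1: "z \<in> gs k I J" unfolding I_def J_def by (rule child_gsq) (use lp(1) in "auto simp: glines_def")
  have z2: "z \<in> glines k I J \<union> cr k I J"
  proof -
   obtain a where a: "b = n * J + a" "a <= n"
   proof (cases "b = j")
    case True thus thesis using j by (intro that[of "j mod n"]) auto
   next
    case False
    hence "b = n * J + (j mod n + 1)" using b j(1) by simp
    moreover have "j mod n + 1 <= n" using n_pos(1) mod_less_divisor[of n j] by linarith
    ultimately show thesis by (intro that[of "j mod n + 1"])
   qed
   consider "1 <= a & a < n" | "a = 0" | "a = n" using a by linarith
   thus ?thesis
   proof cases
    case 1 thus ?thesis unfolding glines_def using z1 lp(3) a by auto
   next
    case 2
    hence "snd z * pw k = real J" using lp(3) a nR by (simp add: field_simps)
    thus ?thesis using z1 unfolding circ_def gbx_def by auto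
   next
    case 3
    hence "snd z * pw k * real n = (real J + 1) * real n" using lp(3) a by (simp add: algebra_simps)
    hence "snd z * pw k = real J + 1" using nR by simp
    thus ?thesis using z1 unfolding circ_def gbx_def by auto
   qed
  qed
  have "R z (rep k I J)" using R_parent[OF cI True z2 zC] True unfolding rep_def by simp
  thus ?thesis using R_rep[OF c lp(1) zC] R_sym R_trans unfolding I_def J_def by blast
 qed
qed

lemma rep_good: "cl k i j ==> R (rep k i j) (rep 0 0 0)"
proof (induction k arbitrary: i j)
 case 0
 hence "i = 0" "j = 0" by auto
 moreover have "rep 0 0 0 \<in> F - C"
 using C_ix hole_inside[of 0 0 ci cj] gsq_bot[of 0 0 0] circ_in_F[of 0 0 0] hub_in[of 0 0 0] glines_in_F[of 0 0 0] C_not_parent[of 0 0 0 "hub 0 0 0"]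
  by (auto simp: parent_def ixs_def C_def circ_def rep_def)
 ultimately show ?case by (simp add: connected_component_refl)
next
 case (Suc k)
 thus ?case using R_link[OF Suc.prems] R_trans by (metis cell.simps(2))
qed

text \<open>The component of the root representative contains the hubs of all cells of level at
  least l, since these are not the parent of C. It is therefore dense, and a set between a connected
  set and its closure is connected.\<close>

lemma C_circle: "C \<in> circles F"
proof -
 have "connected (F - C)"
 proof (rule connected_intermediate_closure)
  show "connected (connected_component_set (F - C) (rep 0 0 0))" by (rule connected_connected_component)
  show "connected_component_set (F - C) (rep 0 0 0) \<subseteq> F - C" by (rule connected_component_subset)
  show "F - C \<subseteq> closure (connected_component_set (F - C) (rep 0 0 0))"
  proof
   fix x assume x: "x \<in> F - C"
   show "x \<in> closure (connected_component_set (F - C) (rep 0 0 0))"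
    unfolding closure_approachable
   proof (intro allI impI)
    fix e :: real assume e: "0 < e"
    have "(%k. 2 * inverse (pw k)) \<longlonglongrightarrow> 2 * 0"
     by (intro tendsto_intros LIMSEQ_inverse_realpow_zero) (use nR in auto)
    hence "\<forall>\<^sub>F k in sequentially. 2 * inverse (pw k) < e"
     using e by (intro order_tendstoD(2)) auto
    then obtain N where N: "!!k. k >= N ==> 2 * inverse (pw k) < e" unfolding eventually_sequentially by auto
    define k where "k = max N l"
    obtain i j where ij: "cl k i j" "x \<in> gs k i j" using x F_iff by blast
    have np: "~ parent k i j" unfolding parent_def k_def by auto
    have "dist (hub k i j) x <= 2 / pw k" using dist_gsq[of "hub k i j" k i j x] hub_in(2) gbx_sub ij by blast
    also have "... < e" using N[of k] unfolding k_def by (simp add: divide_inverse)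
    finally have "dist (hub k i j) x < e" .
    moreover have "R (rep 0 0 0) (hub k i j)" using rep_good[OF ij(1)] np R_sym unfolding rep_def by simp
    ultimately show "\<exists>y\<in>connected_component_set (F - C) (rep 0 0 0). dist y x < e" by blast
   qed
  qed
 qed
 thus ?thesis unfolding circles_def using circ_ix_in_F[OF C_ix] circ_homeomorphic unfolding C_def by blast
qed

end

context carpet_params begin

theorem circles_F: "circles F = circ_of ` ixs"
proof (intro subset_antisym circles_F_sub subsetI)
 fix J assume "J \<in> circ_of ` ixs"
 then obtain l ci cj where c: "(l, ci, cj) \<in> ixs" "J = cr l ci cj" by auto
 then interpret carpet_circle n p l ci cj by unfold_locales
 show "J \<in> circles F" using C_circle c(2) unfolding C_def by simp
qed

end

section \<open>Area\<close>

lemma content_rect: "a <= b ==> c <= d ==> measure lborel ({a..b} \<times> {c..d}) = (b - a) * (d - c)" for a b c d :: real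
 using content_Pair[of a c b d] by (simp add: cbox_Pair_eq)

lemma rect_fmeasurable: "{a..b} \<times> {c..d} \<in> fmeasurable lborel" for a b c d :: real
 using fmeasurable_cbox[of "(a,c)" "(b,d)"] by (simp add: cbox_Pair_eq)

lemma rect_subset_cbox: "{a<..<b} \<times> {c<..<d} = box (a, c) (b, d)" for a b c d :: real
proof -
 have "box (a, c) (b, d) = interior (cbox (a, c) (b, d))" by simp
 thus ?thesis by (simp add: cbox_Pair_eq interior_Times)
qed

lemma orect_fmeasurable: "{a<..<b} \<times> {c<..<d} \<in> fmeasurable lborel" for a b c d :: real
 by (simp add: rect_subset_cbox)

lemma content_orect: "a <= b ==> c <= d ==> measure lborel ({a<..<b} \<times> {c<..<d}) = (b - a) * (d - c)" for a b c d :: real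
proof -
 assume "a <= b" "c <= d"
 have "measure lborel (box (a, c) (b, d)) = measure lborel (cbox (a, c) (b, d))"
  by (simp add: measure_lborel_box_eq measure_lborel_cbox_eq)
 thus ?thesis using content_rect[of a b c d] \<open>a <= b\<close> \<open>c <= d\<close> by (simp add: rect_subset_cbox cbox_Pair_eq)
qed

lemma sum_area_le:
 fixes B :: "'i => pt set"
 assumes "finite I" "!!i. i \<in> I ==> B i \<in> fmeasurable lborel" "disjoint_family_on B I"
  "(\<Union>i\<in>I. B i) \<subseteq> U" "U \<in> fmeasurable lborel"
 shows "(\<Sum>i\<in>I. measure lborel (B i)) <= measure lborel U"
proof -
 have "(\<Sum>i\<in>I. measure lborel (B i)) = measure lborel (\<Union>i\<in>I. B i)"
 proof (rule measure_finite_Union[symmetric, OF assms(1) _ assms(3)])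
  show "B ` I \<subseteq> sets lborel" using assms(2) fmeasurableD by blast
  show "emeasure lborel (B i) ~= \<infinity>" if "i \<in> I" for i using fmeasurableD2[OF assms(2)[OF that]] by simp
 qed
 also have "... <= measure lborel U"
  using assms(1,2) fmeasurableD by (intro measure_mono_fmeasurable assms(4,5) sets.finite_UN) blast+
 finally show ?thesis .
qed

context carpet_params begin

lemma card_cells: "real (card {(i, j). cl k i j}) <= (real n ^ 2 - 4) ^ k"
proof (induction k)
 case 0
 have "{(i, j). cl 0 i j} = {(0,0)}" by auto
 thus ?case by simp
next
 case (Suc k)
 define D where "D = {..<n} \<times> {..<n} - {a. hdig n p a} \<times> {a. hdig n p a}"
 have h: "{a. hdig n p a} = {p, n - 1 - p}" "p ~= n - 1 - p" using p2 unfolding hdig_def by auto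
 have ch: "card {a. hdig n p a} = 2" unfolding h(1) using h(2) by simp
 have sub: "{a. hdig n p a} \<subseteq> {..<n}" using hdig_bounds by fastforce
 have "card D = card ({..<n} \<times> {..<n}) - card ({a. hdig n p a} \<times> {a. hdig n p a})"
  unfolding D_def by (rule card_Diff_subset) (use sub finite_subset[OF sub] in auto)
 hence cD: "card D = n * n - 4" by (simp add: card_cartesian_product ch)
 define f where "f = (%(i,j). ((i div n, j div n), (i mod n, j mod n)))"
 have inj: "inj_on f {(i, j). cl (Suc k) i j}"
  by (rule inj_onI) (auto simp: f_def, (metis div_mult_mod_eq)+)
 have "f ` {(i, j). cl (Suc k) i j} \<subseteq> {(i, j). cl k i j} \<times> D" unfolding f_def D_def by auto
 hence "card {(i, j). cl (Suc k) i j} <= card ({(i, j). cl k i j} \<times> D)"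
  by (rule card_inj_on_le[OF inj]) (use finite_cells[of k] in "auto simp: D_def")
 hence "card {(i, j). cl (Suc k) i j} <= card {(i, j). cl k i j} * (n * n - 4)"
  by (simp add: card_cartesian_product cD)
 hence "real (card {(i, j). cl (Suc k) i j}) <= real (card {(i, j). cl k i j}) * real (n * n - 4)"
  by (metis of_nat_le_iff of_nat_mult)
 also have "real (n * n - 4) = real n ^ 2 - 4"
 proof -
  have "4 <= n * n" using mult_le_mono[OF n5 n5] by simp
  thus ?thesis by (simp add: of_nat_diff power2_eq_square)
 qed
 also have "real (card {(i, j). cl k i j}) * (real n ^ 2 - 4) <= (real n ^ 2 - 4) ^ k * (real n ^ 2 - 4)"
 proof (rule mult_right_mono[OF Suc.IH])
  have "5 * 5 <= real n * real n" using nR by (intro mult_mono) auto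
  thus "0 <= (real n)^2 - 4" by (simp add: power2_eq_square)
 qed
 finally show ?case by (simp add: mult.commute)
qed

text \<open>Shrinking by a factor depending on L turns the balls into disjoint boxes. If the radii
  are at most 1 / n^k, the boxes lie in the cells of level k enlarged by one square on each side,
  whose total area is at most 9 * ((n^2 - 4) / n^2)^k.\<close>

lemma sep_area:
 assumes "dl > 0"
 shows "\<exists>m>0. \<forall>S. finite S & S \<subseteq> F \<times> {0..m} & sep L S --> (\<Sum>(x,r)\<in>S. r^2) <= dl"
proof -
 define L1 where "L1 = max 1 L"
 have L1: "L1 >= 1" "L <= L1" unfolding L1_def by auto
 define q where "q = (real n ^ 2 - 4) / real n ^ 2"
 have n25: "5 * 5 <= real n * real n" using nR by (intro mult_mono) auto
 have q: "0 <= q" "q < 1" unfolding q_def using n25 by (auto simp: power2_eq_square field_simps)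
 have "(%k. 36 * L1^2 * q ^ k) \<longlonglongrightarrow> 36 * L1^2 * 0"
  by (intro tendsto_intros LIMSEQ_realpow_zero q)
 hence "\<forall>\<^sub>F k in sequentially. 36 * L1^2 * q ^ k < dl" using assms by (intro order_tendstoD(2)) auto
 then obtain k where k: "36 * L1^2 * q ^ k < dl" unfolding eventually_sequentially by auto
 define N where "N = pw k"
 have N: "N > 0" unfolding N_def by simp
 define E where "E = (%(i::nat,j::nat). {(real i - 1) / N..(real i + 2) / N} \<times> {(real j - 1) / N..(real j + 2) / N})"
 define U where "U = (\<Union>c\<in>{(i, j). cl k i j}. E c)"
 have mE: "measure lborel (E c) = 9 / N^2" for c
  unfolding E_def using N by (cases c) (simp add: content_rect divide_right_mono power2_eq_square diff_divide_distrib[symmetric])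
 have EU: "E c \<in> fmeasurable lborel" for c unfolding E_def by (cases c) (simp add: rect_fmeasurable)
 have Uf: "U \<in> fmeasurable lborel" unfolding U_def by (rule fmeasurable.finite_UN[OF finite_cells EU])
 have "measure lborel U <= (\<Sum>c\<in>{(i, j). cl k i j}. measure lborel (E c))"
  unfolding U_def by (rule measure_UNION_le[OF finite_cells]) (use EU fmeasurableD in blast)
 also have "... <= (real n ^ 2 - 4) ^ k * (9 / N^2)" using mult_right_mono[OF card_cells[of k], of "9 / N^2"] by (simp add: mE)
 also have "... = 9 * q ^ k" unfolding q_def N_def by (simp add: power_divide power_mult[symmetric] mult.commute)
 finally have mU: "measure lborel U <= 9 * q ^ k" .
 have main: "(\<Sum>(x,r)\<in>S. r^2) <= dl" if S: "finite S" "S \<subseteq> F \<times> {0..1 / N}" "sep L S" for S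
 proof -
  \<comment> \<open>Half side r / (4 * L1): overlapping boxes would have centres closer than (r + s)
    / (2 * L1), which separation forbids.\<close>
  define h where "h = (%r. r / (4 * L1))"
  define B where "B = (%(x::pt, r). {fst x - h r<..<fst x + h r} \<times> {snd x - h r<..<snd x + h r})"
  have Sx: "fst z \<in> F" "0 <= snd z" "snd z <= 1 / N" if "z \<in> S" for z using subsetD[OF S(2) that] by (cases z; auto)+
  have h0: "0 <= h r" "h r <= 1 / N" if "0 <= r" "r <= 1 / N" for r
  proof -
   have "r / (4 * L1) <= r / 1" using that L1 by (intro divide_left_mono) auto
   thus "0 <= h r" "h r <= 1 / N" unfolding h_def using that L1 by auto
  qed
  have mB: "measure lborel (B z) = (snd z)^2 / (4 * L1^2)" if "z \<in> S" for z
   unfolding B_def using h0(1)[OF Sx(2,3)[OF that]] L1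
   by (cases z) (simp add: content_orect h_def power2_eq_square field_simps)
  have "(\<Sum>z\<in>S. measure lborel (B z)) <= measure lborel U"
  proof (rule sum_area_le[OF S(1)])
   show "B z \<in> fmeasurable lborel" for z unfolding B_def by (cases z) (simp add: orect_fmeasurable)
   show "(\<Union>z\<in>S. B z) \<subseteq> U"
   proof
    fix w assume "w \<in> (\<Union>z\<in>S. B z)"
    then obtain z where z: "z \<in> S" "w \<in> B z" by auto
    obtain i j where ij: "cl k i j" "fst z \<in> gs k i j" using Sx(1)[OF z(1)] unfolding F_iff by blast
    have g: "real i / N <= fst (fst z)" "fst (fst z) <= (real i + 1) / N" "real j / N <= snd (fst z)" "snd (fst z) <= (real j + 1) / N"
     using ij(2) N unfolding gsq_def N_def by (auto simp: pos_divide_le_eq pos_le_divide_eq)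
    note hz = h0(2)[OF Sx(2,3)[OF z(1)]]
    have a: "(real i - 1) / N = real i / N - 1 / N" "(real i + 2) / N = (real i + 1) / N + 1 / N" for i
     by (simp_all add: diff_divide_distrib add_divide_distrib)
    have "w \<in> E (i, j)" unfolding E_def using z(2) g hz
     unfolding B_def a by (cases z; cases w) auto
    thus "w \<in> U" unfolding U_def using ij(1) by blast
   qed
   show "disjoint_family_on B S" unfolding disjoint_family_on_def
   proof (intro ballI impI)
    fix z w assume zw: "z \<in> S" "w \<in> S" "z ~= w"
    show "B z \<inter> B w = {}"
    proof (rule ccontr)
     assume "B z \<inter> B w ~= {}"
     then obtain v where v: "v \<in> B z" "v \<in> B w" by blast
     have "dist (fst z) (fst w) <= \<bar>fst (fst z) - fst (fst w)\<bar> + \<bar>snd (fst z) - snd (fst w)\<bar>"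
      unfolding dist_prod_def dist_real_def by (rule sqrt_sum_squares_le_sum) auto
     also have "... < 2 * (h (snd z) + h (snd w))"
      using v unfolding B_def by (cases z; cases w; cases v) auto
     finally have d: "dist (fst z) (fst w) < (snd z + snd w) / (2 * L1)"
      unfolding h_def using L1 by (simp add: field_simps)
     have "snd z <= L * dist (fst z) (fst w)" "snd w <= L * dist (fst w) (fst z)"
      using sepD[OF S(3), of "fst z" "snd z" "fst w" "snd w"] sepD[OF S(3), of "fst w" "snd w" "fst z" "snd z"] zw by auto
     moreover have "L * dist (fst z) (fst w) <= L1 * dist (fst z) (fst w)" using L1 by (intro mult_right_mono) auto
     ultimately have "snd z + snd w <= 2 * L1 * dist (fst z) (fst w)" by (simp add: dist_commute)
     thus False using d L1 by (simp add: field_simps)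
    qed
   qed
  qed (rule Uf)
  hence "(\<Sum>z\<in>S. (snd z)^2 / (4 * L1^2)) <= 9 * q ^ k" using mU mB by simp
  hence "(\<Sum>z\<in>S. (snd z)^2) / (4 * L1^2) <= 9 * q ^ k" by (simp add: sum_divide_distrib)
  hence "(\<Sum>z\<in>S. (snd z)^2) <= 36 * L1^2 * q ^ k" using L1 by (simp add: field_simps)
  thus ?thesis using k by (simp add: case_prod_beta)
 qed
 show ?thesis by (rule exI[of _ "1 / N"]) (use N main in auto)
qed

lemma bounded_fst_F: "bounded (fst ` F)" "bounded (snd ` F)"
 using compact_F compact_imp_bounded bounded_fst bounded_snd by blast+

lemma tame_coord: "tame F fst" "tame F snd"
proof -
 have gen: "tame F g" if b: "bounded (g ` F)" and l: "!!x y. \<bar>g x - g y\<bar> <= dist x y" for g :: "pt => real"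
  unfolding tame_def
 proof (intro conjI allI impI b)
  fix L dl :: real assume "dl > 0"
  then obtain m where m: "m > 0" "!!S. finite S ==> S \<subseteq> F \<times> {0..m} ==> sep L S ==> (\<Sum>(x,r)\<in>S. r^2) <= dl / 4"
   using sep_area[of "dl / 4" L] by auto
  have "(\<Sum>(x,r)\<in>S. (osc g (F \<inter> cball x r))^2) <= dl" if S: "finite S" "S \<subseteq> F \<times> {0..m}" "sep L S" for S
  proof -
   have "(\<Sum>(x,r)\<in>S. (osc g (F \<inter> cball x r))^2) <= (\<Sum>z\<in>S. 4 * (snd z)^2)"
   proof (rule sum_mono)
    fix z assume z: "z \<in> S"
    obtain x r where xr: "z = (x, r)" by (cases z)
    have r: "0 <= r" using z S(2) xr by auto
    have "osc g (F \<inter> cball x r) <= 2 * r"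
    proof (rule osc_le)
     fix y y' assume "y \<in> F \<inter> cball x r" "y' \<in> F \<inter> cball x r"
     hence "dist y y' <= 2 * r" using dist_triangle3[of y y' x] by auto
     thus "g y - g y' <= 2 * r" using l[of y y'] by linarith
    qed (use r in simp)
    moreover have "0 <= osc g (F \<inter> cball x r)" by (rule osc_nonneg) (meson b bounded_subset image_mono inf_le1)
    ultimately have "(osc g (F \<inter> cball x r))^2 <= (2 * r)^2" by (rule power_mono)
    thus "(case z of (x, r) => (osc g (F \<inter> cball x r))\<^sup>2) <= 4 * (snd z)^2" using xr by (simp add: power_mult_distrib)
   qed
   also have "... = 4 * (\<Sum>(x,r)\<in>S. r^2)" by (simp add: sum_distrib_left case_prod_beta)
   also have "... <= dl" using m(2)[OF S] by simp
   finally show ?thesis .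
  qed
  thus "\<exists>m>0. \<forall>S. finite S & S \<subseteq> F \<times> {0..m} & sep L S -->
    (\<Sum>(x,r)\<in>S. (osc g (F \<inter> cball x r))^2) <= dl" using m(1) by blast
 qed
 show "tame F fst" by (rule gen[OF bounded_fst_F(1)]) (metis dist_fst_le dist_real_def)
 show "tame F snd" by (rule gen[OF bounded_fst_F(2)]) (metis dist_snd_le dist_real_def)
qed

section \<open>The outer circle, and sides and areas of holes\<close>

definition OC where "OC = cr 0 0 0"

lemma OC_circle: "OC \<in> circles F"
 unfolding circles_F OC_def ixs_def by auto

lemma hole_circle: "hl k i j ==> cr k i j \<in> circles F"
 unfolding circles_F ixs_def by force

lemma circle_cases:
 assumes "E \<in> circles F"
 obtains "E = OC" | k i j where "hl k i j" "E = cr k i j"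
 using assms unfolding circles_F ixs_def OC_def by auto

lemma circles_ix:
 assumes "E \<in> circles F"
 obtains k i j where "(k, i, j) \<in> ixs" "E = cr k i j"
 using assms unfolding circles_F by auto

lemma circles_disjoint:
 assumes "E \<in> circles F" "E' \<in> circles F" "z \<in> E" "z \<in> E'"
 shows "E = E'"
proof -
 obtain k i j where 1: "(k, i, j) \<in> ixs" "E = cr k i j" using circles_ix[OF assms(1)] .
 obtain l i' j' where 2: "(l, i', j') \<in> ixs" "E' = cr l i' j'" using circles_ix[OF assms(2)] .
 have "k = l & i = i' & j = j'"
  by (rule circ_disjoint[of k i j l i' j' z]) (use 1 2 assms in "auto simp: ixs_def")
 thus ?thesis using 1 2 by simp
qed

lemma corner_in_circ: "(real i / pw k, real j / pw k) \<in> cr k i j"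
 unfolding circ_def gsq_def gbx_def by simp

lemma corner_in_circ': "((real i + 1) / pw k, (real j + 1) / pw k) \<in> cr k i j"
 unfolding circ_def gsq_def gbx_def by simp

lemma circ_eq_iff:
 assumes "(k, i, j) \<in> ixs" "(l, i', j') \<in> ixs"
 shows "cr k i j = cr l i' j' \<longleftrightarrow> k = l & i = i' & j = j'"
 using circ_disjoint[of k i j l i' j'] corner_in_circ[of i k j] assms unfolding ixs_def by auto

lemma hole_ne_OC: "hl k i j ==> cr k i j ~= OC"
 using circ_eq_iff[of k i j 0 0 0] unfolding OC_def ixs_def by auto

text \<open>The side of a circle is written as \<open>osc fst\<close> from here on, so that sides
  and oscillations of functions live in the same l2 space.\<close>

lemma osc_circ: "osc fst (cr k i j) = 1 / pw k" "osc snd (cr k i j) = 1 / pw k"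
proof -
 have gen: "osc g (cr k i j) = 1 / pw k"
  if g: "g = fst | g = snd" for g :: "pt => real"
 proof (rule antisym)
  have b: "bounded (g ` cr k i j)"
   using bounded_subset[OF bounded_gsq[of k i j], of "cr k i j"] g bounded_fst bounded_snd unfolding circ_def by blast
  show "osc g (cr k i j) <= 1 / pw k"
  proof (rule osc_le)
   fix x y assume "x \<in> cr k i j" "y \<in> cr k i j"
   hence "(g x - g y) * pw k <= 1" using g unfolding circ_def gsq_def by (auto simp: left_diff_distrib)
   thus "g x - g y <= 1 / pw k" by (simp add: field_simps)
  qed simp
  have "1 / pw k <= \<bar>g ((real i + 1) / pw k, (real j + 1) / pw k) - g (real i / pw k, real j / pw k)\<bar>"
   using g by (auto simp: diff_divide_distrib[symmetric])
  also have "... <= osc g (cr k i j)" by (rule osc_bound[OF b corner_in_circ' corner_in_circ])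
  finally show "1 / pw k <= osc g (cr k i j)" .
 qed
 show "osc fst (cr k i j) = 1 / pw k" "osc snd (cr k i j) = 1 / pw k" using gen by auto
qed

definition holes :: "pt set set" where "holes = circles F - {OC}"

lemma holes_iff: "E \<in> holes \<longleftrightarrow> (\<exists>k i j. hl k i j & E = cr k i j)"
proof
 assume "E \<in> holes"
 hence "E \<in> circles F" "E ~= OC" unfolding holes_def by auto
 thus "\<exists>k i j. hl k i j & E = cr k i j" by (cases rule: circle_cases) auto
qed (auto simp: holes_def hole_circle hole_ne_OC)

lemma gbx_holes_disjoint:
 assumes "hl k i j" "hl l i' j'" "z \<in> gb k i j" "z \<in> gb l i' j'"
 shows "k = l & i = i' & j = j'"
proof -
 have less: False if h: "hl (k + Suc m) i j" "hl k i' j'" and z: "z \<in> gb (k + Suc m) i j" "z \<in> gb k i' j'" for k m i j i' j'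
 using gbx_gsq_idx[OF z(1), of i' j'] z(2) gbx_sub hole_prefix[OF h(1)] h(2) hole_not_cell by blast
 consider "k = l" | m where "l = k + Suc m" | m where "k = l + Suc m"
  by (metis less_imp_Suc_add linorder_neqE_nat add_Suc_right)
 thus ?thesis
 proof cases
  case 1
  thus ?thesis using gbx_gsq_idx[of z k 0 i j i' j'] assms(3) subsetD[OF gbx_sub assms(4)] by simp
 next
  case 2 thus ?thesis using less[of k m i' j' i j] assms by auto
 next
  case 3 thus ?thesis using less[of l m i j i' j'] assms by auto
 qed
qed

text \<open>(osc fst E)^2 is the area of the removed open square, and removed squares are
  disjoint.\<close>

lemma area_bound:
 assumes "finite T" "T \<subseteq> holes" "!!E. E \<in> T ==> E \<subseteq> {a..b} \<times> {c..d}" "a <= b" "c <= d"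
 shows "(\<Sum>E\<in>T. (osc fst E)^2) <= (b - a) * (d - c)"
proof -
 define f where "f = (%E. SOME c. case c of (k, i, j) => hl k i j & E = cr k i j)"
 have f: "case f E of (k, i, j) => hl k i j & E = cr k i j" if "E \<in> T" for E
 proof -
  obtain k i j where "hl k i j & E = cr k i j" using assms(2) \<open>E \<in> T\<close> holes_iff by blast
  hence "\<exists>c. case c of (k, i, j) => hl k i j & E = cr k i j" by (intro exI[of _ "(k, i, j)"]) simp
  thus ?thesis unfolding f_def by (rule someI_ex)
 qed
 define B where "B = (%E. case f E of (k, i, j) => gb k i j)"
 have B: "\<exists>k i j. hl k i j & E = cr k i j & B E = gb k i j" if "E \<in> T" for E
  using f[OF that] unfolding B_def by (cases "f E") auto
 have Nd: "real i / pw k <= (real i + 1) / pw k" for i k by (simp add: divide_right_mono)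
 have mB: "measure lborel (B E) = (osc fst E)^2" if E: "E \<in> T" for E
 proof -
  obtain k i j where "hl k i j" "E = cr k i j" "B E = gb k i j" using B[OF E] by blast
  thus ?thesis using Nd[of i k] Nd[of j k]
   by (simp add: osc_circ gbx_Times content_orect diff_divide_distrib[symmetric] power2_eq_square)
 qed
 have "(\<Sum>E\<in>T. measure lborel (B E)) <= measure lborel ({a..b} \<times> {c..d})"
 proof (rule sum_area_le[OF assms(1)])
  show "B E \<in> fmeasurable lborel" if "E \<in> T" for E using B[OF that] gbx_Times orect_fmeasurable by auto
  show "disjoint_family_on B T" unfolding disjoint_family_on_def
  proof (intro ballI impI)
   fix E E' assume E: "E \<in> T" "E' \<in> T" "E ~= E'"
   obtain k i j where 1: "hl k i j" "E = cr k i j" "B E = gb k i j" using B[OF E(1)] by blast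
   obtain l i' j' where 2: "hl l i' j'" "E' = cr l i' j'" "B E' = gb l i' j'" using B[OF E(2)] by blast
   show "B E \<inter> B E' = {}" using gbx_holes_disjoint[OF 1(1) 2(1)] 1 2 E(3) by auto
  qed
  show "(\<Union>E\<in>T. B E) \<subseteq> {a..b} \<times> {c..d}"
  proof
   fix z assume "z \<in> (\<Union>E\<in>T. B E)"
   then obtain E where E: "E \<in> T" "z \<in> B E" by blast
   obtain k i j where 1: "hl k i j" "E = cr k i j" "B E = gb k i j" using B[OF E(1)] by blast
   have "(real i / pw k, real j / pw k) \<in> {a..b} \<times> {c..d}"
    "((real i + 1) / pw k, (real j + 1) / pw k) \<in> {a..b} \<times> {c..d}"
    using assms(3)[OF E(1)] corner_in_circ corner_in_circ' 1(2) by blast+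
   thus "z \<in> {a..b} \<times> {c..d}" using E(2) 1(3) unfolding gbx_Times by auto
  qed
 qed (rule rect_fmeasurable)
 thus ?thesis using mB content_rect[OF assms(4,5)] by simp
qed

lemma F_unit_rect: "F \<subseteq> {0..1} \<times> {0..1}"
 using F_unit unit_gsq by simp

lemma holes_unit: "E \<in> holes ==> E \<subseteq> {0..1} \<times> {0..1}"
 using circles_sub F_unit_rect unfolding holes_def by blast

lemma l2_side_holes: "l2 holes (osc fst)" "ns holes (osc fst) <= 1"
proof -
 have b: "(\<Sum>E\<in>T. (osc fst E)^2) <= 1" if "finite T" "T \<subseteq> holes" for T
  using area_bound[OF that, of 0 1 0 1] holes_unit that by force
 show l: "l2 holes (osc fst)" by (rule l2I[OF b])
 show "ns holes (osc fst) <= 1" by (rule ns_le[OF l b])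
qed

lemma l2_insert_OC: "l2 holes f ==> l2 (circles F) f"
proof -
 assume l: "l2 holes f"
 have "circles F = insert OC holes" using OC_circle unfolding holes_def by auto
 thus ?thesis using l unfolding l2_def by (simp add: summable_on_insert_iff)
qed

lemma osc_fst_snd: "E \<in> circles F ==> osc snd E = osc fst E"
 using circles_ix osc_circ by metis

lemma osc_fst_nonneg: "E \<in> circles F ==> 0 <= osc fst E"
 by (rule osc_circle_nonneg[OF tame_coord(1)])

lemma l2_side: "l2 (circles F) (osc fst)"
 by (rule l2_insert_OC[OF l2_side_holes(1)])

text \<open>Lipschitz functions are tame because the carpet has area zero.\<close>

lemma lipschitz_tame:
 assumes K: "0 <= K" and l: "!!x y. x \<in> F ==> y \<in> F ==> \<bar>h x - h y\<bar> <= K * (\<bar>fst x - fst y\<bar> + \<bar>snd x - snd y\<bar>)"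
 shows "tame F h" "E \<in> circles F ==> osc h E <= 2 * K * osc fst E" "l2 (circles F) (osc h)"
proof -
 show t: "tame F h" by (rule tame_comb[OF tame_coord K l])
 have o: "osc h E <= 2 * K * osc fst E" if E: "E \<in> circles F" for E
 proof -
  have "osc h E <= K * (osc fst E + osc snd E)"
  proof (rule osc_le_comb)
   show "bounded (fst ` E)" "bounded (snd ` E)"
    using circles_sub[OF E] by (auto intro: tame_bounded_sub[OF tame_coord(1)] tame_bounded_sub[OF tame_coord(2)])
   show "\<bar>h x - h y\<bar> <= K * (\<bar>fst x - fst y\<bar> + \<bar>snd x - snd y\<bar>)" if "x \<in> E" "y \<in> E" for x y
    by (rule l) (use that circles_sub[OF E] in auto)
  qed (rule K)
  thus ?thesis using osc_fst_snd[OF E] by simp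
 qed
 show "E \<in> circles F ==> osc h E <= 2 * K * osc fst E" by (rule o)
 show "l2 (circles F) (osc h)"
 proof (rule l2_mono[OF l2_cmult[OF l2_side, of "2 * K"]])
  fix E assume E: "E \<in> circles F"
  thus "\<bar>osc h E\<bar> <= \<bar>2 * K * osc fst E\<bar>" using o[OF E] osc_circle_nonneg[OF t E] by linarith
 qed
qed

section \<open>Symmetries and the line lemma\<close>

definition flx :: "pt => pt" where "flx z = (1 - fst z, snd z)"
definition sw :: "pt => pt" where "sw z = (snd z, fst z)"

lemma flx_flx [simp]: "flx (flx z) = z" and sw_sw [simp]: "sw (sw z) = z"
 unfolding flx_def sw_def by auto

lemma hdig_flip: "a < n ==> hdig n p (n - 1 - a) \<longleftrightarrow> hdig n p a"
 using p2 unfolding hdig_def by auto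

lemma flip_divmod:
 assumes "i < n * M"
 shows "(n * M - 1 - i) div n = M - 1 - i div n" "(n * M - 1 - i) mod n = n - 1 - i mod n"
proof -
 have "i div n < M" using assms by (simp add: div_less_iff_less_mult mult.commute)
 then obtain s where s: "M = Suc (i div n) + s" using less_iff_Suc_add by auto
 have r: "i mod n < n" by simp
 have "n * M = n * (i div n) + n + n * s" unfolding s by (simp add: algebra_simps)
 moreover have "i = n * (i div n) + i mod n" by simp
 ultimately have e: "n * M - 1 - i = n * s + (n - 1 - i mod n)" using r by linarith
 have sm: "M - 1 - i div n = s" using s by simp
 have lt: "n - 1 - i mod n < n" using n5 by simp
 show "(n * M - 1 - i) div n = M - 1 - i div n" unfolding e sm using lt by simp
 show "(n * M - 1 - i) mod n = n - 1 - i mod n" unfolding e using lt by simp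
qed

lemma cell_flip: "i < n ^ k ==> cl k (n ^ k - 1 - i) j \<longleftrightarrow> cl k i j"
proof (induction k arbitrary: i j)
 case (Suc k)
 have b: "i < n * n ^ k" "i div n < n ^ k" using Suc.prems by (simp_all add: div_less_iff_less_mult mult.commute)
 show ?case using Suc.IH[OF b(2)] flip_divmod[OF b(1)] hdig_flip[of "i mod n"] by simp
qed simp

lemma hole_flip: "i < n ^ k ==> hl k (n ^ k - 1 - i) j \<longleftrightarrow> hl k i j"
proof (cases k)
 case (Suc m)
 assume "i < n ^ k"
 hence b: "i < n * n ^ m" "i div n < n ^ m" unfolding Suc by (simp_all add: div_less_iff_less_mult mult.commute)
 show ?thesis unfolding Suc using cell_flip[OF b(2)] flip_divmod[OF b(1)] hdig_flip[of "i mod n"] by simp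
qed simp

lemma cell_swap: "cl k i j \<longleftrightarrow> cl k j i"
 by (induction k arbitrary: i j) auto

lemma hole_swap: "hl k i j \<longleftrightarrow> hl k j i"
 by (cases k) (use cell_swap in auto)

lemma flx_gsq: "i < n ^ k ==> flx z \<in> gs k (n ^ k - 1 - i) j \<longleftrightarrow> z \<in> gs k i j"
proof -
 assume "i < n ^ k"
 hence e: "real (n ^ k - 1 - i) = pw k - 1 - real i" by (simp add: of_nat_diff Suc_leI)
 show ?thesis unfolding gsq_def flx_def e by (auto simp: left_diff_distrib)
qed

lemma flx_gbx: "i < n ^ k ==> flx z \<in> gb k (n ^ k - 1 - i) j \<longleftrightarrow> z \<in> gb k i j"
proof -
 assume "i < n ^ k"
 hence e: "real (n ^ k - 1 - i) = pw k - 1 - real i" by (simp add: of_nat_diff Suc_leI)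
 show ?thesis unfolding gbx_def flx_def e by (auto simp: left_diff_distrib)
qed

lemma sw_gsq: "sw z \<in> gs k j i \<longleftrightarrow> z \<in> gs k i j"
 unfolding gsq_def sw_def by auto
lemma sw_gbx: "sw z \<in> gb k j i \<longleftrightarrow> z \<in> gb k i j"
 unfolding gbx_def sw_def by auto

lemma flx_F: "z \<in> F ==> flx z \<in> F"
 unfolding F_iff
proof
 fix k assume "\<forall>k. \<exists>i j. cl k i j & z \<in> gs k i j"
 then obtain i j where ij: "cl k i j" "z \<in> gs k i j" by blast
 thus "\<exists>i j. cl k i j & flx z \<in> gs k i j"
  using cell_flip[of i k j] flx_gsq[of i k z j] cell_bound[of k i j] by blast
qed

lemma sw_F: "z \<in> F ==> sw z \<in> F"
 unfolding F_iff using cell_swap sw_gsq by blast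

lemma involution_img:
 assumes "!!x. x \<in> A ==> f x \<in> A" "!!x. f (f x) = x"
 shows "f ` A = A"
 using assms by (metis image_eqI image_subsetI subsetI subset_antisym)

lemma qsi_flx: "qsi F F flx flx"
 by (rule qsi_isometry[OF involution_img involution_img]) (simp_all add: flx_F, simp_all add: flx_def dist_prod_def dist_real_def power2_commute)

lemma qsi_sw: "qsi F F sw sw"
 by (rule qsi_isometry[OF involution_img involution_img]) (simp_all add: sw_F, simp_all add: sw_def dist_prod_def add.commute)

lemma flx_circ: "i < n ^ k ==> flx ` cr k i j = cr k (n ^ k - 1 - i) j"
proof -
 assume i: "i < n ^ k"
 have "z \<in> flx ` cr k i j \<longleftrightarrow> z \<in> cr k (n ^ k - 1 - i) j" for z
 proof -
  have "z \<in> flx ` cr k i j \<longleftrightarrow> flx z \<in> cr k i j" by (metis flx_flx image_iff)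
  also have "... \<longleftrightarrow> z \<in> cr k (n ^ k - 1 - i) j"
   unfolding circ_def using flx_gsq[OF i, of "flx z" j] flx_gbx[OF i, of "flx z" j] by simp
  finally show ?thesis .
 qed
 thus ?thesis by blast
qed

lemma sw_circ: "sw ` cr k i j = cr k j i"
proof -
 have "z \<in> sw ` cr k i j \<longleftrightarrow> z \<in> cr k j i" for z
 proof -
  have "z \<in> sw ` cr k i j \<longleftrightarrow> sw z \<in> cr k i j" by (metis sw_sw image_iff)
  thus ?thesis unfolding circ_def using sw_gsq[of z k i j] sw_gbx[of z k i j] by simp
 qed
 thus ?thesis by blast
qed

section \<open>Crossing a row of grid squares\<close>

lemma finite_holes: "finite {(l, hi, hj). l <= k & hl l hi hj}"
proof (rule finite_subset)
 show "{(l, hi, hj). l <= k & hl l hi hj} \<subseteq> {..k} \<times> {..n ^ k} \<times> {..n ^ k}"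
 proof (clarsimp)
  fix l hi hj assume "l <= k" "hl l hi hj"
  moreover from this have "n ^ l <= n ^ k" using n5 by (intro power_increasing) auto
  ultimately show "hi <= n ^ k & hj <= n ^ k" using hole_bound[of l hi hj] by linarith
 qed
qed simp

text \<open>Line lemma: along a row of grid squares a function with small oscillation on deep cells can only
 vary by passing through holes; averaging over the lines of the row gives weight \<open>side\<close> to each hole.\<close>

lemma row_telescope:
 assumes g: "tame F g"
  and sq: "!!c. a <= c ==> c < b ==> cl m c r | hl m c r"
  and rho: "rho div n ^ e = r" and rb: "r < n ^ m" and bb: "b <= n ^ m"
 defines "k \<equiv> m + e"
 defines "y \<equiv> (real rho + 1/2) / pw k"
 defines "pt \<equiv> (%c. (real c / pw k, y))"
 defines "IT \<equiv> (%c. {(l, hi, hj). m <= l & l <= k & hl l hi hj & a * n ^ e <= hi * n ^ (k - l) &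
     (hi + 1) * n ^ (k - l) <= c & hj = rho div n ^ (k - l)})"
 assumes start: "pt (a * n ^ e) \<in> F"
 shows "a * n ^ e <= c ==> c <= b * n ^ e ==> pt c \<in> F ==>
  g (pt c) - g (pt (a * n ^ e)) \<le>
   (\<Sum>c'\<in>{c'. a * n ^ e <= c' & c' < c & cl k c' rho}. osc g (gs k c' rho \<inter> F)) +
   (\<Sum>(l, hi, hj)\<in>IT c. osc g (cr l hi hj))"
proof (induction c rule: less_induct)
 case (less c)
 define Cs where "Cs = (%c. {c'. a * n ^ e <= c' & c' < c & cl k c' rho})"
 define SC where "SC = (%c. \<Sum>c'\<in>Cs c. osc g (gs k c' rho \<inter> F))"
 define SH where "SH = (%c. \<Sum>(l, hi, hj)\<in>IT c. osc g (cr l hi hj))"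
 have fC: "finite (Cs c)" for c unfolding Cs_def by (rule finite_subset[of _ "{..<c}"]) auto
 have fI: "finite (IT c)" for c by (rule finite_subset[OF _ finite_holes[of k]]) (auto simp: IT_def)
 have oC: "0 <= osc g (A \<inter> F)" for A by (rule osc_nonneg) (meson g inf_le2 tame_bounded_sub)
 have oH: "0 <= osc g (cr l hi hj)" if "(l, hi, hj) \<in> IT c" for l hi hj c
  using osc_circle_nonneg[OF g hole_circle] that unfolding IT_def by auto
 have SC0: "0 <= SC c" for c unfolding SC_def by (rule sum_nonneg) (rule oC)
 have SH0: "0 <= SH c" for c unfolding SH_def by (rule sum_nonneg) (use oH in auto)
 have mono: "SC c' <= SC c" "SH c' <= SH c" if "c' <= c" for c' c
 proof -
  show "SC c' <= SC c" unfolding SC_def by (rule sum_mono2) (use fC oC that in "auto simp: Cs_def")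
  show "SH c' <= SH c" unfolding SH_def
   by (rule sum_mono2) (use fI oH that in "auto simp: IT_def")
 qed
 have yr: "real rho < y * pw k" "y * pw k < real rho + 1" unfolding y_def by auto
 have goal: "g (pt c) - g (pt (a * n ^ e)) <= SC c + SH c"
 proof (cases "c = a * n ^ e")
  case True thus ?thesis using SC0[of c] SH0[of c] by simp
 next
  case False
  define c1 where "c1 = c - 1"
  have c1: "a * n ^ e <= c1" "c1 < b * n ^ e" "c = Suc c1" using False less.prems unfolding c1_def by auto
  have col: "a <= c1 div n ^ e" "c1 div n ^ e < b"
   using c1 by (simp_all add: less_eq_div_iff_mult_less_eq div_less_iff_less_mult)
  have bnd: "c1 < n ^ k" "rho < n ^ k"
  proof -
   have "b * n ^ e <= n ^ m * n ^ e" using bb by simp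
   thus "c1 < n ^ k" using c1(2) unfolding k_def power_add by linarith
   have "rho div n ^ e < n ^ m" using rho rb by simp
   thus "rho < n ^ k" unfolding k_def power_add by (simp add: div_less_iff_less_mult)
  qed
  \<comment> \<open>The column left of c is either a cell, crossed at the cost of its oscillation,
    or lies in a hole. In the latter case \<open>pt c\<close> in F forces c to be the right side of
    that hole, and the recursion continues at its left side.\<close>
  show ?thesis
  proof (cases "cl k c1 rho")
   case True
   have mem: "pt c1 \<in> gs k c1 rho" "pt c \<in> gs k c1 rho" "pt c1 \<notin> gb k c1 rho"
    unfolding pt_def gsq_def gbx_def c1(3) using yr by auto
   hence "pt c1 \<in> cr k c1 rho" unfolding circ_def by blast
   hence F1: "pt c1 \<in> F" using circ_in_F True by blast
   have "g (pt c1) - g (pt (a * n ^ e)) <= SC c1 + SH c1"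
    using less.IH[of c1] c1 F1 unfolding SC_def SH_def Cs_def by simp
   moreover have "g (pt c) - g (pt c1) <= osc g (gs k c1 rho \<inter> F)"
    using osc_bound[of g "gs k c1 rho \<inter> F" "pt c" "pt c1"] mem F1 less.prems
     tame_bounded_sub[OF g, of "gs k c1 rho \<inter> F"] by simp
   moreover have "SC c = SC c1 + osc g (gs k c1 rho \<inter> F)"
   proof -
    have "Cs c = insert c1 (Cs c1)" "c1 \<notin> Cs c1" unfolding Cs_def using c1 True by auto
    thus ?thesis unfolding SC_def using fC[of c1] by simp
   qed
   moreover have "SH c1 <= SH c" by (rule mono) (use c1 in simp)
   ultimately show ?thesis by linarith
  next
   case False
   obtain l e' where le: "k = l + e'" "hl l (c1 div n ^ e') (rho div n ^ e')"
    using noncell_in_hole[OF bnd False] by blast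
   define hi hj where "hi = c1 div n ^ e'" and "hj = rho div n ^ e'"
   have h: "hl l hi hj" using le unfolding hi_def hj_def by simp
   have ml: "m <= l"
   proof (rule ccontr)
    assume "~ m <= l"
    then obtain d where d: "m = l + Suc d" by (metis add_Suc_right less_imp_Suc_add not_le)
    have e': "e' = e + Suc d" using le(1) unfolding k_def d by simp
    have "hi = (c1 div n ^ e) div n ^ Suc d" "hj = (rho div n ^ e) div n ^ Suc d"
     unfolding hi_def hj_def e' power_add by (simp_all only: div_mult2_eq)
    moreover have "cl m (c1 div n ^ e) (rho div n ^ e) | hl m (c1 div n ^ e) (rho div n ^ e)"
     using sq[OF col] rho by simp
    ultimately have "cl l hi hj" using cell_prefix[of l "Suc d"] hole_prefix[of l d] unfolding d by metis
    thus False using h hole_not_cell by blast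
   qed
   have e'e: "e' <= e" "k - l = e'" using le(1) ml unfolding k_def by auto
   define c0 where "c0 = hi * n ^ e'"
   have c0: "c0 <= c1" "c1 < c0 + n ^ e'"
   proof -
    have "c1 = hi * n ^ e' + c1 mod n ^ e'" unfolding hi_def by (simp only: div_mult_mod_eq)
    moreover have "c1 mod n ^ e' < n ^ e'" using n5 by simp
    ultimately show "c0 <= c1" "c1 < c0 + n ^ e'" unfolding c0_def by linarith+
   qed
   have sc: "real c / pw k * pw l = real c / pw e'" for c
    unfolding le(1) power_add using nR by simp
   have yl: "real hj < y * pw l" "y * pw l < real hj + 1"
    using div_scale_strict[of rho y l e'] yr unfolding le(1) hj_def by auto
   have cc: "c = c0 + n ^ e'"
   proof (rule ccontr)
    assume "c ~= c0 + n ^ e'"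
    hence cs: "c < c0 + n ^ e'" "c0 < c" using c0 c1(3) by auto
    have "real hi < real c / pw e'" using cs(2) unfolding c0_def
     by (simp add: pos_less_divide_eq) (metis of_nat_less_iff of_nat_mult of_nat_power)
    moreover have "real c < real (c0 + n ^ e')" using cs(1) by (simp only: of_nat_less_iff)
    hence "real c / pw e' < real hi + 1" unfolding c0_def
     by (simp add: pos_divide_less_eq distrib_right)
    ultimately have "pt c \<in> gb l hi hj" unfolding gbx_def pt_def using sc yl by auto
    thus False using F_hole[OF less.prems(3) h] by blast
   qed
   have ac0: "a * n ^ e <= c0"
   proof -
    have e1: "n ^ e = n ^ (e - e') * n ^ e'" using e'e by (simp add: power_add[symmetric])
    have "a * n ^ (e - e') <= hi" unfolding hi_def
     using c1(1) by (simp add: less_eq_div_iff_mult_less_eq e1 mult.assoc)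
    thus ?thesis unfolding c0_def e1 by (metis mult.assoc mult_le_mono1)
   qed
   have s0: "real c0 / pw k * pw l = real hi" "real c / pw k * pw l = real hi + 1"
    using nR unfolding sc cc c0_def by (simp_all add: add_divide_distrib)
   have mem: "pt c0 \<in> cr l hi hj" "pt c \<in> cr l hi hj"
    unfolding circ_def gsq_def gbx_def pt_def by (simp_all del: times_divide_eq_left add: s0 yl less_imp_le)
   have F0: "pt c0 \<in> F" using mem circ_in_F h by blast
   have "g (pt c0) - g (pt (a * n ^ e)) <= SC c0 + SH c0"
    using less.IH[of c0] ac0 c0 c1 F0 unfolding SC_def SH_def Cs_def by simp
   moreover have "g (pt c) - g (pt c0) <= osc g (cr l hi hj)"
    using osc_bound[of g "cr l hi hj" "pt c" "pt c0"] mem tame_bounded_sub[OF g circ_in_F[of l hi hj]] h by simp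
   moreover have "SC c0 <= SC c" by (rule mono) (use c0 c1 in simp)
   moreover have "SH c0 + osc g (cr l hi hj) <= SH c"
   proof -
    have new: "(l, hi, hj) \<in> IT c" unfolding IT_def using ml le(1) h ac0 cc e'e(2) unfolding c0_def hj_def by auto
    have "~ (hi + 1) * n ^ (k - l) <= c0" unfolding c0_def e'e(2) using n5 by simp
    hence old: "(l, hi, hj) \<notin> IT c0" unfolding IT_def by simp
    have sub: "insert (l, hi, hj) (IT c0) \<subseteq> IT c" using new cc unfolding IT_def by auto
    have "osc g (cr l hi hj) + SH c0 = (\<Sum>(l, hi, hj)\<in>insert (l, hi, hj) (IT c0). osc g (cr l hi hj))"
     unfolding SH_def using old fI[of c0] by simp
    also have "... <= SH c" unfolding SH_def by (rule sum_mono2[OF fI sub]) (use oH in auto)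
    finally show ?thesis by simp
   qed
   ultimately show ?thesis by linarith
  qed
 qed
 thus ?case unfolding SC_def SH_def Cs_def .
qed

text \<open>Tameness is applied to the balls of radius 2 / n^k around the lower left corners of the
  cells, which are separated with constant 2; Cauchy-Schwarz with at most n^(2k) cells gives the
  bound. After division by n^k the cells disappear from the line lemma.\<close>

lemma cells_osc:
 assumes g: "tame F g" and dl: "dl > 0"
 shows "\<exists>k0. \<forall>k\<ge>k0. (\<Sum>(i, j)\<in>{(i, j). cl k i j}. osc g (gs k i j \<inter> F)) <= sqrt dl * pw k"
proof -
 obtain m where m: "m > 0" "!!S. finite S ==> S \<subseteq> F \<times> {0..m} ==> sep 2 S ==>
    (\<Sum>(x,r)\<in>S. (osc g (F \<inter> cball x r))^2) <= dl" using tameE[OF g dl] by blast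
 have n1: "1 < real n" using n5 by simp
 obtain k0 where k0: "2 / m < pw k0" using real_arch_pow[OF n1] by blast
 have "(\<Sum>(i, j)\<in>{(i, j). cl k i j}. osc g (gs k i j \<inter> F)) <= sqrt dl * pw k" if k: "k0 <= k" for k
 proof -
  define K where "K = {(i, j). cl k i j}"
  define co where "co = (%(i::nat, j::nat). ((real i / pw k, real j / pw k), 2 / pw k))"
  define ho where "ho = (%(i, j). osc g (gs k i j \<inter> F))"
  have fK: "finite K" unfolding K_def by (rule finite_cells)
  have "pw k0 <= pw k" using k n1 by (intro power_increasing) (use n5 in auto)
  hence "m * pw k0 <= m * pw k" by (rule mult_left_mono) (use m(1) in simp)
  moreover have "2 < m * pw k0" using k0 m(1) by (simp add: pos_divide_less_eq mult.commute)
  ultimately have "2 <= m * pw k" by linarith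
  hence rm: "2 / pw k <= m" by (subst pos_divide_le_eq) simp_all
  have inj: "inj_on co K" unfolding inj_on_def co_def using n5 by auto
  have sub: "co ` K \<subseteq> F \<times> {0..m}"
  proof
   fix z assume "z \<in> co ` K"
   then obtain i j where ij: "cl k i j" "z = co (i, j)" unfolding K_def by blast
   have "(real i / pw k, real j / pw k) \<in> F"
    using corner_in_circ[of i k j] circ_in_F[of k i j] ij(1) by blast
   thus "z \<in> F \<times> {0..m}" using rm unfolding ij(2) co_def by simp
  qed
  have sp: "sep 2 (co ` K)"
  proof (rule sepI)
   fix x r y s assume xs: "(x, r) \<in> co ` K" "(y, s) \<in> co ` K" "(x, r) ~= (y, s)"
   obtain i j where i: "x = (real i / pw k, real j / pw k)" "r = 2 / pw k" using xs(1) unfolding co_def by auto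
   obtain i' j' where i': "y = (real i' / pw k, real j' / pw k)" "s = 2 / pw k" using xs(2) unfolding co_def by auto
   have "i ~= i' | j ~= j'" using xs(3) unfolding i i' by auto
   hence d: "1 <= \<bar>real i - real i'\<bar> | 1 <= \<bar>real j - real j'\<bar>" by linarith
   have "\<bar>fst x - fst y\<bar> <= dist x y" "\<bar>snd x - snd y\<bar> <= dist x y"
    using dist_fst_le[of x y] dist_snd_le[of x y] unfolding dist_real_def by auto
   moreover have "\<bar>fst x - fst y\<bar> = \<bar>real i - real i'\<bar> / pw k" "\<bar>snd x - snd y\<bar> = \<bar>real j - real j'\<bar> / pw k"
    unfolding i i' using npow_pos[of k] by (simp_all flip: diff_divide_distrib add: abs_divide)
   moreover have "1 / pw k <= \<bar>real i - real i'\<bar> / pw k | 1 / pw k <= \<bar>real j - real j'\<bar> / pw k"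
    using d by (auto intro: divide_right_mono)
   ultimately have "1 / pw k <= dist x y" by linarith
   thus "r <= 2 * dist x y" unfolding i by simp
  qed
  have "(\<Sum>z\<in>K. (ho z)^2) <= (\<Sum>z\<in>K. (case co z of (x, r) => (osc g (F \<inter> cball x r))\<^sup>2))"
  proof (rule sum_mono)
   fix z assume "z \<in> K"
   then obtain i j where z: "z = (i, j)" "cl k i j" unfolding K_def by blast
   have "gs k i j \<inter> F \<subseteq> F \<inter> cball (real i / pw k, real j / pw k) (2 / pw k)"
    using dist_gsq[of "(real i / pw k, real j / pw k)" k i j] corner_in_circ[of i k j] unfolding circ_def by auto
   hence "osc g (gs k i j \<inter> F) <= osc g (F \<inter> cball (real i / pw k, real j / pw k) (2 / pw k))"
    by (intro osc_mono tame_bounded_sub[OF g]) auto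
   moreover have "0 <= osc g (gs k i j \<inter> F)" by (intro osc_nonneg tame_bounded_sub[OF g]) auto
   ultimately show "(ho z)^2 <= (case co z of (x, r) => (osc g (F \<inter> cball x r))\<^sup>2)"
    unfolding z ho_def co_def by (simp add: power_mono)
  qed
  also have "... = (\<Sum>(x,r)\<in>co ` K. (osc g (F \<inter> cball x r))^2)" by (simp add: sum.reindex[OF inj])
  also have "... <= dl" using m(2)[of "co ` K"] fK sub sp by simp
  finally have q: "(\<Sum>z\<in>K. (ho z)^2) <= dl" .
  have cK: "real (card K) <= (pw k)^2"
  proof -
   have "K \<subseteq> {..<n ^ k} \<times> {..<n ^ k}" unfolding K_def using cell_bound by auto
   hence "card K <= n ^ k * n ^ k" using card_mono[of "{..<n ^ k} \<times> {..<n ^ k}" K] by simp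
   thus ?thesis by (metis of_nat_le_iff of_nat_mult of_nat_power power2_eq_square)
  qed
  have "(\<Sum>z\<in>K. ho z * 1)^2 <= (\<Sum>z\<in>K. (ho z)^2) * (\<Sum>z\<in>K. 1^2)" by (rule Cauchy_Schwarz_ineq_sum)
  also have "... <= dl * (pw k)^2" using q cK dl by (simp add: mult_mono sum_nonneg)
  finally have "(\<Sum>z\<in>K. ho z)^2 <= (sqrt dl * pw k)^2" using dl by (simp add: power_mult_distrib)
  hence "(\<Sum>z\<in>K. ho z) <= sqrt dl * pw k"
   by (rule power2_le_imp_le) (use dl in simp)
  thus ?thesis unfolding K_def ho_def .
 qed
 thus ?thesis by blast
qed

lemma line_lemma:
 assumes g: "tame F g"
  and sq: "!!c. a <= c ==> c < b ==> cl m c r | hl m c r"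
  and ab: "a <= b" and rb: "r < n ^ m" and bb: "b <= n ^ m"
  and pts: "!!y. real r < y * pw m ==> y * pw m < real r + 1 ==>
    (real a / pw m, y) \<in> F & (real b / pw m, y) \<in> F &
    t <= g (real b / pw m, y) - g (real a / pw m, y)"
 defines "T \<equiv> {E \<in> holes. E \<subseteq> {real a / pw m .. real b / pw m} \<times> {real r / pw m .. (real r + 1) / pw m}}"
 assumes l2T: "l2 T (osc g)"
 shows "t / pw m <= infsum (%E. osc fst E * osc g E) T"
proof -
 have TH: "T \<subseteq> circles F" unfolding T_def holes_def by blast
 have smT: "(%E. osc fst E * osc g E) summable_on T" by (rule l2_mult[OF l2_subset[OF l2_side TH] l2T])
 have nn: "0 <= osc fst E * osc g E" if "E \<in> T" for E
  using osc_fst_nonneg osc_circle_nonneg[OF g] TH that by (simp add: subset_iff)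
 have key: "t / pw m <= infsum (%E. osc fst E * osc g E) T + sqrt dl" if dl: "dl > 0" for dl
 proof -
  obtain k0 where k0: "!!k. k0 <= k ==> (\<Sum>(i, j)\<in>{(i, j). cl k i j}. osc g (gs k i j \<inter> F)) <= sqrt dl * pw k"
   using cells_osc[OF g dl] by blast
  define e where "e = k0"
  define k where "k = m + e"
  define R where "R = {r * n ^ e ..< (r + 1) * n ^ e}"
  define U where "U = {(l, hi, hj). m <= l & l <= k & hl l hi hj & a * n ^ e <= hi * n ^ (k - l) &
     (hi + 1) * n ^ (k - l) <= b * n ^ e & r * n ^ e <= hj * n ^ (k - l) & (hj + 1) * n ^ (k - l) <= (r + 1) * n ^ e}"
  define ho where "ho = (%(l, hi, hj). osc g (cr l hi hj))"
  define C where "C = (%rho. {c'. a * n ^ e <= c' & c' < b * n ^ e & cl k c' rho})"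
  have npos: "0 < n ^ q" for q using n5 by simp
  have fU: "finite U" by (rule finite_subset[OF _ finite_holes[of k]]) (auto simp: U_def)
  have o0: "0 <= ho h" if "h \<in> U" for h
   using osc_circle_nonneg[OF g hole_circle] that unfolding U_def ho_def by auto
  have oc0: "0 <= osc g (A \<inter> F)" for A by (rule osc_nonneg) (meson g inf_le2 tame_bounded_sub)
  define SC where "SC = (%rho. \<Sum>c'\<in>C rho. osc g (gs k c' rho \<inter> F))"
  define SH where "SH = (%rho. \<Sum>h\<in>{h \<in> U. rho div n ^ (k - fst h) = snd (snd h)}. ho h)"
  have row: "t <= SC rho + SH rho" if rho: "rho \<in> R" for rho
  proof -
   have rhod: "rho div n ^ e = r" using rho unfolding R_def by (intro div_nat_eqI) (auto simp: mult.commute)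
   define y where "y = (real rho + 1/2) / pw (m + e)"
   have "real rho < y * pw (m + e)" "y * pw (m + e) < real rho + 1"
    unfolding y_def using npow_pos[of "m + e"] by auto
   hence yr: "real r < y * pw m" "y * pw m < real r + 1"
    using div_scale_strict[of rho y m e] rhod by auto
   have sc: "real (c * n ^ e) / pw (m + e) = real c / pw m" for c
    using npow_pos[of e] by (simp add: power_add)
   note P = pts[OF yr]
   let ?V = "{(l, hi, hj). m <= l & l <= m + e & hl l hi hj & a * n ^ e <= hi * n ^ (m + e - l) &
     (hi + 1) * n ^ (m + e - l) <= b * n ^ e & hj = rho div n ^ (m + e - l)}"
   have "g (real (b * n ^ e) / pw (m + e), y) - g (real (a * n ^ e) / pw (m + e), y) \<le>
    (\<Sum>c'\<in>{c'. a * n ^ e <= c' & c' < b * n ^ e & cl (m + e) c' rho}. osc g (gs (m + e) c' rho \<inter> F)) +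
    (\<Sum>(l, hi, hj)\<in>?V. osc g (cr l hi hj))"
    unfolding y_def
    by (rule row_telescope[OF g sq rhod rb bb]) (use P ab in "auto simp only: sc y_def mult_le_mono1")
   moreover have "?V \<subseteq> {h \<in> U. rho div n ^ (k - fst h) = snd (snd h)}"
   proof (clarsimp simp: U_def k_def)
    fix l hi assume l: "m <= l" "l <= m + e"
    define d where "d = m + e - l"
    have e': "e = (l - m) + d" using l unfolding d_def by simp
    have rr: "(rho div n ^ d) div n ^ (l - m) = r" using rhod unfolding e' power_add by (metis div_mult2_eq mult.commute)
    have "r * n ^ (l - m) <= rho div n ^ d" using rr npos[of "l - m"] by (metis div_times_less_eq_dividend)
    moreover have "rho div n ^ d < (r + 1) * n ^ (l - m)" using rr npos[of "l - m"]
     by (metis add.commute dividend_less_div_times mult_Suc plus_1_eq_Suc rr)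
    ultimately have "r * n ^ (l - m) * n ^ d <= rho div n ^ d * n ^ d" "(rho div n ^ d + 1) * n ^ d <= (r + 1) * n ^ (l - m) * n ^ d"
     by (intro mult_le_mono1; simp)+
    thus "r * n ^ e <= rho div n ^ (m + e - l) * n ^ (m + e - l) &
     n ^ (m + e - l) + rho div n ^ (m + e - l) * n ^ (m + e - l) <= n ^ e + r * n ^ e"
     unfolding d_def[symmetric] by (simp add: e' power_add algebra_simps)
   qed
   hence "(\<Sum>(l, hi, hj)\<in>?V. osc g (cr l hi hj)) <= SH rho"
    unfolding SH_def ho_def by (intro sum_mono2) (use fU o0 in "auto simp: ho_def")
   ultimately show ?thesis using P unfolding SC_def C_def k_def sc by linarith
  qed
  \<comment> \<open>Sum over the n^e fine rows. The cells contribute at most sqrt dl * n^k in total,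
    and a hole of level l is met by at most n^(k - l) fine rows, so dividing by n^k = n^m * n^e
    leaves its side as weight.\<close>
  have "real (card R) * t <= (\<Sum>rho\<in>R. SC rho) + (\<Sum>rho\<in>R. SH rho)"
   using sum_mono[of R "%_. t" "%rho. SC rho + SH rho"] row by (simp add: sum.distrib)
  moreover have "real (card R) = pw e" unfolding R_def by (simp add: algebra_simps)
  ultimately have A: "pw e * t <= (\<Sum>rho\<in>R. SC rho) + (\<Sum>rho\<in>R. SH rho)" by simp
  have B: "(\<Sum>rho\<in>R. SC rho) <= sqrt dl * pw k"
  proof -
   have fC: "finite (C rho)" for rho unfolding C_def by (rule finite_subset[of _ "{..<b * n ^ e}"]) auto
   have "(\<Sum>rho\<in>R. SC rho) = (\<Sum>(rho, c')\<in>Sigma R C. osc g (gs k c' rho \<inter> F))"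
    unfolding SC_def using fC by (subst sum.Sigma) (auto simp: R_def)
   also have "... = (\<Sum>(c', rho)\<in>prod.swap ` Sigma R C. osc g (gs k c' rho \<inter> F))"
    by (subst sum.reindex) (auto intro!: sum.cong)
   also have "... <= (\<Sum>(i, j)\<in>{(i, j). cl k i j}. osc g (gs k i j \<inter> F))"
    by (rule sum_mono2[OF finite_cells]) (use oc0 in "auto simp: C_def")
   also have "... <= sqrt dl * pw k" by (rule k0) (simp add: k_def e_def)
   finally show ?thesis .
  qed
  have D: "(\<Sum>rho\<in>R. SH rho) <= (\<Sum>h\<in>U. pw (k - fst h) * ho h)"
  proof -
   have "(\<Sum>rho\<in>R. SH rho) = (\<Sum>h\<in>U. \<Sum>rho\<in>{rho \<in> R. rho div n ^ (k - fst h) = snd (snd h)}. ho h)"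
    unfolding SH_def by (rule sum.swap_restrict) (simp_all add: R_def fU)
   also have "... <= (\<Sum>h\<in>U. pw (k - fst h) * ho h)"
   proof (rule sum_mono)
    fix h assume h: "h \<in> U"
    define w where "w = n ^ (k - fst h)"
    have w0: "0 < w" unfolding w_def by (rule npos)
    have "{rho \<in> R. rho div w = snd (snd h)} \<subseteq> {snd (snd h) * w ..< snd (snd h) * w + w}"
    proof
     fix x assume "x \<in> {rho \<in> R. rho div w = snd (snd h)}"
     hence e: "snd (snd h) = x div w" by simp
     have "x = x div w * w + x mod w" by (simp only: div_mult_mod_eq)
     thus "x \<in> {snd (snd h) * w ..< snd (snd h) * w + w}"
      using mod_less_divisor[OF w0, of x] unfolding e atLeastLessThan_iff by linarith
    qed
    from card_mono[OF finite_atLeastLessThan this]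
    have "card {rho \<in> R. rho div w = snd (snd h)} <= w" by simp
    hence "real (card {rho \<in> R. rho div w = snd (snd h)}) <= real w" by (simp only: of_nat_le_iff)
    hence "real (card {rho \<in> R. rho div w = snd (snd h)}) <= pw (k - fst h)"
     unfolding w_def by simp
    thus "(\<Sum>rho\<in>{rho \<in> R. rho div n ^ (k - fst h) = snd (snd h)}. ho h) <= pw (k - fst h) * ho h"
     using o0[OF h] unfolding w_def by (simp add: mult_right_mono)
   qed
   finally show ?thesis .
  qed
  define ci where "ci = (%(l, hi, hj). cr l hi hj)"
  have injc: "inj_on ci U"
  proof (rule inj_onI)
   fix x y assume xy: "x \<in> U" "y \<in> U" "ci x = ci y"
   obtain l hi hj where x: "x = (l, hi, hj)" "hl l hi hj" using xy(1) unfolding U_def by blast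
   obtain l' hi' hj' where y: "y = (l', hi', hj')" "hl l' hi' hj'" using xy(2) unfolding U_def by blast
   have "(l, hi, hj) \<in> ixs" "(l', hi', hj') \<in> ixs" using x y unfolding ixs_def by auto
   thus "x = y" using xy(3) circ_eq_iff unfolding x y ci_def by simp
  qed
  have ciT: "ci ` U \<subseteq> T"
  proof
   fix E assume "E \<in> ci ` U"
   then obtain l hi hj where h: "(l, hi, hj) \<in> U" "E = cr l hi hj" unfolding ci_def by auto
   have h': "m <= l" "l <= k" "hl l hi hj" "a * n ^ e <= hi * n ^ (k - l)" "(hi + 1) * n ^ (k - l) <= b * n ^ e"
    "r * n ^ e <= hj * n ^ (k - l)" "(hj + 1) * n ^ (k - l) <= (r + 1) * n ^ e"
    using h(1) unfolding U_def by auto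
   define d where "d = k - l"
   have kl: "pw k = pw l * pw d" unfolding d_def using h'(2) by (simp flip: power_add)
   have km: "pw k = pw m * pw e" unfolding k_def by (simp add: power_add)
   have sc: "real x / pw m = real (x * n ^ e) / pw k" "real x / pw l = real (x * n ^ d) / pw k" for x
    using npow_pos[of e] npow_pos[of d] by (simp add: km) (simp add: kl)
   have cv: "real x / pw m <= real z / pw l \<longleftrightarrow> x * n ^ e <= z * n ^ d" "real z / pw l <= real x / pw m \<longleftrightarrow> z * n ^ d <= x * n ^ e" for x z
    unfolding sc using npow_pos[of k] by (simp_all only: divide_le_cancel of_nat_le_iff) simp_all
   have b: "real a / pw m <= real hi / pw l" "(real hi + 1) / pw l <= real b / pw m"
    "real r / pw m <= real hj / pw l" "(real hj + 1) / pw l <= (real r + 1) / pw m"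
    using cv(1)[of a hi] cv(2)[of "hi + 1" b] cv(1)[of r hj] cv(2)[of "hj + 1" "r + 1"] h' unfolding d_def[symmetric] by (auto simp: add.commute)
   have "E \<subseteq> gs l hi hj" unfolding h(2) circ_def by blast
   also have "... \<subseteq> {real hi / pw l .. (real hi + 1) / pw l} \<times> {real hj / pw l .. (real hj + 1) / pw l}"
    unfolding gsq_def using npow_pos[of l] by (auto simp: field_simps)
   also have "... \<subseteq> {real a / pw m .. real b / pw m} \<times> {real r / pw m .. (real r + 1) / pw m}"
    using b by (intro Sigma_mono) auto
   finally show "E \<in> T" unfolding T_def holes_iff using h(2) h'(3) by blast
  qed
  have "(\<Sum>h\<in>U. pw (k - fst h) * ho h) = (\<Sum>h\<in>U. pw k * (osc fst (ci h) * osc g (ci h)))"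
  proof (rule sum.cong[OF refl])
   fix h assume "h \<in> U"
   then obtain l hi hj where h: "h = (l, hi, hj)" "l <= k" unfolding U_def by blast
   have "pw (k - l) = pw k * (1 / pw l)"
    using h(2) npow_pos[of l] by (simp add: power_diff)
   thus "pw (k - fst h) * ho h = pw k * (osc fst (ci h) * osc g (ci h))"
    unfolding h ho_def ci_def by (simp add: osc_circ)
  qed
  also have "... = pw k * (\<Sum>E\<in>ci ` U. osc fst E * osc g E)"
   by (simp add: sum.reindex[OF injc] sum_distrib_left)
  also have "(\<Sum>E\<in>ci ` U. osc fst E * osc g E) <= infsum (%E. osc fst E * osc g E) T"
   by (rule finite_sum_le_infsum[OF smT _ ciT]) (use fU nn in auto)
  finally have G: "(\<Sum>h\<in>U. pw (k - fst h) * ho h) <= pw k * infsum (%E. osc fst E * osc g E) T"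
   using npow_pos[of k] by simp
  have "pw e * t <= pw k * (infsum (%E. osc fst E * osc g E) T + sqrt dl)"
   using A B D G by (simp add: algebra_simps)
  hence "t * pw e <= (pw m * (infsum (%E. osc fst E * osc g E) T + sqrt dl)) * pw e"
   unfolding k_def power_add by (simp add: algebra_simps)
  hence "t <= pw m * (infsum (%E. osc fst E * osc g E) T + sqrt dl)" using npow_pos[of e] by simp
  thus ?thesis using npow_pos[of m] by (simp add: field_simps)
 qed
 show ?thesis
 proof (rule field_le_epsilon)
  fix eps :: real assume "0 < eps"
  thus "t / pw m <= infsum (%E. osc fst E * osc g E) T + eps" using key[of "eps^2"] by simp
 qed
qed

end

section \<open>The first variation on strips\<close>

lemma sqrt_ns_nonneg: "0 <= sqrt (ns A f)"
 by (simp add: ns_nonneg)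

text \<open>The competitor pushes \<open>v\<close> up towards the level \<open>la\<close> where the
  cutoff \<open>tht\<close> is positive: w = v + phi lies between v and max v la. On a circle this
  saves \<open>a E\<close> times the oscillation below the level; a cost \<open>la * osc tht\<close>
  arises only on circles that stay below the level. The condition on C and D keeps their boundary
  values unchanged.\<close>

lemma variation_estimate:
 fixes u :: "nat => 'a::metric_space => real"
 assumes ml: "mlim X C D u rho" and CD: "C \<subseteq> X" "D \<subseteq> X" and s: "s = 1 | s = -1" and la: "0 < la"
  and th: "tame X tht" "l2 (circles X) (osc tht)" "!!x. x \<in> X ==> 0 <= tht x" "!!x. x \<in> X ==> tht x <= 1"
  and vdef: "v = (%x. s * (u k x - c0))"
  and vpos: "!!x. x \<in> X ==> tht x ~= 0 ==> 0 <= v x"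
  and bd: "!!x. x \<in> C \<union> D ==> tht x = 0 | la <= v x"
  and a: "!!E. E \<in> circles X ==> 0 <= a E" "!!E x. E \<in> circles X ==> x \<in> E ==> a E <= tht x"
   "!!E. E \<in> circles X ==> a E <= 1"
 shows "infsum (%E. rho E * (a E * osc (%x. min la (v x)) E - (if \<forall>x\<in>E. v x < la then la * osc tht E else 0))) (circles X)
   <= sqrt (cap X C D) * sqrt (ns (circles X) (%E. osc (u k) E - rho E))"
proof -
 note u = minseqD(1)[OF mlimD(1)[OF ml], of k]
 define phi where "phi = (%x. tht x * max 0 (la - v x))"
 define g where "g = (%x. u k x + s * phi x)"
 have tv: "tame X v" unfolding vdef using tame_affine[OF admD(1)[OF u], of "- s * c0" s] by (simp add: algebra_simps)
 have vv: "\<bar>v x - v y\<bar> = \<bar>u k x - u k y\<bar>" for x y unfolding vdef using s by (auto simp: abs_minus_commute)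
 have osv: "osc v E = osc (u k) E" if E: "E \<in> circles X" for E
  by (intro antisym osc_lip1 tame_bounded_sub[OF admD(1)[OF u] circles_sub[OF E]] tame_bounded_sub[OF tv circles_sub[OF E]]) (simp_all add: vv)
 have tphi: "tame X phi" unfolding phi_def
  using tame_mult[OF th(1) tame_max[OF tame_affine[OF tv, of la "-1"], of 0]] by simp
 have tg: "tame X g" unfolding g_def using tame_add[OF admD(1)[OF u] tame_affine[OF tphi, of 0 s]] by simp
 define w where "w = (%x. v x + phi x)"
 have tw: "tame X w" unfolding w_def by (rule tame_add[OF tv tphi])
 have gw: "\<bar>g x - g y\<bar> = \<bar>w x - w y\<bar>" for x y unfolding g_def w_def vdef using s by (auto simp: algebra_simps)
 have osg: "osc g E = osc w E" if E: "E \<in> circles X" for E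
  by (intro antisym osc_lip1 tame_bounded_sub[OF tg circles_sub[OF E]] tame_bounded_sub[OF tw circles_sub[OF E]]) (simp_all add: gw)
 have p1: "phi x - phi y <= la * \<bar>tht x - tht y\<bar> + \<bar>v x - v y\<bar>" if "x \<in> X" "y \<in> X" for x y
 proof (cases "tht x = 0")
  case True
  have "0 <= tht y * max 0 (la - v y)" "0 <= la * \<bar>tht x - tht y\<bar>" using th(3)[OF that(2)] la by simp_all
  thus ?thesis using True unfolding phi_def by simp
 next
  case False
  have x: "0 <= v x" using vpos that False by blast
  have m: "0 <= max 0 (la - v x)" "max 0 (la - v x) <= la" using x la by auto
  have "phi x - phi y = (tht x - tht y) * max 0 (la - v x) + tht y * (max 0 (la - v x) - max 0 (la - v y))"
   unfolding phi_def by (simp add: algebra_simps)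
  also have "... <= \<bar>tht x - tht y\<bar> * la + 1 * \<bar>v x - v y\<bar>"
  proof (rule add_mono)
   have "(tht x - tht y) * max 0 (la - v x) <= \<bar>tht x - tht y\<bar> * max 0 (la - v x)" using m by (intro mult_right_mono) auto
   also have "... <= \<bar>tht x - tht y\<bar> * la" using m by (intro mult_left_mono) auto
   finally show "(tht x - tht y) * max 0 (la - v x) <= \<bar>tht x - tht y\<bar> * la" .
   have "tht y * (max 0 (la - v x) - max 0 (la - v y)) <= tht y * \<bar>v x - v y\<bar>"
    using th(3)[OF that(2)] by (intro mult_left_mono) auto
   also have "... <= 1 * \<bar>v x - v y\<bar>" using th(4)[OF that(2)] by (intro mult_right_mono) auto
   finally show "tht y * (max 0 (la - v x) - max 0 (la - v y)) <= 1 * \<bar>v x - v y\<bar>" .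
  qed
  finally show ?thesis by (simp add: mult.commute)
 qed
 have p2: "\<bar>w x - w y\<bar> <= (2 + la) * (\<bar>tht x - tht y\<bar> + \<bar>v x - v y\<bar>)" if "x \<in> X" "y \<in> X" for x y
 proof -
  have gen: "\<bar>(a + b) - (c + d)\<bar> <= A + 2 * \<bar>a - c\<bar>" if "b - d <= A + \<bar>a - c\<bar>" "d - b <= A + \<bar>a - c\<bar>" for a b c d A :: real
  using abs_le_iff abs_triangle_ineq[of "a - c" "b - d"] that by argo
  have "\<bar>w x - w y\<bar> <= la * \<bar>tht x - tht y\<bar> + 2 * \<bar>v x - v y\<bar>"
   unfolding w_def by (rule gen) (use p1[OF that] p1[OF that(2,1)] in "simp_all add: abs_minus_commute")
  also have "... <= (2 + la) * \<bar>tht x - tht y\<bar> + (2 + la) * \<bar>v x - v y\<bar>"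
   using la by (intro add_mono mult_right_mono) auto
  finally show ?thesis by (simp add: distrib_left)
 qed
 have b: "bounded (v ` E)" "bounded (tht ` E)" "bounded (w ` E)" "bounded ((%x. min la (v x)) ` E)" if "E \<in> circles X" for E
  using tame_bounded_sub[OF tv] tame_bounded_sub[OF th(1)] tame_bounded_sub[OF tw] tame_bounded_sub[OF tame_min[OF tv, of la]] circles_sub[OF that]
  by blast+
 have nn: "0 <= osc v E" "0 <= osc tht E" "0 <= osc w E" "0 <= osc (%x. min la (v x)) E" if "E \<in> circles X" for E
  using b[OF that] osc_nonneg by blast+
 have lu: "l2 (circles X) (osc (u k))" by (rule admD(2)[OF u])
 have lg: "l2 (circles X) (osc g)"
 proof (rule l2_mono[OF l2_cmult[OF l2_add[OF th(2) lu], of "2 + la"]])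
  fix E assume E: "E \<in> circles X"
  have "osc w E <= (2 + la) * (osc tht E + osc v E)"
   using osc_le_comb[OF b(2)[OF E] b(1)[OF E], of "2 + la" w] p2 circles_sub[OF E] la by (meson add_nonneg_nonneg less_imp_le subsetD zero_le_numeral)
  thus "\<bar>osc g E\<bar> <= \<bar>(2 + la) * (osc tht E + osc (u k) E)\<bar>"
   using nn(3)[OF E] unfolding osg[OF E] osv[OF E] by linarith
 qed
 have ag: "adm X C D g"
 proof -
  have "phi x = 0" if "x \<in> C \<union> D" for x using bd[OF that] unfolding phi_def by auto
  thus ?thesis unfolding adm_def using tg lg admD[OF u] unfolding g_def by auto
 qed
 have pt: "a E * osc (%x. min la (v x)) E - (if \<forall>x\<in>E. v x < la then la * osc tht E else 0) <= osc (u k) E - osc g E"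
  if E: "E \<in> circles X" for E
 proof (cases "\<forall>x\<in>E. v x < la")
  case True
  have eq: "osc (%x. min la (v x)) E = osc v E" by (rule osc_cong) (use True in auto)
  have "osc w E <= (1 - a E) * osc v E + la * osc tht E"
  proof (rule osc_le)
   show "0 <= (1 - a E) * osc v E + la * osc tht E" using nn[OF E] a(3)[OF E] la by simp
   fix x y assume xy: "x \<in> E" "y \<in> E"
   hence X: "x \<in> X" "y \<in> X" using circles_sub[OF E] by auto
   have "w x - w y = (1 - tht y) * (v x - v y) + (tht x - tht y) * (la - v x)"
    using True xy unfolding w_def phi_def by (simp add: max_absorb2 less_imp_le algebra_simps)
   also have "... <= (1 - a E) * osc v E + la * osc tht E"
   proof (rule add_mono)
    have "(1 - tht y) * (v x - v y) <= (1 - tht y) * osc v E"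
     using osc_bound[OF b(1)[OF E] xy] th(4)[OF X(2)] by (intro mult_left_mono) auto
    also have "... <= (1 - a E) * osc v E"
     using a(2)[OF E xy(2)] nn(1)[OF E] by (intro mult_right_mono) auto
    finally show "(1 - tht y) * (v x - v y) <= (1 - a E) * osc v E" .
    show "(tht x - tht y) * (la - v x) <= la * osc tht E"
    proof (cases "tht x = 0")
     case T: True
     have "(tht x - tht y) * (la - v x) <= 0"
      using T th(3)[OF X(2)] True xy(1) by (intro mult_nonpos_nonneg) (auto simp: less_imp_le)
     thus ?thesis using la nn(2)[OF E] by (smt (verit) mult_nonneg_nonneg)
    next
     case False
     hence "0 <= v x" using vpos X by blast
     moreover have "v x < la" using True xy by blast
     ultimately have "(tht x - tht y) * (la - v x) <= osc tht E * (la - v x)"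
      using osc_bound[OF b(2)[OF E] xy] by (intro mult_right_mono) auto
     also have "... <= osc tht E * la" using \<open>0 <= v x\<close> nn(2)[OF E] by (intro mult_left_mono) auto
     finally show ?thesis by (simp add: mult.commute)
    qed
   qed
   finally show "w x - w y <= (1 - a E) * osc v E + la * osc tht E" .
  qed
  thus ?thesis using True unfolding eq osg[OF E] osv[OF E, symmetric] by (simp add: algebra_simps)
 next
  \<comment> \<open>The circle reaches the level, so its top is not raised: w is at most max la v,
    while low points rise by at least \<open>a E\<close> times their deficit. Hence no term with
    \<open>osc tht\<close>.\<close>
  case False
  then obtain z where z: "z \<in> E" "la <= v z" by (auto simp: not_less)
  define e where "e = osc (%x. min la (v x)) E"
  have e: "la - v y <= e" if "y \<in> E" for y
   using osc_bound[OF b(4)[OF E] z(1) that] z(2) unfolding e_def by auto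
  have e0: "e <= osc v E"
   unfolding e_def by (rule osc_lip1[OF b(1)[OF E]]) auto
  have "e <= osc v E" by (rule e0)
  have a01: "0 <= a E" "a E <= 1" using a E by auto
  have "osc w E <= osc v E - a E * e"
  proof (rule osc_le)
   have "a E * e <= 1 * e" using a01 nn(4)[OF E] unfolding e_def by (intro mult_right_mono) auto
   thus "0 <= osc v E - a E * e" using e0 by simp
   fix x y assume xy: "x \<in> E" "y \<in> E"
   hence X: "x \<in> X" "y \<in> X" using circles_sub[OF E] by auto
   have wx: "w x <= max la (v x)"
   proof -
    have "tht x * max 0 (la - v x) <= 1 * max 0 (la - v x)" using th(4)[OF X(1)] by (intro mult_right_mono) auto
    thus ?thesis unfolding w_def phi_def by auto
   qed
   have wy: "v y + a E * max 0 (la - v y) <= w y"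
    unfolding w_def phi_def using a(2)[OF E xy(2)] by (intro add_left_mono mult_right_mono) auto
   show "w x - w y <= osc v E - a E * e"
   proof -
    define M where "M = max (v z) (v x)"
    have M: "w x <= M" "la <= M" "M - v y <= osc v E"
     using wx z(2) osc_bound[OF b(1)[OF E] z(1) xy(2)] osc_bound[OF b(1)[OF E] xy] unfolding M_def by auto
    have eM: "e <= max 0 (la - (M - osc v E))"
     unfolding e_def
    proof (rule osc_le)
     fix q q' assume q: "q \<in> E" "q' \<in> E"
     have "M - osc v E <= v q'"
      using osc_bound[OF b(1)[OF E] z(1) q(2)] osc_bound[OF b(1)[OF E] xy(1) q(2)] unfolding M_def by auto
     thus "min la (v q) - min la (v q') <= max 0 (la - (M - osc v E))" by (auto simp: min_def max_def)
    qed simp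
    show ?thesis
    proof (cases "v y <= la")
     case True
     have "v y + a E * (la - v y) <= w y" using wy True by (simp add: max_absorb2)
     moreover have "(M - osc v E) + a E * (la - (M - osc v E)) <= v y + a E * (la - v y)"
     proof -
      have "0 <= (1 - a E) * (v y - (M - osc v E))" using a01 M(3) by simp
      thus ?thesis by (simp add: algebra_simps)
     qed
     moreover have "a E * e <= a E * (la - (M - osc v E))" using eM a01 M(3) True by (intro mult_left_mono) auto
     ultimately show ?thesis using M(1) by linarith
    next
     case False
     have "a E * e <= 1 * e" using a01 nn(4)[OF E] unfolding e_def by (intro mult_right_mono) auto
     moreover have "v y <= w y" using wy a01 False by simp
     moreover have "e <= osc v E - (M - v y)" using eM M(3) False by auto
     ultimately show ?thesis using M(1) by linarith
    qed
   qed
  qed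
  thus ?thesis unfolding if_not_P[OF False] e_def osg[OF E] osv[OF E, symmetric] by simp
 qed
 have lr: "l2 (circles X) rho" and r0: "!!E. E \<in> circles X ==> 0 <= rho E" using mlimD[OF ml] by auto
 have le: "l2 (circles X) (osc (%x. min la (v x)))"
 proof (rule l2_mono[OF lu])
  fix E assume E: "E \<in> circles X"
  show "\<bar>osc (%x. min la (v x)) E\<bar> <= \<bar>osc (u k) E\<bar>"
   using osc_lip1[OF b(1)[OF E], of "%x. min la (v x)"] nn[OF E] osv[OF E] by auto
 qed
 have lh: "l2 (circles X) (%E. a E * osc (%x. min la (v x)) E - (if \<forall>x\<in>E. v x < la then la * osc tht E else 0))"
 proof (rule l2_diff)
  show "l2 (circles X) (%E. a E * osc (%x. min la (v x)) E)"
  proof (rule l2_mono[OF le])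
   fix E assume E: "E \<in> circles X"
   show "\<bar>a E * osc (%x. min la (v x)) E\<bar> <= \<bar>osc (%x. min la (v x)) E\<bar>"
    using a(1,3)[OF E] by (simp add: abs_mult mult_left_le_one_le)
  qed
  show "l2 (circles X) (%E. if \<forall>x\<in>E. v x < la then la * osc tht E else 0)"
   by (rule l2_mono[OF l2_cmult[OF th(2), of la]]) auto
 qed
 have "infsum (%E. rho E * (a E * osc (%x. min la (v x)) E - (if \<forall>x\<in>E. v x < la then la * osc tht E else 0))) (circles X)
   <= infsum (%E. rho E * (osc (u k) E - osc g E)) (circles X)"
  by (intro infsum_mono l2_mult lr lh l2_diff lu lg mult_left_mono pt r0)
 also have "... <= sqrt (cap X C D) * sqrt (ns (circles X) (%E. osc (u k) E - rho E))"
  by (rule variation_bound[OF ml ag])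
 finally show ?thesis .
qed

context carpet_params begin

abbreviation dev where "dev u rho k \<equiv> sqrt (ns (circles F) (%E. osc (u k) E - rho E))"

text \<open>Square sum of the sides of the circles with small positive \<open>rho\<close>. Leaving
  out the circles with \<open>rho E = 0\<close> is what makes it vanish as \<open>la\<close> tends
  to 0.\<close>

definition low :: "(pt set => real) => real => real" where
 "low rho la = ns (circles F) (%E. if 0 < rho E & rho E <= 2 * la then osc fst E else 0)"

text \<open>A finite set of circles carries all but eps of the total square sum; once 2 * la is
  below the least positive \<open>rho\<close> on it, none of its members counts.\<close>

lemma low_small:
 assumes "0 < eps"
 shows "\<exists>l0>0. \<forall>la. 0 < la & la <= l0 --> low rho la <= eps"
proof -
 let ?f = "%E. (osc fst E)^2"
 have sm: "?f summable_on circles F" using l2_side unfolding l2_def .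
 have "(?f has_sum infsum ?f (circles F)) (circles F)" using sm by (rule has_sum_infsum)
 hence ev: "eventually (%S. dist (sum ?f S) (infsum ?f (circles F)) < eps) (finite_subsets_at_top (circles F))"
  unfolding has_sum_def using assms tendstoD by blast
 obtain S where S: "finite S" "S \<subseteq> circles F" "dist (sum ?f S) (infsum ?f (circles F)) < eps"
  using ev unfolding eventually_finite_subsets_at_top by (metis order_refl)
 define P where "P = insert 1 (rho ` {E \<in> S. 0 < rho E})"
 define l0 where "l0 = Min P / 4"
 have P: "finite P" "P ~= {}" "\<forall>x\<in>P. 0 < x" unfolding P_def using S by auto
 have mp: "0 < Min P" using P by (meson Min_in)
 have "low rho la <= eps" if la: "0 < la" "la <= l0" for la
 proof -
  have z: "~ (0 < rho E & rho E <= 2 * la)" if "E \<in> S" for E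
  using P la mp that by (fastforce simp: P_def l0_def)
  have "low rho la <= infsum ?f (circles F - S)"
   unfolding low_def ns_def
  proof (rule infsum_mono_neutral)
   show "(%E. (if 0 < rho E & rho E <= 2 * la then osc fst E else 0)^2) summable_on circles F"
    by (rule summable_on_real_dom[OF sm]) auto
   show "?f summable_on circles F - S" by (rule summable_on_subset_banach[OF sm]) auto
  qed (use z in auto)
  also have "... = infsum ?f (circles F) - sum ?f S"
   using infsum_Diff[OF sm _ S(2)] S(1) by simp
  also have "... <= eps" using S(3) unfolding dist_real_def by linarith
  finally show ?thesis .
 qed
 thus ?thesis using mp by (intro exI[of _ l0]) (auto simp: l0_def)
qed

text \<open>The shift and the sign bring the value under study to 0 and the region under study to
  nonnegative \<open>v\<close>, so that one argument serves both ends; oscillations are those of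
  \<open>u\<close>.\<close>

definition pot :: "pt set => pt set => (nat => pt => real) =>
  (pt set => real) => (nat => pt => real) => bool" where
 "pot C D u rho v \<longleftrightarrow> mlim F C D u rho & C \<in> circles F & D \<in> circles F &
   (\<exists>s c0. (s = 1 | s = -1) & v = (%k x. s * (u k x - c0)))"

lemma circle_ne: "E \<in> circles F ==> \<exists>x. x \<in> E"
 using circles_ix corner_in_circ by metis

lemma pot_osc:
 assumes "pot C D u rho v" "E \<in> circles F"
 shows "osc (v k) E = osc (u k) E" "tame F (v k)"
proof -
 obtain s c0 where s: "s = 1 | s = -1" "v = (%k x. s * (u k x - c0))" and ml: "mlim F C D u rho"
  using assms(1) unfolding pot_def by blast
 note u = minseqD(1)[OF mlimD(1)[OF ml], of k]
 show tv: "tame F (v k)" unfolding s(2) using tame_affine[OF admD(1)[OF u], of "- s * c0" s] by (simp add: algebra_simps)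
 have vv: "\<bar>v k x - v k y\<bar> = \<bar>u k x - u k y\<bar>" for x y unfolding s(2) using s(1) by (auto simp: abs_minus_commute)
 show "osc (v k) E = osc (u k) E"
  by (intro antisym osc_lip1 tame_bounded_sub[OF admD(1)[OF u] circles_sub[OF assms(2)]] tame_bounded_sub[OF tv circles_sub[OF assms(2)]]) (simp_all add: vv)
qed

text \<open>A plain cutoff would leave \<open>la\<close> times a sum of \<open>rho\<close> times the
  side, which is not known to be of order la^2. Squaring the cutoff gives the cost a factor
  \<open>b E\<close>, the minimum of \<open>psi\<close> on E, so that Young's inequality absorbs it
  in half of the gain (b E)^2 * e E. What is left is of order la^2 and involves only circles with
  small positive \<open>rho\<close>, hence is o(la^2).\<close>

lemma low_estimate:
 assumes P: "pot C D u rho v" and la: "0 < la"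
  and K: "0 <= K" and lip: "!!x y. x \<in> F ==> y \<in> F ==> \<bar>psi x - psi y\<bar> <= K * (\<bar>fst x - fst y\<bar> + \<bar>snd x - snd y\<bar>)"
  and c01: "!!x. 0 <= psi x" "!!x. psi x <= 1" and TT: "T \<subseteq> circles F" "!!E x. E \<in> T ==> x \<in> E ==> psi x = 1"
 shows "\<exists>M\<ge>0. \<forall>k. (\<forall>x\<in>F. psi x ~= 0 --> 0 <= v k x) --> (\<forall>x\<in>C \<union> D. psi x = 0 | la <= v k x) -->
   (\<forall>E\<in>circles F. (\<forall>x\<in>E. v k x < la) & 0 < rho E & (\<exists>x\<in>E. psi x ~= 0) --> (\<forall>x\<in>E. 0 <= v k x)) -->
   infsum (%E. rho E * osc (%x. min la (v k x)) E) T
    <= M * dev u rho k + 48 * la^2 * K^2 * low rho la"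
proof -
 obtain s c0 where s: "s = 1 | s = -1" "v = (%k x. s * (u k x - c0))" and ml: "mlim F C D u rho"
  and CD: "C \<in> circles F" "D \<in> circles F" using P unfolding pot_def by blast
 define tht where "tht = (%x. (psi x)^2)"
 have thlip: "\<bar>tht x - tht y\<bar> <= (2 * K) * (\<bar>fst x - fst y\<bar> + \<bar>snd x - snd y\<bar>)" if "x \<in> F" "y \<in> F" for x y
 proof -
  have "\<bar>tht x - tht y\<bar> = \<bar>psi x - psi y\<bar> * \<bar>psi x + psi y\<bar>"
   unfolding tht_def by (simp add: power2_eq_square square_diff_square_factored abs_mult)
  also have "... <= (K * (\<bar>fst x - fst y\<bar> + \<bar>snd x - snd y\<bar>)) * 2"
   using lip[OF that] c01[of x] c01[of y] K by (intro mult_mono) auto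
  finally show ?thesis by simp
 qed
 have K2: "0 <= 2 * K" using K by simp
 note T = lipschitz_tame[OF K2 thlip] and Cc = lipschitz_tame[OF K lip]
 define b where "b = (%E. Inf (psi ` E))"
 define sd where "sd = (osc fst :: pt set => real)"
 have ne: "E ~= {}" if "E \<in> circles F" for E using circle_ne[OF that] by blast
 have b: "0 <= b E" "b E <= 1" "!!x. x \<in> E ==> b E <= psi x" if E: "E \<in> circles F" for E
 proof -
  show l: "b E <= psi x" if "x \<in> E" for x
   unfolding b_def by (rule cINF_lower[OF bdd_belowI2[of _ 0] that]) (rule c01)
  show "0 <= b E" unfolding b_def by (rule cINF_greatest[OF ne[OF E]]) (rule c01)
  obtain x where "x \<in> E" using ne[OF E] by blast
  thus "b E <= 1" using l[of x] c01(2)[of x] by simp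
 qed
 have sd0: "0 <= sd E" if "E \<in> circles F" for E unfolding sd_def using osc_fst_nonneg[OF that] .
 have ot: "osc tht E <= 4 * b E * K * sd E + 8 * K^2 * (sd E)^2" if E: "E \<in> circles F" for E
 proof -
  define d where "d = 2 * K * sd E"
  have d: "osc psi E <= d" unfolding d_def sd_def using Cc(2)[OF _ _ E] by blast
  have bc: "bounded (psi ` E)" by (rule tame_bounded_sub[OF Cc(1) circles_sub[OF E]])
  have up: "psi x <= b E + d" if "x \<in> E" for x
  proof -
   have "psi x - d <= b E" unfolding b_def
    by (rule cINF_greatest[OF ne[OF E]]) (use osc_bound[OF bc that] d in fastforce)
   thus ?thesis by simp
  qed
  have d0: "0 <= d" unfolding d_def using K sd0[OF E] by simp
  have "osc tht E <= d * (2 * b E + 2 * d)"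
  proof (rule osc_le)
   show "0 <= d * (2 * b E + 2 * d)" using d0 b(1)[OF E] by simp
   fix x y assume xy: "x \<in> E" "y \<in> E"
   have "tht x - tht y = (psi x - psi y) * (psi x + psi y)" unfolding tht_def by (simp add: power2_eq_square algebra_simps)
   also have "... <= d * (2 * b E + 2 * d)"
   using c01[of x] c01[of y] mult_nonpos_nonneg d b E osc_bound[OF bc xy] up[OF xy(1)] up[OF xy(2)] d0 mult_mono by (smt (verit))
   finally show "tht x - tht y <= d * (2 * b E + 2 * d)" .
  qed
  thus ?thesis unfolding d_def by (simp add: power2_eq_square algebra_simps)
 qed
 have lr: "l2 (circles F) rho" and r0: "!!E. E \<in> circles F ==> 0 <= rho E" using mlimD[OF ml] by auto
 have lt: "l2 (circles F) (osc tht)" using T(3) .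
 define M where "M = 3 * sqrt (cap F C D) + 4 * la * sqrt (ns (circles F) (osc tht))"
 have cap0: "0 <= cap F C D" using cap_nonneg[OF minseqD(1)[OF mlimD(1)[OF ml]]] .
 have M0: "0 <= M" unfolding M_def using cap0 la ns_nonneg[of "circles F" "osc tht"] by simp
 have main: "infsum (%E. rho E * osc (%x. min la (v k x)) E) T
    <= M * dev u rho k + 48 * la^2 * K^2 * low rho la"
  if vpos: "\<forall>x\<in>F. psi x ~= 0 --> 0 <= v k x" and bd: "\<forall>x\<in>C \<union> D. psi x = 0 | la <= v k x"
   and vE: "\<forall>E\<in>circles F. (\<forall>x\<in>E. v k x < la) & 0 < rho E & (\<exists>x\<in>E. psi x ~= 0) --> (\<forall>x\<in>E. 0 <= v k x)" for k
 proof -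
  define w where "w = v k"
  have w: "w = (%x. s * (u k x - c0))" unfolding w_def s(2) ..
  note u = minseqD(1)[OF mlimD(1)[OF ml], of k]
  define ou where "ou = osc (u k)"
  define e where "e = osc (%x. min la (w x))"
  define V where "V = (%E. \<forall>x\<in>E. w x < la)"
  define lw where "lw = (%E. if 0 < rho E & rho E <= 2 * la then sd E else 0)"
  have lou: "l2 (circles F) ou" unfolding ou_def by (rule admD(2)[OF u])
  have tv: "tame F w" unfolding w_def by (rule pot_osc(2)[OF P CD(1)])
  have osv: "osc w E = ou E" if "E \<in> circles F" for E unfolding ou_def w_def by (rule pot_osc(1)[OF P that])
  have e_le: "0 <= e E" "e E <= ou E" if E: "E \<in> circles F" for E
  proof -
   show "0 <= e E" unfolding e_def by (rule osc_nonneg[OF tame_bounded_sub[OF tame_min[OF tv] circles_sub[OF E]]])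
   show "e E <= ou E" unfolding e_def osv[OF E, symmetric]
    by (rule osc_lip1[OF tame_bounded_sub[OF tv circles_sub[OF E]]]) auto
  qed
  have le: "l2 (circles F) e" by (rule l2_mono[OF lou]) (use e_le in fastforce)
  have vest: "infsum (%E. rho E * ((b E)^2 * e E - (if V E then la * osc tht E else 0))) (circles F)
   <= sqrt (cap F C D) * sqrt (ns (circles F) (%E. ou E - rho E))"
   unfolding e_def V_def ou_def
  proof (rule variation_estimate[OF ml circles_sub[OF CD(1)] circles_sub[OF CD(2)] s(1) la T(1) lt _ _ w])
   fix E x assume "E \<in> circles F" "x \<in> E"
   thus "(b E)^2 <= tht x" unfolding tht_def using b[of E] by (intro power_mono) auto
  next
   fix E assume "E \<in> circles F"
   thus "(b E)^2 <= 1" using b[of E] by (simp add: power_le_one)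
  qed (use vpos bd c01 in "auto simp: tht_def w_def power_le_one")
  \<comment> \<open>If rho E <= 2 * la, Young's inequality leaves 8 from the mixed term and 16 from
    the squared side, that is 24, doubled to 48 when half of x1 is absorbed. If rho E > 2 * la, then
    ou E <= la forces rho E <= 2 * \<bar>ou E - rho E\<bar>, an error term.\<close>
  have pw: "rho E * (if V E then la * osc tht E else 0) <= 1/2 * (rho E * ((b E)^2 * e E))
    + (1/2 * (rho E * \<bar>ou E - rho E\<bar>) + 24 * la^2 * K^2 * (lw E)^2 + 2 * la * (\<bar>ou E - rho E\<bar> * osc tht E))" if E: "E \<in> circles F" for E
  proof -
   have tt: "0 <= osc tht E" by (rule osc_circle_nonneg[OF T(1) E])
   have n0: "0 <= rho E * ((b E)^2 * e E)" "0 <= rho E * \<bar>ou E - rho E\<bar>" "0 <= 24 * la^2 * K^2 * (lw E)^2" "0 <= 2 * la * (\<bar>ou E - rho E\<bar> * osc tht E)"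
    using r0[OF E] e_le[OF E] tt la by simp_all
   show ?thesis
   proof (cases "V E & 0 < rho E & (\<exists>x\<in>E. psi x ~= 0)")
    case False
    have "osc tht E = 0" if "\<forall>x\<in>E. psi x = 0" by (rule osc_const[of _ _ 0]) (use that in "simp add: tht_def")
    hence "rho E * (if V E then la * osc tht E else 0) = 0" using False r0[OF E] by (cases "V E") (auto simp: less_le)
    thus ?thesis using n0 by linarith
   next
    case True
    hence VE: "V E" "0 < rho E" by auto
    have ve: "0 <= w x & w x < la" if "x \<in> E" for x using vE E True that unfolding w_def V_def by blast
    have eu: "e E = ou E" unfolding osv[OF E, symmetric] e_def by (rule osc_cong) (use ve in fastforce)
    have ul: "ou E <= la" unfolding osv[OF E, symmetric]
    proof (rule osc_le)
     show "w x - w y <= la" if "x \<in> E" "y \<in> E" for x y using ve[OF that(1)] ve[OF that(2)] by linarith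
    qed (use la in simp)
    show ?thesis
    proof (cases "rho E <= 2 * la")
     case True
     have lw: "lw E = sd E" unfolding lw_def using True VE by simp
     define r bb S where "r = rho E" and "bb = b E" and "S = K * sd E"
     have pos: "0 <= r" "0 <= bb" "bb <= 1" "0 <= S" using VE b[OF E] K sd0[OF E] unfolding r_def bb_def S_def by auto
     have "r * (la * osc tht E) <= r * (la * (4 * bb * S + 8 * S^2))"
      using ot[OF E] pos la unfolding bb_def S_def by (intro mult_left_mono) (auto simp: power_mult_distrib algebra_simps)
     also have "... = 4 * la * r * bb * S + 8 * la * r * S^2" by (simp add: algebra_simps)
     also have "... <= (1/2 * r^2 * bb^2 + 8 * la^2 * S^2) + 16 * la^2 * S^2"
     proof (rule add_mono)
      have "0 <= 1/2 * (r * bb - 4 * la * S)^2" by simp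
      thus "4 * la * r * bb * S <= 1/2 * r^2 * bb^2 + 8 * la^2 * S^2" by (simp add: power2_eq_square algebra_simps)
      have "8 * la * r * S^2 <= 8 * la * (2 * la) * S^2"
       using True la unfolding r_def by (intro mult_right_mono mult_left_mono) auto
      thus "8 * la * r * S^2 <= 16 * la^2 * S^2" by (simp add: power2_eq_square)
     qed
     finally have st: "r * (la * osc tht E) <= (1/2 * r^2 * bb^2 + 8 * la^2 * S^2) + 16 * la^2 * S^2" .
     have "r^2 * bb^2 <= r * (bb^2 * e E) + r * \<bar>ou E - r\<bar>"
     proof -
      have "r * (bb^2 * (r - ou E)) <= r * (1 * \<bar>ou E - r\<bar>)"
      proof (rule mult_left_mono[OF _ pos(1)])
       have "bb^2 * (r - ou E) <= bb^2 * \<bar>ou E - r\<bar>" by (intro mult_left_mono) auto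
       also have "... <= 1 * \<bar>ou E - r\<bar>" using pos by (intro mult_right_mono) (auto simp: power_le_one)
       finally show "bb^2 * (r - ou E) <= 1 * \<bar>ou E - r\<bar>" .
      qed
      thus ?thesis unfolding eu by (simp add: power2_eq_square algebra_simps)
     qed
     with st have "r * (la * osc tht E) <= 1/2 * (r * (bb^2 * e E)) + (1/2 * (r * \<bar>ou E - r\<bar>) + 24 * la^2 * S^2)"
      by (simp add: algebra_simps)
     thus ?thesis using n0(4) VE(1) unfolding r_def bb_def S_def lw power_mult_distrib by (simp add: mult_ac)
    next
     case False
     hence "rho E <= 2 * \<bar>ou E - rho E\<bar>" using ul by (smt (verit))
     hence "rho E * (la * osc tht E) <= (2 * \<bar>ou E - rho E\<bar>) * (la * osc tht E)"
      using la tt by (intro mult_right_mono) auto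
     hence "rho E * (la * osc tht E) <= 2 * la * (\<bar>ou E - rho E\<bar> * osc tht E)" by (simp add: mult_ac)
     moreover have "rho E * (if V E then la * osc tht E else 0) = rho E * (la * osc tht E)" using VE(1) by simp
     ultimately show ?thesis using n0(1-3) by linarith
    qed
   qed
  qed
  have ld: "l2 (circles F) (%E. ou E - rho E)" by (rule l2_diff[OF lou lr])
  have ldb: "l2 (circles F) (%E. \<bar>ou E - rho E\<bar>)" by (rule l2_abs[OF ld])
  have lb: "l2 (circles F) (%E. (b E)^2 * e E)"
  proof (rule l2_mono[OF le])
   fix E assume E: "E \<in> circles F"
   show "\<bar>(b E)\<^sup>2 * e E\<bar> <= \<bar>e E\<bar>" using b[OF E] e_le[OF E] by (simp add: abs_mult power_le_one mult_left_le_one_le)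
  qed
  have llw: "l2 (circles F) lw" by (rule l2_mono[OF l2_side]) (auto simp: lw_def sd_def)
  have lV: "l2 (circles F) (%E. if V E then la * osc tht E else 0)" by (rule l2_mono[OF l2_cmult[OF lt, of la]]) auto
  define x1 where "x1 = infsum (%E. rho E * ((b E)^2 * e E)) (circles F)"
  define x2 where "x2 = infsum (%E. rho E * (if V E then la * osc tht E else 0)) (circles F)"
  define x3 where "x3 = infsum (%E. rho E * \<bar>ou E - rho E\<bar>) (circles F)"
  define x4 where "x4 = infsum (%E. (lw E)^2) (circles F)"
  define x5 where "x5 = infsum (%E. \<bar>ou E - rho E\<bar> * osc tht E) (circles F)"
  define N where "N = sqrt (ns (circles F) (%E. ou E - rho E))"
  note s1 = l2_mult[OF lr lb] and s2 = l2_mult[OF lr lV] and s3 = l2_mult[OF lr ldb] and s5 = l2_mult[OF ldb lt]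
  have s4: "(%E. (lw E)^2) summable_on circles F" using llw unfolding l2_def .
  have "x1 - x2 <= sqrt (cap F C D) * N"
   unfolding x1_def x2_def N_def infsum_diff[OF s1 s2, symmetric] using vest by (simp only: right_diff_distrib)
  moreover have "x2 <= 1/2 * x1 + (1/2 * x3 + 24 * la^2 * K^2 * x4 + 2 * la * x5)"
  proof -
   have "x2 <= infsum (%E. 1/2 * (rho E * ((b E)^2 * e E))
    + (1/2 * (rho E * \<bar>ou E - rho E\<bar>) + 24 * la^2 * K^2 * (lw E)^2 + 2 * la * (\<bar>ou E - rho E\<bar> * osc tht E))) (circles F)"
    unfolding x2_def by (intro infsum_mono s2 summable_on_add summable_on_cmult_right s1 s3 s4 s5 pw)
   also have "... = 1/2 * x1 + (1/2 * x3 + 24 * la^2 * K^2 * x4 + 2 * la * x5)"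
    unfolding x1_def x3_def x4_def x5_def
    by (simp only: infsum_add summable_on_add summable_on_cmult_right s1 s3 s4 s5 infsum_cmult_right')
   finally show ?thesis .
  qed
  moreover have "x3 <= sqrt (cap F C D) * N"
  using infsum_cong r0 l2_cs_abs[OF lr ld] mlim_ns[OF ml] x3_def N_def by (smt (verit))
  moreover have "x5 <= N * sqrt (ns (circles F) (osc tht))"
  using infsum_cong osc_circle_nonneg[OF T(1)] l2_cs_abs[OF ld lt] x5_def N_def by (smt (verit))
  moreover have "x4 = low rho la" unfolding x4_def low_def ns_def lw_def sd_def ..
  moreover have "2 * la * x5 <= 2 * la * (N * sqrt (ns (circles F) (osc tht)))"
   using \<open>x5 <= _\<close> la by (intro mult_left_mono) auto
  ultimately have "x1 <= M * N + 48 * la^2 * K^2 * low rho la"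
   unfolding M_def by (simp add: algebra_simps)
  moreover have "infsum (%E. rho E * e E) T <= x1"
  proof -
   have b1: "b E = 1" if E: "E \<in> T" for E
   proof -
    obtain x where "x \<in> E" using circle_ne E TT(1) by blast
    hence "psi ` E = {1}" using TT(2)[OF E] by (auto intro: rev_image_eqI)
    thus ?thesis unfolding b_def by simp
   qed
   have "infsum (%E. rho E * e E) T = infsum (%E. rho E * ((b E)^2 * e E)) T" by (rule infsum_cong) (simp add: b1)
   also have "... <= x1" unfolding x1_def
    by (rule infsum_mono_neutral[OF summable_on_subset_banach[OF s1 TT(1)] s1]) (use TT(1) r0 e_le in auto)
   finally show ?thesis .
  qed
  ultimately show ?thesis unfolding N_def e_def w_def ou_def by linarith
 qed
 show ?thesis by (rule exI[of _ M]) (use M0 main in auto)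
qed

end

section \<open>Cutoff functions\<close>

definition rmp :: "real => real => real => real => real" where
 "rmp A a b t = min (A * t - a + 1) (b + 1 - A * t)"

text \<open>Product-free trapezoid: 1 on the rectangle a <= A * x <= b, a' <= A' * y <= b', and 0
  from one scaled unit outside it.\<close>

definition bump :: "real => real => real => real => real => real => pt => real" where
 "bump A a b A' a' b' z = max 0 (min 1 (min (rmp A a b (fst z)) (rmp A' a' b' (snd z))))"

lemma bump_range: "0 <= bump A a b A' a' b' z" "bump A a b A' a' b' z <= 1"
 unfolding bump_def by auto

lemma bump_1: "a <= A * fst z ==> A * fst z <= b ==> a' <= A' * snd z ==> A' * snd z <= b' ==> bump A a b A' a' b' z = 1"
 unfolding bump_def rmp_def by auto

lemma bump_nz: "bump A a b A' a' b' z ~= 0 ==>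
  a - 1 < A * fst z & A * fst z < b + 1 & a' - 1 < A' * snd z & A' * snd z < b' + 1"
 unfolding bump_def rmp_def by (auto simp: max_def min_def split: if_splits)

lemma rmp_lip: "0 <= A ==> \<bar>rmp A a b s - rmp A a b t\<bar> <= A * \<bar>s - t\<bar>"
proof -
 assume A: "0 <= A"
 have "A * \<bar>s - t\<bar> = \<bar>A * s - A * t\<bar>" using A by (simp add: abs_mult right_diff_distrib[symmetric])
 thus ?thesis unfolding rmp_def by (auto simp: min_def abs_if split: if_splits)
qed

lemma bump_lip:
 assumes "0 <= A" "A <= K" "0 <= A'" "A' <= K"
 shows "\<bar>bump A a b A' a' b' z - bump A a b A' a' b' w\<bar> <= K * (\<bar>fst z - fst w\<bar> + \<bar>snd z - snd w\<bar>)"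
proof -
 define X X' Y Y' where "X = rmp A a b (fst z)" and "X' = rmp A a b (fst w)" and "Y = rmp A' a' b' (snd z)" and "Y' = rmp A' a' b' (snd w)"
 have x: "\<bar>X - X'\<bar> <= K * \<bar>fst z - fst w\<bar>"
  unfolding X_def X'_def by (rule order_trans[OF rmp_lip[OF assms(1)]]) (use assms in "simp add: mult_right_mono")
 have y: "\<bar>Y - Y'\<bar> <= K * \<bar>snd z - snd w\<bar>"
  unfolding Y_def Y'_def by (rule order_trans[OF rmp_lip[OF assms(3)]]) (use assms in "simp add: mult_right_mono")
 have "\<bar>max 0 (min 1 (min X Y)) - max 0 (min 1 (min X' Y'))\<bar> <= \<bar>X - X'\<bar> + \<bar>Y - Y'\<bar>"
  by (auto simp: min_def max_def abs_if split: if_splits)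
 thus ?thesis using x y unfolding bump_def X_def[symmetric] X'_def[symmetric] Y_def[symmetric] Y'_def[symmetric]
  by (simp add: distrib_left)
qed

section \<open>Live and dead circles\<close>

context carpet_params begin

text \<open>In the limit \<open>v\<close> is bounded away from 0 on live circles and vanishes on dead ones.\<close>

definition live :: "(nat => pt => real) => pt set => bool" where
 "live v E \<longleftrightarrow> (\<exists>la>0. \<forall>\<^sub>F k in sequentially. \<forall>x\<in>E. la <= v k x)"

text \<open>Only infinitely many k are required: this is what the negation of \<open>live\<close>
  yields when \<open>rho E = 0\<close>, and a single suitable k suffices for the
  contradictions.\<close>

definition dead :: "(pt set => real) => (nat => pt => real) => pt set => bool" where
 "dead rho v E \<longleftrightarrow> rho E = 0 & (\<forall>eps>0. \<exists>\<^sub>F k in sequentially. \<forall>x\<in>E. v k x <= eps)"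

text \<open>The open block of nine squares of level l centred at (l, i, j); it contains the support
  of the cutoff belonging to that hole.\<close>

definition blk :: "nat => nat => nat => pt set" where
 "blk l i j = {z. real i - 1 < pw l * fst z & pw l * fst z < real i + 2 &
          real j - 1 < pw l * snd z & pw l * snd z < real j + 2}"

lemma blk_parent:
 assumes h: "hl (Suc l) i j"
 shows "blk (Suc l) i j \<subseteq> gb l (i div n) (j div n)"
proof
 fix z assume z: "z \<in> blk (Suc l) i j"
 have one: "real (q div n) < t & t < real (q div n) + 1"
  if q: "hdig n p (q mod n)" "real q - 1 < real n * t" "real n * t < real q + 2" for q t
 proof -
  have "real q = real n * real (q div n) + real (q mod n)" by (metis mult_div_mod_eq of_nat_add of_nat_mult)
  moreover have "1 <= real (q mod n)" "real (q mod n) + 2 <= real n" using hdig_bounds[OF q(1)] by linarith+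
  ultimately have "real n * real (q div n) < real n * t" "real n * t < real n * (real (q div n) + 1)"
   using q(2,3) unfolding distrib_left by linarith+
  thus ?thesis by (simp only: mult_less_cancel_left_pos[OF nR(1)])
 qed
 have "hdig n p (i mod n)" "hdig n p (j mod n)" using h by auto
 thus "z \<in> gb l (i div n) (j div n)"
  using z one[of i "fst z * pw l"] one[of j "snd z * pw l"] unfolding blk_def gbx_def by (simp add: mult_ac)
qed

lemma blk_self: "cr l i j \<subseteq> blk l i j"
 unfolding circ_def gsq_def blk_def by (auto simp: mult.commute)

text \<open>Hole digits are not adjacent and holes keep off the boundary of their parent, so no
  other circle of level at most l reaches the block. A deeper circle lies inside one square of level
  l.\<close>

lemma blk_circles:
 assumes h: "hl l hi hj" and ix: "(l', i', j') \<in> ixs" and z: "z \<in> cr l' i' j'" "z \<in> blk l hi hj"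
 shows "cr l' i' j' \<subseteq> blk l hi hj & (l' <= l --> l' = l & i' = hi & j' = hj)"
proof -
 obtain q where l: "l = Suc q" using h by (cases l) auto
 have zg: "z \<in> gb q (hi div n) (hj div n)" using blk_parent h z(2) unfolding l by blast
 have zs: "z \<in> gs l' i' j'" "z \<notin> gb l' i' j'" using z(1) unfolding circ_def by auto
 consider (lt) m where "q = l' + m" | (eq) "l' = l" | (gt) m where "l' = l + Suc m"
  using level_cases[of q l'] l by (metis Suc_pred add_Suc_right add_cancel_right_right level_cases not_gr0 add_Suc_shift)
 thus ?thesis
 proof cases
  case lt
  have zg': "z \<in> gb (l' + m) (hi div n) (hj div n)" using zg lt by simp
  have i: "i' = (hi div n) div n ^ m" "j' = (hj div n) div n ^ m" using gbx_gsq_idx[OF zg' zs(1)] by auto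
  have "z \<in> gb l' i' j'" using gbx_nest[of l' m] zg' unfolding i by blast
  thus ?thesis using zs by blast
 next
  case eq
  have h': "hl (Suc q) i' j'" using ix eq l unfolding ixs_def by auto
  have zs': "z \<in> gs (q + 1) i' j'" using zs(1) eq l by simp
  have par: "i' div n = hi div n" "j' div n = hj div n" using gsq_gbx_idx[OF zs' zg] by auto
  have "i' <= hi + 1" "hi <= i' + 1" "j' <= hj + 1" "hj <= j' + 1"
   using zs(1) z(2) unfolding eq gsq_def blk_def by (auto simp: mult.commute)
  hence "i' = hi" "j' = hj" using idx_close[of i' hi] idx_close[of j' hj] par h h' unfolding l by auto
  thus ?thesis using blk_self eq by auto
 next
  case gt
  have h': "hl (l + Suc m) i' j'" using ix gt unfolding ixs_def by auto
  define c d where "c = i' div n ^ Suc m" and "d = j' div n ^ Suc m"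
  have sub: "gs l' i' j' \<subseteq> gb l c d" using hole_inside[OF h'] unfolding gt c_def d_def .
  have zc: "z \<in> gb l c d" using sub zs(1) by blast
  have "real c < real hi + 2" "real hi - 1 < real c + 1" "real d < real hj + 2" "real hj - 1 < real d + 1"
   using zc z(2) unfolding gbx_def blk_def by (auto simp: mult.commute)
  hence "c <= hi + 1" "hi <= c + 1" "d <= hj + 1" "hj <= d + 1" by linarith+
  hence "real c + 1 <= real hi + 2" "real hi - 1 <= real c" "real d + 1 <= real hj + 2" "real hj - 1 <= real d" by linarith+
  hence "gb l c d \<subseteq> blk l hi hj" unfolding gbx_def blk_def by (auto simp: mult.commute)
  thus ?thesis using sub gt unfolding circ_def by auto
 qed
qed

lemma mlim_err:
 assumes ml: "mlim F C D u rho" and d: "0 < dl"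
 shows "\<forall>\<^sub>F k in sequentially. M * dev u rho k < dl"
proof -
 have "(%k. M * dev u rho k) \<longlonglongrightarrow> M * sqrt 0"
  by (intro tendsto_intros mlimD(4)[OF ml])
 thus ?thesis using d by (intro order_tendstoD(2)) auto
qed

text \<open>If \<open>v\<close> fell below la / 2 somewhere on the circle, its oscillation there,
  close to rho > la, would make it exceed la elsewhere, so the part below la oscillates by at least
  la / 2. The first variation bounds rho * la / 2 by a vanishing error plus a term of order la^2:
  impossible for small la.\<close>

lemma hole_live:
 assumes P: "pot C D u rho v" and h: "hl l hi hj" and rho: "0 < rho (cr l hi hj)"
  and vp: "!!k x. x \<in> F ==> x \<in> blk l hi hj ==> 0 <= v k x"
  and CD: "C \<inter> blk l hi hj = {}" "D \<inter> blk l hi hj = {}"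
 shows "live v (cr l hi hj)"
proof -
 define H where "H = cr l hi hj"
 have ml: "mlim F C D u rho" using P unfolding pot_def by blast
 have HF: "H \<in> circles F" unfolding H_def by (rule hole_circle[OF h])
 define psi where "psi = bump (pw l) (real hi) (real hi + 1) (pw l) (real hj) (real hj + 1)"
 define K where "K = pw l"
 define r where "r = rho H"
 have r: "0 < r" using rho unfolding r_def H_def .
 have K: "0 < K" unfolding K_def by simp
 have nz: "z \<in> blk l hi hj" if "psi z ~= 0" for z
  using bump_nz that unfolding psi_def blk_def by fastforce
 have one: "psi z = 1" if "z \<in> H" for z
  unfolding psi_def by (rule bump_1) (use that in "auto simp: H_def circ_def gsq_def mult.commute")
 obtain l0 where l0: "0 < l0" "!!la. 0 < la ==> la <= l0 ==> low rho la <= 1" using low_small[of 1] by force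
 \<comment> \<open>The last bound turns the second order term into at most la * r / 8; together with
   an error below la * r / 8 this stays under r * la / 2.\<close>
 define la where "la = min l0 (min (r / 8) (r / (384 * K^2)))"
 have la: "0 < la" "low rho la <= 1" "la <= r / 8" "48 * la * K^2 <= r / 8"
 proof -
  show "0 < la" "la <= r / 8" unfolding la_def using l0 r K by auto
  thus "low rho la <= 1" using l0(2) unfolding la_def by auto
  have "la <= r / (384 * K^2)" unfolding la_def by auto
  thus "48 * la * K^2 <= r / 8" using K by (simp add: field_simps)
 qed
 have HT: "{H} \<subseteq> circles F" using HF by simp
 obtain M where M: "0 <= M" "!!k. (\<forall>x\<in>F. psi x ~= 0 --> 0 <= v k x) ==> (\<forall>x\<in>C \<union> D. psi x = 0 | la <= v k x) ==>
   (\<forall>E\<in>circles F. (\<forall>x\<in>E. v k x < la) & 0 < rho E & (\<exists>x\<in>E. psi x ~= 0) --> (\<forall>x\<in>E. 0 <= v k x)) ==>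
   infsum (%E. rho E * osc (%x. min la (v k x)) E) {H}
    <= M * dev u rho k + 48 * la^2 * K^2 * low rho la"
  using low_estimate[OF P la(1) _ _ _ _ HT, of K psi] one
   bump_lip[of "pw l" K "pw l"] bump_range K unfolding psi_def K_def by force
 have ev1: "\<forall>\<^sub>F k in sequentially. M * dev u rho k < la * r / 8"
  by (rule mlim_err[OF ml]) (use la r in simp)
 have ev2: "\<forall>\<^sub>F k in sequentially. r / 2 < osc (u k) H"
  using mlim_point[OF ml HF] r unfolding r_def by (intro order_tendstoD(1)) auto
 have key: "la / 2 <= v k x" if k: "M * dev u rho k < la * r / 8" "r / 2 < osc (u k) H"
  and x: "x \<in> H" for k x
 proof (rule ccontr)
  assume "~ la / 2 <= v k x"
  hence xs: "v k x < la / 2" by simp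
  define e where "e = (%E. osc (%x. min la (v k x)) E)"
  have tv: "tame F (v k)" by (rule pot_osc(2)[OF P HF])
  have vb: "0 <= v k y" if "y \<in> H" for y
   using vp[of y k] that circles_sub[OF HF] blk_self unfolding H_def by blast
  have "\<exists>y\<in>H. la <= v k y"
  proof (rule ccontr)
   assume "~ (\<exists>y\<in>H. la <= v k y)"
   hence a: "v k y < la" if "y \<in> H" for y using that by force
   have "osc (v k) H <= la"
   proof (rule osc_le)
    show "v k y - v k z <= la" if "y \<in> H" "z \<in> H" for y z using a[OF that(1)] vb[OF that(2)] by linarith
   qed (use la in simp)
   thus False using k(2) la r unfolding pot_osc(1)[OF P HF] by linarith
  qed
  then obtain y where y: "y \<in> H" "la <= v k y" by blast
  have te: "tame F (%x. min la (v k x))" by (rule tame_min[OF tv])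
  have eH: "la / 2 <= e H"
   using osc_bound[OF tame_bounded_sub[OF te circles_sub[OF HF]] y(1) x] y(2) xs unfolding e_def by (auto simp: min_def split: if_splits)
  have sub: "E \<subseteq> blk l hi hj" if a: "E \<in> circles F" "x \<in> E" "psi x ~= 0" for E x
  proof -
   obtain l' i' j' where "(l', i', j') \<in> ixs" "E = cr l' i' j'" using circles_ix[OF a(1)] .
   thus ?thesis using blk_circles[OF h _ _ nz[OF a(3)]] a(2) by blast
  qed
  have "r * (la / 2) <= infsum (%E. rho E * e E) {H}"
   using eH r unfolding r_def[symmetric] by (simp add: r_def)
  also have "... <= M * dev u rho k + 48 * la^2 * K^2 * low rho la"
   unfolding e_def
  proof (rule M(2))
   show "\<forall>x\<in>F. psi x ~= 0 --> 0 <= v k x" using vp nz by blast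
   show "\<forall>x\<in>C \<union> D. psi x = 0 | la <= v k x" using CD nz by blast
   show "\<forall>E\<in>circles F. (\<forall>x\<in>E. v k x < la) & 0 < rho E & (\<exists>x\<in>E. psi x ~= 0) --> (\<forall>x\<in>E. 0 <= v k x)"
    using sub vp circles_sub by blast
  qed
  also have "... < la * r / 8 + 48 * la^2 * K^2 * low rho la" using k(1) by simp
  also have "48 * la^2 * K^2 * low rho la <= la * (48 * la * K^2) * 1"
   using mult_left_mono[OF la(2), of "48 * la^2 * K^2"] la(1) K by (simp add: power2_eq_square mult_ac)
  also have "la * (48 * la * K^2) * 1 <= la * (r / 8)" using la by simp
  finally have "r * (la / 2) < la * r / 8 + la * (r / 8)" by simp
  moreover have "0 < la * r" using la r by simp
  ultimately show False by (simp add: field_simps)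
 qed
 have "\<forall>\<^sub>F k in sequentially. \<forall>x\<in>H. la / 2 <= v k x"
  using ev1 ev2 by eventually_elim (use key in blast)
 thus ?thesis unfolding live_def H_def using la(1) by (intro exI[of _ "la / 2"]) auto
qed

text \<open>With \<open>rho E = 0\<close> the oscillation on E tends to 0, so one small value makes
  \<open>v\<close> small on all of E.\<close>

lemma not_live_dead:
 assumes P: "pot C D u rho v" and E: "E \<in> circles F" and z: "rho E = 0" and nl: "~ live v E"
 shows "dead rho v E"
 unfolding dead_def
proof (intro conjI allI impI)
 show "rho E = 0" by (rule z)
 fix eps :: real assume eps: "0 < eps"
 have ml: "mlim F C D u rho" using P unfolding pot_def by blast
 have "~ (\<forall>\<^sub>F k in sequentially. \<forall>x\<in>E. eps / 2 <= v k x)" using nl eps unfolding live_def by (meson half_gt_zero)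
 hence fr: "\<exists>\<^sub>F k in sequentially. \<exists>x\<in>E. v k x < eps / 2" unfolding not_eventually by (simp add: not_le)
 have ev: "\<forall>\<^sub>F k in sequentially. osc (u k) E < eps / 2"
  using mlim_point[OF ml E] eps unfolding z by (intro order_tendstoD(2)) auto
 have "\<exists>\<^sub>F k in sequentially. (\<exists>x\<in>E. v k x < eps / 2) & osc (u k) E < eps / 2"
  using fr ev by (rule frequently_rev_mp[OF _ eventually_mono]) auto
 thus "\<exists>\<^sub>F k in sequentially. \<forall>x\<in>E. v k x <= eps"
 proof (rule frequently_elim1, clarify)
  fix k x y assume a: "x \<in> E" "v k x < eps / 2" "osc (u k) E < eps / 2" "y \<in> E"
  have "\<bar>v k y - v k x\<bar> <= osc (u k) E"
   using osc_bound[OF tame_bounded_sub[OF pot_osc(2)[OF P E] circles_sub[OF E]] a(4) a(1)] unfolding pot_osc(1)[OF P E] .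
  thus "v k y <= eps" using a by linarith
 qed
qed

lemma hole_live_or_dead:
 assumes P: "pot C D u rho v" and h: "hl l hi hj"
  and vp: "!!k x. x \<in> F ==> x \<in> blk l hi hj ==> 0 <= v k x"
  and CD: "C \<inter> blk l hi hj = {}" "D \<inter> blk l hi hj = {}"
 shows "live v (cr l hi hj) | dead rho v (cr l hi hj)"
proof (cases "rho (cr l hi hj) = 0")
 case True
 thus ?thesis using not_live_dead[OF P hole_circle[OF h]] by blast
next
 case False
 have "0 <= rho (cr l hi hj)" using P mlimD(3) hole_circle[OF h] unfolding pot_def by blast
 thus ?thesis using hole_live[OF P h _ vp CD] False by force
qed

lemma live_not_dead:
 assumes "live v E" "dead rho v E" "x \<in> E"
 shows False
proof -
 obtain la where la: "0 < la" "\<forall>\<^sub>F k in sequentially. \<forall>x\<in>E. la <= v k x" using assms(1) unfolding live_def by blast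
 have "\<exists>\<^sub>F k in sequentially. \<forall>x\<in>E. v k x <= la / 2" using assms(2) half_gt_zero[OF la(1)] unfolding dead_def by blast
 hence "\<exists>\<^sub>F k in sequentially. (\<forall>x\<in>E. v k x <= la / 2) & (\<forall>x\<in>E. la <= v k x)"
  using la(2) by (rule frequently_rev_mp[OF _ eventually_mono]) auto
 then obtain k where "\<forall>x\<in>E. v k x <= la / 2" "\<forall>x\<in>E. la <= v k x" using frequently_ex by blast
 thus False using assms(3) la(1) by fastforce
qed

section \<open>Rows of squares between two circles\<close>

definition strip :: "nat => nat => nat => nat => pt set" where
 "strip i a b r = {z. real a <= fst z * pw i & fst z * pw i <= real b &
            real r < snd z * pw i & snd z * pw i < real r + 1}"

text \<open>The circle \<open>A\<close> closes off row \<open>r\<close> of level \<open>i\<close> on the left of column \<open>a\<close>.\<close>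

definition lface :: "nat => nat => nat => pt set => bool" where
 "lface i a r A \<longleftrightarrow> A \<in> circles F & (a = 0 | ~ cl i (a - 1) r) &
   (\<forall>y. real r < y * pw i & y * pw i < real r + 1 --> (real a / pw i, y) \<in> A)"

definition rface :: "nat => nat => nat => pt set => bool" where
 "rface i b r B \<longleftrightarrow> B \<in> circles F & (b = n ^ i | ~ cl i b r) &
   (\<forall>y. real r < y * pw i & y * pw i < real r + 1 --> (real b / pw i, y) \<in> B)"

text \<open>The cutoff reaches one column beyond each end. There the square is not a cell or lies
  outside the unit square, so the carpet has no points in its interior.\<close>

lemma strip_x:
 assumes A: "lface i a r A" and B: "rface i b r B" and z: "z \<in> F"
  "real a - 1 < fst z * pw i" "fst z * pw i < real b + 1"
  "real r < snd z * pw i" "snd z * pw i < real r + 1"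
 shows "z \<in> strip i a b r"
proof -
 have "real a <= fst z * pw i"
 proof (rule ccontr)
  assume c: "~ ?thesis"
  have f: "0 <= fst z" using F_unit z(1) unfolding gsq_def by auto
  hence "0 <= fst z * pw i" by simp
  hence "a ~= 0" using c by (intro notI) simp
  hence "~ cl i (a - 1) r" "real (a - 1) = real a - 1" using A unfolding lface_def by auto
  moreover have "z \<in> gb i (a - 1) r" using c z calculation(2) unfolding gbx_def by auto
  ultimately show False using F_noncell[OF z(1)] by blast
 qed
 moreover have "fst z * pw i <= real b"
 using F_unit z(1) mult_right_mono B z F_noncell[OF z(1)] by (fastforce simp: gsq_def rface_def gbx_def)
 ultimately show ?thesis using z unfolding strip_def by auto
qed

text \<open>A circle of level at most i that met the row strictly between its ends would bound an
  ancestor of a cell of the row; but such ancestors are cells, and the outer circle stays off the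
  interior of the unit square. Deeper circles lie inside one cell of the row.\<close>

lemma strip_circles:
 assumes A: "lface i a r A" and B: "rface i b r B" and cells: "!!c. a <= c ==> c < b ==> cl i c r"
  and b: "b <= n ^ i" and E: "E \<in> circles F" and z: "z \<in> E" "z \<in> strip i a b r"
 shows "E = A | E = B | E \<subseteq> strip i a b r"
proof -
 obtain l i' j' where ix: "(l, i', j') \<in> ixs" and Ec: "E = cr l i' j'" using circles_ix[OF E] .
 define X where "X = fst z * pw i"
 have zs: "z \<in> gs l i' j'" "z \<notin> gb l i' j'" using z(1) unfolding Ec circ_def by auto
 have Z: "real a <= X" "X <= real b" "real r < snd z * pw i" "snd z * pw i < real r + 1"
  using z(2) unfolding strip_def X_def by auto
 have fz: "fst z = X / pw i" unfolding X_def by simp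
 consider "X = real a" | "X = real b" | "real a < X" "X < real b" using Z by linarith
 thus ?thesis
 proof cases
  case 1
  hence "(fst z, snd z) \<in> A" using A Z unfolding lface_def fz by auto
  thus ?thesis using circles_disjoint[OF E _ z(1)] A unfolding lface_def by auto
 next
  case 2
  hence "(fst z, snd z) \<in> B" using B Z unfolding rface_def fz by auto
  thus ?thesis using circles_disjoint[OF E _ z(1)] B unfolding rface_def by auto
 next
  case 3
  define c where "c = nat \<lfloor>X\<rfloor>"
  have c: "real c <= X" "X < real c + 1" using 3 unfolding c_def by (auto simp: floor_le_iff)
  have ca: "a <= c" using 3(1) c(2) by linarith
  have cb: "c < b" using 3(2) c(1) by linarith
  have cc: "cl i c r" by (rule cells[OF ca cb])
  have no: False if le: "i = l + m" and q: "cl i q r" "q div n ^ m = i'" for m q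
  proof -
   have y: "real j' <= snd z * pw l" "snd z * pw l <= real j' + 1" using zs(1) unfolding gsq_def by auto
   have rj: "r div n ^ m = j'" using idx_unique div_scale_strict[of r "snd z" l m] Z(3,4) y unfolding le by metis
   have "cl l i' j'" using cell_prefix[of l m q r] q rj unfolding le by simp
   hence "l = 0" using ix hole_not_cell unfolding ixs_def by auto
   hence l0: "l = 0" "i' = 0" "j' = 0" using ix unfolding ixs_def by auto
   have "z \<in> gb 0 0 0"
   proof -
    have "real b <= pw i" using b by (metis of_nat_le_iff of_nat_power)
    hence "0 < X" "X < pw i" using 3 by linarith+
    hence "0 < fst z" "fst z < 1" unfolding fz by simp_all
    moreover have "r < n ^ i" using cell_bound[OF cc] by simp
    hence "real r + 1 <= pw i" by (metis Suc_leI of_nat_Suc of_nat_le_iff of_nat_power add.commute)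
    hence "0 < snd z * pw i" "snd z * pw i < 1 * pw i" using Z(3,4) by linarith+
    hence "0 < snd z" "snd z < 1" by (simp_all only: zero_less_mult_iff mult_less_cancel_right_pos[OF npow_pos]) auto
    ultimately show ?thesis unfolding gbx_def by simp
   qed
   thus False using zs(2) unfolding l0 by simp
  qed
  from level_cases[of i l] show ?thesis
  proof cases
   case (gt m)
   have h: "hl (i + Suc m) i' j'" using ix gt unfolding ixs_def by auto
   define d e where "d = i' div n ^ Suc m" and "e = j' div n ^ Suc m"
   have sub: "gs l i' j' \<subseteq> gb i d e" using hole_inside[OF h] unfolding gt d_def e_def .
   hence zd: "z \<in> gb i d e" using zs(1) by blast
   have "r = e" by (rule idx_unique[of e "snd z * pw i"]) (use zd Z in "auto simp: gbx_def")
   moreover have "c = d" by (rule idx_unique[of d X]) (use zd c in "auto simp: gbx_def X_def")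
   moreover have "real a <= real c" "real c + 1 <= real b" using ca cb by auto
   ultimately have "gb i d e \<subseteq> strip i a b r" unfolding gbx_def strip_def by auto
   thus ?thesis using sub unfolding Ec circ_def by auto
  next
   case (le m)
   have xl: "real i' <= fst z * pw l" "fst z * pw l <= real i' + 1" using zs(1) unfolding gsq_def by auto
   have X: "X = fst z * pw l * pw m" unfolding X_def le power_add by simp
   show ?thesis
   proof (cases "real c < X")
    case True
    have "c div n ^ m = i'" using idx_unique div_scale_strict[of c "fst z" l m] True c xl unfolding X_def le by metis
    thus ?thesis using no[OF le cc] by blast
   next
    case False
    hence Xc: "X = real c" using c by linarith
    have y: "real j' <= snd z * pw l" "snd z * pw l <= real j' + 1" using zs(1) unfolding gsq_def by auto
    have "real (r div n ^ m) < snd z * pw l & snd z * pw l < real (r div n ^ m) + 1"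
     using div_scale_strict[of r "snd z" l m] Z(3,4) unfolding le by simp
    moreover from this have "j' = r div n ^ m" using idx_unique y by blast
    ultimately have "~ (real i' < fst z * pw l & fst z * pw l < real i' + 1)"
     using zs(2) unfolding gbx_def by simp
    then consider "fst z * pw l = real i'" | "fst z * pw l = real i' + 1" using xl by linarith
    thus ?thesis
    proof cases
     case 1
     hence "real c = real (i' * n ^ m)" using X Xc by simp
     hence "c = i' * n ^ m" by (simp only: of_nat_eq_iff)
     thus ?thesis using no[OF le cc] n5 by simp
    next
     case 2
     hence "real c = real ((i' + 1) * n ^ m)" using X Xc by (simp add: distrib_right)
     hence c': "c = (i' + 1) * n ^ m" by (simp only: of_nat_eq_iff)
     have "a < c" using 3(1) Xc by simp
     hence "cl i (c - 1) r" using cells[of "c - 1"] cb by simp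
     moreover have "(c - 1) div n ^ m = i'"
     proof -
      obtain q where q: "n ^ m = Suc q" using npow_pos'[of m] gr0_implies_Suc by blast
      have "c - 1 = i' * Suc q + q" using c' unfolding q by simp
      thus ?thesis unfolding q by (intro div_nat_eqI) (auto simp: mult.commute)
     qed
     ultimately show ?thesis using no[OF le] by blast
    qed
   qed
  qed
 qed
qed

text \<open>Truncated at a small level la, \<open>v\<close> still grows from at most la / 2 on A to
  la on B. The line lemma in one subrow then forces a square sum of oscillations of at least la^2 /
  (4 * N^2). The first variation makes the same sum o(la^2), because a squared oscillation is at
  most \<open>rho\<close> times the oscillation up to a vanishing error.\<close>

lemma strip_lemma:
 assumes P: "pot C D u rho v"
  and A: "lface i a r A" "dead rho v A" "A ~= C" "A ~= D"
  and B: "rface i b r B" "live v B"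
  and cells: "!!c. a <= c ==> c < b ==> cl i c r" and b: "b <= n ^ i" and ab: "a < b"
  and CD: "~ C \<subseteq> strip i a b r" "~ D \<subseteq> strip i a b r"
  and vp: "!!k x. x \<in> F ==> x \<in> strip i a b r ==> 0 <= v k x"
 shows False
proof -
 have ml: "mlim F C D u rho"
  and cCD: "C \<in> circles F" "D \<in> circles F" using P unfolding pot_def by blast+
 have cA: "A \<in> circles F" and cB: "B \<in> circles F" using A(1) B(1) unfolding lface_def rface_def by auto
 define N where "N = pw (Suc i)"
 \<comment> \<open>An inner subrow of the next level: the cutoff can be 1 on it and vanish outside
   row r.\<close>
 define r' where "r' = n * r + p"
 define psi where "psi = bump (pw i) (real a) (real b) N (real r') (real r' + 1)"
 have N: "0 < N" "1 <= N" unfolding N_def by (rule npow_pos, rule npow_ge1)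
 have Ni: "pw i <= N" unfolding N_def using n5 by simp
 have N': "N = real n * pw i" unfolding N_def by simp
 have rr: "real r' = real n * real r + real p" unfolding r'_def by simp
 have pp: "1 <= real p" "real p + 2 <= real n" using p1 p2 by linarith+
 have row: "real r < y * pw i & y * pw i < real r + 1" if "real r' - 1 < N * y" "N * y < real r' + 2" for y
 proof -
  have "real n * real r < real n * (y * pw i)" "real n * (y * pw i) < real n * (real r + 1)"
  proof -
   have e: "N * y = real n * (y * pw i)" unfolding N' by simp
   show "real n * real r < real n * (y * pw i)" "real n * (y * pw i) < real n * (real r + 1)"
    using that pp unfolding e rr distrib_left by linarith+
  qed
  thus ?thesis by (simp only: mult_less_cancel_left_pos[OF nR(1)])
 qed
 have nz: "z \<in> strip i a b r" if "z \<in> F" "psi z ~= 0" for z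
 proof -
  have q: "real a - 1 < pw i * fst z" "pw i * fst z < real b + 1" "real r' - 1 < N * snd z" "N * snd z < real r' + 2"
   using bump_nz that(2) unfolding psi_def by fastforce+
  show ?thesis by (rule strip_x[OF A(1) B(1) that(1)]) (use q row[of "snd z"] in "auto simp: mult.commute")
 qed
 obtain l1 where l1: "0 < l1" "\<forall>\<^sub>F k in sequentially. \<forall>x\<in>B. l1 <= v k x" using B(2) unfolding live_def by blast
 \<comment> \<open>In this unit the lower bound is 4 * dl * la^2, while the upper estimates add up
   to 3 * dl * la^2.\<close>
 define dl where "dl = 1 / (16 * N^2)"
 have dl: "0 < dl" unfolding dl_def using N by simp
 obtain l0 where l0: "0 < l0" "!!la. 0 < la ==> la <= l0 ==> low rho la <= dl / (48 * N^2)"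
  using low_small[of "dl / (48 * N^2)"] dl N by force
 define la where "la = min l0 l1"
 have la: "0 < la" "la <= l1" "48 * la^2 * N^2 * low rho la <= la^2 * dl"
 proof -
  show "0 < la" "la <= l1" unfolding la_def using l0 l1 by auto
  hence "low rho la <= dl / (48 * N^2)" using l0(2) unfolding la_def by auto
  hence "48 * la^2 * N^2 * low rho la <= 48 * la^2 * N^2 * (dl / (48 * N^2))" by (intro mult_left_mono) auto
  thus "48 * la^2 * N^2 * low rho la <= la^2 * dl" using N by simp
 qed
 let ?Q = "{real (n * a) / pw (Suc i) .. real (n * b) / pw (Suc i)} \<times> {real r' / pw (Suc i) .. (real r' + 1) / pw (Suc i)}"
 define T where "T = {E \<in> holes. E \<subseteq> ?Q}"
 have TF: "T \<subseteq> circles F" unfolding T_def holes_def by blast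
 have T1: "psi z = 1" if E: "E \<in> T" "z \<in> E" for E z
 proof -
  have "z \<in> ?Q"
   using E unfolding T_def by blast
  moreover have q: "real (n * c) / pw (Suc i) = real c / pw i" for c using nR by simp
  ultimately have z: "real a / pw i <= fst z" "fst z <= real b / pw i" "real r' / N <= snd z" "snd z <= (real r' + 1) / N"
   unfolding q mem_Times_iff atLeastAtMost_iff N_def by blast+
  show ?thesis unfolding psi_def
   by (rule bump_1) (use z N npow_pos[of i] in "simp_all add: pos_divide_le_eq pos_le_divide_eq mult.commute")
 qed
 have "\<exists>M\<ge>0. \<forall>k. (\<forall>x\<in>F. psi x ~= 0 --> 0 <= v k x) --> (\<forall>x\<in>C \<union> D. psi x = 0 | la <= v k x) -->
   (\<forall>E\<in>circles F. (\<forall>x\<in>E. v k x < la) & 0 < rho E & (\<exists>x\<in>E. psi x ~= 0) --> (\<forall>x\<in>E. 0 <= v k x)) -->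
   infsum (%E. rho E * osc (%x. min la (v k x)) E) T
    <= M * dev u rho k + 48 * la^2 * N^2 * low rho la"
  by (rule low_estimate[OF P la(1) _ _ _ _ TF T1])
   (use bump_lip[of "pw i" N N] bump_range N Ni in "auto simp: psi_def")
 then obtain M where "0 <= M" and M: "!!k. (\<forall>x\<in>F. psi x ~= 0 --> 0 <= v k x) ==> (\<forall>x\<in>C \<union> D. psi x = 0 | la <= v k x) ==>
   (\<forall>E\<in>circles F. (\<forall>x\<in>E. v k x < la) & 0 < rho E & (\<exists>x\<in>E. psi x ~= 0) --> (\<forall>x\<in>E. 0 <= v k x)) ==>
   infsum (%E. rho E * osc (%x. min la (v k x)) E) T
    <= M * dev u rho k + 48 * la^2 * N^2 * low rho la" by blast
 define cp where "cp = cap F C D"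
 define err where "err = (%k. dev u rho k)"
 have lr: "l2 (circles F) rho" and r0: "!!E. E \<in> circles F ==> 0 <= rho E" using mlimD[OF ml] by auto
 have lr: "l2 (circles F) rho" using mlimD[OF ml] by auto
 have key: False if live: "\<forall>x\<in>B. l1 <= v k x" and small: "\<forall>x\<in>A. v k x <= la / 2"
  and en: "en F (u k) < cp + 1" and er: "(M + sqrt (cp + 1)) * err k < la^2 * (2 * dl)" for k
 proof -
  define e where "e = (%E. osc (%x. min la (v k x)) E)"
  have tv: "tame F (v k)" by (rule pot_osc(2)[OF P cA])
  have te: "tame F (%x. min la (v k x))" by (rule tame_min[OF tv])
  have lou: "l2 (circles F) (osc (u k))" by (rule admD(2)[OF minseqD(1)[OF mlimD(1)[OF ml]]])
  have e: "0 <= e E" "e E <= osc (u k) E" if "E \<in> circles F" for E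
  proof -
   show "0 <= e E" unfolding e_def by (rule osc_circle_nonneg[OF te that])
   show "e E <= osc (u k) E" unfolding e_def pot_osc(1)[OF P that, symmetric]
    by (rule osc_lip1[OF tame_bounded_sub[OF tv circles_sub[OF that]]]) auto
  qed
  have le: "l2 (circles F) e" by (rule l2_mono[OF lou]) (use e in fastforce)
  have liveB: "la <= v k x" if "x \<in> B" for x using live la(2) that by force
  have cls: "E = A | E = B | E \<subseteq> strip i a b r" if "E \<in> circles F" "x \<in> E" "psi x ~= 0" for E x
   by (rule strip_circles[OF A(1) B(1) cells b that(1,2) nz]) (use that circles_sub in auto)
  define Y where "Y = infsum (%E. rho E * e E) T"
  have Yle: "Y <= M * err k + 48 * la^2 * N^2 * low rho la"
   unfolding Y_def e_def err_def
  proof (rule M)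
   show "\<forall>x\<in>F. psi x ~= 0 --> 0 <= v k x" using vp nz by blast
   show "\<forall>x\<in>C \<union> D. psi x = 0 | la <= v k x" using cls[OF cCD(1)] cls[OF cCD(2)] A(3,4) CD liveB by blast
   show "\<forall>E\<in>circles F. (\<forall>x\<in>E. v k x < la) & 0 < rho E & (\<exists>x\<in>E. psi x ~= 0) --> (\<forall>x\<in>E. 0 <= v k x)"
   proof (intro ballI impI)
    fix E x assume E: "E \<in> circles F" and h: "(\<forall>x\<in>E. v k x < la) & 0 < rho E & (\<exists>x\<in>E. psi x ~= 0)" and x: "x \<in> E"
    have "E ~= A" "E ~= B" using h A(2) x liveB unfolding dead_def by fastforce+
    hence "E \<subseteq> strip i a b r" using cls[OF E] h by blast
    thus "0 <= v k x" using vp[of x k] x circles_sub[OF E] by blast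
   qed
  qed
  \<comment> \<open>(e E)^2 <= e E * osc (u k) E, and the oscillations of \<open>u k\<close> differ
    from \<open>rho\<close> by a vector tending to 0 in l2.\<close>
  have e2: "ns T e <= Y + sqrt (cp + 1) * err k"
  proof -
   have l2e: "l2 (circles F) (%E. osc (u k) E - rho E)" by (rule l2_diff[OF lou lr])
   have s1: "(%E. rho E * e E) summable_on T" by (rule summable_on_subset_banach[OF l2_mult[OF lr le] TF])
   have s2': "(%E. \<bar>osc (u k) E\<bar> * \<bar>osc (u k) E - rho E\<bar>) summable_on circles F"
    by (rule l2_mult[OF l2_abs[OF lou] l2_abs[OF l2e]])
   have s2: "(%E. \<bar>osc (u k) E\<bar> * \<bar>osc (u k) E - rho E\<bar>) summable_on T" by (rule summable_on_subset_banach[OF s2' TF])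
   have "ns T e <= infsum (%E. rho E * e E + \<bar>osc (u k) E\<bar> * \<bar>osc (u k) E - rho E\<bar>) T"
    unfolding ns_def
   proof (rule infsum_mono)
    show "(%E. (e E)^2) summable_on T" using l2_subset[OF le TF] unfolding l2_def .
    show "(%E. rho E * e E + \<bar>osc (u k) E\<bar> * \<bar>osc (u k) E - rho E\<bar>) summable_on T" by (rule summable_on_add[OF s1 s2])
    fix E assume "E \<in> T"
    hence E: "E \<in> circles F" using TF by blast
    have "(e E)^2 <= e E * osc (u k) E" using e[OF E] by (simp add: power2_eq_square mult_left_mono)
    also have "... = rho E * e E + e E * (osc (u k) E - rho E)" by (simp add: algebra_simps)
    also have "e E * (osc (u k) E - rho E) <= \<bar>osc (u k) E\<bar> * \<bar>osc (u k) E - rho E\<bar>"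
    proof -
     have "e E * (osc (u k) E - rho E) <= e E * \<bar>osc (u k) E - rho E\<bar>" using e[OF E] by (intro mult_left_mono) auto
     also have "... <= \<bar>osc (u k) E\<bar> * \<bar>osc (u k) E - rho E\<bar>" using e[OF E] by (intro mult_right_mono) auto
     finally show ?thesis .
    qed
    finally show "(e E)^2 <= rho E * e E + \<bar>osc (u k) E\<bar> * \<bar>osc (u k) E - rho E\<bar>" by simp
   qed
   also have "... = Y + infsum (%E. \<bar>osc (u k) E\<bar> * \<bar>osc (u k) E - rho E\<bar>) T"
    unfolding Y_def by (rule infsum_add[OF s1 s2])
   also have "infsum (%E. \<bar>osc (u k) E\<bar> * \<bar>osc (u k) E - rho E\<bar>) T <= infsum (%E. \<bar>osc (u k) E\<bar> * \<bar>osc (u k) E - rho E\<bar>) (circles F)"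
    by (rule infsum_mono_neutral[OF s2 s2']) (use TF in auto)
   also have "... <= sqrt (en F (u k)) * err k" unfolding en_def err_def by (rule l2_cs_abs[OF lou l2e])
   also have "... <= sqrt (cp + 1) * err k"
    unfolding err_def using en by (intro mult_right_mono) (auto simp: ns_nonneg)
   finally show ?thesis by simp
  qed
  have lT: "l2 T e" by (rule l2_subset[OF le TF])
  have "(la / 2) / N <= infsum (%E. osc fst E * e E) T"
   unfolding N_def T_def e_def
  proof (rule line_lemma[OF te])
   fix c assume c: "n * a <= c" "c < n * b"
   have "a <= c div n" "c div n < b" using c n5 by (simp_all add: less_eq_div_iff_mult_less_eq div_less_iff_less_mult mult.commute)
   hence "cl i (c div n) r" by (rule cells)
   moreover have "r' div n = r" unfolding r'_def using p2 by simp
   ultimately show "cl (Suc i) c r' | hl (Suc i) c r'" by auto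
  next
   show "n * a <= n * b" using ab by simp
   show "n * b <= n ^ Suc i" using b by simp
   have "cl i a r" using cells ab by simp
   hence "r < n ^ i" using cell_bound by blast
   hence "n * (r + 1) <= n * n ^ i" by (intro mult_le_mono2) simp
   thus "r' < n ^ Suc i" unfolding r'_def using p2 by simp
  next
   fix y assume y: "real r' < y * pw (Suc i)" "y * pw (Suc i) < real r' + 1"
   have ry: "real r < y * pw i & y * pw i < real r + 1"
    by (rule row) (use y in "auto simp: N_def mult.commute")
   have q: "real (n * c) / pw (Suc i) = real c / pw i" for c using nR by simp
   have yA: "(real a / pw i, y) \<in> A" and yB: "(real b / pw i, y) \<in> B"
    using A(1) B(1) ry unfolding lface_def rface_def by auto
   have "la / 2 <= min la (v k (real b / pw i, y)) - min la (v k (real a / pw i, y))"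
    using liveB[OF yB] small yA by fastforce
   thus "(real (n * a) / pw (Suc i), y) \<in> F & (real (n * b) / pw (Suc i), y) \<in> F &
     la / 2 <= min la (v k (real (n * b) / pw (Suc i), y)) - min la (v k (real (n * a) / pw (Suc i), y))"
    unfolding q using yA yB circles_sub[OF cA] circles_sub[OF cB] by blast
  next
   show "l2 {E \<in> holes. E \<subseteq> ?Q}
     (osc (%x. min la (v k x)))" using lT unfolding T_def e_def .
  qed
  also have "... <= sqrt (ns T (osc fst)) * sqrt (ns T e)"
   using l2_cs[OF l2_subset[OF l2_side TF] lT] by simp
  also have "... <= 1 * sqrt (ns T e)"
  proof (rule mult_right_mono[OF _ sqrt_ns_nonneg])
   have "ns T (osc fst) <= ns holes (osc fst)" unfolding ns_def
    by (rule infsum_mono_neutral) (use l2_subset[OF l2_side_holes(1), of T] l2_side_holes(1) in "auto simp: l2_def T_def")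
   thus "sqrt (ns T (osc fst)) <= 1" using l2_side_holes(2) by simp
  qed
  finally have "((la / 2) / N)^2 <= (sqrt (ns T e))^2" using la(1) N by (intro power_mono) auto
  also have "... = ns T e" by (simp add: ns_nonneg)
  also have "... <= (M + sqrt (cp + 1)) * err k + la^2 * dl" using e2 Yle la(3) by (simp add: distrib_right)
  also have "... < la^2 * (2 * dl) + la^2 * dl" using er by linarith
  finally have "((la / 2) / N)^2 < la^2 * (3 * dl)" by (simp add: mult_ac)
  moreover have "((la / 2) / N)^2 = la^2 * (4 * dl)" unfolding dl_def by (simp add: power_divide)
  ultimately show False using la(1) dl by simp
 qed
 have ev1: "\<forall>\<^sub>F k in sequentially. (M + sqrt (cp + 1)) * err k < la^2 * (2 * dl)"
  unfolding err_def by (rule mlim_err[OF ml]) (use la(1) dl in simp)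
 have ev2: "\<forall>\<^sub>F k in sequentially. en F (u k) < cp + 1"
  using minseqD(4)[OF mlimD(1)[OF ml]] unfolding cp_def by (intro order_tendstoD(2)) auto
 have fr: "\<exists>\<^sub>F k in sequentially. \<forall>x\<in>A. v k x <= la / 2" using A(2) half_gt_zero[OF la(1)] unfolding dead_def by blast
 have "\<forall>\<^sub>F k in sequentially. (\<forall>x\<in>A. v k x <= la / 2) --> False"
  using ev1 ev2 l1(2) by eventually_elim (use key in blast)
 thus False using fr unfolding frequently_def by simp
qed

lemma face_div: "r div n ^ m = hj ==> real r < y * pw (l + m) ==> y * pw (l + m) < real r + 1 ==>
  real hj < y * pw l & y * pw l < real hj + 1"
 using div_scale_strict[of r y l m] by simp

lemma hole_lface:
 assumes h: "hl l hi hj" and r: "r div n ^ m = hj"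
 shows "lface (l + m) ((hi + 1) * n ^ m) r (cr l hi hj)"
 unfolding lface_def
proof (intro conjI allI impI)
 show "cr l hi hj \<in> circles F" by (rule hole_circle[OF h])
 have "((hi + 1) * n ^ m - 1) div n ^ m = hi"
 proof -
  obtain q where q: "n ^ m = Suc q" using npow_pos'[of m] gr0_implies_Suc by blast
  show ?thesis unfolding q by (intro div_nat_eqI) (auto simp: mult.commute)
 qed
 hence "~ cl (l + m) ((hi + 1) * n ^ m - 1) r"
  using cell_prefix[of l m "(hi + 1) * n ^ m - 1" r] r hole_not_cell[OF h] by auto
 thus "(hi + 1) * n ^ m = 0 | ~ cl (l + m) ((hi + 1) * n ^ m - 1) r" ..
 fix y assume y: "real r < y * pw (l + m) & y * pw (l + m) < real r + 1"
 have x: "real ((hi + 1) * n ^ m) / pw (l + m) * pw l = real hi + 1"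
  using n5 by (simp add: power_add field_simps)
 show "(real ((hi + 1) * n ^ m) / pw (l + m), y) \<in> cr l hi hj"
  unfolding circ_def gsq_def gbx_def using face_div[OF r, of y l] y x by simp
qed

lemma hole_rface:
 assumes h: "hl l hi hj" and r: "r div n ^ m = hj"
 shows "rface (l + m) (hi * n ^ m) r (cr l hi hj)"
 unfolding rface_def
proof (intro conjI allI impI)
 show "cr l hi hj \<in> circles F" by (rule hole_circle[OF h])
 have "(hi * n ^ m) div n ^ m = hi" using npow_pos'[of m] by simp
 hence "~ cl (l + m) (hi * n ^ m) r"
  using cell_prefix[of l m "hi * n ^ m" r] r hole_not_cell[OF h] by auto
 thus "hi * n ^ m = n ^ (l + m) | ~ cl (l + m) (hi * n ^ m) r" ..
 fix y assume y: "real r < y * pw (l + m) & y * pw (l + m) < real r + 1"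
 have x: "real (hi * n ^ m) / pw (l + m) * pw l = real hi"
  using npow_pos[of m] npow_pos[of l] by (simp add: power_add del: npow_pos)
 show "(real (hi * n ^ m) / pw (l + m), y) \<in> cr l hi hj"
  unfolding circ_def gsq_def gbx_def using face_div[OF r, of y l] y x by simp
qed

lemma OC_iff: "z \<in> OC \<longleftrightarrow> 0 <= fst z & fst z <= 1 & 0 <= snd z & snd z <= 1 & (fst z = 0 | fst z = 1 | snd z = 0 | snd z = 1)"
 unfolding OC_def circ_def gsq_def gbx_def by auto

lemma row_unit:
 assumes "r < n ^ i" "real r < y * pw i" "y * pw i < real r + 1"
 shows "0 < y" "y < 1"
proof -
 have "real r + 1 <= pw i" using assms(1) by (metis Suc_leI of_nat_Suc of_nat_le_iff of_nat_power add.commute)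
 hence "0 < y * pw i" "y * pw i < 1 * pw i" using assms(2,3) by linarith+
 thus "0 < y" "y < 1" by (simp_all only: zero_less_mult_iff mult_less_cancel_right_pos[OF npow_pos]) auto
qed

lemma OC_lface: "r < n ^ i ==> lface i 0 r OC"
 unfolding lface_def using OC_circle row_unit[of r i] by (auto simp: OC_iff less_imp_le)

lemma strip_mono: "a <= a' ==> b' <= b ==> strip i a' b' r \<subseteq> strip i a b r"
by (auto simp: strip_def)

abbreviation clear where "clear v C D B \<equiv> (\<forall>k. \<forall>x\<in>F \<inter> B. 0 <= v k x) & C \<inter> B = {} & D \<inter> B = {}"

text \<open>Induction on the length of the row. The first hole H on the way from A to B is live or
  dead: if live, the strip lemma applies between A and H; if dead, H takes the place of A.\<close>

lemma row_lemma:
 assumes P: "pot C D u rho v"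
  and B: "rface i b r B" "live v B"
  and b: "b <= n ^ i" and ri: "r < n ^ i"
  and CD: "~ C \<subseteq> strip i a0 b r" "~ D \<subseteq> strip i a0 b r"
  and vp: "!!k x. x \<in> F ==> x \<in> strip i a0 b r ==> 0 <= v k x"
  and hol: "!!l m c. a0 <= c ==> c < b ==> i = l + m ==> hl l (c div n ^ m) (r div n ^ m) ==>
    clear v C D (blk l (c div n ^ m) (r div n ^ m))"
 shows "lface i a r A ==> dead rho v A ==> A ~= C ==> A ~= D ==> a0 <= a ==> a <= b ==> False"
proof (induction "b - a" arbitrary: a A rule: less_induct)
 case less
 note A = less.prems(1-4) and a0 = less.prems(5) and ab = less.prems(6)
 have cA: "A \<in> circles F" and cB: "B \<in> circles F" using A(1) B(1) unfolding lface_def rface_def by auto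
 define y where "y = (real r + 1/2) / pw i"
 have y: "real r < y * pw i" "y * pw i < real r + 1" unfolding y_def using npow_pos[of i] by simp_all
 have pA: "(real a / pw i, y) \<in> A" and pB: "(real b / pw i, y) \<in> B"
  using A(1) B(1) y unfolding lface_def rface_def by auto
 show False
 proof (cases "\<forall>c. a <= c & c < b --> cl i c r")
  case True
  show False
  proof (cases "a = b")
   case True
   hence "A = B" using circles_disjoint[OF cA cB pA] pB by simp
   thus False using live_not_dead[OF B(2)] A(2) pA by blast
  next
   case False
   have s: "strip i a b r \<subseteq> strip i a0 b r" by (rule strip_mono) (use a0 in auto)
   show False
    by (rule strip_lemma[OF P A B _ b _ _ _ vp]) (use True False ab CD s in auto)
  qed
 next
  case False
  define c where "c = (LEAST c. a <= c & c < b & ~ cl i c r)"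
  have c: "a <= c" "c < b" "~ cl i c r" and cm: "!!d. a <= d ==> d < c ==> cl i d r"
  proof -
   have ex: "\<exists>c. a <= c & c < b & ~ cl i c r" using False by blast
   show "a <= c" "c < b" "~ cl i c r" using LeastI_ex[OF ex] unfolding c_def by auto
   thus "cl i d r" if "a <= d" "d < c" for d using not_less_Least[of d "%c. a <= c & c < b & ~ cl i c r"] that unfolding c_def by auto
  qed
  have cn: "c < n ^ i" using c(2) b by simp
  obtain l m where i: "i = l + m" and h: "hl l (c div n ^ m) (r div n ^ m)"
   using noncell_in_hole[OF cn ri c(3)] by blast
  define hi hj where "hi = c div n ^ m" and "hj = r div n ^ m"
  define H where "H = cr l hi hj"
  have hH: "hl l hi hj" using h unfolding hi_def hj_def .
  have yl: "real hj < y * pw l" "y * pw l < real hj + 1" using face_div[of r m hj y l] y unfolding i hj_def by auto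
  have sc: "real d / pw i * pw l = real d / pw m" for d unfolding i power_add using npow_pos[of l] by (simp del: npow_pos)
  have inF: "~ (real hi < real d / pw m & real d / pw m < real hi + 1)" if "(real d / pw i, y) \<in> F" for d
   using F_hole[OF that hH] yl sc[of d] unfolding gbx_def by auto
  have nc: "~ cl i d r" if "d div n ^ m = hi" for d
   using cell_prefix[of l m d r] hole_not_cell[OF hH] that unfolding i hj_def by auto
  have chi: "hi * n ^ m <= c" "c < hi * n ^ m + n ^ m"
  proof -
   have "c = hi * n ^ m + c mod n ^ m" unfolding hi_def by (simp only: div_mult_mod_eq)
   moreover have "c mod n ^ m < n ^ m" by (rule mod_less_divisor) simp
   ultimately show "hi * n ^ m <= c" "c < hi * n ^ m + n ^ m" by linarith+
  qed
  have FA: "(real a / pw i, y) \<in> F" and FB: "(real b / pw i, y) \<in> F" using pA pB circles_sub cA cB by blast+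
  have rdiv: "real hi < real d / pw m" if "hi * n ^ m < d" for d
  proof -
   have "real (hi * n ^ m) < real d" using that by (simp only: of_nat_less_iff)
   thus ?thesis by (simp add: pos_less_divide_eq)
  qed
  have rdiv': "real d / pw m < real hi + 1" if "d < hi * n ^ m + n ^ m" for d
  proof -
   have "real d < real (hi * n ^ m + n ^ m)" using that by (simp only: of_nat_less_iff)
   thus ?thesis by (simp add: pos_divide_less_eq distrib_right)
  qed
  have ah: "a <= hi * n ^ m"
  using inF[OF FA] rdiv[of a] rdiv'[of a] c(1) chi by force
  have ceq: "c = hi * n ^ m"
  using cm ah chi nc[of "hi * n ^ m"] npow_pos'[of m] by force
  have faceH: "rface i c r H" "lface i (c + n ^ m) r H"
   using hole_rface[OF hH, of r m] hole_lface[OF hH, of r m] hj_def unfolding H_def i ceq by (simp_all add: add.commute)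
  have cH: "H \<in> circles F" unfolding H_def by (rule hole_circle[OF hH])
  \<comment> \<open>Otherwise A and H meet and so coincide; then the square left of column a would
    belong to the same hole, whose left side is column a.\<close>
  have ac: "a ~= c"
  proof
   assume e: "a = c"
   have pH: "(real c / pw i, y) \<in> H" using faceH(1) y unfolding rface_def by blast
   hence AH: "A = H" using circles_disjoint[OF cA cH pA] unfolding e by simp
   show False
   proof (cases "a = 0")
    case True
    hence "(real a / pw i, y) \<in> OC" using OC_lface[OF ri] y unfolding lface_def by blast
    hence "A = OC" using circles_disjoint[OF cA OC_circle pA] by simp
    thus False using hole_ne_OC[OF hH] AH unfolding H_def by simp
   next
    case a: False
    hence "~ cl i (a - 1) r" using A(1) unfolding lface_def by simp
    moreover have "a - 1 < n ^ i" using cn unfolding e[symmetric] by simp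
    ultimately obtain l2 m2 where i2: "i = l2 + m2" and h2: "hl l2 ((a - 1) div n ^ m2) (r div n ^ m2)"
     using noncell_in_hole[of "a - 1" i r] ri by blast
    define g where "g = (a - 1) div n ^ m2"
    have y2: "real (r div n ^ m2) < y * pw l2" "y * pw l2 < real (r div n ^ m2) + 1" using face_div[of r m2 _ y l2] y unfolding i2 by auto
    have s2: "real a / pw i * pw l2 = real a / pw m2" unfolding i2 power_add using npow_pos[of l2] by (simp del: npow_pos)
    have g1: "g * n ^ m2 <= a" "a <= g * n ^ m2 + n ^ m2"
    proof -
     have "a - 1 = g * n ^ m2 + (a - 1) mod n ^ m2" unfolding g_def by (simp only: div_mult_mod_eq)
     moreover have "(a - 1) mod n ^ m2 < n ^ m2" by (rule mod_less_divisor) simp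
     ultimately show "g * n ^ m2 <= a" "a <= g * n ^ m2 + n ^ m2" by linarith+
    qed
    have g2: "real g <= real a / pw m2" "real a / pw m2 <= real g + 1"
    proof -
     have "real (g * n ^ m2) <= real a" "real a <= real (g * n ^ m2 + n ^ m2)" using g1 by (simp_all only: of_nat_le_iff)
     thus "real g <= real a / pw m2" "real a / pw m2 <= real g + 1"
      by (simp_all add: pos_divide_le_eq pos_le_divide_eq distrib_right)
    qed
    have h2': "hl l2 g (r div n ^ m2)" using h2 unfolding g_def .
    have "(real a / pw i, y) \<in> gs l2 g (r div n ^ m2)" unfolding gsq_def using g2 s2 y2 by simp
    hence "(real a / pw i, y) \<in> cr l2 g (r div n ^ m2)" using F_hole[OF FA h2'] unfolding circ_def by blast
    hence "H = cr l2 g (r div n ^ m2)" using circles_disjoint[OF cA hole_circle[OF h2'] pA] AH by simp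
    hence "l = l2 & hi = g" using circ_eq_iff[of l hi hj l2 g "r div n ^ m2"] hH h2' unfolding H_def ixs_def by auto
    hence "hi = (a - 1) div n ^ m" using i i2 g_def by auto
    moreover have "a = hi * n ^ m" using e ceq by simp
    ultimately have "(hi * n ^ m - 1) div n ^ m = hi" by simp
    moreover have "(hi * n ^ m - 1) div n ^ m < hi"
     using a \<open>a = hi * n ^ m\<close> by (simp add: div_less_iff_less_mult)
    ultimately show False by simp
   qed
  qed
  have cb: "c + n ^ m <= b"
  using inF[OF FB] rdiv[of b] rdiv'[of b] c(2) ceq by force
  have hc: "clear v C D (blk l hi hj)"
   using hol[OF _ c(2) i h] a0 c(1) unfolding hi_def hj_def by simp
  have "live v H | dead rho v H"
   unfolding H_def by (rule hole_live_or_dead[OF P hH]) (use hc in auto)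
  thus False
  proof
   assume L: "live v H"
   have s: "strip i a c r \<subseteq> strip i a0 b r" by (rule strip_mono) (use a0 c in auto)
   show False
    by (rule strip_lemma[OF P A faceH(1) L cm _ _ _ _ vp]) (use ac c cn CD s in auto)
  next
   assume Dd: "dead rho v H"
   have dec: "b - (c + n ^ m) < b - a" using c cb npow_pos'[of m] by linarith
   have ne: "H ~= C" "H ~= D" using hc blk_self[of l hi hj] circle_ne[OF cH] unfolding H_def by blast+
   show False
    by (rule less.hyps[OF dec faceH(2) Dd ne]) (use a0 c cb in auto)
  qed
 qed
qed

end

section \<open>Folding and maximal capacity\<close>

lemma adm_flip: "adm X C D g ==> adm X D C (%x. 1 - g x) & en X (%x. 1 - g x) = en X g"
proof -
 assume g: "adm X C D g"
 have t: "tame X (%x. 1 - g x)" using tame_affine[OF admD(1)[OF g], of 1 "-1"] by simp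
 have o: "osc (%x. 1 - g x) E = osc g E" if E: "E \<in> circles X" for E
  by (intro antisym osc_lip1 tame_bounded_sub[OF t circles_sub[OF E]] tame_bounded_sub[OF admD(1)[OF g] circles_sub[OF E]]) auto
 have l: "l2 (circles X) (osc (%x. 1 - g x))" by (rule l2_mono[OF admD(2)[OF g]]) (simp add: o)
 have "en X (%x. 1 - g x) = en X g" unfolding en_def ns_def by (rule infsum_cong) (simp add: o)
 thus ?thesis unfolding adm_def using t l admD[OF g] by auto
qed

lemma cap_sym: "cap X C D = cap X D C"
proof -
 have "en X ` {g. adm X C D g} \<subseteq> en X ` {g. adm X D C g}" for C D
 proof
  fix e assume "e \<in> en X ` {g. adm X C D g}"
  then obtain g where "adm X C D g" "e = en X g" by blast
  hence "adm X D C (%x. 1 - g x)" "e = en X (%x. 1 - g x)" using adm_flip by metis+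
  thus "e \<in> en X ` {g. adm X D C g}" by blast
 qed
 hence "en X ` {g. adm X C D g} = en X ` {g. adm X D C g}" by blast
 thus ?thesis unfolding cap_def by simp
qed

lemma mlim_qsi:
 assumes q: "qsi X Y f g" and X: "compact X" "compact Y" and sub: "C \<subseteq> Y" "D \<subseteq> Y" and ml: "mlim Y C D u rho"
 shows "mlim X (g ` C) (g ` D) (%k. u k \<circ> f) (%E. rho (f ` E))"
proof -
 have h: "homeomorphism X Y f g" by (rule qsi_homeo[OF q])
 have fg: "f ` g ` C = C" "f ` g ` D = D" using homeomorphism_image_inv[OF homeomorphism_symD[OF h]] sub by auto
 note m = mlimD(1)[OF ml]
 have cp: "cap X (g ` C) (g ` D) = cap Y C D"
  by (rule cap_qsi[OF qsi_sym[OF q] X(2,1) minseqD(1)[OF m, of 0] sub])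
 have a: "adm X (g ` C) (g ` D) (u k \<circ> f)" for k
  by (rule adm_qsi[OF q X(1)]) (simp add: fg minseqD(1)[OF m])
 have fX: "f x \<in> Y" if "x \<in> X" for x using h that unfolding homeomorphism_def by blast
 have e: "en X (u k \<circ> f) = en Y (u k)" for k by (rule l2_osc_qsi(2)[OF h admD(2)[OF minseqD(1)[OF m]]])
 have n: "ns (circles X) (%E. osc (u k \<circ> f) E - rho (f ` E)) = ns (circles Y) (%E. osc (u k) E - rho E)" for k
  unfolding ns_def osc_comp using infsum_reindex_bij_betw[OF circles_bij[OF h], of "%E. (osc (u k) E - rho E)^2"] by simp
 have l: "l2 (circles X) (%E. rho (f ` E))"
  using summable_on_reindex_bij_betw[OF circles_bij[OF h], of "%E. (rho E)^2"] mlimD(2)[OF ml] unfolding l2_def by simp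
 have "minseq X (g ` C) (g ` D) (%k. u k \<circ> f)"
  unfolding minseq_def e cp using a minseqD[OF m] fX by auto
 thus ?thesis unfolding mlim_def n using l mlimD(3,4)[OF ml] circles_homeo[OF h] by auto
qed

section \<open>The triangle wave and the folding map\<close>

definition tri :: "real => real" where "tri t = \<bar>t - 2 * of_int \<lfloor>(t + 1) / 2\<rfloor>\<bar>"

text \<open>\<open>tri\<close> is the distance to the nearest even integer; this minimality also
  makes it 1-Lipschitz.\<close>

lemma tri_le: "tri t <= \<bar>t - 2 * of_int m\<bar>"
proof -
 define q where "q = \<lfloor>(t + 1) / 2\<rfloor>"
 have "of_int q <= (t + 1) / 2" "(t + 1) / 2 < of_int q + 1" unfolding q_def by linarith+
 hence a: "\<bar>t - 2 * of_int q\<bar> <= 1" by (simp add: abs_le_iff)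
 show ?thesis
 proof (cases "m = q")
  case False
  hence "m + 1 <= q | q + 1 <= m" by linarith
  hence "real_of_int m + 1 <= of_int q | real_of_int q + 1 <= of_int m" by linarith
  hence "1 <= \<bar>t - 2 * of_int m\<bar>" using a by (smt (verit))
  thus ?thesis using a unfolding tri_def q_def by linarith
 qed (simp add: tri_def q_def)
qed

lemma tri_lip: "\<bar>tri s - tri t\<bar> <= \<bar>s - t\<bar>"
proof -
 have "tri s <= tri t + \<bar>s - t\<bar>" for s t
  using tri_le[of s "\<lfloor>(t + 1) / 2\<rfloor>"] unfolding tri_def[of t] by linarith
 from this[of s t] this[of t s] show ?thesis by linarith
qed

lemma tri_val:
 assumes "real i <= t" "t <= real i + 1"
 shows "tri t = (if even i then t - real i else real i + 1 - t)"
proof (cases "even i")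
 case True
 then obtain m where m: "i = 2 * m" by blast
 show ?thesis
 proof (cases "t = real i + 1")
  case True
  hence "(t + 1) / 2 = real_of_int (int m + 1)" unfolding m by simp
  hence "\<lfloor>(t + 1) / 2\<rfloor> = int m + 1" by (simp only: floor_of_int)
  thus ?thesis using True m unfolding tri_def by simp
 next
  case False
  hence "\<lfloor>(t + 1) / 2\<rfloor> = int m" using assms unfolding m by (intro floor_unique) auto
  thus ?thesis using assms m unfolding tri_def by simp
 qed
next
 case False
 then obtain m where m: "i = 2 * m + 1" by (rule oddE)
 have "\<lfloor>(t + 1) / 2\<rfloor> = int m + 1" using assms unfolding m by (intro floor_unique) auto
 thus ?thesis using assms m False unfolding tri_def by simp
qed

context carpet_params begin

text \<open>The fold traverses squares with odd index backwards, which reverses the indices of their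
  subsquares at every deeper level.\<close>

definition fdig :: "nat => nat => nat => nat" where
 "fdig i m a = (if even i then a else n ^ m - 1 - a)"

lemma fdig_bound: "a < n ^ m ==> fdig i m a < n ^ m"
 unfolding fdig_def by auto

lemma tri_scale:
 assumes t: "real i <= t" "t <= real i + 1" and a: "a < n ^ m"
 shows "real (fdig i m a) <= tri t * pw m & tri t * pw m <= real (fdig i m a) + 1 \<longleftrightarrow>
     real (i * n ^ m + a) <= t * pw m & t * pw m <= real (i * n ^ m + a) + 1"
  "real (fdig i m a) < tri t * pw m & tri t * pw m < real (fdig i m a) + 1 \<longleftrightarrow>
     real (i * n ^ m + a) < t * pw m & t * pw m < real (i * n ^ m + a) + 1"
proof -
 have e: "real (n ^ m - Suc a) = pw m - 1 - real a" using a by (simp add: of_nat_diff Suc_leI)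
 show "real (fdig i m a) <= tri t * pw m & tri t * pw m <= real (fdig i m a) + 1 \<longleftrightarrow>
     real (i * n ^ m + a) <= t * pw m & t * pw m <= real (i * n ^ m + a) + 1"
  unfolding tri_val[OF t] fdig_def by (auto simp: e algebra_simps)
 show "real (fdig i m a) < tri t * pw m & tri t * pw m < real (fdig i m a) + 1 \<longleftrightarrow>
     real (i * n ^ m + a) < t * pw m & t * pw m < real (i * n ^ m + a) + 1"
  unfolding tri_val[OF t] fdig_def by (auto simp: e algebra_simps)
qed

lemma index_split: "(i * n ^ Suc m + a) div n = i * n ^ m + a div n" "(i * n ^ Suc m + a) mod n = a mod n"
proof -
 have e: "i * n ^ Suc m + a = n * (i * n ^ m) + a" by simp
 show "(i * n ^ Suc m + a) div n = i * n ^ m + a div n" "(i * n ^ Suc m + a) mod n = a mod n"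
  unfolding e using n5 by simp_all
qed

lemma index_div_less: "a < n ^ Suc m ==> a div n < n ^ m"
 by (simp add: div_less_iff_less_mult mult.commute)

text \<open>Self-similarity: the address of a subsquare is the address of the square followed by the
  address inside it.\<close>

lemma cell_compose:
 assumes "a < n ^ m" "b < n ^ m"
 shows "cl (k + m) (i * n ^ m + a) (j * n ^ m + b) \<longleftrightarrow> cl k i j & cl m a b"
 using assms
proof (induction m arbitrary: a b)
 case (Suc m)
 show ?case using Suc.IH[OF index_div_less[OF Suc.prems(1)] index_div_less[OF Suc.prems(2)]]
  by (simp add: index_split del: power_Suc)
qed simp

lemma hole_compose:
 assumes "a < n ^ Suc m" "b < n ^ Suc m"
 shows "hl (k + Suc m) (i * n ^ Suc m + a) (j * n ^ Suc m + b) \<longleftrightarrow> cl k i j & hl (Suc m) a b"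
 using cell_compose[OF index_div_less[OF assms(1)] index_div_less[OF assms(2)], of k i j]
 by (simp add: index_split del: power_Suc)

lemma cell_flip2: "b < n ^ k ==> cl k i (n ^ k - 1 - b) \<longleftrightarrow> cl k i b"
 by (simp only: cell_swap[of k i "n ^ k - 1 - b"] cell_swap[of k i b] cell_flip)

lemma cell_fdig: "a < n ^ m ==> b < n ^ m ==> cl m (fdig i m a) (fdig j m b) \<longleftrightarrow> cl m a b"
 unfolding fdig_def by (simp only: cell_flip cell_flip2 split: if_split) simp

lemma hole_flip2: "b < n ^ k ==> hl k i (n ^ k - 1 - b) \<longleftrightarrow> hl k i b"
 by (simp only: hole_swap[of k i "n ^ k - 1 - b"] hole_swap[of k i b] hole_flip)

lemma hole_fdig: "a < n ^ m ==> b < n ^ m ==> hl m (fdig i m a) (fdig j m b) \<longleftrightarrow> hl m a b"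
 unfolding fdig_def by (simp only: hole_flip hole_flip2 split: if_split) simp

text \<open>The triangle wave folds adjacent grid squares onto each other, which makes \<open>fold k\<close> continuous.\<close>

definition fold :: "nat => pt => pt" where
 "fold k z = (tri (fst z * pw k), tri (snd z * pw k))"

lemma fold_gsq:
 assumes "z \<in> gs k i j" "a < n ^ m" "b < n ^ m"
 shows "fold k z \<in> gs m (fdig i m a) (fdig j m b) \<longleftrightarrow> z \<in> gs (k + m) (i * n ^ m + a) (j * n ^ m + b)"
  "fold k z \<in> gb m (fdig i m a) (fdig j m b) \<longleftrightarrow> z \<in> gb (k + m) (i * n ^ m + a) (j * n ^ m + b)"
proof -
 have x: "real i <= fst z * pw k" "fst z * pw k <= real i + 1"
  and y: "real j <= snd z * pw k" "snd z * pw k <= real j + 1" using assms(1) unfolding gsq_def by auto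
 show "fold k z \<in> gs m (fdig i m a) (fdig j m b) \<longleftrightarrow> z \<in> gs (k + m) (i * n ^ m + a) (j * n ^ m + b)"
  using tri_scale(1)[OF x assms(2)] tri_scale(1)[OF y assms(3)]
  unfolding gsq_def mem_Collect_eq fold_def fst_conv snd_conv power_add mult.assoc[symmetric] by blast
 show "fold k z \<in> gb m (fdig i m a) (fdig j m b) \<longleftrightarrow> z \<in> gb (k + m) (i * n ^ m + a) (j * n ^ m + b)"
  using tri_scale(2)[OF x assms(2)] tri_scale(2)[OF y assms(3)]
  unfolding gbx_def mem_Collect_eq fold_def fst_conv snd_conv power_add mult.assoc[symmetric] by blast
qed

lemma idx_split: "(a::nat) = (a div n ^ m) * n ^ m + a mod n ^ m" "a mod n ^ m < n ^ m"
 by (simp only: div_mult_mod_eq) (rule mod_less_divisor, simp)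

lemma p_gap: "real p + 1 < real (n - 1 - p)"
using p2 of_nat_less_iff by simp

lemma fold_F: "z \<in> F ==> fold k z \<in> F"
 unfolding F_iff
proof
 fix m assume "\<forall>k. \<exists>i j. cl k i j & z \<in> gs k i j"
 then obtain a b where ab: "cl (k + m) a b" "z \<in> gs (k + m) a b" by blast
 define i j a' b' where "i = a div n ^ m" and "j = b div n ^ m" and "a' = a mod n ^ m" and "b' = b mod n ^ m"
 have e: "a = i * n ^ m + a'" "b = j * n ^ m + b'" "a' < n ^ m" "b' < n ^ m"
  unfolding i_def j_def a'_def b'_def using idx_split by auto
 have zi: "z \<in> gs k i j" using gsq_nest[of k m a b] ab(2) unfolding i_def j_def by blast
 have "cl m (fdig i m a') (fdig j m b')" using cell_fdig[OF e(3,4)] cell_compose[OF e(3,4), of k i j] ab(1) unfolding e(1,2) by blast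
 moreover have "fold k z \<in> gs m (fdig i m a') (fdig j m b')" using fold_gsq(1)[OF zi e(3,4)] ab(2) unfolding e(1,2) by blast
 ultimately show "\<exists>i j. cl m i j & fold k z \<in> gs m i j" by blast
qed

lemma fold_surj:
 assumes "w \<in> gs 0 0 0"
 shows "\<exists>z\<in>gs k i j. fold k z = w"
proof -
 define x where "x = (if even i then real i + fst w else real i + 1 - fst w)"
 define y where "y = (if even j then real j + snd w else real j + 1 - snd w)"
 have w: "0 <= fst w" "fst w <= 1" "0 <= snd w" "snd w <= 1" using assms unfolding gsq_def by auto
 have xy: "real i <= x" "x <= real i + 1" "real j <= y" "y <= real j + 1" unfolding x_def y_def using w by auto
 have c: "x / pw k * pw k = x" "y / pw k * pw k = y" using n5 by simp_all
 have "(x / pw k, y / pw k) \<in> gs k i j" unfolding gsq_def using xy c by simp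
 moreover have "fold k (x / pw k, y / pw k) = w"
  unfolding fold_def fst_conv snd_conv c tri_val[OF xy(1,2)] tri_val[OF xy(3,4)] unfolding x_def y_def by (simp add: prod_eq_iff)
 ultimately show ?thesis by blast
qed

lemma tri_inj:
 assumes "real i <= s" "s <= real i + 1" "real i <= t" "t <= real i + 1"
 shows "\<bar>tri s - tri t\<bar> = \<bar>s - t\<bar>"
 unfolding tri_val[OF assms(1,2)] tri_val[OF assms(3,4)] by auto

lemma fold_dist: "dist (fold k x) (fold k y) <= pw k * dist x y"
proof -
 have "\<bar>tri (s * pw k) - tri (t * pw k)\<bar> <= pw k * \<bar>s - t\<bar>" for s t
 proof -
  have "\<bar>s * pw k - t * pw k\<bar> = pw k * \<bar>s - t\<bar>" by (simp add: left_diff_distrib[symmetric] abs_mult)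
  thus ?thesis using tri_lip[of "s * pw k" "t * pw k"] by simp
 qed
 hence q: "(tri (s * pw k) - tri (t * pw k))^2 <= (pw k * (s - t))^2" for s t
  by (metis abs_mult abs_of_pos npow_pos abs_le_square_iff)
 have "dist (fold k x) (fold k y) <= sqrt ((pw k * (fst x - fst y))^2 + (pw k * (snd x - snd y))^2)"
  unfolding dist_prod_def fold_def dist_real_def by (simp add: add_mono q)
 also have "... = pw k * dist x y"
  unfolding dist_prod_def dist_real_def by (simp add: power_mult_distrib distrib_left[symmetric] real_sqrt_mult)
 finally show ?thesis .
qed

lemma fold_dist_eq:
 assumes "x \<in> gs k i j" "y \<in> gs k i j"
 shows "dist (fold k x) (fold k y) = pw k * dist x y"
proof -
 have q: "(tri (s * pw k) - tri (t * pw k))^2 = (pw k * (s - t))^2"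
  if "real i <= s * pw k" "s * pw k <= real i + 1" "real i <= t * pw k" "t * pw k <= real i + 1" for s t i
 proof -
  have "\<bar>tri (s * pw k) - tri (t * pw k)\<bar>\<^sup>2 = \<bar>s * pw k - t * pw k\<bar>\<^sup>2" unfolding tri_inj[OF that] ..
  thus ?thesis by (simp add: left_diff_distrib[symmetric] mult.commute)
 qed
 have "dist (fold k x) (fold k y) = sqrt ((pw k * (fst x - fst y))^2 + (pw k * (snd x - snd y))^2)"
  unfolding dist_prod_def fold_def dist_real_def fst_conv snd_conv power2_abs
  by (subst q[of i], use assms in "simp_all add: gsq_def", subst q[of j], simp_all add: power2_commute)
 also have "... = pw k * dist x y"
  unfolding dist_prod_def dist_real_def by (simp add: power_mult_distrib distrib_left[symmetric] real_sqrt_mult)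
 finally show ?thesis .
qed

lemma fold_inj: "inj_on (fold k) (gs k i j)"
proof (rule inj_onI)
 fix x y assume a: "x \<in> gs k i j" "y \<in> gs k i j" "fold k x = fold k y"
 hence "pw k * dist x y = 0" using fold_dist_eq[OF a(1,2)] by simp
 thus "x = y" using n5 by simp
qed

lemma fold_circ:
 assumes "a < n ^ m" "b < n ^ m"
 shows "fold k ` cr (k + m) (i * n ^ m + a) (j * n ^ m + b) = cr m (fdig i m a) (fdig j m b)"
proof
 have dv: "(i * n ^ m + a) div n ^ m = i" "(j * n ^ m + b) div n ^ m = j" using assms by (simp_all add: div_nat_eqI mult.commute)
 have sub: "gs (k + m) (i * n ^ m + a) (j * n ^ m + b) \<subseteq> gs k i j" using gsq_nest[of k m "i * n ^ m + a" "j * n ^ m + b"] unfolding dv .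
 show "fold k ` cr (k + m) (i * n ^ m + a) (j * n ^ m + b) \<subseteq> cr m (fdig i m a) (fdig j m b)"
 using image_subsetI sub fold_gsq[OF _ assms] by (auto simp: circ_def)
 show "cr m (fdig i m a) (fdig j m b) \<subseteq> fold k ` cr (k + m) (i * n ^ m + a) (j * n ^ m + b)"
 proof
  fix w assume w: "w \<in> cr m (fdig i m a) (fdig j m b)"
  have "w \<in> gs 0 0 0" using w gsq_unit[OF fdig_bound[OF assms(1)] fdig_bound[OF assms(2)]] unfolding circ_def by blast
  then obtain z where z: "z \<in> gs k i j" "fold k z = w" using fold_surj by blast
  have "z \<in> cr (k + m) (i * n ^ m + a) (j * n ^ m + b)"
   using fold_gsq[OF z(1) assms] w z(2) unfolding circ_def by blast
  thus "w \<in> fold k ` cr (k + m) (i * n ^ m + a) (j * n ^ m + b)" using z(2) by blast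
 qed
qed

text \<open>Inside one cell the fold is a similarity with factor n^k, and globally it is Lipschitz
  with the same constant. So ratios are controlled as soon as x and z share a cell, which is the
  reason for the pieces in \<open>tame_pullback\<close>.\<close>

lemma tame_fold:
 assumes "tame F u"
 shows "tame F (u \<circ> fold k)"
proof (rule tame_pullback[OF assms, where I = "{(i, j). cl k i j}" and P = "%(i, j). gs k i j"])
 show "fold k ` F \<subseteq> F" using fold_F by blast
 show "uniformly_continuous_on F (fold k)"
  unfolding uniformly_continuous_on_def
 proof (intro allI impI)
  fix e :: real assume e: "0 < e"
  show "\<exists>d>0. \<forall>x\<in>F. \<forall>x'\<in>F. dist x' x < d --> dist (fold k x') (fold k x) < e"
  proof (intro exI[of _ "e / pw k"] conjI ballI impI)
   fix x x' :: "pt" assume "dist x' x < e / pw k"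
   hence "pw k * dist x' x < e" by (simp add: pos_less_divide_eq mult.commute)
   thus "dist (fold k x') (fold k x) < e" using fold_dist[of k x' x] by simp
  qed (use e in simp)
 qed
 show "finite {(i, j). cl k i j}" by (rule finite_cells)
 show "F \<subseteq> (\<Union>i\<in>{(i, j). cl k i j}. case i of (i, j) => gs k i j)"
 using F_iff by auto
 fix L
 show "\<exists>L'. \<forall>i\<in>{(i, j). cl k i j}. \<forall>x\<in>F \<inter> (case i of (i, j) => gs k i j). \<forall>z\<in>F \<inter> (case i of (i, j) => gs k i j). \<forall>y\<in>F.
   dist x y <= L * dist x z --> dist (fold k x) (fold k y) <= L' * dist (fold k x) (fold k z)"
 proof (intro exI[of _ L] ballI impI)
  fix q x z y assume q: "q \<in> {(i, j). cl k i j}" "x \<in> F \<inter> (case q of (i, j) => gs k i j)" "z \<in> F \<inter> (case q of (i, j) => gs k i j)"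
   and d: "dist x y <= L * dist x z"
  obtain i j where ij: "q = (i, j)" by fastforce
  have e: "dist (fold k x) (fold k z) = pw k * dist x z" by (rule fold_dist_eq[of _ k i j]) (use q ij in auto)
  have "dist (fold k x) (fold k y) <= pw k * dist x y" by (rule fold_dist)
  also have "... <= pw k * (L * dist x z)" using d by (intro mult_left_mono) auto
  finally show "dist (fold k x) (fold k y) <= L * dist (fold k x) (fold k z)" unfolding e by (simp add: mult_ac)
 qed
qed

section \<open>Transplantation into a cell\<close>

definition transp :: "nat => nat => nat => (pt => real) => pt => real" where
 "transp k i j u z = (if z \<in> gs k i j then u (fold k z) else 1)"

lemma meets_cell:
 assumes "z \<in> cr l i' j'" "z \<in> gb k i j"
 obtains m where "l = k + Suc m" "i' div n ^ Suc m = i" "j' div n ^ Suc m = j"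
proof -
 have zs: "z \<in> gs l i' j'" "z \<notin> gb l i' j'" using assms(1) unfolding circ_def by auto
 from level_cases[of k l] show ?thesis
 proof cases
  case (le m)
  have z: "z \<in> gb (l + m) i j" using assms(2) le by simp
  have "i' = i div n ^ m" "j' = j div n ^ m" using gbx_gsq_idx[OF z zs(1)] by auto
  thus ?thesis using gbx_nest[of l m i j] z zs(2) by blast
 next
  case (gt m)
  have z: "z \<in> gs (k + Suc m) i' j'" using zs(1) gt by simp
  show ?thesis using that[OF gt] gsq_gbx_idx[OF z assms(2)] by blast
 qed
qed

lemma fold_boundary:
 assumes "z \<in> cr k i j"
 shows "fold k z \<in> OC"
proof -
 have f: "fdig i 0 0 = 0" for i unfolding fdig_def by simp
 have "fold k ` cr (k + 0) (i * n ^ 0 + 0) (j * n ^ 0 + 0) = cr 0 (fdig i 0 0) (fdig j 0 0)" by (rule fold_circ) auto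
 hence "fold k ` cr k i j = OC" unfolding OC_def f by simp
 thus ?thesis using assms by blast
qed

lemma transp_out:
 assumes u: "!!x. x \<in> OC ==> u x = 1" and z: "z \<notin> gb k i j"
 shows "transp k i j u z = 1"
using z u fold_boundary by (simp add: circ_def transp_def)

text \<open>A ball with carpet points inside and outside the cell contains a boundary point of the
  cell, since balls are convex, and that boundary lies in F. There the folded function has the value
  1, so the constant value outside adds no oscillation.\<close>

lemma transp_tame:
 assumes c: "cl k i j" and t: "tame F u" and u: "!!x. x \<in> OC ==> u x = 1"
 shows "tame F (transp k i j u)"
proof -
 define h where "h = u \<circ> fold k"
 have th: "tame F h" unfolding h_def by (rule tame_fold[OF t])
 define w where "w = transp k i j u"
 have wh: "w z = h z" if "z \<in> gs k i j" for z using that unfolding w_def transp_def h_def by simp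
 have hb: "h b = 1" if "b \<in> cr k i j" for b using u fold_boundary[OF that] unfolding h_def by simp
 have bF: "b \<in> F" if "b \<in> cr k i j" for b using circ_in_F[of k i j] c that by blast
 have o: "osc w (F \<inter> cball x r) <= osc h (F \<inter> cball x r)" for x r
 proof -
  define A where "A = F \<inter> cball x r"
  have AF: "A \<subseteq> F" unfolding A_def by blast
  have bh: "bounded (h ` A)" by (rule tame_bounded_sub[OF th AF])
  have h0: "0 <= osc h A" by (rule osc_nonneg[OF bh])
  have "osc w A <= osc h A"
  proof (cases "A \<subseteq> gs k i j | A \<inter> gb k i j = {}")
   case True
   thus ?thesis
   proof
    assume a: "A \<subseteq> gs k i j"
    have "osc w A = osc h A" by (rule osc_cong) (use a wh in blast)
    thus ?thesis by simp
   next
    assume a: "A \<inter> gb k i j = {}"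
    have "osc w A = 0"
    proof (rule osc_const)
     fix x assume "x \<in> A"
     hence "x \<notin> gb k i j" using a by blast
     thus "w x = 1" unfolding w_def by (intro transp_out u)
    qed
    thus ?thesis using h0 by simp
   qed
  next
   case False
   then obtain q y where q: "q \<in> A" "q \<in> gb k i j" and y: "y \<in> A" "y \<notin> gs k i j" by blast
   have seg: "closed_segment q y \<subseteq> cball x r"
    using q(1) y(1) convex_cball[of x r] unfolding A_def by (intro closed_segment_subset) auto
   have "closed_segment q y \<inter> frontier (gs k i j) ~= {}"
   proof (rule connected_Int_frontier)
    show "closed_segment q y \<inter> gs k i j ~= {}" using q(2) gbx_sub ends_in_segment by blast
    show "closed_segment q y - gs k i j ~= {}" using y(2) ends_in_segment by blast
   qed simp
   then obtain b where b: "b \<in> closed_segment q y" "b \<in> cr k i j" unfolding frontier_gsq by blast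
   have bA: "b \<in> A" using b seg bF unfolding A_def by blast
   have ex: "\<exists>z'\<in>A. w z = h z'" if "z \<in> A" for z
    by (metis wh w_def transp_def hb bA b(2) that)
   show ?thesis
   proof (rule osc_le[OF h0])
    fix z z' assume "z \<in> A" "z' \<in> A"
    then obtain y y' where "y \<in> A" "w z = h y" "y' \<in> A" "w z' = h y'" using ex by metis
    thus "w z - w z' <= osc h A" using osc_bound[OF bh, of y y'] by simp
   qed
  qed
  thus ?thesis unfolding A_def .
 qed
 have bw: "bounded (w ` F)"
 proof (rule bounded_subset)
  show "bounded (insert 1 (u ` F))" using tame_bounded[OF t] by simp
  show "w ` F \<subseteq> insert 1 (u ` F)" using fold_F unfolding w_def transp_def by auto
 qed
 have "tame F w"
 proof (rule tame_dom[OF th th _ bw, of 1 1])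
  fix x r assume "x \<in> F"
  have "0 <= osc h (F \<inter> cball x r)" by (rule osc_nonneg[OF tame_bounded_sub[OF th]]) auto
  thus "osc w (F \<inter> cball x r) <= 1 * (osc h (F \<inter> cball x r) + osc h (F \<inter> cball x r))" using o[of x r] by simp
 qed auto
 thus ?thesis unfolding w_def .
qed

text \<open>Circles that meet the open cell lie in the closed one and fold injectively onto circles
  of F; on all others the function is constantly 1. So the energy does not grow, while D may be any
  set missing the open cell.\<close>

lemma transp_adm:
 assumes c: "cl k i j" and u: "adm F (cr (Suc m) A B) OC u"
  and ab: "a < n ^ Suc m" "b < n ^ Suc m" "fdig i (Suc m) a = A" "fdig j (Suc m) b = B"
  and D: "D \<inter> gb k i j = {}"
 shows "adm F (cr (k + Suc m) (i * n ^ Suc m + a) (j * n ^ Suc m + b)) D (transp k i j u)"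
  "en F (transp k i j u) <= en F u"
proof -
 define w where "w = transp k i j u"
 have u1: "u x = 1" if "x \<in> OC" for x using admD(4)[OF u that] .
 have tw: "tame F w" unfolding w_def by (rule transp_tame[OF c admD(1)[OF u] u1])
 have bd: "(\<Sum>E\<in>S. (osc w E)^2) <= en F u" if S: "finite S" "S \<subseteq> circles F" for S
 proof -
  define S' where "S' = {E \<in> S. E \<inter> gb k i j ~= {}}"
  have in1: "E \<subseteq> gs k i j & fold k ` E \<in> circles F" if E: "E \<in> S'" for E
  proof -
   obtain z where z: "z \<in> E" "z \<in> gb k i j" and EF: "E \<in> circles F" using E S unfolding S'_def by blast
   obtain l i' j' where ix: "(l, i', j') \<in> ixs" "E = cr l i' j'" using circles_ix[OF EF] .
   have zc: "z \<in> cr l i' j'" using z ix by simp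
   obtain q where q: "l = k + Suc q" "i' div n ^ Suc q = i" "j' div n ^ Suc q = j" using meets_cell[OF zc z(2)] .
   define a' b' where "a' = i' mod n ^ Suc q" and "b' = j' mod n ^ Suc q"
   have e: "i' = i * n ^ Suc q + a'" "j' = j * n ^ Suc q + b'" "a' < n ^ Suc q" "b' < n ^ Suc q"
    using idx_split[of i' "Suc q"] idx_split[of j' "Suc q"] q unfolding a'_def b'_def by auto
   have "hl (k + Suc q) i' j'" using ix(1) q(1) unfolding ixs_def by auto
   hence "hl (Suc q) a' b'" using hole_compose[OF e(3,4), of k i j] unfolding e(1,2) by blast
   hence h: "hl (Suc q) (fdig i (Suc q) a') (fdig j (Suc q) b')" using hole_fdig[OF e(3,4)] by blast
   have "fold k ` E = cr (Suc q) (fdig i (Suc q) a') (fdig j (Suc q) b')"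
    using fold_circ[OF e(3,4), of k i j] unfolding ix(2) q(1) e(1,2) .
   hence "fold k ` E \<in> circles F" using hole_circle[OF h] by simp
   moreover have "E \<subseteq> gs k i j" using gsq_nest[of k "Suc q" i' j'] unfolding q(2,3) ix(2) q(1) circ_def by blast
   ultimately show ?thesis by blast
  qed
  have inj: "inj_on ((`) (fold k)) S'"
  proof (rule inj_onI)
   fix E E' assume "E \<in> S'" "E' \<in> S'" "fold k ` E = fold k ` E'"
   thus "E = E'" using inj_on_image_eq_iff[OF fold_inj, of E k i j E'] in1 by blast
  qed
  have ow: "osc w E = osc u (fold k ` E)" if "E \<in> S'" for E
  proof -
   have "osc w E = osc (u \<circ> fold k) E" by (rule osc_cong) (use in1[OF that] in "auto simp: w_def transp_def")
   thus ?thesis by (simp add: osc_comp)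
  qed
  have ow0: "osc w E = 0" if "E \<in> S - S'" for E
  proof (rule osc_const)
   fix x assume "x \<in> E"
   hence "x \<notin> gb k i j" using that unfolding S'_def by blast
   thus "w x = 1" unfolding w_def by (intro transp_out u1)
  qed
  have "(\<Sum>E\<in>S. (osc w E)^2) = (\<Sum>E\<in>S'. (osc w E)^2)"
   by (rule sum.mono_neutral_right) (use S ow0 in "auto simp: S'_def")
  also have "... = (\<Sum>E\<in>(`) (fold k) ` S'. (osc u E)^2)" by (simp add: sum.reindex[OF inj] ow)
  also have "... <= en F u" unfolding en_def
   by (rule sum_le_ns[OF admD(2)[OF u]]) (use in1 S in "auto simp: S'_def")
  finally show ?thesis .
 qed
 have l: "l2 (circles F) (osc w)" by (rule l2I[OF bd])
 show "en F (transp k i j u) <= en F u" using ns_le[OF l bd] unfolding en_def w_def by blast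
 have C0: "w x = 0" if x: "x \<in> cr (k + Suc m) (i * n ^ Suc m + a) (j * n ^ Suc m + b)" for x
 proof -
  have dv: "(i * n ^ Suc m + a) div n ^ Suc m = i" "(j * n ^ Suc m + b) div n ^ Suc m = j" using ab(1,2) by (simp_all add: div_nat_eqI mult.commute)
  have "x \<in> gs k i j" using x gsq_nest[of k "Suc m" "i * n ^ Suc m + a" "j * n ^ Suc m + b"] unfolding dv circ_def by blast
  moreover have "fold k x \<in> cr (Suc m) A B" using fold_circ[OF ab(1,2), of k i j] x unfolding ab(3,4) by blast
  ultimately show ?thesis unfolding w_def transp_def using admD(3)[OF u] by simp
 qed
 have D1: "w x = 1" if "x \<in> D" for x
 proof -
  have "x \<notin> gb k i j" using that D by blast
  thus ?thesis unfolding w_def by (intro transp_out u1)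
 qed
 show "adm F (cr (k + Suc m) (i * n ^ Suc m + a) (j * n ^ Suc m + b)) D (transp k i j u)"
  unfolding adm_def using tw l C0 D1 unfolding w_def by blast
qed

section \<open>Capacities of arbitrary pairs of circles\<close>

lemma circle_compact: "E \<in> circles F ==> compact E"
proof -
 assume E: "E \<in> circles F"
 obtain k i j where "E = cr k i j" using circles_ix[OF E] by blast
 hence "E = gs k i j \<inter> - gb k i j" unfolding circ_def by auto
 thus ?thesis using closed_gsq open_gbx bounded_gsq
  by (metis closed_Int closed_Compl compact_Int_closed compact_eq_bounded_closed)
qed

lemma adm_exists:
 assumes C: "C \<in> circles F" and D: "D \<in> circles F" and ne: "C ~= D"
 shows "\<exists>g. adm F C D g"
proof -
 have "C \<inter> D = {}" using circles_disjoint[OF C D] ne by blast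
 then obtain d where d: "0 < d" "!!x y. x \<in> C ==> y \<in> D ==> d <= dist x y"
  using separate_compact_closed[OF circle_compact[OF C] compact_imp_closed[OF circle_compact[OF D]]] by blast
 have C0: "C ~= {}" using circle_ne[OF C] by blast
 define g where "g = (%z. min 1 (infdist z C / d))"
 have lip: "\<bar>g x - g y\<bar> <= (1 / d) * (\<bar>fst x - fst y\<bar> + \<bar>snd x - snd y\<bar>)" for x y
 proof -
  have "\<bar>g x - g y\<bar> <= \<bar>infdist x C / d - infdist y C / d\<bar>" unfolding g_def by auto
  also have "... = \<bar>infdist x C - infdist y C\<bar> / d" using d(1) by (simp add: diff_divide_distrib[symmetric])
  also have "... <= dist x y / d" using infdist_triangle_abs[of x C y] d(1) by (intro divide_right_mono) auto
  also have "... <= (\<bar>fst x - fst y\<bar> + \<bar>snd x - snd y\<bar>) / d"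
  using divide_right_mono sqrt_sum_squares_le_sum_abs[of "fst x - fst y" "snd x - snd y"] d
 by (fastforce simp: dist_prod_def dist_real_def)
  finally show ?thesis by simp
 qed
 note L = lipschitz_tame[OF _ lip]
 have "g x = 0" if "x \<in> C" for x using that unfolding g_def by simp
 moreover have "g x = 1" if "x \<in> D" for x
 proof -
  have "d <= infdist x C" unfolding infdist_notempty[OF C0]
   by (rule cINF_greatest[OF C0]) (use d(2) that in "simp add: dist_commute")
  thus ?thesis using d(1) unfolding g_def by simp
 qed
 ultimately show ?thesis unfolding adm_def using L(1,3) d(1) by (intro exI[of _ g]) auto
qed

lemma pot_qsi:
 assumes q: "qsi F F f g" and P: "pot C D u rho v"
 shows "pot (g ` C) (g ` D) (%k. u k \<circ> f) (%E. rho (f ` E)) (%k. v k \<circ> f)"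
proof -
 obtain s c0 where s: "s = 1 | s = -1" "v = (%k x. s * (u k x - c0))" and ml: "mlim F C D u rho"
  and cCD: "C \<in> circles F" "D \<in> circles F" using P unfolding pot_def by blast
 have h: "homeomorphism F F g f" using qsi_homeo[OF q] homeomorphism_symD by blast
 have "mlim F (g ` C) (g ` D) (%k. u k \<circ> f) (%E. rho (f ` E))"
  by (rule mlim_qsi[OF q compact_F compact_F circles_sub[OF cCD(1)] circles_sub[OF cCD(2)] ml])
 moreover have "(%k. v k \<circ> f) = (%k x. s * ((u k \<circ> f) x - c0))" unfolding s(2) by (simp add: comp_def)
 ultimately show ?thesis unfolding pot_def using circles_homeo[OF h] cCD s(1) by blast
qed

lemma flx_OC: "flx ` OC = OC"
 unfolding OC_def using flx_circ[of 0 0 0] by simp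

lemma sw_OC: "sw ` OC = OC"
 unfolding OC_def by (rule sw_circ)

text \<open>\<open>v\<close> vanishes outside the open cell Q around C. Along the row of C, the
  nearest circle blocking the row to the left of Q, or the outer circle if there is none, is dead,
  and \<open>row_lemma\<close> runs from it to C. The last two assumptions keep D from being that
  circle.\<close>

lemma left_lemma:
 assumes P: "pot C D u rho v" and h: "hl (Suc k) ci cj" and k: "1 <= k" and Cdef: "C = cr (Suc k) ci cj"
  and v0: "!!m x. x \<in> F ==> 0 <= v m x" and vz: "!!m x. x \<in> F ==> x \<notin> gb k (ci div n) (cj div n) ==> v m x = 0"
  and L: "live v C" and D: "D \<inter> gb k (ci div n) (cj div n) = {}"
  and DO: "D = OC ==> ci div n ~= 0"
  and DL: "D ~= OC ==> \<exists>x\<in>D. real (ci div n) < fst x * pw k"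
 shows False
proof -
 define qi qj where "qi = ci div n" and "qj = cj div n"
 have cQ: "cl k qi qj" and hd: "hdig n p (ci mod n)" "hdig n p (cj mod n)" using h unfolding qi_def qj_def by auto
 have cD: "D \<in> circles F" and cC: "C \<in> circles F" and ml: "mlim F C D u rho" using P unfolding pot_def by auto
 have cij: "ci < n ^ Suc k" "cj < n ^ Suc k" using hole_bound[OF h] by auto
 have ci1: "qi * n < ci"
 proof -
  have "ci = qi * n + ci mod n" unfolding qi_def by simp
  thus ?thesis using hdig_bounds[OF hd(1)] by linarith
 qed
 have cin: "ci < qi * n + n"
 proof -
  have "ci = qi * n + ci mod n" unfolding qi_def by simp
  moreover have "ci mod n < n" using n5 by simp
  ultimately show ?thesis by linarith
 qed
 have qn: "qi * n < n ^ Suc k" using ci1 cij(1) by linarith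
 have left: "dead rho v A" if A: "A \<in> circles F" "!!x. x \<in> A ==> fst x * pw k <= real qi | x \<in> OC" for A
  unfolding dead_def
 proof
  have z: "v m x = 0" if "x \<in> A" for m x
  proof (rule vz)
   show xF: "x \<in> F" using that circles_sub[OF A(1)] by blast
   show "x \<notin> gb k (ci div n) (cj div n)"
   using gbx_nest[of 0 k qi qj] cell_bound[OF cQ] A(2)[OF that] by (auto simp: OC_def circ_def qi_def qj_def gbx_def)
  qed
  have "osc (u m) A = 0" for m
   unfolding pot_osc(1)[OF P A(1), symmetric] by (rule osc_const) (rule z)
  hence "(%m. 0) \<longlonglongrightarrow> rho A" using mlim_point[OF ml A(1)] by simp
  thus "rho A = 0" using LIMSEQ_unique tendsto_const by blast
  show "\<forall>eps>0. \<exists>\<^sub>F m in sequentially. \<forall>x\<in>A. v m x <= eps" using z by (simp add: less_imp_le)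
 qed
 have cellcol: "cl (Suc k) c cj | hl (Suc k) c cj" if "qi * n <= c" "c < ci" for c
 proof -
  have "qi * n <= c" "c < qi * n + n" using that cin by linarith+
  hence "c div n = qi" by (intro div_nat_eqI) (auto simp: mult.commute)
  thus ?thesis using cQ hd unfolding qj_def by auto
 qed
 have noD: "~ D \<subseteq> strip (Suc k) a ci cj" for a
 proof
  assume s: "D \<subseteq> strip (Suc k) a ci cj"
  show False
  proof (cases "D = OC")
   case True
   have "(1, 1) \<in> OC" unfolding OC_iff by simp
   hence "pw (Suc k) <= real ci" using s True unfolding strip_def by auto
   thus False using cij(1) by (metis not_less of_nat_le_iff of_nat_power)
  next
   case False
   then obtain x where x: "x \<in> D" "real qi < fst x * pw k" using DL unfolding qi_def by blast
   have xs: "fst x * pw (Suc k) <= real ci" "real cj < snd x * pw (Suc k)" "snd x * pw (Suc k) < real cj + 1"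
    using s x(1) unfolding strip_def by auto
   have sy: "real cj < snd x * pw (k + 1)" "snd x * pw (k + 1) < real cj + 1" using xs(2,3) by simp_all
   have "real qj < snd x * pw k & snd x * pw k < real qj + 1"
    using div_scale_strict[OF sy] unfolding qj_def by simp
   moreover have "fst x * pw k < real qi + 1"
   proof -
    have "ci < (qi + 1) * n" using cin by simp
    hence "real ci < (real qi + 1) * real n" by (metis of_nat_less_iff of_nat_mult of_nat_add of_nat_1)
    moreover have "fst x * pw (Suc k) = fst x * pw k * real n" by simp
    ultimately have "fst x * pw k * real n < (real qi + 1) * real n" using xs(1) by linarith
    thus ?thesis using nR(1) by (simp only: mult_less_cancel_right_pos)
   qed
   ultimately have "x \<in> gb k qi qj" using x(2) unfolding gbx_def by simp
   thus False using D x(1) unfolding qi_def qj_def by blast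
  qed
 qed
 have noC: "~ C \<subseteq> strip (Suc k) a ci cj" for a
 using corner_in_circ' Cdef power_Suc by (force simp: strip_def)
 have fin: False if A: "lface (Suc k) a cj A" "dead rho v A" "A ~= D" "a <= qi * n"
  and cols: "!!c. a <= c ==> c < qi * n ==> cl (Suc k) c cj" for a A
 proof -
  have AC: "A ~= C" using live_not_dead[OF L] A(2) circle_ne[OF cC] by blast
  have rf: "rface (Suc k) ci cj C" using hole_rface[OF h, of cj 0] unfolding Cdef by simp
  show False
  proof (rule row_lemma[OF P rf L _ cij(2) noC noD _ _ A(1,2) AC A(3) order_refl])
   show "ci <= n ^ Suc k" "a <= ci" using cij ci1 A(4) by auto
   fix l m c assume c: "a <= c" "c < ci" and l: "Suc k = l + m" and hh: "hl l (c div n ^ m) (cj div n ^ m)"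
   have nc: "~ cl (Suc k) c cj" using cell_prefix[of l m c cj] hole_not_cell[OF hh] l by auto
   hence cq: "qi * n <= c" using cols c by (meson not_le)
   hence hc: "hl (Suc k) c cj" using cellcol[OF cq c(2)] nc by blast
   have cdiv: "c div n = qi"
   using c(2) cin cq div_nat_eqI mult.commute by (simp add: field_simps)
   \<comment> \<open>A hole of smaller level would contain the cell Q.\<close>
   have m0: "m = 0"
   proof (rule ccontr)
    assume "m ~= 0"
    then obtain m' where m': "m = Suc m'" by (cases m) auto
    hence kl: "k = l + m'" using l by simp
    have "cl l (qi div n ^ m') (qj div n ^ m')" using cell_prefix[of l m' qi qj] cQ unfolding kl by blast
    moreover have "c div n ^ m = qi div n ^ m'" "cj div n ^ m = qj div n ^ m'"
     unfolding m' cdiv[symmetric] qj_def by (simp_all add: div_mult2_eq)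
    ultimately show False using hh hole_not_cell by auto
   qed
   hence lk: "l = Suc k" using l by simp
   have "C \<inter> blk (Suc k) c cj = {}"
   proof (rule ccontr)
    assume "C \<inter> blk (Suc k) c cj ~= {}"
    then obtain z where z: "z \<in> cr (Suc k) ci cj" "z \<in> blk (Suc k) c cj" unfolding Cdef by blast
    have "(Suc k, ci, cj) \<in> ixs" using h unfolding ixs_def by blast
    hence "ci = c" using blk_circles[OF hc _ z] by blast
    thus False using c by simp
   qed
   moreover have "D \<inter> blk (Suc k) c cj = {}"
    using blk_parent[OF hc] D unfolding cdiv qi_def[symmetric] by blast
   ultimately show "clear v C D (blk l (c div n ^ m) (cj div n ^ m))"
    using v0 unfolding m0 lk by simp
  qed (rule v0)
 qed
 show False
 proof (cases "qi = 0")
  case True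
  have "dead rho v OC" by (rule left[OF OC_circle]) auto
  moreover have "OC ~= D" using DO True unfolding qi_def by auto
  ultimately show False using fin[OF OC_lface[OF cij(2)]] True by simp
 next
  case False
  \<comment> \<open>The last column before Q that is not a cell. One exists: as cj has a hole digit,
    column n - 1 - p of the square adjoining Q on the left is not a cell.\<close>
  define c where "c = (GREATEST c. c < qi * n & ~ cl (Suc k) c cj)"
  have ex: "qi * n - 1 - p < qi * n & ~ cl (Suc k) (qi * n - 1 - p) cj"
  proof
   have q: "qi * n - 1 - p = (qi - 1) * n + (n - 1 - p)" using False p2 by (cases qi) auto
   have md: "(qi * n - 1 - p) mod n = n - 1 - p" "n - 1 - p < n" unfolding q using n5 by auto
   show "qi * n - 1 - p < qi * n" using False n5 by simp
   have "hdig n p ((qi * n - 1 - p) mod n)" unfolding md hdig_def by simp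
   thus "~ cl (Suc k) (qi * n - 1 - p) cj" using hd by simp
  qed
  have cg: "c < qi * n" "~ cl (Suc k) c cj" and cm: "!!d. d < qi * n ==> c < d ==> cl (Suc k) d cj"
  proof -
   have "c < qi * n & ~ cl (Suc k) c cj" unfolding c_def
    by (rule GreatestI_nat[where P = "%c. c < qi * n & ~ cl (Suc k) c cj", OF ex, of "qi * n"]) auto
   thus "c < qi * n" "~ cl (Suc k) c cj" by auto
   show "cl (Suc k) d cj" if "d < qi * n" "c < d" for d
   using Greatest_le_nat[where P = "%c. c < qi * n & ~ cl (Suc k) c cj", of _ "qi * n"] that
    by (fastforce simp: c_def)
  qed
  have "c < n ^ Suc k" using cg(1) qn by linarith
  then obtain l m where l: "Suc k = l + m" and hh: "hl l (c div n ^ m) (cj div n ^ m)"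
   using noncell_in_hole[OF _ cij(2) cg(2)] by blast
  define hi where "hi = c div n ^ m"
  define H where "H = cr l hi (cj div n ^ m)"
  have hH: "hl l hi (cj div n ^ m)" using hh unfolding hi_def .
  have lf: "lface (Suc k) ((hi + 1) * n ^ m) cj H" using hole_lface[OF hH, of cj m] unfolding H_def l by simp
  have c2: "c < (hi + 1) * n ^ m"
  proof -
   have "c = hi * n ^ m + c mod n ^ m" unfolding hi_def by (rule idx_split)
   moreover have "c mod n ^ m < n ^ m" by (rule idx_split)
   ultimately show ?thesis unfolding distrib_right mult_1 by linarith
  qed
  have le: "(hi + 1) * n ^ m <= qi * n"
  proof (rule ccontr)
   assume a: "~ ?thesis"
   have "hi * n ^ m <= c" unfolding hi_def using idx_split(1)[of c m] by linarith
   hence "(qi * n) div n ^ m = hi" using a cg(1) by (intro div_nat_eqI) (auto simp: mult.commute)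
   hence "~ cl (Suc k) (qi * n) cj" using cell_prefix[of l m "qi * n" cj] hole_not_cell[OF hH] unfolding l by auto
   moreover have "(qi * n) div n = qi" "(qi * n) mod n = 0" using n5 by auto
   ultimately show False using cQ hdig_0(1) unfolding qj_def by auto
  qed
  have Hx: "fst x * pw k <= real qi" if "x \<in> H" for x
  proof -
   have "fst x * pw l <= real hi + 1" using that unfolding H_def circ_def gsq_def by auto
   hence "fst x * pw l * pw m <= (real hi + 1) * pw m" by (intro mult_right_mono) auto
   also have "... = real ((hi + 1) * n ^ m)" by (simp add: distrib_right)
   also have "... <= real (qi * n)" using le by (simp only: of_nat_le_iff)
   finally have "fst x * pw (Suc k) <= real qi * real n" unfolding l power_add by (simp add: mult.assoc)
   hence "fst x * pw k * real n <= real qi * real n" by (simp add: mult_ac)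
   thus ?thesis using nR(1) by (simp only: mult_le_cancel_right_pos)
  qed
  have cH: "H \<in> circles F" unfolding H_def by (rule hole_circle[OF hH])
  have dH: "dead rho v H" by (rule left[OF cH]) (use Hx in blast)
  have "H ~= D"
  using hole_ne_OC[OF hH] DL Hx H_def qi_def by (smt (verit))
  thus False using fin[OF lf dH _ le] cm c2 by simp
 qed
qed

section \<open>Maximal capacity\<close>

definition Ms :: "pt set set" where
 "Ms = {cr 1 a b | a b. hdig n p a & hdig n p b}"

definition m0 :: real where "m0 = cap F (cr 1 p p) OC"

lemma hdig_less: "hdig n p a ==> a < n"
 using hdig_bounds[of a] by linarith

lemma hole1_iff: "hl 1 a b \<longleftrightarrow> hdig n p a & hdig n p b & a < n & b < n"
using n5 div_eq_0_iff hdig_less by auto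

lemma hole1: "hdig n p a ==> hdig n p b ==> hl 1 a b"
 unfolding hole1_iff using hdig_less by blast

lemma hdigs [simp]: "hdig n p p" "hdig n p (n - Suc p)"
 unfolding hdig_def by auto

lemma cap_flx:
 assumes "C \<in> circles F" "D \<in> circles F" "C ~= D"
 shows "cap F (flx ` C) (flx ` D) = cap F C D" "cap F (sw ` C) (sw ` D) = cap F C D"
proof -
 obtain g where "adm F C D g" using adm_exists[OF assms] by blast
 thus "cap F (flx ` C) (flx ` D) = cap F C D" "cap F (sw ` C) (sw ` D) = cap F C D"
  using cap_qsi[OF qsi_flx compact_F compact_F _ circles_sub[OF assms(1)] circles_sub[OF assms(2)]]
   cap_qsi[OF qsi_sw compact_F compact_F _ circles_sub[OF assms(1)] circles_sub[OF assms(2)]] by blast+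
qed

lemma cap_Ms:
 assumes "M \<in> Ms"
 shows "cap F M OC = m0"
proof -
 obtain a b where ab: "hdig n p a" "hdig n p b" "M = cr 1 a b" using assms unfolding Ms_def by blast
 have f: "cap F (cr 1 (n - 1 - a) b) OC = cap F (cr 1 a b) OC" if h: "hdig n p a" "hdig n p b" for a b
  using cap_flx(1)[OF hole_circle[OF hole1[OF h]] OC_circle hole_ne_OC[OF hole1[OF h]]] flx_circ[of a 1 b] hdig_less[OF h(1)] flx_OC by simp
 have s: "cap F (cr 1 b a) OC = cap F (cr 1 a b) OC" if h: "hdig n p a" "hdig n p b" for a b
  using cap_flx(2)[OF hole_circle[OF hole1[OF h]] OC_circle hole_ne_OC[OF hole1[OF h]]] sw_circ[of 1 a b] sw_OC by simp
 have p1: "cap F (cr 1 a b) OC = cap F (cr 1 p b) OC"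
  using ab(1,2) f[of p b] unfolding hdig_def by auto
 have p2: "cap F (cr 1 b p) OC = cap F (cr 1 p p) OC"
  using ab(2) f[of p p] unfolding hdig_def by auto
 show ?thesis unfolding ab(3) m0_def p1 using p2 s[of p b] ab(2) by simp
qed

text \<open>Otherwise the transplant of a minimising sequence for a first-level circle and the outer
  circle would be minimising for C and D. It is constant outside the parent cell of C, hence has
  dead circles next to it, which \<open>left_lemma\<close> refutes, possibly after a
  reflection.\<close>

lemma strict:
 assumes h: "hl (Suc k) ci cj" and k: "1 <= k" and cD: "D \<in> circles F" and D: "D \<inter> gb k (ci div n) (cj div n) = {}"
 shows "cap F (cr (Suc k) ci cj) D < m0"
proof (rule ccontr)
 define C where "C = cr (Suc k) ci cj"
 assume "~ cap F (cr (Suc k) ci cj) D < m0"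
 hence ge: "m0 <= cap F C D" unfolding C_def by simp
 define i j a b where "i = ci div n" and "j = cj div n" and "a = ci mod n" and "b = cj mod n"
 have cQ: "cl k i j" and hd: "hdig n p a" "hdig n p b" using h unfolding i_def j_def a_def b_def by auto
 have cC: "C \<in> circles F" unfolding C_def by (rule hole_circle[OF h])
 have ab: "a < n ^ Suc 0" "b < n ^ Suc 0" using hdig_less hd by auto
 define A B where "A = fdig i (Suc 0) a" and "B = fdig j (Suc 0) b"
 have hA: "hdig n p A" "hdig n p B" unfolding A_def B_def fdig_def using hd ab hdig_flip by auto
 have MM: "cr (Suc 0) A B \<in> Ms" unfolding Ms_def using hA by auto
 have ix: "ci = i * n ^ Suc 0 + a" "cj = j * n ^ Suc 0 + b" unfolding i_def j_def a_def b_def by simp_all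
 have h1: "hl (Suc 0) A B" using hole1[OF hA] by simp
 obtain g where "adm F (cr (Suc 0) A B) OC g" using adm_exists[OF hole_circle[OF h1] OC_circle hole_ne_OC[OF h1]] by blast
 then obtain u where u: "minseq F (cr (Suc 0) A B) OC u" using minseq_exists by blast
 define w where "w = (%m. transp k i j (u m))"
 have au: "adm F (cr (Suc 0) A B) OC (u m)" for m by (rule minseqD(1)[OF u])
 have D': "D \<inter> gb k i j = {}" using D unfolding i_def j_def .
 have Cc: "cr (k + Suc 0) (i * n ^ Suc 0 + a) (j * n ^ Suc 0 + b) = C" unfolding C_def ix(1)[symmetric] ix(2)[symmetric] by simp
 have aw: "adm F C D (w m)" "en F (w m) <= en F (u m)" for m
  using transp_adm[OF cQ au ab _ _ D', of m] unfolding Cc w_def A_def B_def by auto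
 have u1: "x \<in> OC ==> u m x = 1" for m x using admD(4)[OF au] .
 have w01: "0 <= w m x" "w m x <= 1" if "x \<in> F" for m x
  using minseqD(2,3)[OF u fold_F[OF that]] unfolding w_def transp_def by auto
 have mw: "minseq F C D w"
 proof (rule minseqI[OF aw(1) w01])
  have "cap F (cr (Suc 0) A B) OC = m0" by (rule cap_Ms[OF MM])
  thus "(%m. en F (u m) - m0) \<longlonglongrightarrow> 0" using minseqD(4)[OF u] by (simp add: LIM_zero)
  show "en F (w m) <= cap F C D + (en F (u m) - m0)" for m using aw(2)[of m] ge by simp
 qed auto
 obtain rho where ml: "mlim F C D w rho" using mlim_exists[OF mw] .
 define v where "v = (%m x. -1 * (w m x - 1))"
 have P: "pot C D w rho v" unfolding pot_def v_def using ml cC cD by blast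
 have v0: "0 <= v m x" if "x \<in> F" for m x using w01[OF that, of m] unfolding v_def by simp
 have vz: "v m x = 0" if "x \<notin> gb k i j" for m x
 using transp_out u1 that by (simp add: w_def v_def)
 have vC: "v m x = 1" if "x \<in> C" for m x using admD(3)[OF aw(1) that] unfolding v_def by simp
 show False
 proof (cases "(D = OC --> i ~= 0) & (D ~= OC --> (\<exists>x\<in>D. real i < fst x * pw k))")
  case True
  have L: "live v C" unfolding live_def using vC by (intro exI[of _ 1]) auto
  show False
   by (rule left_lemma[OF P h k C_def v0 _ L D]) (use True vz in "auto simp: i_def[symmetric] j_def[symmetric]")
 next
  \<comment> \<open>D does not reach beyond the left side of the cell, or D is the outer circle and
    the cell is at the left edge. Reflection puts the free side to the left; k >= 1 keeps the cell
    from touching both edges.\<close>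
  case False
  define ci' where "ci' = n ^ Suc k - 1 - ci"
  have cib: "ci < n ^ Suc k" using hole_bound[OF h] by simp
  have ik: "i < n ^ k" using cell_bound[OF cQ] by simp
  have i': "ci' div n = n ^ k - 1 - i"
   using flip_divmod(1)[of ci "n ^ k"] cib unfolding ci'_def i_def by simp
  have h': "hl (Suc k) ci' cj" unfolding ci'_def using hole_flip[OF cib] h by blast
  have C': "flx ` C = cr (Suc k) ci' cj" unfolding C_def ci'_def by (rule flx_circ[OF cib])
  have P': "pot (flx ` C) (flx ` D) (%k. w k \<circ> flx) (%E. rho (flx ` E)) (%k. v k \<circ> flx)" by (rule pot_qsi[OF qsi_flx P])
  have g: "flx x \<in> gb k i j \<longleftrightarrow> x \<in> gb k (n ^ k - 1 - i) j" for x using flx_gbx[OF ik, of "flx x" j] by simp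
  have L': "live (%k. v k \<circ> flx) (flx ` C)" unfolding live_def using vC by (intro exI[of _ 1]) auto
  have inv: "flx ` D = OC \<longleftrightarrow> D = OC"
  proof
   assume "flx ` D = OC"
   hence "flx ` flx ` D = flx ` OC" by simp
   thus "D = OC" unfolding flx_OC image_image by simp
  qed (simp add: flx_OC)
  show False
  proof (rule left_lemma[OF P' h' k C' _ _ L'])
   show "0 <= (v m \<circ> flx) x" if "x \<in> F" for m x using v0[OF flx_F[OF that]] by simp
   show "(v m \<circ> flx) x = 0" if "x \<notin> gb k (ci' div n) (cj div n)" for m x
    using vz[of "flx x"] that g unfolding i' j_def[symmetric] by simp
   show "flx ` D \<inter> gb k (ci' div n) (cj div n) = {}"
   proof (rule ccontr)
    assume "flx ` D \<inter> gb k (ci' div n) (cj div n) ~= {}"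
    then obtain d where d: "d \<in> D" "flx d \<in> gb k (ci' div n) (cj div n)" by blast
    have "flx (flx d) \<in> gb k i j" using g[of "flx d"] d(2) unfolding i' j_def[symmetric] by blast
    thus False using D' d(1) by auto
   qed
   show "ci' div n ~= 0" if "flx ` D = OC"
   proof -
    have "i = 0" using that False inv by auto
    moreover have "n ^ 1 <= n ^ k" using k n5 by (intro power_increasing) auto
    ultimately show ?thesis unfolding i' using n5 by simp
   qed
   show "\<exists>x\<in>flx ` D. real (ci' div n) < fst x * pw k" if "flx ` D ~= OC"
   proof -
    obtain x where x: "x \<in> D" using circle_ne[OF cD] by blast
    hence "fst x * pw k <= real i" using False that inv by auto
    moreover have "real (n ^ k - 1 - i) = pw k - 1 - real i" using ik by (simp add: of_nat_diff Suc_leI)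
    ultimately have "real (ci' div n) < fst (flx x) * pw k" unfolding i' flx_def by (simp add: left_diff_distrib)
    thus ?thesis using x by blast
   qed
  qed
 qed
qed

text \<open>Siblings escape the comparison, because a transplant into their common parent cell does
  not keep the value 1 on D.\<close>

definition sib :: "pt set => pt set => bool" where
 "sib C D \<longleftrightarrow> (\<exists>k a b a' b'. hl (Suc k) a b & hl (Suc k) a' b' & a div n = a' div n & b div n = b' div n &
   C = cr (Suc k) a b & D = cr (Suc k) a' b')"

lemma sib_sym: "sib C D ==> sib D C"
 unfolding sib_def by metis

text \<open>With C the deeper circle, D may miss the open parent cell of C; then
  \<open>strict\<close> leaves only the unit square as that cell, so D is the outer circle.
  Otherwise D lies in the cell and, not being deeper than C, is a sibling.\<close>

lemma high_cap:
 assumes C: "C \<in> circles F" and D: "D \<in> circles F" and ne: "C ~= D" and ge: "m0 <= cap F C D"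
 shows "sib C D | (C = OC & D \<in> Ms) | (D = OC & C \<in> Ms)"
proof -
 have main: "sib C D | (D = OC & C \<in> Ms)"
  if ix: "(l, i, j) \<in> ixs" "C = cr l i j" and ix': "(l', i', j') \<in> ixs" "D = cr l' i' j'" and le: "l' <= l"
   and ne: "C ~= D" and ge: "m0 <= cap F C D" for C D l i j l' i' j'
 proof -
  have cD: "D \<in> circles F" unfolding circles_F using ix' by force
  show ?thesis
  proof (cases l)
   case 0
   hence "C = D" using ix ix' le unfolding ixs_def by auto
   thus ?thesis using ne by blast
  next
   case (Suc k)
   have h: "hl (Suc k) i j" using ix Suc unfolding ixs_def by auto
   show ?thesis
   proof (cases "D \<inter> gb k (i div n) (j div n) = {}")
    case True
    have k: "k = 0" using strict[OF h _ cD True] ge ix(2) Suc by force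
    have "l' ~= Suc 0"
    proof
     assume l': "l' = Suc 0"
     hence h': "hl 1 i' j'" using ix' unfolding ixs_def by auto
     have "cr 1 i' j' \<subseteq> gb 0 0 0" using hole_inside[of 0 0 i' j'] h' hole_bound[OF h'] unfolding circ_def by auto
     moreover have "i div n = 0" "j div n = 0" using h unfolding k by auto
     ultimately show False using True circle_ne[OF cD] l' unfolding ix'(2) k by auto
    qed
    hence "l' = 0" using le Suc k by simp
    hence "D = OC" using ix' unfolding ixs_def OC_def by auto
    moreover have "C \<in> Ms" using h hole1_iff[of i j] ix(2) Suc k unfolding Ms_def by auto
    ultimately show ?thesis by blast
   next
    case False
    then obtain z where z: "z \<in> cr l' i' j'" "z \<in> gb k (i div n) (j div n)" unfolding ix'(2) by blast
    obtain m where m: "l' = k + Suc m" "i' div n ^ Suc m = i div n" "j' div n ^ Suc m = j div n" using meets_cell[OF z] .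
    have "m = 0" using m(1) le Suc by simp
    hence q: "l' = Suc k" "i' div n = i div n" "j' div n = j div n" using m by auto
    have "hl (Suc k) i' j'" using ix' q unfolding ixs_def by auto
    hence "sib C D" unfolding sib_def using h ix(2) ix'(2) q Suc by metis
    thus ?thesis ..
   qed
  qed
 qed
 obtain l i j where ix: "(l, i, j) \<in> ixs" "C = cr l i j" using circles_ix[OF C] .
 obtain l' i' j' where ix': "(l', i', j') \<in> ixs" "D = cr l' i' j'" using circles_ix[OF D] .
 show ?thesis
 proof (cases "l' <= l")
  case True
  thus ?thesis using main[OF ix ix' True ne ge] by blast
 next
  case False
  have "m0 <= cap F D C" using ge cap_sym by metis
  thus ?thesis using main[OF ix' ix _ ne[symmetric]] False sib_sym by auto
 qed
qed

section \<open>Polarization\<close>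

text \<open>\<open>Y\<close> is the closed half on one side of the axis. What polarization needs of
  a reflection: for points on opposite sides, reflecting one of them does not increase the distance,
  and every circle is symmetric or lies in one closed half.\<close>

definition refl :: "(pt => pt) => pt set => bool" where
 "refl R Y \<longleftrightarrow> (\<forall>z\<in>F. R z \<in> F & R (R z) = z) &
   (\<forall>c\<in>F. \<forall>y\<in>F. (c \<in> Y) ~= (y \<in> Y) --> dist c (R y) <= dist c y) &
   (\<forall>z\<in>F. z \<notin> Y --> R z \<in> Y) & (\<forall>z\<in>F. z \<in> Y --> R z \<in> Y --> R z = z) &
   (\<forall>E\<in>circles F. R ` E \<subseteq> E | E \<subseteq> Y | (\<forall>z\<in>E. R z \<in> Y))"

text \<open>The values are arranged so that the larger one of each orbit sits in \<open>Y\<close>; the slack \<open>kap\<close> allows \<open>u + u \<circ> R = 1\<close> to hold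
  only approximately.\<close>

definition pol :: "real => pt set => (pt => real) => pt => real" where
 "pol kap Y u z = (if z \<in> Y then 1/2 + max 0 (\<bar>u z - 1/2\<bar> - kap) else 1/2 - max 0 (\<bar>u z - 1/2\<bar> - kap))"

text \<open>If a' = 1 - a and b' = 1 - b, then \<bar>a - 1/2\<bar> + \<bar>b - 1/2\<bar> is the
  larger of \<bar>a - b\<bar> and \<bar>a - b'\<bar>; the slack \<open>kap\<close> absorbs the
  deviation from antisymmetry.\<close>

lemma pol_pair:
 fixes a b kap :: real
 defines "phi \<equiv> %t. max 0 (\<bar>t - 1/2\<bar> - kap)"
 assumes "\<bar>a + a' - 1\<bar> <= kap" "\<bar>b + b' - 1\<bar> <= kap"
  "\<bar>a - a'\<bar> <= d" "\<bar>a - b\<bar> <= d" "\<bar>a - b'\<bar> <= d" "\<bar>a' - b\<bar> <= d" "\<bar>a' - b'\<bar> <= d" "\<bar>b - b'\<bar> <= d"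
 shows "phi a + phi b <= d"
 using assms(2-) unfolding phi_def max_def by (smt (verit) field_sum_of_halves)

lemma pol_ball:
 fixes a b kap :: real
 defines "phi \<equiv> %t. max 0 (\<bar>t - 1/2\<bar> - kap)"
 assumes "\<bar>b + b' - 1\<bar> <= kap" "\<bar>a - b\<bar> <= d" "\<bar>b - b'\<bar> <= d"
 shows "phi a + phi b <= 2 * d"
 using assms(2-) unfolding phi_def max_def by (smt (verit) field_sum_of_halves)

text \<open>A symmetric circle contains both orbits, so \<open>pol_pair\<close> applies. A ball need
  not be symmetric, but of two points on opposite sides one lies across the axis from the centre,
  and its mirror image is again in the ball. This costs a factor 2, which tameness
  tolerates.\<close>

lemma polarize:
 assumes R: "refl R Y" and u: "tame F u" and k: "0 <= kap"
  and as: "!!x. x \<in> F ==> \<bar>u x + u (R x) - 1\<bar> <= kap"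
 shows "tame F (pol kap Y u)" "E \<in> circles F ==> osc (pol kap Y u) E <= osc u E"
proof -
 define phi where "phi = (%z. max 0 (\<bar>u z - 1/2\<bar> - kap))"
 define w where "w = pol kap Y u"
 have w: "w z = (if z \<in> Y then 1/2 + phi z else 1/2 - phi z)" for z unfolding w_def pol_def phi_def by simp
 have lip: "\<bar>phi x - phi y\<bar> <= \<bar>u x - u y\<bar>" for x y unfolding phi_def by (auto simp: max_def abs_if)
 have p0: "0 <= phi x" for x unfolding phi_def by simp
 have RF: "R z \<in> F" "R (R z) = z" if "z \<in> F" for z using R that unfolding refl_def by auto
 have b: "osc w (F \<inter> cball c r) <= 1 * (osc u (F \<inter> cball c r) + osc u (F \<inter> cball c r))" if c: "c \<in> F" for c r
 proof -
  define A where "A = F \<inter> cball c r"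
  have bu: "bounded (u ` A)" by (rule tame_bounded_sub[OF u]) (simp add: A_def)
  have o0: "0 <= osc u A" by (rule osc_nonneg[OF bu])
  have ox: "\<bar>u x - u y\<bar> <= osc u A" if "x \<in> A" "y \<in> A" for x y by (rule osc_bound[OF bu that])
  have mixed: "phi x + phi y <= 2 * osc u A" if m: "x \<in> A" "y \<in> A" "(x \<in> Y) ~= (y \<in> Y)" for x y
  proof -
   have xy: "x \<in> F" "y \<in> F" "dist c x <= r" "dist c y <= r" using m unfolding A_def by auto
   consider "(c \<in> Y) ~= (y \<in> Y)" | "(c \<in> Y) ~= (x \<in> Y)" using m(3) by blast
   thus ?thesis
   proof cases
    case 1
    hence "dist c (R y) <= dist c y" using R c xy unfolding refl_def by blast
    hence RA: "R y \<in> A" using RF[OF xy(2)] xy(4) unfolding A_def by auto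
    show ?thesis unfolding phi_def
     by (rule pol_ball[OF as[OF xy(2)] ox[OF m(1,2)] ox[OF m(2) RA]])
   next
    case 2
    hence "dist c (R x) <= dist c x" using R c xy unfolding refl_def by blast
    hence RA: "R x \<in> A" using RF[OF xy(1)] xy(3) unfolding A_def by auto
    have "phi y + phi x <= 2 * osc u A" unfolding phi_def
     by (rule pol_ball[OF as[OF xy(1)] ox[OF m(2,1)] ox[OF m(1) RA]])
    thus ?thesis by simp
   qed
  qed
  have "osc w A <= 2 * osc u A"
  proof (rule osc_le)
   show "0 <= 2 * osc u A" using o0 by simp
   fix x y assume xy: "x \<in> A" "y \<in> A"
   show "w x - w y <= 2 * osc u A"
   proof (cases "(x \<in> Y) = (y \<in> Y)")
    case True
    hence "w x - w y <= \<bar>phi x - phi y\<bar>" unfolding w by auto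
    also have "... <= 2 * osc u A" using lip[of x y] ox[OF xy] o0 by linarith
    finally show ?thesis .
   next
    case False
    have "w x - w y <= phi x + phi y" using p0[of x] p0[of y] unfolding w by auto
    thus ?thesis using mixed[OF xy False] by linarith
   qed
  qed
  thus ?thesis unfolding A_def by simp
 qed
 have bw: "bounded (w ` F)"
 proof -
  obtain B where B: "!!x. x \<in> F ==> \<bar>u x\<bar> <= B" using tame_bounded[OF u] unfolding bounded_iff by auto
  have "\<bar>w x\<bar> <= B + 1" if "x \<in> F" for x
   using B[OF that] k unfolding w phi_def by (auto simp: max_def abs_if split: if_splits)
  thus ?thesis unfolding bounded_iff by (intro exI[of _ "B + 1"]) auto
 qed
 have "tame F w" by (rule tame_dom[OF u u _ bw, of 1 1]) (use b in auto)
 thus "tame F (pol kap Y u)" unfolding w_def .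
 show "osc (pol kap Y u) E <= osc u E" if E: "E \<in> circles F"
 proof -
  have EF: "E \<subseteq> F" by (rule circles_sub[OF E])
  have bu: "bounded (u ` E)" by (rule tame_bounded_sub[OF u EF])
  have o0: "0 <= osc u E" by (rule osc_nonneg[OF bu])
  have ox: "\<bar>u x - u y\<bar> <= osc u E" if "x \<in> E" "y \<in> E" for x y by (rule osc_bound[OF bu that])
  have "osc w E <= osc u E"
  proof (rule osc_le[OF o0])
   fix x y assume xy: "x \<in> E" "y \<in> E"
   have F: "x \<in> F" "y \<in> F" using xy EF by auto
   have d: "\<bar>phi x - phi y\<bar> <= osc u E" using lip[of x y] ox[OF xy] by linarith
   show "w x - w y <= osc u E"
   proof (cases "(x \<in> Y) = (y \<in> Y)")
    case True
    hence "w x - w y <= \<bar>phi x - phi y\<bar>" unfolding w by auto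
    thus ?thesis using d by linarith
   next
    case False
    consider "R ` E \<subseteq> E" | "\<forall>z\<in>E. R z \<in> Y" using R E False xy unfolding refl_def by blast
    thus ?thesis
    proof cases
     case 1
     hence RE: "R x \<in> E" "R y \<in> E" using xy by auto
     have "phi x + phi y <= osc u E" unfolding phi_def
      by (rule pol_pair[OF as[OF F(1)] as[OF F(2)]]) (intro ox xy RE)+
     moreover have "w x - w y <= phi x + phi y" using p0[of x] p0[of y] unfolding w by auto
     ultimately show ?thesis by linarith
    next
     case 2
     \<comment> \<open>Such q lies on the axis, where near antisymmetry puts \<open>u\<close> within
       kap / 2 of 1/2.\<close>
     have z: "phi q = 0" if "q \<in> E" "q \<in> Y" for q
     proof -
      have qF: "q \<in> F" using that EF by auto
      have "R q = q" using R 2 that qF unfolding refl_def by blast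
      thus ?thesis using as[OF qF] k unfolding phi_def by (auto simp: max_def abs_if split: if_splits)
     qed
     have "w q = 1/2 - phi q" if "q \<in> E" for q using z[OF that] unfolding w by auto
     thus ?thesis using d xy by auto
    qed
   qed
  qed
  thus ?thesis unfolding w_def .
 qed
qed

section \<open>Exchange of top and bottom; nearly antisymmetric sequences\<close>

definition yfl :: "pt => pt" where "yfl z = (fst z, 1 - snd z)"

lemma yfl_yfl [simp]: "yfl (yfl z) = z"
 unfolding yfl_def by simp

lemma yfl_eq: "yfl = sw \<circ> (flx \<circ> sw)"
 unfolding yfl_def sw_def flx_def by auto

lemma qsi_yfl: "qsi F F yfl yfl"
using qsi_trans[OF qsi_trans[OF qsi_sw qsi_flx] qsi_sw] yfl_eq comp_assoc by metis

lemma yfl_circ: "j < n ^ k ==> yfl ` cr k i j = cr k i (n ^ k - 1 - j)"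
 unfolding yfl_eq image_comp[symmetric] sw_circ by (simp add: flx_circ sw_circ)

lemma yfl_OC: "yfl ` OC = OC"
 unfolding OC_def using yfl_circ[of 0 0 0] by simp

lemma yfl_F: "z \<in> F ==> yfl z \<in> F"
 unfolding yfl_eq using sw_F flx_F by simp

lemma refl_yfl: "refl yfl {z. 1/2 <= snd z}"
 unfolding refl_def
proof (intro conjI ballI impI)
 fix c y :: "pt" assume "(c \<in> {z. 1/2 <= snd z}) ~= (y \<in> {z. 1/2 <= snd z})"
 hence "(snd c >= 1/2) ~= (snd y >= (1/2::real))" by simp
 hence "\<bar>snd c - (1 - snd y)\<bar> <= \<bar>snd c - snd y\<bar>" by (auto simp: abs_if)
 thus "dist c (yfl y) <= dist c y" unfolding dist_prod_def dist_real_def yfl_def by (simp add: abs_le_square_iff[symmetric])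
next
 fix z :: "pt" assume "z \<in> {z. 1/2 <= snd z}" "yfl z \<in> {z. 1/2 <= snd z}"
 thus "yfl z = z" unfolding yfl_def by (simp add: prod_eq_iff)
next
 fix E assume "E \<in> circles F"
 then obtain k i j where ix: "(k, i, j) \<in> ixs" "E = cr k i j" using circles_ix by blast
 have j: "j < n ^ k" using ixs_bound[OF ix(1)] by simp
 consider "2 * j + 1 = n ^ k" | "n ^ k <= 2 * j" | "2 * j + 2 <= n ^ k" by linarith
 thus "yfl ` E \<subseteq> E | E \<subseteq> {z. 1/2 <= snd z} | (\<forall>z\<in>E. yfl z \<in> {z. 1/2 <= snd z})"
 proof cases
  case 1
  hence "n ^ k - 1 - j = j" by simp
  thus ?thesis using yfl_circ[OF j, of i] unfolding ix(2) by simp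
 next
  case 2
  hence "real (n ^ k) <= real (2 * j)" by (simp only: of_nat_le_iff)
  hence "pw k <= 2 * real j" by simp
  hence "1/2 <= snd z" if "z \<in> E" for z
  proof -
   have "real j <= snd z * pw k" using that unfolding ix(2) circ_def gsq_def by auto
   hence "(1/2) * pw k <= snd z * pw k" using \<open>pw k <= 2 * real j\<close> by linarith
   thus ?thesis by (simp only: mult_le_cancel_right_pos[OF npow_pos])
  qed
  thus ?thesis by blast
 next
  case 3
  hence "real (2 * j + 2) <= real (n ^ k)" by (simp only: of_nat_le_iff)
  hence "2 * real j + 2 <= pw k" by simp
  hence "snd z <= 1/2" if "z \<in> E" for z
  proof -
   have "snd z * pw k <= real j + 1" using that unfolding ix(2) circ_def gsq_def by auto
   hence "snd z * pw k <= (1/2) * pw k" using \<open>2 * real j + 2 <= pw k\<close> by linarith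
   thus ?thesis by (simp only: mult_le_cancel_right_pos[OF npow_pos])
  qed
  thus ?thesis unfolding yfl_def by auto
 qed
qed (simp_all add: yfl_F, simp add: yfl_def)

text \<open>Cesaro averages over the iterates of \<open>h\<close> are admissible by convexity, do
  not raise the energy, and change under \<open>h\<close> only by the two end terms of a telescoping
  sum.\<close>

lemma avg_adm:
 assumes q: "qsi F F h h'" and C: "h ` C = C" "h ` D = D" and u: "adm F C D u" and r: "!!x. x \<in> F ==> 0 <= u x & u x <= 1"
 defines "A \<equiv> %N x. (\<Sum>j\<le>N. u ((h ^^ j) x)) / (real N + 1)"
 shows "adm F C D (A N)" "en F (A N) <= en F u" "x \<in> F ==> 0 <= A N x & A N x <= 1"
  "x \<in> F ==> \<bar>A N (h x) - A N x\<bar> <= 1 / (real N + 1)"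
proof -
 have hF: "h x \<in> F" if "x \<in> F" for x using qsi_homeo[OF q] that unfolding homeomorphism_def by blast
 have hjF: "(h ^^ j) x \<in> F" if "x \<in> F" for x j using that by (induction j) (auto simp: hF)
 have it: "adm F C D (u \<circ> (h ^^ j)) & en F (u \<circ> (h ^^ j)) = en F u" for j
 proof (induction j)
  case 0 thus ?case using u by simp
 next
  case (Suc j)
  have e: "u \<circ> (h ^^ Suc j) = (u \<circ> (h ^^ j)) \<circ> h" unfolding funpow_Suc_right by (simp only: comp_assoc)
  have X: "adm F C D ((u \<circ> (h ^^ j)) \<circ> h)" by (rule adm_qsi[OF q compact_F]) (simp only: C conjunct1[OF Suc.IH])
  have "en F ((u \<circ> (h ^^ j)) \<circ> h) = en F (u \<circ> (h ^^ j))"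
   by (rule l2_osc_qsi(2)[OF qsi_homeo[OF q]]) (use admD(2) Suc.IH in blast)
  hence "en F ((u \<circ> (h ^^ j)) \<circ> h) = en F u" using conjunct2[OF Suc.IH] by (rule trans)
  thus ?case unfolding e using X by (rule conjI[rotated])
 qed
 have rec: "A (Suc N) = (%x. (1 - 1 / (real N + 2)) * A N x + 1 / (real N + 2) * (u \<circ> (h ^^ Suc N)) x)" for N
 proof
  fix x
  have "A N x * (real N + 1) = (\<Sum>j\<le>N. u ((h ^^ j) x))" unfolding A_def by (simp add: field_simps)
  hence "A (Suc N) x = (A N x * (real N + 1) + u ((h ^^ Suc N) x)) / (real N + 2)" unfolding A_def by (simp add: add.commute)
  also have "... = (1 - 1 / (real N + 2)) * A N x + 1 / (real N + 2) * (u \<circ> (h ^^ Suc N)) x"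
  proof -
   have "(a * (q - 1) + U) / q = (1 - 1 / q) * a + 1 / q * U" if "q ~= 0" for a q U :: real using that by (simp add: field_simps)
   from this[of "real N + 2" "A N x" "u ((h ^^ Suc N) x)"] show ?thesis by (simp add: add.commute)
  qed
  finally show "A (Suc N) x = (1 - 1 / (real N + 2)) * A N x + 1 / (real N + 2) * (u \<circ> (h ^^ Suc N)) x" .
 qed
 have main: "adm F C D (A N) & en F (A N) <= en F u"
 proof (induction N)
  case 0
  have "A 0 = u" unfolding A_def by auto
  thus ?case using u by simp
 next
  case (Suc N)
  have t: "0 <= 1 / (real N + 2)" "1 / (real N + 2) <= 1" by auto
  note c = adm_convex[OF conjunct1[OF Suc.IH] conjunct1[OF it[of "Suc N"]] t]
  have "en F (A (Suc N)) <= (1 - 1 / (real N + 2)) * en F (A N) + 1 / (real N + 2) * en F (u \<circ> (h ^^ Suc N))"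
   unfolding rec by (rule c(3))
  also have "... <= (1 - 1 / (real N + 2)) * en F u + 1 / (real N + 2) * en F u"
   using Suc.IH it[of "Suc N"] t by (intro add_mono mult_left_mono) auto
  also have "... = en F u" by (simp add: algebra_simps)
  finally show ?case unfolding rec using c(1) by simp
 qed
 thus "adm F C D (A N)" "en F (A N) <= en F u" by auto
 show "0 <= A N x & A N x <= 1" if x: "x \<in> F"
 proof -
  have "0 <= (\<Sum>j\<le>N. u ((h ^^ j) x))" by (rule sum_nonneg) (use r hjF[OF x] in blast)
  moreover have "(\<Sum>j\<le>N. u ((h ^^ j) x)) <= (\<Sum>j\<le>N. 1)" by (rule sum_mono) (use r hjF[OF x] in blast)
  ultimately show ?thesis unfolding A_def by (simp add: field_simps)
 qed
 show "\<bar>A N (h x) - A N x\<bar> <= 1 / (real N + 1)" if x: "x \<in> F"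
 proof -
  have "(\<Sum>j\<le>N. u ((h ^^ j) (h x))) = (\<Sum>j\<le>N. u ((h ^^ Suc j) x))" by (simp add: funpow_swap1)
  hence "(\<Sum>j\<le>N. u ((h ^^ j) (h x))) - (\<Sum>j\<le>N. u ((h ^^ j) x)) = u ((h ^^ Suc N) x) - u x"
   using sum.atMost_Suc_shift[of "%j. u ((h ^^ j) x)" N] sum.atMost_Suc[of "%j. u ((h ^^ j) x)" N] by simp
  hence "A N (h x) - A N x = (u ((h ^^ Suc N) x) - u x) / (real N + 1)"
   unfolding A_def by (simp add: diff_divide_distrib[symmetric])
  moreover have "\<bar>u ((h ^^ Suc N) x) - u x\<bar> <= 1" using r[OF x] r[OF hjF[OF x, of "Suc N"]] by (auto simp: abs_le_iff)
  ultimately show ?thesis by (simp add: abs_divide divide_right_mono)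
 qed
qed

text \<open>The two involutions may generate an infinite group, so averaging gives only approximate
  invariance, under \<open>h = tau \<circ> R\<close>, which fixes C and D. Antisymmetrising with R
  is then exact, and tau = \<open>h \<circ> R\<close> inherits the relation up to the averaging
  error.\<close>

lemma antisymmetrize:
 assumes q1: "qsi F F R R" and q2: "qsi F F tau tau" and sw1: "R ` C = D" "R ` D = C" and sw2: "tau ` C = D" "tau ` D = C"
  and sub: "C \<in> circles F" "D \<in> circles F" "C ~= D"
 shows "\<exists>u. minseq F C D u & (\<forall>k. \<forall>x\<in>F. u k x + u k (R x) = 1) & (\<forall>k. \<forall>x\<in>F. \<bar>u k x + u k (tau x) - 1\<bar> <= 1 / (real k + 1))"
proof -
 obtain g0 where "adm F C D g0" using adm_exists[OF sub] by blast
 then obtain u where u: "minseq F C D u" using minseq_exists by blast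
 have RF: "R x \<in> F" "R (R x) = x" and tF: "tau x \<in> F" "tau (tau x) = x" if "x \<in> F" for x
  using qsi_homeo[OF q1] qsi_homeo[OF q2] that unfolding homeomorphism_def by blast+
 define h where "h = tau \<circ> R"
 have q: "qsi F F h (R \<circ> tau)" unfolding h_def by (rule qsi_trans[OF q1 q2])
 have hC: "h ` C = C" "h ` D = D" unfolding h_def image_comp[symmetric] using sw1 sw2 by auto
 define A where "A = (%N x. (\<Sum>j\<le>N. u N ((h ^^ j) x)) / (real N + 1))"
 note au = minseqD(1)[OF u]
 have r: "0 <= u N x & u N x <= 1" if "x \<in> F" for N x using minseqD(2,3)[OF u that] by blast
 note AA = avg_adm[OF q hC au r, folded A_def]
 have A1: "adm F C D (A N)" "en F (A N) <= en F (u N)" and A2: "x \<in> F ==> 0 <= A N x & A N x <= 1"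
  and A3: "x \<in> F ==> \<bar>A N (h x) - A N x\<bar> <= 1 / (real N + 1)" for N x
  using avg_adm[OF q hC au[of N] r[of _ N], where N = N] unfolding A_def by auto
 have aR: "adm F D C (A N \<circ> R)" for N by (rule adm_qsi[OF q1 compact_F]) (use sw1 A1 in simp)
 have eR: "en F (A N \<circ> R) = en F (A N)" for N by (rule l2_osc_qsi(2)[OF qsi_homeo[OF q1] admD(2)[OF A1(1)]])
 define B where "B = (%N x. 1 - (A N \<circ> R) x)"
 have B1: "adm F C D (B N)" "en F (B N) = en F (A N)" for N using adm_flip[OF aR[of N]] eR unfolding B_def by auto
 define w where "w = (%N x. (1 - 1/2) * A N x + 1/2 * B N x)"
 have w1: "adm F C D (w N)" "en F (w N) <= en F (u N)" for N
 proof -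
  note c = adm_convex[OF A1(1)[of N] B1(1)[of N], of "1/2"]
  show "adm F C D (w N)" unfolding w_def by (rule c(1)) auto
  have "en F (w N) <= (1 - 1/2) * en F (A N) + 1/2 * en F (B N)" unfolding w_def by (rule c(3)) auto
  thus "en F (w N) <= en F (u N)" using A1(2)[of N] B1(2)[of N] by simp
 qed
 have w01: "0 <= w N x" "w N x <= 1" if "x \<in> F" for N x
 proof -
  have "w N x = (A N x + 1 - A N (R x)) / 2" unfolding w_def B_def by (simp add: field_simps)
  thus "0 <= w N x" "w N x <= 1" using A2[OF that, of N] A2[OF RF(1)[OF that], of N] by auto
 qed
 have "minseq F C D w"
 proof (rule minseqI[OF w1(1) w01])
  show "(%m. en F (u m) - cap F C D) \<longlonglongrightarrow> 0" using minseqD(4)[OF u] by (simp add: LIM_zero)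
  show "en F (w m) <= cap F C D + (en F (u m) - cap F C D)" for m using w1(2)[of m] by simp
 qed auto
 moreover have "w N x + w N (R x) = 1" if "x \<in> F" for N x using RF[OF that] unfolding w_def B_def by (simp add: field_simps)
 moreover have "\<bar>w N x + w N (tau x) - 1\<bar> <= 1 / (real N + 1)" if x: "x \<in> F" for N x
 proof -
  have e1: "tau x = h (R x)" unfolding h_def using RF[OF x] by simp
  have e2: "h (R (tau x)) = x" unfolding h_def using RF[OF tF(1)[OF x]] tF[OF x] by simp
  have "2 * (w N x + w N (tau x) - 1) = (A N (h (R x)) - A N (R x)) + (A N (h (R (tau x))) - A N (R (tau x)))"
   unfolding w_def B_def e2 e1[symmetric] comp_def by (simp add: diff_divide_distrib)
  moreover have "\<bar>A N (h (R x)) - A N (R x)\<bar> <= 1 / (real N + 1)" by (rule A3[OF RF(1)[OF x]])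
  moreover have "\<bar>A N (h (R (tau x))) - A N (R (tau x))\<bar> <= 1 / (real N + 1)" by (rule A3[OF RF(1)[OF tF(1)[OF x]]])
  ultimately show ?thesis by (smt (verit))
 qed
 ultimately show ?thesis by blast
qed

section \<open>The four first-level circles\<close>

definition dg :: "bool => nat" where "dg s = (if s then n - 1 - p else p)"

text \<open>The first flag is horizontal and \<open>True\<close> stands for the high digit:
  \<open>cm True False\<close> is the lower right circle.\<close>

definition cm :: "bool => bool => pt set" where "cm s t = cr 1 (dg s) (dg t)"

lemma dg: "hdig n p (dg s)" "dg s < n" "n - 1 - dg s = dg (~ s)"
 using p2 unfolding dg_def hdig_def by auto

lemma cm_hole: "hl 1 (dg s) (dg t)"
 by (rule hole1) (rule dg)+

lemma cm_circle: "cm s t \<in> circles F"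
 unfolding cm_def by (rule hole_circle[OF cm_hole])

lemma dg_inj: "dg s = dg t \<longleftrightarrow> s = t"
 using p2 unfolding dg_def by auto

lemma cm_inj: "cm s t = cm s' t' \<longleftrightarrow> s = s' & t = t'"
using cm_hole circ_eq_iff dg_inj by (simp add: ixs_def cm_def)

lemma cm_OC: "cm s t ~= OC"
 unfolding cm_def by (rule hole_ne_OC[OF cm_hole])

lemma Ms_cm: "M \<in> Ms \<longleftrightarrow> (\<exists>s t. M = cm s t)"
proof
 assume "M \<in> Ms"
 then obtain a b where ab: "hdig n p a" "hdig n p b" "M = cr 1 a b" unfolding Ms_def by blast
 have "\<exists>s. a = dg s" "\<exists>s. b = dg s" using ab(1,2) unfolding hdig_def dg_def by (metis (full_types))+
 thus "\<exists>s t. M = cm s t" using ab(3) unfolding cm_def by blast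
qed (use dg in "auto simp: Ms_def cm_def")

lemma flx_cm: "flx ` cm s t = cm (~ s) t"
 unfolding cm_def using flx_circ[of "dg s" 1 "dg t"] dg by simp

lemma yfl_cm: "yfl ` cm s t = cm s (~ t)"
 unfolding cm_def using yfl_circ[of "dg t" 1 "dg s"] dg by simp

lemma sw_cm: "sw ` cm s t = cm t s"
 unfolding cm_def by (rule sw_circ)

text \<open>A minimising sequence for the two right circles can be taken antisymmetric under the
  reflection and nearly so under tau. As tau keeps the upper left circle A, values on A differ from
  1/2 by about half its oscillation at most, so polarizing halves the oscillation on A. Both
  sequences are minimising, hence that oscillation tends to 0: A is dead at the value 1/2, the upper
  right circle is live, and the row of cells between them contradicts the strip lemma.\<close>

lemma noninv_base:
 assumes q: "qsi F F tau tau" and sC: "tau ` cm True False = cm True True" "tau ` cm True True = cm True False"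
  and sA: "tau ` cm False True = cm False True"
 shows False
proof -
 define C D A where "C = cm True False" and "D = cm True True" and "A = cm False True"
 define Y where "Y = {z::pt. 1/2 <= snd z}"
 have cC: "C \<in> circles F" and cD: "D \<in> circles F" and cA: "A \<in> circles F" unfolding C_def D_def A_def by (rule cm_circle)+
 have ne: "C ~= D" "A ~= C" "A ~= D" unfolding C_def D_def A_def cm_inj by auto
 have RC: "yfl ` C = D" "yfl ` D = C" unfolding C_def D_def yfl_cm by simp_all
 have tC: "tau ` C = D" "tau ` D = C" "tau ` A = A" using sC sA unfolding C_def D_def A_def by auto
 obtain u where u: "minseq F C D u" and uR: "!!k x. x \<in> F ==> u k x + u k (yfl x) = 1"
  and ut: "!!k x. x \<in> F ==> \<bar>u k x + u k (tau x) - 1\<bar> <= 1 / (real k + 1)"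
  using antisymmetrize[OF qsi_yfl q RC tC(1,2) cC cD ne(1)] by blast
 note au = minseqD(1)[OF u]
 define w where "w = (%k. pol 0 Y (u k))"
 have wp: "tame F (w k)" "E \<in> circles F ==> osc (w k) E <= osc (u k) E" for k E
  using polarize[OF refl_yfl admD(1)[OF au[of k]], of 0] uR[of _ k] unfolding w_def Y_def by simp_all
 have half: "2 * (p + 1) <= n" "n <= 2 * (n - 1 - p)" using p2 by simp_all
 have low: "snd x < 1/2" if "x \<in> C" for x
 proof -
  have "snd x * real n <= real p + 1" using that unfolding C_def cm_def circ_def gsq_def dg_def by auto
  moreover have "real (2 * p + 2) < real n" using p2 by (simp only: of_nat_less_iff)
  hence "2 * (real p + 1) < real n" by simp
  moreover have "s * m < (1/2) * m" if "s * m <= q + 1" "2 * (q + 1) < m" for s m q :: real using that by argo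
  ultimately have "snd x * real n < (1/2) * real n" by blast
  thus ?thesis using nR(1) by (simp only: mult_less_cancel_right_pos)
 qed
 have high: "1/2 <= snd x" if "real (n - 1 - p) <= snd x * real n" for x :: "pt"
 proof -
  have "real n <= 2 * real (n - 1 - p)" using half(2) by linarith
  hence "(1/2) * real n <= snd x * real n" using that by linarith
  thus ?thesis using nR(1) by (simp only: mult_le_cancel_right_pos)
 qed
 have inY: "x \<in> Y" if "x \<in> cm s True" for x s
  unfolding Y_def using high[of x] that unfolding cm_def circ_def gsq_def dg_def by auto
 have wl: "\<bar>osc (w k) E\<bar> <= \<bar>osc (u k) E\<bar>" if "E \<in> circles F" for k E
  using wp(2)[OF that, of k] osc_circle_nonneg[OF wp(1)[of k] that] by linarith
 have aw: "adm F C D (w k)" for k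
 proof -
  have "w k x = 0" if "x \<in> C" for x using admD(3)[OF au that] low[OF that] unfolding w_def pol_def Y_def by simp
  moreover have "w k x = 1" if "x \<in> D" for x using admD(4)[OF au that] inY[of x True] that unfolding w_def pol_def D_def by simp
  ultimately show ?thesis unfolding adm_def using wp(1) l2_mono[OF admD(2)[OF au] wl] by blast
 qed
 have ew: "en F (w k) <= en F (u k)" for k unfolding en_def by (rule ns_mono[OF admD(2)[OF au] wl])
 have u01: "0 <= u k x" "u k x <= 1" if "x \<in> F" for k x using minseqD(2,3)[OF u that] by auto
 have w01: "0 <= w k x" "w k x <= 1" if "x \<in> F" for k x using u01[OF that, of k] unfolding w_def pol_def by (auto simp: abs_if)
 have e0: "(%m. en F (u m) - cap F C D) \<longlonglongrightarrow> 0" using minseqD(4)[OF u] by (simp add: LIM_zero)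
 have mw: "minseq F C D w"
 proof (rule minseqI[OF aw w01 _ e0])
  show "en F (w m) <= cap F C D + (en F (u m) - cap F C D)" for m using ew[of m] by simp
 qed auto
 obtain rho where ml: "mlim F C D w rho" using mlim_exists[OF mw] .
 define v where "v = (%k x. 1 * (w k x - 1/2))"
 have P: "pot C D w rho v" unfolding pot_def v_def using ml cC cD by blast
 have AY: "x \<in> Y" if "x \<in> A" for x using inY[of x False] that unfolding A_def by blast
 have AF: "A \<subseteq> F" by (rule circles_sub[OF cA])
 \<comment> \<open>x and tau x both lie on A, and their values add up to nearly 1.\<close>
 have ub: "\<bar>u k x - 1/2\<bar> <= 1/2 * (osc (u k) A + 1 / (real k + 1))" if "x \<in> A" for k x
 proof -
  have tx: "tau x \<in> A" using tC(3) that by blast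
  have "\<bar>u k x - u k (tau x)\<bar> <= osc (u k) A" by (rule osc_bound[OF tame_bounded_sub[OF admD(1)[OF au] AF] that tx])
  moreover have "\<bar>u k x + u k (tau x) - 1\<bar> <= 1 / (real k + 1)" by (rule ut) (use that AF in blast)
  moreover have "2 * (u k x - 1/2) = (u k x - u k (tau x)) + (u k x + u k (tau x) - 1)" by simp
  ultimately have "\<bar>2 * (u k x - 1/2)\<bar> <= osc (u k) A + 1 / (real k + 1)" by (smt (verit))
  thus ?thesis unfolding abs_mult by simp
 qed
 have owA: "osc (w k) A <= 1/2 * (osc (u k) A + 1 / (real k + 1))" for k
 proof (rule osc_le)
  show "0 <= 1/2 * (osc (u k) A + 1 / (real k + 1))"
   using osc_circle_nonneg[OF admD(1)[OF au[of k]] cA] by simp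
  fix x y assume xy: "x \<in> A" "y \<in> A"
  have "w k x - w k y <= \<bar>u k x - 1/2\<bar>" using AY xy unfolding w_def pol_def by auto
  thus "w k x - w k y <= 1/2 * (osc (u k) A + 1 / (real k + 1))" using ub[OF xy(1), of k] by linarith
 qed
 \<comment> \<open>Both sequences minimise for the same pair, so the parallelogram bound brings
   their oscillations together.\<close>
 have dif: "(%k. osc (u k) A - osc (w k) A) \<longlonglongrightarrow> 0"
 proof (rule Lim_null_comparison)
  have b: "ns (circles F) (%E. osc (u k) E - osc (w k) E) <= 4 * (en F (u k) - cap F C D)" for k
   using adm_parallelogram[OF au[of k] aw[of k]] ew[of k] by simp
  show "\<forall>\<^sub>F k in sequentially. norm (osc (u k) A - osc (w k) A) <= sqrt (4 * (en F (u k) - cap F C D))"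
  proof (intro always_eventually allI)
   fix k
   have "\<bar>osc (u k) A - osc (w k) A\<bar> <= sqrt (ns (circles F) (%E. osc (u k) E - osc (w k) E))"
    by (rule point_le_sqrt_ns[OF l2_diff[OF admD(2)[OF au] admD(2)[OF aw]] cA])
   also have "... <= sqrt (4 * (en F (u k) - cap F C D))" using b[of k] by simp
   finally show "norm (osc (u k) A - osc (w k) A) <= sqrt (4 * (en F (u k) - cap F C D))" by simp
  qed
  show "(%k. sqrt (4 * (en F (u k) - cap F C D))) \<longlonglongrightarrow> 0"
   using tendsto_real_sqrt[OF tendsto_mult[OF tendsto_const[of 4] e0]] by simp
 qed
 have i0: "(%k. 1 / (real k + 1)) \<longlonglongrightarrow> 0" using LIMSEQ_Suc[OF lim_1_over_n[where 'a = real]] by (simp add: add.commute)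
 define b where "b = (%k. 2 * (osc (u k) A - osc (w k) A) + 1 / (real k + 1))"
 have b0: "b \<longlonglongrightarrow> 0"
  unfolding b_def using tendsto_add[OF tendsto_mult[OF tendsto_const[of 2] dif] i0] by simp
 have ob: "osc (u k) A <= b k" for k using owA[of k] unfolding b_def by (simp add: field_simps)
 define bb where "bb = (%k. 1/2 * (b k + 1 / (real k + 1)))"
 have bb0: "bb \<longlonglongrightarrow> 0"
  unfolding bb_def using tendsto_mult[OF tendsto_const[of "1/2"] tendsto_add[OF b0 i0]] by simp
 have vb: "v k x <= bb k" if "x \<in> A" for k x
 using AY[OF that] ub[OF that, of k] ob[of k] by (simp add: v_def w_def pol_def bb_def)
 have dA: "dead rho v A"
  unfolding dead_def
 proof (intro conjI allI impI)
  have "(%k. osc (w k) A) \<longlonglongrightarrow> 0"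
  proof (rule tendsto_sandwich[OF _ _ tendsto_const bb0])
   show "\<forall>\<^sub>F k in sequentially. 0 <= osc (w k) A" using osc_circle_nonneg[OF wp(1) cA] by simp
   show "\<forall>\<^sub>F k in sequentially. osc (w k) A <= bb k"
   proof (intro always_eventually allI)
    fix k show "osc (w k) A <= bb k" using owA[of k] ob[of k] unfolding bb_def by argo
   qed
  qed
  thus "rho A = 0" using mlim_point[OF ml cA] LIMSEQ_unique by blast
  fix eps :: real assume "0 < eps"
  hence "\<forall>\<^sub>F k in sequentially. bb k < eps" using order_tendstoD(2)[OF bb0] by blast
  hence "\<forall>\<^sub>F k in sequentially. \<forall>x\<in>A. v k x <= eps"
   by eventually_elim (use vb in "meson less_imp_le order_trans")
  thus "\<exists>\<^sub>F k in sequentially. \<forall>x\<in>A. v k x <= eps" by (rule eventually_frequently[rotated]) simp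
 qed
 have LD: "live v D"
 proof -
  have "v k x = 1/2" if "x \<in> D" for k x using admD(4)[OF aw that] unfolding v_def by simp
  thus ?thesis unfolding live_def by (intro exI[of _ "1/2"]) auto
 qed
 define r where "r = n - 1 - p"
 have hA: "hl 1 p r" and hD: "hl 1 r r" using cm_hole[of False True] cm_hole[of True True] unfolding dg_def r_def by auto
 have lA: "lface 1 (p + 1) r A" using hole_lface[OF hA, of r 0] unfolding A_def cm_def dg_def r_def by simp
 have rD: "rface 1 r r D" using hole_rface[OF hD, of r 0] unfolding D_def cm_def dg_def r_def by simp
 have rn: "r < n" unfolding r_def using n5 by simp
 show False
 proof (rule strip_lemma[OF P lA dA ne(2,3) rD LD])
  fix c assume c: "p + 1 <= c" "c < r"
  hence "~ hdig n p c" unfolding hdig_def r_def by auto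
  moreover have "c < n" using c rn by simp
  ultimately show "cl 1 c r" using rn by (simp add: One_nat_def)
 next
  show "r <= n ^ 1" using rn by simp
  show "p + 1 < r" unfolding r_def using p2 by simp
 next
  obtain x where x: "x \<in> C" using circle_ne[OF cC] by blast
  have "snd x < 1/2" by (rule low[OF x])
  hence "~ real r <= snd x * real n" using high[of x] unfolding r_def by linarith
  thus "~ C \<subseteq> strip 1 (p + 1) r r" using x unfolding strip_def by auto
 next
  have "((real r + 1) / pw 1, (real r + 1) / pw 1) \<in> D"
   unfolding D_def cm_def dg_def r_def using corner_in_circ'[of "n - 1 - p" 1 "n - 1 - p"] by simp
  moreover have "((real r + 1) / pw 1, (real r + 1) / pw 1) \<notin> strip 1 (p + 1) r r" unfolding strip_def using n5 by simp
  ultimately show "~ D \<subseteq> strip 1 (p + 1) r r" by blast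
 next
  fix k x assume "x \<in> strip 1 (p + 1) r r"
  hence "x \<in> Y" unfolding Y_def strip_def using high[of x] unfolding r_def by auto
  thus "0 <= v k x" unfolding v_def w_def pol_def by simp
 qed
qed

lemma conj_inv:
 assumes "qsi F F g g" "qsi F F tau tau"
 shows "qsi F F (g \<circ> tau \<circ> g) (g \<circ> tau \<circ> g)"
 using qsi_trans[OF assms(1) qsi_trans[OF assms(2,1)]] by (simp add: comp_assoc)

lemma inv_image: "qsi F F g g ==> M \<subseteq> F ==> g ` g ` M = M"
 by (rule homeomorphism_image_inv[OF qsi_homeo])

lemma cm_sub: "cm s t \<subseteq> F"
 by (rule circles_sub[OF cm_circle])

lemma noninv_col:
 assumes q: "qsi F F tau tau" and s: "tau ` cm s False = cm s True" and f: "tau ` cm (~ s) r = cm (~ s) r"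
 shows False
proof -
 have base: False if q: "qsi F F tau tau" and s: "tau ` cm True False = cm True True" and f: "tau ` cm False r = cm False r" for tau r
 proof -
  have s': "tau ` cm True True = cm True False" using inv_image[OF q cm_sub[of True False]] unfolding s .
  show False
  proof (cases r)
   case True
   thus False using noninv_base[OF q s s'] f by simp
  next
   case False
   have q': "qsi F F (yfl \<circ> tau \<circ> yfl) (yfl \<circ> tau \<circ> yfl)" by (rule conj_inv[OF qsi_yfl q])
   show False
    by (rule noninv_base[OF q']; unfold image_comp[symmetric]; use yfl_cm s s' f False in simp)
  qed
 qed
 show False
 proof (cases s)
  case True
  thus False using base[OF q] s f by auto
 next
  case False
  have q': "qsi F F (flx \<circ> tau \<circ> flx) (flx \<circ> tau \<circ> flx)" by (rule conj_inv[OF qsi_flx q])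
  have 1: "(flx \<circ> tau \<circ> flx) ` cm True False = cm True True" unfolding image_comp[symmetric] using flx_cm s False by simp
  have 2: "(flx \<circ> tau \<circ> flx) ` cm False r = cm False r" unfolding image_comp[symmetric] using flx_cm f False by simp
  show False by (rule base[OF q' 1 2])
 qed
qed

definition adj :: "pt set => pt set => bool" where
 "adj A B \<longleftrightarrow> (\<exists>s t. (A = cm s t & B = cm s (~ t)) | (A = cm s t & B = cm (~ s) t))"

text \<open>The fixed circle is not one of the exchanged adjacent pair, so it lies on the opposite
  side of the square; conjugation with symmetries of the square leads to
  \<open>noninv_base\<close>.\<close>

lemma noninv:
 assumes q: "qsi F F tau tau" and A: "tau ` A = B" "adj A B" and M: "M \<in> Ms" "tau ` M = M"
 shows False
proof -
 have col: False if q: "qsi F F tau tau" and st: "tau ` cm s t = cm s (~ t)" and f: "tau ` cm a b = cm a b" for tau s t a b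
 proof -
  have st': "tau ` cm s (~ t) = cm s t" using inv_image[OF q cm_sub[of s t]] unfolding st .
  have "a = (~ s)"
  using f st st' cm_inj by metis
  moreover have "tau ` cm s False = cm s True" using st st' by (cases t) auto
  ultimately show False using noninv_col[OF q] f by blast
 qed
 obtain a b where ab: "M = cm a b" using M(1) unfolding Ms_cm by blast
 obtain s t where "(A = cm s t & B = cm s (~ t)) | (A = cm s t & B = cm (~ s) t)" using A(2) unfolding adj_def by blast
 thus False
 proof
  assume "A = cm s t & B = cm s (~ t)"
  thus False using col[OF q _ M(2)[unfolded ab]] A(1) by blast
 next
  assume h: "A = cm s t & B = cm (~ s) t"
  have q': "qsi F F (sw \<circ> tau \<circ> sw) (sw \<circ> tau \<circ> sw)" by (rule conj_inv[OF qsi_sw q])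
  have 1: "(sw \<circ> tau \<circ> sw) ` cm t s = cm t (~ s)" unfolding image_comp[symmetric] using sw_cm h A(1) by simp
  have 2: "(sw \<circ> tau \<circ> sw) ` cm b a = cm b a" unfolding image_comp[symmetric] using sw_cm M(2) ab by simp
  show False by (rule col[OF q' 1 2])
 qed
qed

section \<open>Preservation of the first-level circles\<close>

lemma sib_Ms: "sib Y X ==> X \<in> Ms ==> Y \<in> Ms"
proof -
 assume s: "sib Y X" "X \<in> Ms"
 obtain k a b a' b' where h: "hl (Suc k) a b" "hl (Suc k) a' b'" "X = cr (Suc k) a' b'" "Y = cr (Suc k) a b"
  using s(1) unfolding sib_def by blast
 obtain c d where cd: "hdig n p c" "hdig n p d" "X = cr 1 c d" using s(2) unfolding Ms_def by blast
 have "(Suc k, a', b') \<in> ixs" "(1, c, d) \<in> ixs" using h(2) hole1[OF cd(1,2)] unfolding ixs_def by blast+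
 hence "Suc k = 1" using circ_eq_iff h(3) cd(3) by blast
 hence "hl 1 a b" "Y = cr 1 a b" using h by auto
 thus ?thesis unfolding Ms_def hole1_iff by blast
qed

lemma sib_not_OC: "sib Y X ==> Y ~= OC & X ~= OC"
 unfolding sib_def using hole_ne_OC by blast

lemma sib_card:
 assumes "finite T" "!!Y. Y \<in> T ==> sib Y X & Y ~= X"
 shows "card T <= 3"
proof (cases "T = {}")
 case False
 then obtain Y where "Y \<in> T" by blast
 then obtain k a b where X: "hl (Suc k) a b" "X = cr (Suc k) a b" using assms(2) unfolding sib_def by blast
 define F4 where "F4 = (%(s, t). cr (Suc k) (a div n * n + dg s) (b div n * n + dg t))"
 have dgm: "\<exists>s. c = c div n * n + dg s" if "hdig n p (c mod n)" for c
 using div_mult_mod_eq that hdig_def dg_def by metis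
 have mem: "Z \<in> range F4" if "sib Z X" for Z
 proof -
  obtain k' c d c' d' where z: "hl (Suc k') c d" "hl (Suc k') c' d'" "c div n = c' div n" "d div n = d' div n"
   "Z = cr (Suc k') c d" "X = cr (Suc k') c' d'" using \<open>sib Z X\<close> unfolding sib_def by blast
  have "(Suc k, a, b) \<in> ixs" "(Suc k', c', d') \<in> ixs" using X z unfolding ixs_def by blast+
  hence e: "k' = k" "c' = a" "d' = b" using circ_eq_iff X(2) z(6) by blast+
  obtain s where s: "c = c div n * n + dg s" using dgm[of c] z(1) by auto
  obtain t where t: "d = d div n * n + dg t" using dgm[of d] z(1) by auto
  have "Z = F4 (s, t)" using z(3,4,5) s t e unfolding F4_def by simp
  thus ?thesis by blast
 qed
 have XX: "X \<in> range F4" by (rule mem, unfold sib_def, intro exI[of _ k] exI[of _ a] exI[of _ b]) (use X in blast)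
 have "T \<subseteq> range F4 - {X}" using assms(2) mem by blast
 hence "card T <= card (range F4 - {X})" by (intro card_mono) auto
 also have "... = card (range F4) - 1" using XX by (simp add: card_Diff_singleton)
 also have "card (range F4) <= card (UNIV :: (bool \<times> bool) set)" by (rule card_image_le) simp
 finally show ?thesis by (simp add: card_UNIV_bool card_cartesian_product flip: UNIV_Times_UNIV)
qed simp

definition asw :: "pt => pt" where "asw z = (1 - snd z, 1 - fst z)"

lemma asw_eq: "asw = flx \<circ> (sw \<circ> flx)"
 unfolding asw_def sw_def flx_def by auto

lemma qsi_asw: "qsi F F asw asw"
using qsi_trans[OF qsi_trans[OF qsi_flx qsi_sw] qsi_flx] asw_eq comp_assoc by metis

lemma asw_cm: "asw ` cm s t = cm (~ t) (~ s)"
 unfolding asw_eq image_comp[symmetric] flx_cm sw_cm by simp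

lemma asw_OC: "asw ` OC = OC"
 unfolding asw_eq image_comp[symmetric] flx_OC sw_OC ..

lemma adj_cm: "adj (cm s t) (cm s' t') \<longleftrightarrow> (s = s') ~= (t = t')"
 unfolding adj_def using cm_inj by metis

text \<open>The reflection in the diagonal through circle (s, t): it keeps that circle and the
  opposite one and exchanges the other two.\<close>

definition fixdiag :: "bool => bool => pt => pt" where
 "fixdiag s t = (if s = t then sw else asw)"

lemma fixdiag:
 "qsi F F (fixdiag s t) (fixdiag s t)" "fixdiag s t ` OC = OC"
 "fixdiag s t ` cm s t = cm s t" "fixdiag s t ` cm (~ s) (~ t) = cm (~ s) (~ t)"
 "fixdiag s t ` cm s (~ t) = cm (~ s) t" "fixdiag s t ` cm (~ s) t = cm s (~ t)"
 unfolding fixdiag_def using qsi_sw qsi_asw sw_OC asw_OC by (auto simp: sw_cm asw_cm)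

end

section \<open>Two carpets: images of the outer and first-level circles\<close>

locale carpet_pair = A: carpet_params n p + B: carpet_params n' p' for n p n' p' :: nat
begin

lemma conj_qsi:
 assumes f: "qsi A.F B.F f g" and d: "qsi A.F A.F d d"
 shows "qsi B.F B.F (f \<circ> d \<circ> g) (f \<circ> d \<circ> g)"
 using qsi_trans[OF qsi_sym[OF f] qsi_trans[OF d f]] by (simp add: comp_assoc)

lemma conj_img:
 assumes f: "qsi A.F B.F f g" and M: "M \<subseteq> A.F"
 shows "(f \<circ> d \<circ> g) ` f ` M = f ` d ` M"
using homeomorphism_image_inv[OF qsi_homeo[OF f] M] image_comp[symmetric] by metis

lemma img_circle: "qsi A.F B.F f g ==> M \<in> circles A.F ==> f ` M \<in> circles B.F"
 using circles_homeo qsi_homeo by blast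

lemma img_inj:
 assumes f: "qsi A.F B.F f g" and M: "M \<in> circles A.F" "N \<in> circles A.F" "f ` M = f ` N"
 shows "M = N"
 by (metis homeomorphism_image_inv[OF qsi_homeo[OF f]] circles_sub M)

lemma img_cm_inj: "qsi A.F B.F f g ==> f ` A.cm s t = f ` A.cm s' t' \<longleftrightarrow> s = s' & t = t'"
 using img_inj[OF _ A.cm_circle A.cm_circle, of f g s t s' t'] A.cm_inj[of s t s' t'] by (intro iffI) simp_all

lemma img_cm_OC: "qsi A.F B.F f g ==> f ` A.cm s t ~= f ` A.OC"
 using img_inj[OF _ A.cm_circle A.OC_circle, of f g s t] A.cm_OC[of s t] by (intro notI) simp

text \<open>By invariance the images of the pairs of a first-level circle and the outer circle have
  capacity \<open>A.m0\<close>, so \<open>B.high_cap\<close> lists the possibilities. Not all four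
  images can be siblings of the image of the outer circle, since a circle has at most three
  siblings.\<close>

lemma labels:
 assumes f: "qsi A.F B.F f g" and m: "B.m0 <= A.m0"
 shows "(f ` A.OC = B.OC & (\<forall>s t. f ` A.cm s t \<in> B.Ms)) |
  (f ` A.OC \<in> B.Ms & (\<exists>s t. f ` A.cm s t = B.OC) & (\<forall>s t. f ` A.cm s t \<in> B.Ms | f ` A.cm s t = B.OC))"
proof -
 define X where "X = f ` A.OC"
 have cX: "X \<in> circles B.F" unfolding X_def by (rule img_circle[OF f A.OC_circle])
 have cY: "f ` A.cm s t \<in> circles B.F" for s t by (rule img_circle[OF f A.cm_circle])
 have XY: "f ` A.cm s t ~= X" for s t unfolding X_def by (rule img_cm_OC[OF f])
 have rel: "B.sib (f ` A.cm s t) X | (f ` A.cm s t = B.OC & X \<in> B.Ms) | (X = B.OC & f ` A.cm s t \<in> B.Ms)" for s t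
 using B.high_cap[OF cY cX XY] A.adm_exists[OF A.cm_circle A.OC_circle A.cm_OC] cap_qsi[OF f A.compact_F B.compact_F _ A.cm_sub circles_sub[OF A.OC_circle]] A.cap_Ms A.Ms_cm m X_def
  by metis
 show ?thesis
 proof (cases "X = B.OC")
  case True
  have "f ` A.cm s t \<in> B.Ms" for s t using rel[of s t] B.sib_not_OC[of "f ` A.cm s t" X] True XY[of s t] by blast
  thus ?thesis using True unfolding X_def by blast
 next
  case False
  have r: "B.sib (f ` A.cm s t) X | (f ` A.cm s t = B.OC & X \<in> B.Ms)" for s t using rel[of s t] False by blast
  have ex: "\<exists>s t. f ` A.cm s t = B.OC & X \<in> B.Ms"
  proof (rule ccontr)
   assume "~ ?thesis"
   hence sb: "B.sib (f ` A.cm s t) X" for s t using r by blast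
   define T where "T = (%(s, t). f ` A.cm s t) ` (UNIV :: (bool \<times> bool) set)"
   have "inj_on (%(s, t). f ` A.cm s t) (UNIV :: (bool \<times> bool) set)"
   proof (rule inj_onI, clarify)
    fix s t s' t' assume "f ` A.cm s t = f ` A.cm s' t'"
    thus "s = s' & t = t'" unfolding img_cm_inj[OF f] .
   qed
   hence "card T = card (UNIV :: (bool \<times> bool) set)" unfolding T_def by (rule card_image)
   moreover have "card T <= 3" by (rule B.sib_card[of _ X]) (use sb XY in "auto simp: T_def")
   ultimately show False by (simp add: card_UNIV_bool card_cartesian_product flip: UNIV_Times_UNIV)
  qed
  hence XM: "X \<in> B.Ms" by blast
  have "f ` A.cm s t \<in> B.Ms | f ` A.cm s t = B.OC" for s t using r[of s t] B.sib_Ms XM by blast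
  thus ?thesis using ex XM unfolding X_def by blast
 qed
qed

text \<open>Suppose the outer circle goes to a first-level circle x. Reflections of A, transported
  by f, are involutions of B that fix x. The first one exchanges wa and wb, which are therefore
  opposite. Composing the second with a reflection of B produces an involution that moves z to the
  adjacent wa and fixes x, against \<open>noninv\<close>.\<close>

lemma OC_fixed:
 assumes f: "qsi A.F B.F f g" and m: "B.m0 <= A.m0"
 shows "f ` A.OC = B.OC & (\<forall>s t. f ` A.cm s t \<in> B.Ms)"
proof (rule ccontr)
 assume "~ ?thesis"
 then obtain s t where OM: "f ` A.OC \<in> B.Ms" and y: "f ` A.cm s t = B.OC"
  and al: "!!s t. f ` A.cm s t \<in> B.Ms | f ` A.cm s t = B.OC" using labels[OF f m] by blast
 have inj: "f ` A.cm a b = f ` A.cm a' b' \<longleftrightarrow> a = a' & b = b'" for a b a' b'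
  by (rule img_cm_inj[OF f])
 have injO: "f ` A.cm a b ~= f ` A.OC" for a b by (rule img_cm_OC[OF f])
 have oth: "f ` A.cm a b \<in> B.Ms" if "~ (a = s & b = t)" for a b
  using al[of a b] inj[of a b s t] y that by auto
 have OF: "A.OC \<subseteq> A.F" by (rule circles_sub[OF A.OC_circle])
 define d where "d = A.fixdiag s t"
 define e where "e = f \<circ> d \<circ> g"
 have qe: "qsi B.F B.F e e" unfolding e_def d_def by (rule conj_qsi[OF f A.fixdiag(1)])
 have ei: "e ` f ` M = f ` d ` M" if "M \<subseteq> A.F" for M unfolding e_def by (rule conj_img[OF f that])
 define wa wb z x where "wa = f ` A.cm s (~ t)" and "wb = f ` A.cm (~ s) t" and "z = f ` A.cm (~ s) (~ t)" and "x = f ` A.OC"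
 have eab: "e ` wa = wb" and ex: "e ` x = x"
  unfolding wa_def wb_def x_def ei[OF A.cm_sub] ei[OF OF] unfolding d_def by (simp_all add: A.fixdiag)
 have nadj: "~ B.adj wa wb" using B.noninv[OF qe eab _ _ ex] OM unfolding x_def by blast
 obtain q r where wa: "wa = B.cm q r" using oth[of s "~ t"] B.Ms_cm unfolding wa_def by auto
 obtain q1 r1 where wb: "wb = B.cm q1 r1" using oth[of "~ s" t] B.Ms_cm unfolding wb_def by auto
 obtain q2 r2 where z: "z = B.cm q2 r2" using oth[of "~ s" "~ t"] B.Ms_cm unfolding z_def by auto
 obtain q3 r3 where x: "x = B.cm q3 r3" using OM B.Ms_cm unfolding x_def by auto
 have ne: "wa ~= wb" "z ~= wa" "z ~= wb" "x ~= wa" "x ~= wb" "x ~= z"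
  unfolding wa_def wb_def z_def x_def using inj injO by (auto dest: sym)
 have qr1: "q1 = (~ q)" "r1 = (~ r)" using nadj ne(1) unfolding wa wb B.adj_cm B.cm_inj by auto
 have qr2: "(q2 = q) ~= (r2 = r)" using ne(2,3) qr1 unfolding z wa wb B.cm_inj by auto
 have qr3: "q3 = (~ q2)" "r3 = (~ r2)" using ne(4,5,6) qr1 qr2 unfolding x z wa wb B.cm_inj by auto
 define d' where "d' = A.fixdiag s (~ t)"
 define e' where "e' = f \<circ> d' \<circ> g"
 have qe': "qsi B.F B.F e' e'" unfolding e'_def d'_def by (rule conj_qsi[OF f A.fixdiag(1)])
 have ei': "e' ` f ` M = f ` d' ` M" if "M \<subseteq> A.F" for M unfolding e'_def by (rule conj_img[OF f that])
 have d'1: "d' ` A.cm s t = A.cm (~ s) (~ t)" "d' ` A.cm (~ s) (~ t) = A.cm s t"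
  "d' ` A.cm s (~ t) = A.cm s (~ t)" "d' ` A.OC = A.OC"
  using A.fixdiag[of s "~ t"] unfolding d'_def by auto
 have E: "e' ` B.OC = z" "e' ` z = B.OC" "e' ` wa = wa" "e' ` x = x"
  unfolding y[symmetric] z_def wa_def x_def ei'[OF A.cm_sub] ei'[OF OF] d'1 by simp_all
 \<comment> \<open>The axis reflection of B that exchanges the adjacent circles z and wa, and hence
   also x and wb.\<close>
 define R where "R = (if q2 = q then B.yfl else B.flx)"
 have qR: "qsi B.F B.F R R" unfolding R_def using B.qsi_yfl B.qsi_flx by simp
 have RO: "R ` B.OC = B.OC" unfolding R_def using B.yfl_OC B.flx_OC by simp
 have Rz: "R ` z = wa" "R ` wa = z" unfolding R_def z wa using qr2 by (auto simp: B.yfl_cm B.flx_cm)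
 have E2: "e' ` wb = wb"
 using A.fixdiag[of s "~ t"] ei'[OF A.cm_sub] d'_def wb_def by metis
 have Rx: "R ` x = wb" "R ` wb = x" unfolding R_def x wb using qr1 qr2 qr3 by (auto simp: B.yfl_cm B.flx_cm)
 \<comment> \<open>t1 exchanges the outer circle with wa, as e' exchanges it with z. Conjugating e'
   by t1 gives an involution that exchanges z and wa and still fixes x.\<close>
 define t1 where "t1 = R \<circ> e' \<circ> R"
 have q1: "qsi B.F B.F t1 t1" unfolding t1_def by (rule B.conj_inv[OF qR qe'])
 have T1: "t1 ` B.OC = wa" "t1 ` z = z" "t1 ` x = x" unfolding t1_def image_comp[symmetric] using RO Rz Rx E E2 by simp_all
 define t2 where "t2 = t1 \<circ> e' \<circ> t1"
 have q2: "qsi B.F B.F t2 t2" unfolding t2_def by (rule B.conj_inv[OF q1 qe'])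
 have T2: "t2 ` z = wa" "t2 ` x = x" unfolding t2_def image_comp[symmetric] using T1 E by simp_all
 have "B.adj z wa" unfolding z wa B.adj_cm using qr2 by auto
 thus False using B.noninv[OF q2 T2(1) _ _ T2(2)] OM unfolding x_def by blast
qed

definition normal :: "(pt => pt) => (pt => pt) => bool" where
 "normal f g \<longleftrightarrow> qsi A.F B.F f g & f ` A.OC = B.OC & (\<forall>s t. f ` A.cm s t = B.cm s t)"

text \<open>A reflection of A exchanging two opposite circles fixes a third one, so by
  \<open>noninv\<close> their images are not adjacent: opposite circles stay opposite. Any such
  labelling is undone by a symmetry of the square.\<close>

lemma normal_exists:
 assumes f: "qsi A.F B.F f g" and m: "B.m0 <= A.m0"
 shows "\<exists>f g. normal f g"
proof -
 have O: "f ` A.OC = B.OC" and M: "!!s t. f ` A.cm s t \<in> B.Ms" using OC_fixed[OF f m] by auto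
 have opp: "\<exists>q r. f ` A.cm s t = B.cm q r & f ` A.cm (~ s) (~ t) = B.cm (~ q) (~ r)" if f: "qsi A.F B.F f g" and M: "!!s t. f ` A.cm s t \<in> B.Ms" for f g s t
 proof -
  obtain q r where q: "f ` A.cm s t = B.cm q r" using M[of s t] B.Ms_cm by auto
  obtain q' r' where q': "f ` A.cm (~ s) (~ t) = B.cm q' r'" using M[of "~ s" "~ t"] B.Ms_cm by auto
  define d where "d = A.fixdiag s (~ t)"
  define e where "e = f \<circ> d \<circ> g"
  have qe: "qsi B.F B.F e e" unfolding e_def d_def by (rule conj_qsi[OF f A.fixdiag(1)])
  have ei: "e ` f ` M = f ` d ` M" if "M \<subseteq> A.F" for M unfolding e_def by (rule conj_img[OF f that])
  have "d ` A.cm s t = A.cm (~ s) (~ t)" "d ` A.cm s (~ t) = A.cm s (~ t)"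
   using A.fixdiag[of s "~ t"] unfolding d_def by auto
  hence 1: "e ` f ` A.cm s t = f ` A.cm (~ s) (~ t)" "e ` f ` A.cm s (~ t) = f ` A.cm s (~ t)"
   unfolding ei[OF A.cm_sub] by simp_all
  have na: "~ B.adj (f ` A.cm s t) (f ` A.cm (~ s) (~ t))" using B.noninv[OF qe 1(1) _ M 1(2)] by blast
  have ne: "f ` A.cm s t ~= f ` A.cm (~ s) (~ t)" unfolding img_cm_inj[OF f] by simp
  have "q' = (~ q)" "r' = (~ r)" using na ne unfolding q q' B.adj_cm B.cm_inj by auto
  thus ?thesis using q q' by blast
 qed
 obtain q r where q: "f ` A.cm False False = B.cm q r" "f ` A.cm True True = B.cm (~ q) (~ r)" using opp[OF f M, of False False] by auto
 \<comment> \<open>R1 and R2 move the images of one opposite pair into place; R3 then exchanges the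
   other pair if necessary and keeps the first.\<close>
 define R1 where "R1 = (if q then B.flx else id)"
 define R2 where "R2 = (if r then B.yfl else id)"
 have idq: "qsi B.F B.F id id" by (rule qsi_isometry) auto
 have qR: "qsi B.F B.F R1 R1" "qsi B.F B.F R2 R2" unfolding R1_def R2_def using B.qsi_yfl B.qsi_flx idq by simp_all
 define f1 where "f1 = R2 \<circ> (R1 \<circ> f)"
 define g1 where "g1 = (g \<circ> R1) \<circ> R2"
 have f1: "qsi A.F B.F f1 g1" unfolding f1_def g1_def by (rule qsi_trans[OF qsi_trans[OF f qR(1)] qR(2)])
 have O1: "f1 ` A.OC = B.OC" unfolding f1_def image_comp[symmetric] O by (simp add: R1_def R2_def B.flx_OC B.yfl_OC)
 have FF: "f1 ` A.cm False False = B.cm False False" "f1 ` A.cm True True = B.cm True True"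
  unfolding f1_def image_comp[symmetric] q by (simp_all add: R1_def R2_def B.flx_cm B.yfl_cm)
 have M1: "f1 ` A.cm s t \<in> B.Ms" for s t
 proof -
  obtain a b where "f ` A.cm s t = B.cm a b" using M[of s t] B.Ms_cm by auto
  thus ?thesis unfolding f1_def image_comp[symmetric] B.Ms_cm by (simp add: R1_def R2_def B.flx_cm B.yfl_cm) blast
 qed
 obtain a b where ab: "f1 ` A.cm False True = B.cm a b" "f1 ` A.cm True False = B.cm (~ a) (~ b)" using opp[OF f1 M1, of False True] by auto
 have "B.cm a b ~= B.cm False False" "B.cm a b ~= B.cm True True"
  unfolding ab(1)[symmetric] FF[symmetric] img_cm_inj[OF f1] by simp_all
 hence "b = (~ a)" unfolding B.cm_inj by auto
 define R3 where "R3 = (if a then B.sw else id)"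
 have qR3: "qsi B.F B.F R3 R3" unfolding R3_def using B.qsi_sw idq by simp
 have "normal (R3 \<circ> f1) (g1 \<circ> R3)"
  unfolding normal_def
 proof (intro conjI allI)
  show "qsi A.F B.F (R3 \<circ> f1) (g1 \<circ> R3)" by (rule qsi_trans[OF f1 qR3])
  show "(R3 \<circ> f1) ` A.OC = B.OC" unfolding image_comp[symmetric] O1 by (simp add: R3_def B.sw_OC)
  fix s t
  show "(R3 \<circ> f1) ` A.cm s t = B.cm s t"
   unfolding image_comp[symmetric] using ab FF \<open>b = (~ a)\<close>
   by (cases s; cases t; cases a) (auto simp: R3_def B.sw_cm)
 qed
 thus ?thesis by blast
qed

end

section \<open>Preservation of the corners\<close>

context carpet_params begin

lemma refl_sw: "refl sw {z. fst z <= snd z}"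
 unfolding refl_def
proof (intro conjI ballI impI)
 fix c y :: "pt" assume h: "(c \<in> {z. fst z <= snd z}) ~= (y \<in> {z. fst z <= snd z})"
 have "(fst c - snd c) * (fst y - snd y) <= 0"
  using h by (auto simp: mult_le_0_iff)
 hence "(fst c - snd y)^2 + (snd c - fst y)^2 <= (fst c - fst y)^2 + (snd c - snd y)^2"
  by (simp add: power2_eq_square algebra_simps)
 thus "dist c (sw y) <= dist c y" unfolding dist_prod_def dist_real_def sw_def by simp
next
 fix z :: "pt" assume "z \<in> {z. fst z <= snd z}" "sw z \<in> {z. fst z <= snd z}"
 thus "sw z = z" unfolding sw_def by (simp add: prod_eq_iff)
next
 fix E assume "E \<in> circles F"
 then obtain k i j where ix: "(k, i, j) \<in> ixs" "E = cr k i j" using circles_ix by blast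
 have le: "x <= y" if "x * pw k <= real a + 1" "real b <= y * pw k" "a < b" for x y a b
 proof -
  have "real a + 1 <= real b" using that(3) by linarith
  hence "x * pw k <= y * pw k" using that(1,2) by linarith
  thus ?thesis by (simp only: mult_le_cancel_right_pos[OF npow_pos])
 qed
 consider "i = j" | "i < j" | "j < i" by linarith
 thus "sw ` E \<subseteq> E | E \<subseteq> {z. fst z <= snd z} | (\<forall>z\<in>E. sw z \<in> {z. fst z <= snd z})"
 proof cases
  case 1
  thus ?thesis unfolding ix(2) sw_circ by simp
 next
  case 2
  have "fst z <= snd z" if "z \<in> E" for z
   by (rule le[of "fst z" i j "snd z"]) (use that 2 in "auto simp: ix(2) circ_def gsq_def")
  thus ?thesis by blast
 next
  case 3
  have "snd z <= fst z" if "z \<in> E" for z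
   by (rule le[of "snd z" j i "fst z"]) (use that 3 in "auto simp: ix(2) circ_def gsq_def")
  thus ?thesis unfolding sw_def by simp
 qed
qed (simp_all add: sw_F, simp add: sw_def)

lemma cm_below: "z \<in> cm True False ==> snd z < fst z"
 and cm_above: "z \<in> cm False True ==> fst z < snd z"
proof -
 have le: "x < y" if "x * real n <= real p + 1" "real (n - 1 - p) <= y * real n" for x y
 proof -
  have "x * real n < y * real n" using that p_gap by linarith
  thus ?thesis using nR(1) by (simp only: mult_less_cancel_right_pos)
 qed
 show "z \<in> cm True False ==> snd z < fst z" by (rule le) (auto simp: cm_def circ_def gsq_def dg_def)
 show "z \<in> cm False True ==> fst z < snd z" by (rule le) (auto simp: cm_def circ_def gsq_def dg_def)
qed

text \<open>Were the second hole live, \<open>row_lemma\<close> would apply between the two. The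
  holes met by the low row a are small compared with the height 1 / n below all first-level circles,
  so their blocks avoid C and D and stay where \<open>v\<close> is nonnegative.\<close>

lemma row_dead:
 assumes P: "pot C D u rho v" and hA: "hl l b a" and hE: "hl l r a" and br: "b < r" and an: "(a + 1) * n < n ^ l"
  and CDy: "!!x. x \<in> C \<union> D ==> 1 <= snd x * real n"
  and vp: "!!k z. z \<in> F ==> snd z * pw l <= 3 * (real a + 1) ==> real b - 2 * (real a + 1) <= fst z * pw l ==>
    fst z * pw l <= real r + 1 + 2 * (real a + 1) ==> 0 <= v k z"
  and dA: "dead rho v (cr l b a)"
 shows "dead rho v (cr l r a)"
proof -
 have cC: "C \<in> circles F" and cD: "D \<in> circles F" using P unfolding pot_def by auto
 obtain x0 y0 where xy0: "x0 \<in> C" "y0 \<in> D" using circle_ne[OF cC] circle_ne[OF cD] by blast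
 have an': "(real a + 1) * real n < pw l"
 proof -
  have "real ((a + 1) * n) < real (n ^ l)" using an by (simp only: of_nat_less_iff)
  thus ?thesis by (simp add: distrib_right)
 qed
 have small: "snd x * real n < 1" if "snd x * pw l <= real a + 1" for x :: "pt"
 proof -
  have "snd x * pw l * real n <= (real a + 1) * real n" using that by (intro mult_right_mono) auto
  moreover have "(snd x * real n) * pw l = snd x * pw l * real n" by simp
  ultimately have "(snd x * real n) * pw l < 1 * pw l" using an' by linarith
  thus ?thesis by (simp only: mult_less_cancel_right_pos[OF npow_pos])
 qed
 have blkok: "clear v C D (blk l2 (c div n ^ m) (a div n ^ m))"
  if c: "b <= c" "c <= r" and l: "l = l2 + m" and h: "hl l2 (c div n ^ m) (a div n ^ m)" for l2 m c
 proof -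
  define al ga where "al = a div n ^ m" and "ga = c div n ^ m"
  define K W where "K = pw l2" and "W = pw m"
  have h': "hl l2 ga al" using h unfolding al_def ga_def .
  obtain q where q: "l2 = Suc q" using h by (cases l2) auto
  have hd: "hdig n p (al mod n)" using h' unfolding q by simp
  \<comment> \<open>A hole digit is not 0, so al >= 1 and the side W of the hole, in units of level
    l, is at most a; this explains the bounds 2 * (a + 1) and 3 * (a + 1).\<close>
  have al1: "1 <= al"
  proof (rule ccontr)
   assume "~ 1 <= al"
   hence "al = 0" by simp
   hence "al mod n = 0" by simp
   thus False using hdig_bounds[OF hd] by simp
  qed
  have KW: "pw l = K * W" unfolding l K_def W_def by (rule power_add)
  have W0: "0 < W" unfolding W_def by simp
  have a1: "real al * W <= real a" "real a < (real al + 1) * W" and c1: "real ga * W <= real c" "real c < (real ga + 1) * W"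
   using div_real[of a m] div_real[of c m] unfolding W_def al_def ga_def by linarith+
  have Wa: "W <= real al * W" using al1 W0 by simp
  have v: "0 <= v k z" if z: "z \<in> F" "z \<in> blk l2 ga al" for k z
  proof (rule vp[OF z(1)])
   have s: "K * snd z < real al + 2" and f: "real ga - 1 < K * fst z" "K * fst z < real ga + 2"
    using z(2) unfolding blk_def K_def by auto
   have "K * snd z * W <= (real al + 2) * W" "(real ga - 1) * W <= K * fst z * W" "K * fst z * W <= (real ga + 2) * W"
    using s f W0 by (simp_all add: mult_right_mono less_imp_le)
   hence b: "snd z * pw l <= real al * W + 2 * W" "real ga * W - W <= fst z * pw l" "fst z * pw l <= real ga * W + 2 * W"
    unfolding KW by (simp_all add: algebra_simps)
   have r: "real b <= real c" "real c <= real r" using c by auto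
   have c2: "real c < real ga * W + W" using c1(2) by (simp add: distrib_right)
   show "snd z * pw l <= 3 * (real a + 1)" using b(1) Wa a1(1) by argo
   show "real b - 2 * (real a + 1) <= fst z * pw l" using b(2) Wa a1(1) c2 r by argo
   show "fst z * pw l <= real r + 1 + 2 * (real a + 1)" using b(3) Wa a1(1) c1(1) r by argo
  qed
  \<comment> \<open>The block lies in the parent square of the hole, which stays below height 1 / n
    because al < n^q.\<close>
  have no: "snd z * real n < 1" if "z \<in> blk l2 ga al" for z
  proof -
   have zg: "z \<in> gb q (ga div n) (al div n)" using blk_parent h' that unfolding q by blast
   have "real al * W * real n <= real a * real n" using a1(1) by (intro mult_right_mono) auto
   also have "... <= (real a + 1) * real n" by (intro mult_right_mono) auto
   also have "... < K * W" using an' unfolding KW .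
   also have "real al * W * real n = (real al * real n) * W" by simp
   finally have "(real al * real n) * W < K * W" .
   hence "real al * real n < K" using W0 by simp
   hence "real al * real n < pw q * real n" unfolding K_def q by (simp add: mult.commute)
   hence alq: "real al < pw q" using nR(1) by (simp only: mult_less_cancel_right_pos)
   hence alq': "al < n ^ q" by (metis of_nat_less_iff of_nat_power)
   have "q ~= 0" using alq' al1 by (intro notI) simp
   then obtain s where s: "q = Suc s" by (cases q) auto
   have "al div n < n ^ s" using alq' unfolding s by (simp add: div_less_iff_less_mult mult.commute)
   hence "al div n + 1 <= n ^ s" by simp
   hence "real (al div n + 1) <= real (n ^ s)" by (simp only: of_nat_le_iff)
   hence "real (al div n) + 1 <= pw s" by simp
   moreover have "snd z * pw q < real (al div n) + 1" using zg unfolding gbx_def by simp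
   moreover have "(snd z * real n) * pw s = snd z * pw q" unfolding s by simp
   ultimately have "(snd z * real n) * pw s < 1 * pw s" by linarith
   thus ?thesis by (simp only: mult_less_cancel_right_pos[OF npow_pos])
  qed
  have "C \<inter> blk l2 ga al = {}" "D \<inter> blk l2 ga al = {}" using no CDy by (meson UnI1 UnI2 disjoint_iff not_le)+
  thus ?thesis using v unfolding al_def ga_def by blast
 qed
 have bE: "clear v C D (blk l r a)"
  using blkok[of r l 0] br hE by simp
 have lod: "live v (cr l r a) | dead rho v (cr l r a)"
  by (rule hole_live_or_dead[OF P hE]) (use bE in auto)
 have "~ live v (cr l r a)"
 proof
  assume L: "live v (cr l r a)"
  have lf: "lface l (b + 1) a (cr l b a)" using hole_lface[OF hA, of a 0] by simp
  have rf: "rface l r a (cr l r a)" using hole_rface[OF hE, of a 0] by simp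
  have bnd: "a < n ^ l" "r < n ^ l" using hole_bound[OF hE] by auto
  have inA: "snd x * real n < 1" if "x \<in> cr l b a" for x
   by (rule small) (use that in "auto simp: circ_def gsq_def")
  have inS: "snd x * real n < 1" if "x \<in> strip l (b + 1) r a" for x
   by (rule small) (use that in "auto simp: strip_def")
  have nx: "~ snd x0 * real n < 1" "~ snd y0 * real n < 1" using CDy[of x0] CDy[of y0] xy0 by auto
  show False
  proof (rule row_lemma[OF P rf L _ bnd(1) _ _ _ _ lf dA _ _ order_refl])
   show "cr l b a ~= C" "cr l b a ~= D" using inA xy0 nx by blast+
   show "~ C \<subseteq> strip l (b + 1) r a" "~ D \<subseteq> strip l (b + 1) r a" using inS xy0 nx by blast+
   show "r <= n ^ l" "b + 1 <= r" using bnd br by auto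
   fix k x assume x: "x \<in> F" "x \<in> strip l (b + 1) r a"
   show "0 <= v k x" by (rule vp[OF x(1)]) (use x(2) in "auto simp: strip_def")
  next
   fix l2 m c assume c: "b + 1 <= c" "c < r" "l = l2 + m" "hl l2 (c div n ^ m) (a div n ^ m)"
   show "clear v C D (blk l2 (c div n ^ m) (a div n ^ m))" by (rule blkok) (use c in auto)
  qed
 qed
 thus ?thesis using lod by blast
qed

end

context carpet_pair begin

text \<open>Weaker than \<open>normal\<close>, so that it survives composition with the antidiagonal
  reflection on one side only.\<close>

definition semi :: "(pt => pt) => (pt => pt) => bool" where
 "semi f g \<longleftrightarrow> qsi A.F B.F f g & f ` A.OC = B.OC & f ` A.cm True False = B.cm True False & f ` A.cm False True = B.cm False True"

text \<open>A sequence for the two circles off the diagonal, antisymmetric under the diagonal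
  reflection of B and nearly so under the one transported from A, is polarized with respect to both,
  and \<open>v\<close> is the rescaled mean of the results. Where the two diagonals disagree about
  the side of a point, the polarizations cancel.\<close>

lemma corner_pot:
 assumes S: "semi f g"
 shows "\<exists>u rho v. B.pot (B.cm True False) (B.cm False True) u rho v &
   (\<forall>k. \<forall>z\<in>B.F. fst z <= snd z --> 0 <= v k z) &
   (\<forall>k. \<forall>z\<in>B.F. fst z <= snd z & snd (g z) < fst (g z) --> v k z = 0) &
   (\<forall>k. \<forall>z\<in>B.cm False True. v k z = 1/2)"
proof -
 have f: "qsi A.F B.F f g" and fC: "f ` A.cm True False = B.cm True False" and fD: "f ` A.cm False True = B.cm False True"
  using S unfolding semi_def by auto
 define C D where "C = B.cm True False" and "D = B.cm False True"
 have cC: "C \<in> circles B.F" and cD: "D \<in> circles B.F" and ne: "C ~= D" unfolding C_def D_def B.cm_inj by (auto simp: B.cm_circle)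
 have h: "homeomorphism A.F B.F f g" by (rule qsi_homeo[OF f])
 have fF: "f x \<in> B.F" "g (f x) = x" if "x \<in> A.F" for x using h that unfolding homeomorphism_def by blast+
 have gF: "g x \<in> A.F" "f (g x) = x" if "x \<in> B.F" for x using h that unfolding homeomorphism_def by blast+
 define e where "e = f \<circ> B.sw \<circ> g"
 have qe: "qsi B.F B.F e e" unfolding e_def by (rule conj_qsi[OF f A.qsi_sw])
 have eC: "e ` C = D" "e ` D = C"
 proof -
  have "e ` f ` M = f ` A.sw ` M" if "M \<subseteq> A.F" for M unfolding e_def by (rule conj_img[OF f that])
  thus "e ` C = D" "e ` D = C" unfolding C_def D_def fC[symmetric] fD[symmetric] by (simp_all add: A.cm_sub A.sw_cm)
 qed
 have sC: "B.sw ` C = D" "B.sw ` D = C" unfolding C_def D_def B.sw_cm by auto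
 obtain u' where u': "minseq B.F C D u'" and us': "!!k x. x \<in> B.F ==> u' k x + u' k (B.sw x) = 1"
  and ue': "!!k x. x \<in> B.F ==> \<bar>u' k x + u' k (e x) - 1\<bar> <= 1 / (real k + 1)"
  using B.antisymmetrize[OF B.qsi_sw qe sC eC cC cD ne] by blast
 \<comment> \<open>The shift by 4 keeps the slack at most 1/5, so that 1 - 2 * kap stays
   positive.\<close>
 define u where "u = (%k. u' (k + 4))"
 have u: "minseq B.F C D u"
  using minseq_subseq[OF u', of "%k. k + 4"] unfolding u_def comp_def by (simp add: strict_mono_def)
 define kap where "kap = (%k. 1 / (real k + 5))"
 have k0: "0 <= kap k" "kap k <= 1/5" for k unfolding kap_def by (simp_all add: field_simps)
 have us: "u k x + u k (B.sw x) = 1" if "x \<in> B.F" for k x unfolding u_def by (rule us'[OF that])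
 have ue: "\<bar>u k x + u k (e x) - 1\<bar> <= kap k" if "x \<in> B.F" for k x
  using ue'[OF that, of "k + 4"] unfolding u_def kap_def by (simp add: add.commute)
 note au = minseqD(1)[OF u]
 have u01: "0 <= u k x" "u k x <= 1" if "x \<in> B.F" for k x using minseqD(2,3)[OF u that] by auto
 define Y where "Y = {z :: pt. fst z <= snd z}"
 define w1 where "w1 = (%k. B.pol (kap k) Y (u k))"
 define w2 where "w2 = (%k. B.pol (kap k) Y (u k \<circ> f) \<circ> g)"
 have t1: "tame B.F (w1 k)" "E \<in> circles B.F ==> osc (w1 k) E <= osc (u k) E" for k E
  using B.polarize[OF B.refl_sw admD(1)[OF au[of k]] k0(1)[of k]] us[of _ k] k0(1)[of k] unfolding w1_def Y_def by simp_all
 have tuf: "tame A.F (u k \<circ> f)" for k by (rule tame_qsi[OF f A.compact_F admD(1)[OF au]])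
 have asf: "\<bar>(u k \<circ> f) x + (u k \<circ> f) (A.sw x) - 1\<bar> <= kap k" if "x \<in> A.F" for k x
  using ue[OF fF(1)[OF that], of k] fF(2)[OF that] unfolding e_def by simp
 have p2: "tame A.F (B.pol (kap k) Y (u k \<circ> f))" "E \<in> circles A.F ==> osc (B.pol (kap k) Y (u k \<circ> f)) E <= osc (u k \<circ> f) E" for k E
  using A.polarize[OF A.refl_sw tuf[of k] k0(1)[of k] asf[of _ k]] unfolding Y_def by (simp_all add: comp_def)
 have t2: "tame B.F (w2 k)" for k unfolding w2_def by (rule tame_qsi[OF qsi_sym[OF f] B.compact_F p2(1)])
 have o2: "osc (w2 k) E <= osc (u k) E" if E: "E \<in> circles B.F" for k E
 proof -
  have "osc (w2 k) E = osc (B.pol (kap k) Y (u k \<circ> f)) (g ` E)" unfolding w2_def by (rule osc_comp)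
  also have "... <= osc (u k \<circ> f) (g ` E)"
   by (rule p2(2)) (rule circles_homeo[OF homeomorphism_symD[OF h] E])
  also have "... = osc (u k) (f ` g ` E)" by (rule osc_comp)
  also have "f ` g ` E = E" by (rule homeomorphism_image_inv[OF homeomorphism_symD[OF h] circles_sub[OF E]])
  finally show ?thesis .
 qed
 \<comment> \<open>Polarization with slack leaves the boundary values at distance 1/2 - kap from
   1/2; the factor c restores 0 and 1 and tends to 1.\<close>
 define c where "c = (%k. 1 / (1 - 2 * kap k))"
 have c0: "0 < c k" "1 - 2 * kap k > 0" for k unfolding c_def using k0(2)[of k] by auto
 define V where "V = (%k z. c k * ((w1 k z - 1/2) + (w2 k z - 1/2)) / 2)"
 define w where "w = (%k z. 1/2 + V k z)"
 have tw: "tame B.F (w k)" for k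
 proof -
  have "tame B.F (%x. (1/2 - c k / 2) + (c k / 2) * (w1 k x + w2 k x))" by (rule tame_affine[OF tame_add[OF t1(1) t2]])
  thus ?thesis unfolding w_def V_def by (rule tame_cong) (simp add: field_simps)
 qed
 have ow: "osc (w k) E <= c k * osc (u k) E" if E: "E \<in> circles B.F" for k E
 proof (rule osc_le)
  have b: "bounded (w1 k ` E)" "bounded (w2 k ` E)" using tame_bounded_sub[OF t1(1) circles_sub[OF E]] tame_bounded_sub[OF t2 circles_sub[OF E]] by auto
  have o: "0 <= osc (u k) E" by (rule osc_circle_nonneg[OF admD(1)[OF au] E])
  show "0 <= c k * osc (u k) E" using o c0[of k] by simp
  fix x y assume xy: "x \<in> E" "y \<in> E"
  have "(w1 k x - w1 k y) + (w2 k x - w2 k y) <= 2 * osc (u k) E"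
   using osc_bound[OF b(1) xy] osc_bound[OF b(2) xy] t1(2)[OF E, of k] o2[OF E, of k] by linarith
  hence "c k * ((w1 k x - w1 k y) + (w2 k x - w2 k y)) <= c k * (2 * osc (u k) E)" using c0(1)[of k] by (intro mult_left_mono) auto
  thus "w k x - w k y <= c k * osc (u k) E" unfolding w_def V_def by (simp add: field_simps)
 qed
 have ow': "\<bar>osc (w k) E\<bar> <= \<bar>c k * osc (u k) E\<bar>" if E: "E \<in> circles B.F" for k E
  using ow[OF E, of k] osc_circle_nonneg[OF tw[of k] E] by linarith
 have l: "l2 (circles B.F) (osc (w k))" for k by (rule l2_mono[OF l2_cmult[OF admD(2)[OF au]] ow'])
 have ew: "en B.F (w k) <= (c k)^2 * en B.F (u k)" for k
  unfolding en_def ns_cmult[symmetric] by (rule ns_mono[OF l2_cmult[OF admD(2)[OF au]] ow'])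
 have w1v: "\<bar>w1 k z - 1/2\<bar> <= 1/2 - kap k" "\<bar>w2 k z - 1/2\<bar> <= 1/2 - kap k" if z: "z \<in> B.F" for k z
 proof -
  have "\<bar>u k z - 1/2\<bar> <= 1/2" using u01[OF z, of k] by argo
  thus "\<bar>w1 k z - 1/2\<bar> <= 1/2 - kap k" "\<bar>w2 k z - 1/2\<bar> <= 1/2 - kap k"
   using k0[of k] gF(2)[OF z] unfolding w1_def w2_def B.pol_def by auto
 qed
 have Vb: "\<bar>V k z\<bar> <= 1/2" if z: "z \<in> B.F" for k z
 proof -
  have "\<bar>(w1 k z - 1/2) + (w2 k z - 1/2)\<bar> <= 1 - 2 * kap k" using w1v[OF z, of k] by linarith
  hence "c k * \<bar>(w1 k z - 1/2) + (w2 k z - 1/2)\<bar> <= c k * (1 - 2 * kap k)" using c0(1)[of k] by (intro mult_left_mono) auto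
  also have "... = 1" unfolding c_def using c0(2)[of k] by simp
  finally show ?thesis unfolding V_def using c0(1)[of k] by (simp add: abs_mult)
 qed
 have Ve: "V k z = e / 2"
  if z: "z \<in> B.F" and e: "e = 1 & z \<in> Y & g z \<in> Y & u k z = 1 | e = -1 & z \<notin> Y & g z \<notin> Y & u k z = 0" for k z e
 proof -
  have "w1 k z - 1/2 = e * (1/2 - kap k)" "w2 k z - 1/2 = e * (1/2 - kap k)"
   using e gF(2)[OF z] k0[of k] unfolding w1_def w2_def B.pol_def by auto
  hence s: "(w1 k z - 1/2) + (w2 k z - 1/2) = e * (1 - 2 * kap k)" by (simp only:) (simp add: algebra_simps)
  have "V k z = e * (c k * (1 - 2 * kap k)) / 2" unfolding V_def s by simp
  also have "c k * (1 - 2 * kap k) = 1" unfolding c_def using c0(2)[of k] by simp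
  finally show ?thesis by simp
 qed
 have gm: "g z \<in> M" if "z \<in> f ` M" "M \<subseteq> A.F" for z M using that fF(2) by auto
 have VC: "V k z = -1/2" if z: "z \<in> C" for k z
  using Ve[of z "-1" k] gm[of z "A.cm True False"] A.cm_sub A.cm_below[of "g z"] B.cm_below[of z] circles_sub[OF cC] admD(3)[OF au z, of k] z
  unfolding C_def fC Y_def by auto
 have VD: "V k z = 1/2" if z: "z \<in> D" for k z
  using Ve[of z 1 k] gm[of z "A.cm False True"] A.cm_sub A.cm_above[of "g z"] B.cm_above[of z] circles_sub[OF cD] admD(4)[OF au z, of k] z
  unfolding D_def fD Y_def by auto
 have aw: "adm B.F C D (w k)" for k
 proof -
  have "w k x = 0" if "x \<in> C" for x unfolding w_def VC[OF that] by simp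
  moreover have "w k x = 1" if "x \<in> D" for x unfolding w_def VD[OF that] by simp
  ultimately show ?thesis unfolding adm_def using tw l by blast
 qed
 have w01: "0 <= w k z" "w k z <= 1" if "z \<in> B.F" for k z using Vb[OF that, of k] unfolding w_def by argo+
 have mw: "minseq B.F C D w"
 proof (rule minseqI[OF aw w01])
  show "en B.F (w k) <= cap B.F C D + ((c k)^2 * en B.F (u k) - cap B.F C D)" for k using ew[of k] by simp
  have "(%k. kap k) \<longlonglongrightarrow> 0"
   unfolding kap_def using LIMSEQ_ignore_initial_segment[OF lim_1_over_n[where 'a = real], of 5] by simp
  hence "c \<longlonglongrightarrow> 1 / (1 - 2 * 0)" unfolding c_def by (intro tendsto_intros) auto
  hence "(%k. (c k)^2 * en B.F (u k) - cap B.F C D) \<longlonglongrightarrow> (1 / (1 - 2 * 0))\<^sup>2 * cap B.F C D - cap B.F C D"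
   by (intro tendsto_intros minseqD(4)[OF u])
  thus "(%k. (c k)^2 * en B.F (u k) - cap B.F C D) \<longlonglongrightarrow> 0" by simp
 qed auto
 obtain rho where ml: "mlim B.F C D w rho" using mlim_exists[OF mw] .
 have Vw: "V = (%k x. 1 * (w k x - 1/2))" unfolding w_def by simp
 have P: "B.pot C D w rho V" unfolding B.pot_def using ml cC cD Vw by blast
 have V1: "0 <= V k z" if z: "z \<in> B.F" "fst z <= snd z" for k z
 proof -
  have "0 <= (w1 k z - 1/2) + (w2 k z - 1/2)" using z gF(2)[OF z(1)] unfolding w1_def w2_def B.pol_def Y_def by auto
  thus ?thesis unfolding V_def using c0(1)[of k] by simp
 qed
 have V2: "V k z = 0" if z: "z \<in> B.F" "fst z <= snd z" "snd (g z) < fst (g z)" for k z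
 proof -
  have "(w1 k z - 1/2) + (w2 k z - 1/2) = 0" using z gF(2)[OF z(1)] unfolding w1_def w2_def B.pol_def Y_def by auto
  thus ?thesis unfolding V_def by simp
 qed
 show ?thesis using P V1 V2 VD unfolding C_def D_def by blast
qed

end

section \<open>Dead holes near an edge\<close>

context carpet_params begin

lemma cell_00: "cl k 0 0"
 by (induction k) (use hdig_0 in auto)

lemma cell_row0: "c < n ^ k ==> cl k c 0"
proof (induction k arbitrary: c)
 case (Suc k)
 have "c div n < n ^ k" using Suc.prems by (simp add: div_less_iff_less_mult mult.commute)
 thus ?case using Suc.IH hdig_0(1) by simp
qed simp

lemma cm_snd: "x \<in> cm s t ==> 1 <= snd x * real n"
using hdig_bounds[OF dg(1)[of t]] by (simp add: cm_def circ_def gsq_def)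

lemma dead_img:
 assumes "!!x. x \<in> E' ==> T x \<in> E" "T ` E' = E"
 shows "dead (%E. rho (T ` E)) (%k. v k \<circ> T) E' \<longleftrightarrow> dead rho v E"
using assms assms(2) by (auto simp: dead_def comp_def)

text \<open>The dead hole lies to the left of the upper left circle, in a row that hits this circle.
  The holes in between stay above the diagonal and away from the first-level circles, so
  \<open>row_lemma\<close> runs from the dead hole to the live circle.\<close>

lemma strip_to_cm:
 assumes P: "pot (cm True False) (cm False True) u rho v" and v0: "!!k z. z \<in> F ==> fst z <= snd z ==> 0 <= v k z"
  and L: "live v (cm False True)" and h: "hl (Suc (Suc s)) a ((n - 1 - p) * n ^ Suc s + p)" and an: "(a + 1) * n < n ^ Suc (Suc s)"
  and dE: "dead rho v (cr (Suc (Suc s)) a ((n - 1 - p) * n ^ Suc s + p))"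
 shows False
proof -
 define r W where "r = (n - 1 - p) * n ^ Suc s + p" and "W = n ^ Suc s"
 define l where "l = Suc (Suc s)"
 define C D E where "C = cm True False" and "D = cm False True" and "E = cr l a r"
 have hE: "hl l a r" using h unfolding l_def r_def .
 have W: "0 < W" "p < W" "n ^ l = n * W"
 proof -
  show "0 < W" unfolding W_def by (rule npow_pos')
  have "n ^ 1 <= W" unfolding W_def by (rule power_increasing) (use n5 in auto)
  thus "p < W" using p2 by simp
  show "n ^ l = n * W" unfolding l_def W_def by simp
 qed
 have lW: "l = 1 + Suc s" unfolding l_def by simp
 have rdiv: "r div n ^ Suc s = n - 1 - p" unfolding r_def using W(2) unfolding W_def by (intro div_nat_eqI) (auto simp: mult.commute)
 have hD: "hl 1 p (n - 1 - p)" using cm_hole[of False True] unfolding dg_def by simp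
 have rD: "rface l (p * n ^ Suc s) r D"
  using hole_rface[OF hD rdiv] unfolding lW D_def cm_def dg_def by simp
 have lE: "lface l (a + 1) r E" using hole_lface[OF hE, of r 0] unfolding E_def by simp
 have "(a + 1) * n < W * n" using an unfolding l_def[symmetric] W(3) mult.commute[of n W] .
 hence aW: "a + 1 < W" by (simp only: mult_less_cancel2)
 have lc: "1 ~= l" unfolding l_def by simp
 have ixE: "(l, a, r) \<in> ixs" using hE unfolding ixs_def by blast
 have ixM: "(1, dg s, dg t) \<in> ixs" for s t using cm_hole unfolding ixs_def by blast
 have ne: "E ~= C" "E ~= D" unfolding E_def C_def D_def cm_def using circ_eq_iff[OF ixE ixM] lc by blast+
 have rW: "real (n - 1 - p) * real W <= real r" unfolding r_def W_def by simp
 have Nl: "pw l = real n * real W" using W(3) by (metis of_nat_mult of_nat_power)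
 have st: "fst x * real n <= real p & real (n - 1 - p) < snd x * real n" if "x \<in> strip l (a + 1) (p * n ^ Suc s) r" for x
 proof -
  have "fst x * pw l <= real p * real W" "real r < snd x * pw l" using that unfolding strip_def W_def by auto
  hence "(fst x * real n) * real W <= real p * real W" "real (n - 1 - p) * real W < (snd x * real n) * real W"
   using rW unfolding Nl by (simp_all add: mult_ac)
  thus ?thesis using W(1) by simp
 qed
 have less: "x <= y" if "x * real n <= real p" "real (n - 1 - p) < y * real n" for x y
 proof -
  have "x * real n <= y * real n" using that p_gap by linarith
  thus ?thesis using nR(1) by (simp only: mult_le_cancel_right_pos)
 qed
 show False
 proof (rule row_lemma[OF P rD L[folded D_def] _ _ _ _ _ _ lE dE[folded r_def l_def, folded E_def] ne[unfolded C_def D_def] order_refl])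
  have "p * W <= n * W" using p2 by (intro mult_le_mono1) simp
  thus "p * n ^ Suc s <= n ^ l" unfolding W(3) unfolding W_def .
  show "r < n ^ l" using hole_bound[OF hE] by simp
  have "1 * W <= p * W" using p1 by (intro mult_le_mono1) simp
  thus "a + 1 <= p * n ^ Suc s" using aW unfolding W_def by linarith
  show "~ cm True False \<subseteq> strip l (a + 1) (p * n ^ Suc s) r"
  proof
   assume s: "cm True False \<subseteq> strip l (a + 1) (p * n ^ Suc s) r"
   obtain x where x: "x \<in> cm True False" using circle_ne[OF cm_circle] by blast
   have "fst x <= snd x" using st less s x by blast
   thus False using cm_below[OF x] by simp
  qed
  show "~ cm False True \<subseteq> strip l (a + 1) (p * n ^ Suc s) r"
  proof
   assume s: "cm False True \<subseteq> strip l (a + 1) (p * n ^ Suc s) r"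
   have "((real p + 1) / pw 1, (real (n - 1 - p) + 1) / pw 1) \<in> cm False True"
    unfolding cm_def dg_def using corner_in_circ'[of p 1 "n - 1 - p"] by simp
   hence "(real p + 1) / real n * real n <= real p" using st s by fastforce
   thus False using n5 by simp
  qed
 next
  fix k x assume "x \<in> F" "x \<in> strip l (a + 1) (p * n ^ Suc s) r"
  thus "0 <= v k x" using v0 st less by blast
 next
  fix l2 m c assume c: "a + 1 <= c" "c < p * n ^ Suc s" and l2: "l = l2 + m" and hh: "hl l2 (c div n ^ m) (r div n ^ m)"
  define c1 where "c1 = c div W"
  have c1: "c1 < p" unfolding c1_def using c(2) W(1) unfolding W_def by (simp add: div_less_iff_less_mult)
  have l0: "l2 ~= 0" using hh by (intro notI) simp
  \<comment> \<open>Columns with leading digit below p carry no hole of the first level.\<close>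
  have l1: "l2 ~= 1"
  proof
   assume e: "l2 = 1"
   hence "m = Suc s" using l2 l_def by simp
   hence "hdig n p c1" using hh e hole1_iff unfolding c1_def W_def by simp
   thus False using c1 p2 unfolding hdig_def by auto
  qed
  obtain t where t: "l2 = Suc (1 + t)" using l0 l1 by (cases l2; cases "l2 - 1") auto
  have ms: "Suc s = m + 1 + t" using l2 l_def t by simp
  have pw: "n ^ Suc s = n ^ m * n * n ^ t" unfolding ms by (simp add: power_add)
  have "blk l2 (c div n ^ m) (r div n ^ m) \<subseteq> gb (1 + t) (c div n ^ m div n) (r div n ^ m div n)"
   using blk_parent[of "1 + t"] hh unfolding t by blast
  also have "... \<subseteq> gb 1 (c div n ^ m div n div n ^ t) (r div n ^ m div n div n ^ t)" by (rule gbx_nest)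
  also have "c div n ^ m div n div n ^ t = c1" unfolding c1_def W_def pw div_mult2_eq ..
  also have "r div n ^ m div n div n ^ t = n - 1 - p" unfolding rdiv[symmetric] pw div_mult2_eq ..
  finally have sub: "blk l2 (c div n ^ m) (r div n ^ m) \<subseteq> gb 1 c1 (n - 1 - p)" .
  have "v k z >= 0" if "z \<in> F" "z \<in> gb 1 c1 (n - 1 - p)" for k z
  proof (rule v0[OF that(1)])
   have "fst z * real n < real c1 + 1" "real (n - 1 - p) < snd z * real n" using that(2) unfolding gbx_def by auto
   moreover have "real c1 + 1 <= real p" using c1 by linarith
   ultimately have "fst z * real n <= real p" "real (n - 1 - p) < snd z * real n" by linarith+
   thus "fst z <= snd z" by (rule less)
  qed
  moreover have "cm q q' \<inter> gb 1 c1 (n - 1 - p) = {}" for q q'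
  proof (rule ccontr)
   assume "cm q q' \<inter> gb 1 c1 (n - 1 - p) ~= {}"
   then obtain z where z: "z \<in> gs (1 + 0) (dg q) (dg q')" "z \<in> gb 1 c1 (n - 1 - p)" unfolding cm_def circ_def by auto
   have "dg q = c1" using gsq_gbx_idx(1)[OF z] by simp
   thus False using c1 p2 unfolding dg_def by (auto split: if_splits)
  qed
  ultimately show "clear v (cm True False) (cm False True) (blk l2 (c div n ^ m) (r div n ^ m))" using sub by blast
 qed
qed

text \<open>Base n digits of the row: n - 1 - p first, which puts it beside the upper left circle,
  then zeros, which avoid earlier holes, and p last, which together with the last digit of a makes a
  hole. The bound on a makes its leading digit 0.\<close>

lemma hole_target:
 assumes h: "hl l a b" and an: "(a + 1) * n < n ^ l"
 obtains s where "l = Suc (Suc s)" "hl l a ((n - 1 - p) * n ^ Suc s + p)"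
proof -
 have "l ~= 0" using an n5 by (intro notI) simp
 moreover have "l ~= 1" using an by (intro notI) simp
 ultimately obtain s where s: "l = Suc (Suc s)" by (cases l; cases "l - 1") auto
 have e: "n ^ Suc (Suc s) = (n ^ s * n) * n" by simp
 have "(a + 1) * n < (n ^ s * n) * n" using an unfolding s e .
 hence "a + 1 < n ^ s * n" by (simp only: mult_less_cancel2)
 hence "a < n ^ s * n" by simp
 hence ad: "a div n < n ^ s" by (simp add: div_less_iff_less_mult)
 have "cl (1 + s) (0 * n ^ s + a div n) ((n - 1 - p) * n ^ s + 0) \<longleftrightarrow> cl 1 0 (n - 1 - p) & cl s (a div n) 0"
  by (rule cell_compose[OF ad]) simp
 moreover have "cl 1 0 (n - 1 - p)" using hdig_0(1) n5 by (simp add: One_nat_def)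
 ultimately have "cl (Suc s) (a div n) ((n - 1 - p) * n ^ s)" using cell_row0[OF ad] by simp
 moreover have "((n - 1 - p) * n ^ Suc s + p) div n = (n - 1 - p) * n ^ s" "((n - 1 - p) * n ^ Suc s + p) mod n = p"
  using index_split[of "n - 1 - p" s p] p2 by simp_all
 moreover have "hdig n p (a mod n)" using h unfolding s by simp
 ultimately have "hl l a ((n - 1 - p) * n ^ Suc s + p)" unfolding s by (simp del: power_Suc)
 thus ?thesis using that s by blast
qed

text \<open>From the dead hole near the left edge, deadness is carried along its column to the row
  of \<open>hole_target\<close>, upwards after exchanging the coordinates and downwards after a
  quarter turn; then \<open>strip_to_cm\<close> applies. The factor 5 = 3 + 2 keeps the region used
  by \<open>row_dead\<close> where \<open>v\<close> is nonnegative, above the diagonal.\<close>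

lemma left_point_False:
 assumes P: "pot (cm True False) (cm False True) u rho v" and v0: "!!k z. z \<in> F ==> fst z <= snd z ==> 0 <= v k z"
  and vD: "!!k z. z \<in> cm False True ==> v k z = 1/2"
  and h: "hl l a b" and vA: "!!k z. z \<in> cr l a b ==> v k z = 0"
  and an: "5 * (a + 1) * n < n ^ l" and ab: "5 * (a + 1) <= b"
 shows False
proof -
 have ml: "mlim F (cm True False) (cm False True) u rho" using P unfolding pot_def by blast
 have cA: "cr l a b \<in> circles F" by (rule hole_circle[OF h])
 have dA: "dead rho v (cr l a b)"
  unfolding dead_def
 proof
  have "osc (u m) (cr l a b) = 0" for m
   unfolding pot_osc(1)[OF P cA, symmetric] by (rule osc_const) (rule vA)
  hence "(%m. 0) \<longlonglongrightarrow> rho (cr l a b)" using mlim_point[OF ml cA] by simp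
  thus "rho (cr l a b) = 0" using LIMSEQ_unique tendsto_const by blast
  show "\<forall>eps>0. \<exists>\<^sub>F m in sequentially. \<forall>x\<in>cr l a b. v m x <= eps" using vA by (simp add: less_imp_le)
 qed
 have "(a + 1) * n <= 5 * (a + 1) * n" by (intro mult_le_mono1) simp
 hence an': "(a + 1) * n < n ^ l" using an by linarith
 obtain s where s: "l = Suc (Suc s)" and hr: "hl l a ((n - 1 - p) * n ^ Suc s + p)" by (rule hole_target[OF h an'])
 define r where "r = (n - 1 - p) * n ^ Suc s + p"
 have hE: "hl l a r" using hr unfolding r_def .
 have r5: "5 * (a + 1) <= r"
 proof -
  have e: "n ^ Suc (Suc s) = n ^ Suc s * n" by simp
  have "5 * (a + 1) * n < n ^ Suc s * n" using an unfolding s e .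
  hence "5 * (a + 1) < n ^ Suc s" by (simp only: mult_less_cancel2)
  also have "n ^ Suc s = 1 * n ^ Suc s" by simp
  also have "1 * n ^ Suc s <= (n - 1 - p) * n ^ Suc s" using p2 by (intro mult_le_mono1) simp
  finally show ?thesis unfolding r_def by linarith
 qed
 have L: "live v (cm False True)" unfolding live_def using vD by (intro exI[of _ "1/2"]) auto
 have fin: "x <= y" if "x * pw l <= 3 * (real a + 1)" "3 * (real a + 1) <= y * pw l" for x y
 proof -
  have "x * pw l <= y * pw l" using that by linarith
  thus ?thesis by (simp only: mult_le_cancel_right_pos[OF npow_pos])
 qed
 have bN: "b < n ^ l" "r < n ^ l" using hole_bound[OF h] hole_bound[OF hE] by auto
 have dE: "dead rho v (cr l a r)"
 proof -
  consider "b = r" | "b < r" | "r < b" by linarith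
  thus ?thesis
  proof cases
   case 1 thus ?thesis using dA by simp
  next
   case 2
   have P': "pot (cm False True) (cm True False) (%k. u k \<circ> sw) (%E. rho (sw ` E)) (%k. v k \<circ> sw)"
    using pot_qsi[OF qsi_sw P] unfolding sw_cm .
   have dA': "dead (%E. rho (sw ` E)) (%k. v k \<circ> sw) (cr l b a)"
    using dead_img[of "cr l b a" sw "cr l a b" rho v] dA sw_circ[of l b a] by auto
   have "dead (%E. rho (sw ` E)) (%k. v k \<circ> sw) (cr l r a)"
   proof (rule row_dead[OF P' _ _ 2 an' _ _ dA'])
    show "hl l b a" "hl l r a" using h hE hole_swap by blast+
    show "1 <= snd x * real n" if "x \<in> cm False True \<union> cm True False" for x using that cm_snd by blast
    fix k z assume z: "z \<in> F" "snd z * pw l <= 3 * (real a + 1)" "real b - 2 * (real a + 1) <= fst z * pw l"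
    have "real (5 * (a + 1)) <= real b" using ab by (simp only: of_nat_le_iff)
    hence "3 * (real a + 1) <= fst z * pw l" using z(3) by simp
    hence "snd z <= fst z" using fin z(2) by blast
    thus "0 <= (v k \<circ> sw) z" using v0[OF sw_F[OF z(1)]] unfolding sw_def by simp
   qed
   thus ?thesis using dead_img[of "cr l r a" sw "cr l a r" rho v] sw_circ[of l r a] by auto
  next
   case 3
   define T where "T = sw \<circ> flx"
   have qT: "qsi F F T (flx \<circ> sw)" unfolding T_def by (rule qsi_trans[OF qsi_flx qsi_sw])
   have P': "pot (cm True True) (cm False False) (%k. u k \<circ> T) (%E. rho (T ` E)) (%k. v k \<circ> T)"
    using pot_qsi[OF qT P] unfolding image_comp[symmetric] sw_cm flx_cm by simp
   have TC: "T ` cr l (n ^ l - 1 - c) a = cr l a c" if "c < n ^ l" for c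
   proof -
    have "n ^ l - 1 - c < n ^ l" using that by simp
    thus ?thesis unfolding T_def image_comp[symmetric] using that by (simp add: flx_circ sw_circ)
   qed
   define b' r' where "b' = n ^ l - 1 - b" and "r' = n ^ l - 1 - r"
   have br: "b' < r'" unfolding b'_def r'_def using 3 bN by simp
   have dA': "dead (%E. rho (T ` E)) (%k. v k \<circ> T) (cr l b' a)"
    using dead_img[of "cr l b' a" T "cr l a b" rho v] dA TC[OF bN(1)] unfolding b'_def by auto
   have "dead (%E. rho (T ` E)) (%k. v k \<circ> T) (cr l r' a)"
   proof (rule row_dead[OF P' _ _ br an' _ _ dA'])
    show "hl l b' a" "hl l r' a" unfolding b'_def r'_def using hole_flip[OF bN(1)] hole_flip[OF bN(2)] h hE hole_swap by blast+
    show "1 <= snd x * real n" if "x \<in> cm True True \<union> cm False False" for x using that cm_snd by blast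
    fix k z assume z: "z \<in> F" "snd z * pw l <= 3 * (real a + 1)" "fst z * pw l <= real r' + 1 + 2 * (real a + 1)"
    have "real (5 * (a + 1)) <= real r" using r5 by (simp only: of_nat_le_iff)
    hence r5': "5 * (real a + 1) <= real r" by simp
    have "real r' = pw l - 1 - real r" unfolding r'_def using bN(2) by (simp add: of_nat_diff Suc_leI)
    hence "3 * (real a + 1) <= (1 - fst z) * pw l" using z(3) r5' by (simp add: left_diff_distrib)
    hence "snd z <= 1 - fst z" using fin z(2) by blast
    thus "0 <= (v k \<circ> T) z" using v0[OF sw_F[OF flx_F[OF z(1)]]] unfolding T_def sw_def flx_def by simp
   qed
   thus ?thesis using dead_img[of "cr l r' a" T "cr l a r" rho v] TC[OF bN(2)] unfolding r'_def by auto
  qed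
 qed
 show False
  by (rule strip_to_cm[OF P v0 L]) (use hE an' dE in "auto simp: r_def s simp del: power_Suc")
qed

text \<open>Zero digits followed by a hole position: these holes shrink to the corner (0, 0) while
  staying below the diagonal.\<close>

lemma small_hole: "hl (Suc q) (n - 1 - p) p"
 using cell_00[of q] p2 hdig_less[of p] by (simp add: hdig_def)

lemma small_hole_below: "x \<in> cr (Suc q) (n - 1 - p) p ==> snd x < fst x"
 and small_hole_near: "x \<in> cr (Suc q) (n - 1 - p) p ==> dist x (0, 0) <= 2 / pw q"
proof -
 assume x: "x \<in> cr (Suc q) (n - 1 - p) p"
 have g: "real (n - 1 - p) <= fst x * pw (Suc q)" "fst x * pw (Suc q) <= real (n - 1 - p) + 1"
  "real p <= snd x * pw (Suc q)" "snd x * pw (Suc q) <= real p + 1" using x unfolding circ_def gsq_def by auto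
 have "snd x * pw (Suc q) < fst x * pw (Suc q)" using g p_gap by linarith
 thus "snd x < fst x" by (simp only: mult_less_cancel_right_pos[OF npow_pos])
 have pos: "0 <= fst x" "0 <= snd x"
 proof -
  have "0 * pw (Suc q) <= fst x * pw (Suc q)" "0 * pw (Suc q) <= snd x * pw (Suc q)" using g by linarith+
  thus "0 <= fst x" "0 <= snd x" by (simp_all only: mult_le_cancel_right_pos[OF npow_pos])
 qed
 have up: "t <= 1 / pw q" if "t * pw (Suc q) <= real m + 1" "m + 1 <= n" for t m
 proof -
  have "real m + 1 <= real n" using that(2) by linarith
  hence "t * pw (Suc q) <= 1 * real n" using that(1) by linarith
  hence "(t * pw q) * real n <= 1 * real n" by (simp add: mult_ac)
  hence "t * pw q <= 1" using nR(1) by (simp only: mult_le_cancel_right_pos)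
  thus ?thesis by (simp add: pos_le_divide_eq)
 qed
 have "fst x <= 1 / pw q" "snd x <= 1 / pw q" using up[OF g(2)] up[OF g(4)] p2 by auto
 moreover have "dist x (0, 0) <= \<bar>fst x\<bar> + \<bar>snd x\<bar>"
  unfolding dist_prod_def dist_real_def using sqrt_sum_squares_le_sum_abs[of "fst x" "snd x"] by simp
 ultimately have "dist x (0, 0) <= 1 / pw q + 1 / pw q" using pos by simp
 thus "dist x (0, 0) <= 2 / pw q" by simp
qed

lemma OC_F: "OC \<subseteq> F"
 by (rule circles_sub[OF OC_circle])

end

section \<open>Images of the corners\<close>

context carpet_pair begin

lemma semiD:
 assumes "semi f g"
 shows "qsi A.F B.F f g" "f ` A.OC = B.OC" "f ` A.cm True False = B.cm True False" "f ` A.cm False True = B.cm False True"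
 using assms unfolding semi_def by auto

text \<open>Small holes below the diagonal near (0, 0) are mapped close to (0, y0), hence above the
  diagonal. There the two polarizations cancel, so an image hole carries the value 0 and lies close
  to the left edge, against \<open>left_point_False\<close>.\<close>

lemma corner_left:
 assumes S: "semi f g" and P: "f (0, 0) = (0, y0)" and y0: "0 < y0"
 shows False
proof -
 note f = semiD[OF S]
 have h: "homeomorphism A.F B.F f g" by (rule qsi_homeo[OF f(1)])
 have cf: "continuous_on A.F f" and gf: "!!x. x \<in> A.F ==> g (f x) = x" using h unfolding homeomorphism_def by auto
 obtain u rho v where Pt: "B.pot (B.cm True False) (B.cm False True) u rho v"
  and v0: "!!k z. z \<in> B.F ==> fst z <= snd z ==> 0 <= v k z"
  and vz: "!!k z. z \<in> B.F ==> fst z <= snd z ==> snd (g z) < fst (g z) ==> v k z = 0"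
  and vD: "!!k z. z \<in> B.cm False True ==> v k z = 1/2"
  using corner_pot[OF S] by blast
 \<comment> \<open>Closeness to the left edge relative to the height y0 and to 1 / n', as
   \<open>left_point_False\<close> demands through its factors 5.\<close>
 define dl where "dl = min (y0 / 20) (1 / (5 * real n'))"
 have d: "0 < dl" "20 * dl <= y0" "dl * (5 * real n') <= 1"
 proof -
  show "0 < dl" unfolding dl_def using y0 B.nR by simp
  show "20 * dl <= y0" unfolding dl_def by auto
  have "dl <= 1 / (5 * real n')" unfolding dl_def by simp
  thus "dl * (5 * real n') <= 1" using B.nR(1) by (simp add: pos_le_divide_eq)
 qed
 have "(0, 0) \<in> A.OC" unfolding A.OC_iff by simp
 hence o: "(0, 0) \<in> A.F" using A.OC_F by blast
 obtain eta where eta: "0 < eta" "!!x. x \<in> A.F ==> dist x (0, 0) < eta ==> dist (f x) (f (0, 0)) < dl"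
  using cf o d(1) unfolding continuous_on_iff by blast
 have "1 < real n" using A.n5 by simp
 then obtain q where q: "2 / eta < real n ^ q" using real_arch_pow by blast
 define Ej where "Ej = circ n (Suc q) (n - 1 - p) p"
 have cE: "Ej \<in> circles A.F" unfolding Ej_def by (rule A.hole_circle[OF A.small_hole])
 have EO: "Ej ~= A.OC" unfolding Ej_def by (rule A.hole_ne_OC[OF A.small_hole])
 have near: "dist (f x) (0, y0) < dl" if "x \<in> Ej" for x
 proof -
  have "2 < eta * real n ^ q" using q eta(1) by (simp add: pos_divide_less_eq mult.commute)
  hence "2 / real n ^ q < eta" by (simp add: pos_divide_less_eq)
  hence "dist x (0, 0) < eta" using A.small_hole_near[of x q] that unfolding Ej_def by simp
  thus ?thesis using eta(2)[of x] that circles_sub[OF cE] unfolding P by blast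
 qed
 have cfE: "f ` Ej \<in> circles B.F" by (rule img_circle[OF f(1) cE])
 have "f ` Ej ~= B.OC"
 proof
  assume "f ` Ej = B.OC"
  hence "f ` Ej = f ` A.OC" unfolding f(2) .
  thus False using img_inj[OF f(1) cE A.OC_circle] EO by blast
 qed
 then obtain l a b where hA: "B.hl l a b" and Ac: "f ` Ej = circ n' l a b" using B.circle_cases[OF cfE] by blast
 define N where "N = real n' ^ l"
 have N: "0 < N" unfolding N_def by simp
 have nz: "\<bar>fst z\<bar> < dl & \<bar>snd z - y0\<bar> < dl" if "z \<in> f ` Ej" for z
 proof -
  obtain x where x: "x \<in> Ej" "z = f x" using \<open>z \<in> f ` Ej\<close> by blast
  have "\<bar>fst z\<bar> <= dist z (0, y0)" "\<bar>snd z - y0\<bar> <= dist z (0, y0)"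
   using dist_fst_le[of z "(0, y0)"] dist_snd_le[of z "(0, y0)"] unfolding dist_real_def by simp_all
  thus ?thesis using near[OF x(1)] unfolding x(2) by linarith
 qed
 have vA: "v k z = 0" if z: "z \<in> circ n' l a b" for k z
 proof -
  have zf: "z \<in> f ` Ej" using z unfolding Ac .
  then obtain x where x: "x \<in> Ej" "z = f x" by blast
  have "g z = x" using gf[OF subsetD[OF circles_sub[OF cE] x(1)]] x(2) by simp
  hence "snd (g z) < fst (g z)" using A.small_hole_below[of x q] x(1) unfolding Ej_def by simp
  moreover have "fst z <= snd z" using nz[OF zf] d by linarith
  moreover have "z \<in> B.F" using zf circles_sub[OF cfE] by blast
  ultimately show ?thesis using vz by blast
 qed
 have x1: "(real a + 1) / N < dl"
  using nz[of "((real a + 1) / real n' ^ l, (real b + 1) / real n' ^ l)"] B.corner_in_circ'[of a l b] unfolding Ac N_def by simp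
 have y1: "y0 - dl < real b / N"
  using nz[of "(real a / real n' ^ l, real b / real n' ^ l)"] B.corner_in_circ[of a l b] unfolding Ac N_def by (simp add: abs_less_iff)
 have x2: "real a + 1 < dl * N" using x1 N by (simp add: pos_divide_less_eq)
 have y2: "(y0 - dl) * N < real b" using y1 N by (simp add: pos_less_divide_eq)
 have "5 * (real a + 1) * real n' < N"
 proof -
  have "(real a + 1) * (5 * real n') < dl * N * (5 * real n')" using x2 B.nR(1) by (intro mult_strict_right_mono) auto
  also have "... = (dl * (5 * real n')) * N" by simp
  also have "... <= 1 * N" using d(3) N by (intro mult_right_mono) auto
  finally show ?thesis by (simp add: mult_ac)
 qed
 hence "real (5 * (a + 1) * n') < real (n' ^ l)" unfolding N_def by (simp add: add.commute)
 hence an: "5 * (a + 1) * n' < n' ^ l" by (simp only: of_nat_less_iff)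
 have "5 * (real a + 1) <= real b"
 proof -
  have "5 * (dl * N) <= (y0 - dl) * N"
  proof -
   have "5 * dl <= y0 - dl" using d by linarith
   hence "(5 * dl) * N <= (y0 - dl) * N" using N by (intro mult_right_mono) auto
   thus ?thesis by simp
  qed
  thus ?thesis using x2 y2 by argo
 qed
 hence "real (5 * (a + 1)) <= real b" by simp
 hence ab: "5 * (a + 1) <= b" by (simp only: of_nat_le_iff)
 show False by (rule B.left_point_False[OF Pt v0 vD hA vA an ab])
qed

lemma semi_conj:
 assumes S: "semi f g"
 shows "semi (A.asw \<circ> f) (g \<circ> A.asw)" "semi ((A.sw \<circ> f) \<circ> A.sw) (A.sw \<circ> (g \<circ> A.sw))"
proof -
 note f = semiD[OF S]
 show "semi (A.asw \<circ> f) (g \<circ> A.asw)" unfolding semi_def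
 proof (intro conjI)
  show "qsi A.F B.F (A.asw \<circ> f) (g \<circ> A.asw)" by (rule qsi_trans[OF f(1) B.qsi_asw])
 qed (simp_all only: image_comp[symmetric] f B.asw_OC B.asw_cm not_True_eq_False not_False_eq_True)
 show "semi ((A.sw \<circ> f) \<circ> A.sw) (A.sw \<circ> (g \<circ> A.sw))" unfolding semi_def
 using conjI qsi_trans[OF A.qsi_sw qsi_trans[OF f(1) B.qsi_sw]] image_comp[symmetric] f B.sw_OC B.sw_cm A.sw_OC A.sw_cm by metis
qed

lemma OC_img: "qsi A.F B.F f g ==> f ` A.OC = B.OC ==> x \<in> A.OC ==> f x \<in> B.OC"
 by blast

text \<open>An image off the diagonal lies above or below it, and conjugation with the diagonal
  reflection exchanges these cases. Above the diagonal it is on the left or the top edge, and the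
  antidiagonal reflection moves the top edge to the left one.\<close>

lemma corner_semi:
 assumes S: "semi f g"
 shows "f (0, 0) = (0, 0) | f (0, 0) = (1, 1)"
proof (rule ccontr)
 assume neg: "~ ?thesis"
 have main: False if S: "semi f g" and lt: "fst (f (0, 0)) < snd (f (0, 0))" for f g
 proof -
  note f = semiD[OF S]
  have "(0, 0) \<in> A.OC" unfolding A.OC_iff by simp
  hence "f (0, 0) \<in> B.OC" using f(2) by blast
  hence "fst (f (0, 0)) = 0 | snd (f (0, 0)) = 1" using lt unfolding B.OC_iff by auto
  thus False
  proof
   assume "fst (f (0, 0)) = 0"
   thus False using corner_left[OF S, of "snd (f (0, 0))"] lt by (simp add: prod_eq_iff)
  next
   assume "snd (f (0, 0)) = 1"
   thus False using corner_left[OF semi_conj(1)[OF S], of "1 - fst (f (0, 0))"] lt by (simp add: A.asw_def)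
  qed
 qed
 note f = semiD[OF S]
 have "(0, 0) \<in> A.OC" unfolding A.OC_iff by simp
 hence O: "f (0, 0) \<in> B.OC" using f(2) by blast
 have "fst (f (0, 0)) ~= snd (f (0, 0))" using O neg unfolding B.OC_iff by (auto simp: prod_eq_iff)
 then consider "fst (f (0, 0)) < snd (f (0, 0))" | "snd (f (0, 0)) < fst (f (0, 0))" by linarith
 thus False
 proof cases
  case 1 thus False by (rule main[OF S])
 next
  case 2
  show False by (rule main[OF semi_conj(2)[OF S]]) (use 2 in "simp add: A.sw_def")
 qed
qed

lemma normalD:
 assumes "normal f g"
 shows "qsi A.F B.F f g" "f ` A.OC = B.OC" "f ` A.cm s t = B.cm s t"
 using assms unfolding normal_def by auto

lemma normal_semi: "normal f g ==> semi f g"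
 unfolding normal_def semi_def by simp

lemma normal_conj:
 assumes S: "normal f g"
 shows "normal ((A.flx \<circ> f) \<circ> A.flx) (A.flx \<circ> (g \<circ> A.flx))" "normal ((A.yfl \<circ> f) \<circ> A.yfl) (A.yfl \<circ> (g \<circ> A.yfl))"
proof -
 note f = normalD[OF S]
 show "normal ((A.flx \<circ> f) \<circ> A.flx) (A.flx \<circ> (g \<circ> A.flx))" unfolding normal_def
 proof (intro conjI allI)
  show "qsi A.F B.F ((A.flx \<circ> f) \<circ> A.flx) (A.flx \<circ> (g \<circ> A.flx))"
   by (rule qsi_trans[OF A.qsi_flx qsi_trans[OF f(1) B.qsi_flx]])
 qed (simp_all only: image_comp[symmetric] f B.flx_OC B.flx_cm A.flx_OC A.flx_cm not_not)
 show "normal ((A.yfl \<circ> f) \<circ> A.yfl) (A.yfl \<circ> (g \<circ> A.yfl))" unfolding normal_def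
 proof (intro conjI allI)
  show "qsi A.F B.F ((A.yfl \<circ> f) \<circ> A.yfl) (A.yfl \<circ> (g \<circ> A.yfl))"
   by (rule qsi_trans[OF A.qsi_yfl qsi_trans[OF f(1) B.qsi_yfl]])
 qed (simp_all only: image_comp[symmetric] f B.yfl_OC B.yfl_cm A.yfl_OC A.yfl_cm not_not)
qed

lemma corners:
 assumes S: "normal f g"
 shows "f (0, 0) = (0, 0) | f (0, 0) = (1, 1)" "f (1, 1) = (0, 0) | f (1, 1) = (1, 1)"
  "f (1, 0) = (1, 0) | f (1, 0) = (0, 1)" "f (0, 1) = (1, 0) | f (0, 1) = (0, 1)"
proof -
 show "f (0, 0) = (0, 0) | f (0, 0) = (1, 1)" by (rule corner_semi[OF normal_semi[OF S]])
 show "f (1, 0) = (1, 0) | f (1, 0) = (0, 1)"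
  using corner_semi[OF normal_semi[OF normal_conj(1)[OF S]]] by (auto simp: A.flx_def prod_eq_iff)
 show "f (0, 1) = (1, 0) | f (0, 1) = (0, 1)"
  using corner_semi[OF normal_semi[OF normal_conj(2)[OF S]]] by (auto simp: A.yfl_def prod_eq_iff)
 show "f (1, 1) = (0, 0) | f (1, 1) = (1, 1)"
  using corner_semi[OF normal_semi[OF normal_conj(2)[OF normal_conj(1)[OF S]]]] by (auto simp: A.yfl_def A.flx_def prod_eq_iff)
qed

lemma OC_inj:
 assumes S: "normal f g" and e: "f x = f y" and xy: "x \<in> A.OC" "y \<in> A.OC"
 shows "x = y"
 using homeomorphism_apply1[OF qsi_homeo[OF normalD(1)[OF S]]] A.OC_F e xy by (metis subsetD)

lemma corners_cases:
 assumes S: "normal f g"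
 shows "f (0, 0) = (0, 0) & f (1, 1) = (1, 1) | f (0, 0) = (1, 1) & f (1, 1) = (0, 0)"
  "f (0, 1) = (0, 1) & f (1, 0) = (1, 0) | f (0, 1) = (1, 0) & f (1, 0) = (0, 1)"
proof -
 have memc: "(0, 0) \<in> A.OC" "(0, 1) \<in> A.OC" "(1, 0) \<in> A.OC" "(1, 1) \<in> A.OC" unfolding A.OC_iff by auto
 have d: "f (0, 0) ~= f (1, 1)" "f (1, 0) ~= f (0, 1)"
  using OC_inj[OF S _ memc(1,4)] OC_inj[OF S _ memc(3,2)] by (intro notI; simp)+
 show "f (0, 0) = (0, 0) & f (1, 1) = (1, 1) | f (0, 0) = (1, 1) & f (1, 1) = (0, 0)"
  using corners(1,2)[OF S] d(1) by (elim disjE) simp_all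
 show "f (0, 1) = (0, 1) & f (1, 0) = (1, 0) | f (0, 1) = (1, 0) & f (1, 0) = (0, 1)"
  using corners(3,4)[OF S] d(2) by (elim disjE) simp_all
qed

end

section \<open>Images of the sides of the square\<close>

lemma sign_const:
 fixes phi :: "real => real"
 assumes c: "continuous_on {0..1} phi" and nz: "!!t. 0 < t ==> t < 1 ==> phi t ~= 0" and e: "e = 0 | e = 1"
  and t: "0 < t" "t < 1"
 shows "0 < phi e ==> 0 < phi t" "phi e < 0 ==> phi t < 0"
proof -
 have pos: "0 < phi t" if c: "continuous_on {0..1} phi" and nz: "!!t. 0 < t ==> t < 1 ==> phi t ~= 0" and p: "0 < phi e" for phi :: "real => real"
 proof (rule ccontr)
  assume "~ 0 < phi t"
  hence le: "phi t <= 0" by simp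
  have c1: "continuous_on {0..t} phi" "continuous_on {t..1} phi" using continuous_on_subset[OF c] t by auto
  have "\<exists>x. 0 < x & x < 1 & phi x = 0"
  using IVT2'[of phi t 0 0] le p t c1 exI[of _ x] e IVT'[of phi t 0 1] by (smt (verit))
  thus False using nz by blast
 qed
 show "0 < phi e ==> 0 < phi t" by (rule pos[OF c nz])
 show "phi t < 0" if "phi e < 0"
  using pos[of "%t. - phi t"] that continuous_on_minus[OF c] nz by simp
qed

context carpet_pair begin

text \<open>By \<open>corners_cases\<close> the image of an open side avoids the corners and hence,
  within the outer circle, both diagonals. So the signs of fst - snd and of fst + snd - 1 are
  constant along it, each read off at the endpoint where it does not vanish; together they single
  out one side of the square.\<close>

lemma side:
 assumes S: "normal f g" and s: "s = 0 | s = (1::real)"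
 defines "P \<equiv> f (s, 0)" and "Q \<equiv> f (s, 1)"
 assumes PQ: "fst P ~= snd P & fst P + snd P = 1 & fst Q = snd Q & fst Q + snd Q ~= 1 | fst P = snd P & fst P + snd P ~= 1 & fst Q ~= snd Q & fst Q + snd Q = 1"
  and t: "0 < t" "t < 1"
 defines "d1 \<equiv> (if fst P ~= snd P then fst P - snd P else fst Q - snd Q)"
  and "d2 \<equiv> (if fst P ~= snd P then fst Q + snd Q - 1 else fst P + snd P - 1)"
 shows "d1 < 0 ==> d2 < 0 ==> fst (f (s, t)) = 0" "d1 > 0 ==> d2 > 0 ==> fst (f (s, t)) = 1"
  "d1 > 0 ==> d2 < 0 ==> snd (f (s, t)) = 0" "d1 < 0 ==> d2 > 0 ==> snd (f (s, t)) = 1"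
proof -
 note f = normalD[OF S]
 have h: "homeomorphism A.F B.F f g" by (rule qsi_homeo[OF f(1)])
 have cf: "continuous_on A.F f" and gf: "!!x. x \<in> A.F ==> g (f x) = x" using h unfolding homeomorphism_def by auto
 have mem: "(s, t) \<in> A.OC" if "0 <= t" "t <= 1" for t using that s unfolding A.OC_iff by auto
 have memc: "(0, 0) \<in> A.OC" "(0, 1) \<in> A.OC" "(1, 0) \<in> A.OC" "(1, 1) \<in> A.OC" unfolding A.OC_iff by auto
 have cont: "continuous_on {0..1} (%t. f (s, t))"
 proof (rule continuous_on_compose2[OF cf])
  show "continuous_on {0..1} (%t. (s, t))" by (intro continuous_intros)
  show "(%t. (s, t)) ` {0..1} \<subseteq> A.F" using mem A.OC_F by auto
 qed
 note C = corners_cases[OF S]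
 have z1: "fst (f (s, t)) - snd (f (s, t)) ~= 0" and z2: "fst (f (s, t)) + snd (f (s, t)) - 1 ~= 0" if t: "0 < t" "t < 1" for t
 proof -
  have O: "f (s, t) \<in> B.OC" by (rule OC_img[OF f(1) f(2) mem]) (use t in auto)
  have mt: "(s, t) \<in> A.OC" by (rule mem) (use t in auto)
  have nf: "f (s, t) ~= f c" if "c \<in> A.OC" "snd c = 0 | snd c = 1" for c
   using OC_inj[OF S _ mt that(1)] that(2) t by (intro notI) auto
  have nf4: "f (s, t) ~= f (0, 0)" "f (s, t) ~= f (1, 1)" "f (s, t) ~= f (1, 0)" "f (s, t) ~= f (0, 1)"
   by (rule nf; use memc in simp)+
  have "f (s, t) ~= (0, 0) & f (s, t) ~= (1, 1)" using nf4(1,2) C(1) by (elim disjE) auto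
  moreover have "f (s, t) ~= (1, 0) & f (s, t) ~= (0, 1)" using nf4(3,4) C(2) by (elim disjE) auto
  ultimately have "f (s, t) ~= (0, 0)" "f (s, t) ~= (1, 1)" "f (s, t) ~= (1, 0)" "f (s, t) ~= (0, 1)" by simp_all
  thus "fst (f (s, t)) - snd (f (s, t)) ~= 0" "fst (f (s, t)) + snd (f (s, t)) - 1 ~= 0"
   using O unfolding B.OC_iff prod_eq_iff by auto
 qed
 define p1 where "p1 = (%t. fst (f (s, t)) - snd (f (s, t)))"
 define p2 where "p2 = (%t. fst (f (s, t)) + snd (f (s, t)) - 1)"
 have c1: "continuous_on {0..1} p1" and c2: "continuous_on {0..1} p2" unfolding p1_def p2_def by (intro continuous_intros cont)+
 have n1: "!!t. 0 < t ==> t < 1 ==> p1 t ~= 0" and n2: "!!t. 0 < t ==> t < 1 ==> p2 t ~= 0" unfolding p1_def p2_def using z1 z2 by auto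
 have e: "\<exists>e. (e = 0 | e = 1) & d1 = p1 e" "\<exists>e. (e = 0 | e = 1) & d2 = p2 e"
  unfolding d1_def d2_def p1_def p2_def P_def Q_def by auto
 have s1: "0 < d1 ==> 0 < p1 t" "d1 < 0 ==> p1 t < 0" using e(1) sign_const[OF c1 n1 _ t] by auto
 have s2: "0 < d2 ==> 0 < p2 t" "d2 < 0 ==> p2 t < 0" using e(2) sign_const[OF c2 n2 _ t] by auto
 have O: "f (s, t) \<in> B.OC" by (rule OC_img[OF f(1) f(2) mem]) (use t in auto)
 show "d1 < 0 ==> d2 < 0 ==> fst (f (s, t)) = 0" "d1 > 0 ==> d2 > 0 ==> fst (f (s, t)) = 1"
  "d1 > 0 ==> d2 < 0 ==> snd (f (s, t)) = 0" "d1 < 0 ==> d2 > 0 ==> snd (f (s, t)) = 1"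
  using s1 s2 O unfolding p1_def p2_def B.OC_iff by auto
qed

text \<open>A normal map may still exchange opposite corners, so the coordinate vanishing on the
  image of the left side is one of x, y, 1 - x, 1 - y. The last bound holds for all four, since the
  lower left circle has distance at least p' / n' from every side.\<close>

lemma coord_exists:
 assumes S: "normal f g"
 shows "\<exists>psi. tame B.F psi & (\<forall>E\<in>circles B.F. osc psi E = osc fst E) &
   (\<forall>t. 0 < t & t < 1 --> psi (f (0, t)) = 0 & psi (f (1, t)) = 1) & (\<forall>x\<in>B.cm False False. real p' / real n' <= psi x)"
proof -
 have osf: "osc (%x. 1 - k x) E = osc k E" if "tame B.F k" "E \<in> circles B.F" for k E
 proof -
  have t: "tame B.F (%x. 1 - k x)" using tame_affine[OF that(1), of 1 "-1"] by simp
  show ?thesis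
   by (intro antisym osc_lip1 tame_bounded_sub[OF t circles_sub[OF that(2)]] tame_bounded_sub[OF that(1) circles_sub[OF that(2)]]) auto
 qed
 have t4: "tame B.F fst" "tame B.F snd" "tame B.F (%x. 1 - fst x)" "tame B.F (%x. 1 - snd x)"
  using B.tame_coord tame_affine[OF B.tame_coord(1), of 1 "-1"] tame_affine[OF B.tame_coord(2), of 1 "-1"] by simp_all
 have o4: "osc snd E = osc fst E" "osc (%x. 1 - fst x) E = osc fst E" "osc (%x. 1 - snd x) E = osc fst E" if "E \<in> circles B.F" for E
  using B.osc_fst_snd[OF that] osf[OF t4(1) that] osf[OF t4(2) that] by simp_all
 have m4: "real p' / real n' <= fst x" "real p' / real n' <= snd x" "real p' / real n' <= 1 - fst x" "real p' / real n' <= 1 - snd x"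
  if "x \<in> B.cm False False" for x
 proof -
  have g: "real p' <= fst x * real n'" "fst x * real n' <= real p' + 1" "real p' <= snd x * real n'" "snd x * real n' <= real p' + 1"
   using that unfolding B.cm_def B.dg_def circ_def gsq_def by auto
  have "real (2 * p' + 2) < real n'" using B.p2 by (simp only: of_nat_less_iff)
  hence q: "2 * real p' + 2 < real n'" by simp
  have lo: "real p' / real n' <= y" if "real p' <= y * real n'" for y using that B.nR(1) by (simp add: pos_divide_le_eq)
  show "real p' / real n' <= fst x" "real p' / real n' <= snd x" using g by (auto intro: lo)
  have "real p' <= (1 - fst x) * real n'" "real p' <= (1 - snd x) * real n'" using g q unfolding left_diff_distrib by argo+
  thus "real p' / real n' <= 1 - fst x" "real p' / real n' <= 1 - snd x" by (auto intro: lo)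
 qed
 have fin: ?thesis if m: "psi \<in> {fst, snd, %x. 1 - fst x, %x. 1 - snd x}"
  and lr: "!!t. 0 < t ==> t < 1 ==> psi (f (0, t)) = 0 & psi (f (1, t)) = 1" for psi
  by (intro exI[of _ psi] conjI ballI allI impI) (use m lr t4 o4 m4 in auto)
 note sd = side[OF S]
 consider "f (0, 0) = (0, 0)" "f (1, 1) = (1, 1)" "f (0, 1) = (0, 1)" "f (1, 0) = (1, 0)"
  | "f (0, 0) = (0, 0)" "f (1, 1) = (1, 1)" "f (0, 1) = (1, 0)" "f (1, 0) = (0, 1)"
  | "f (0, 0) = (1, 1)" "f (1, 1) = (0, 0)" "f (0, 1) = (0, 1)" "f (1, 0) = (1, 0)"
  | "f (0, 0) = (1, 1)" "f (1, 1) = (0, 0)" "f (0, 1) = (1, 0)" "f (1, 0) = (0, 1)"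
  using corners_cases[OF S] by argo
 thus ?thesis
 proof cases
  case 1 thus ?thesis by (intro fin[of fst]) (simp_all add: sd(1,2))
 next
  case 2 thus ?thesis by (intro fin[of snd]) (simp_all add: sd(3,4))
 next
  case 3 thus ?thesis by (intro fin[of "%x. 1 - snd x"]) (simp_all add: sd(3,4))
 next
  case 4 thus ?thesis by (intro fin[of "%x. 1 - fst x"]) (simp_all add: sd(1,2))
 qed
qed

section \<open>Comparison of the hole sizes\<close>

lemma holes_bij:
 assumes S: "normal f g"
 shows "bij_betw ((`) f) A.holes B.holes"
proof -
 note f = normalD[OF S]
 have b: "bij_betw ((`) f) (circles A.F) (circles B.F)" by (rule circles_bij[OF qsi_homeo[OF f(1)]])
 have i: "inj_on ((`) f) (circles A.F)" and im: "(`) f ` circles A.F = circles B.F" using b unfolding bij_betw_def by auto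
 have "(`) f ` A.holes = (`) f ` circles A.F - (`) f ` {A.OC}"
  unfolding A.holes_def by (rule inj_on_image_set_diff[OF i]) (use A.OC_circle in auto)
 also have "... = B.holes" unfolding im B.holes_def by (simp add: f(2))
 finally show ?thesis unfolding bij_betw_def using inj_on_subset[OF i, of A.holes] unfolding A.holes_def by auto
qed

text \<open>Both \<open>E \<mapsto> side E\<close> and \<open>E \<mapsto> side (f E)\<close> have square sum at most 1, while the line lemma bounds their inner
 product below by 1, so they coincide.\<close>

lemma normal_le:
 assumes S: "normal f g"
 shows "n = n' & p' <= p"
proof -
 note f = normalD[OF S]
 have h: "homeomorphism A.F B.F f g" by (rule qsi_homeo[OF f(1)])
 obtain psi where tpsi: "tame B.F psi" and opsi: "!!E. E \<in> circles B.F ==> osc psi E = osc fst E"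
  and lr: "!!t. 0 < t ==> t < 1 ==> psi (f (0, t)) = 0 & psi (f (1, t)) = 1"
  and cmv: "!!x. x \<in> B.cm False False ==> real p' / real n' <= psi x"
  using coord_exists[OF S] by blast
 define k where "k = psi \<circ> f"
 have tk: "tame A.F k" unfolding k_def by (rule tame_qsi[OF f(1) A.compact_F tpsi])
 have ok: "osc k E = osc fst (f ` E)" if "E \<in> circles A.F" for E
  unfolding k_def osc_comp by (rule opsi[OF img_circle[OF f(1) that]])
 have lpsi: "l2 (circles B.F) (osc psi)" by (rule l2_mono[OF B.l2_side]) (simp add: opsi)
 have lk: "l2 (circles A.F) (osc k)" unfolding k_def by (rule l2_osc_qsi(1)[OF h lpsi])
 have hc: "A.holes \<subseteq> circles A.F" unfolding A.holes_def by blast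
 have lkh: "l2 A.holes (osc k)" by (rule l2_subset[OF lk hc])
 have nk: "ns A.holes (osc k) <= 1"
 proof -
  have "ns A.holes (osc k) = infsum (%E. (osc fst (f ` E))^2) A.holes"
   unfolding ns_def by (rule infsum_cong) (use hc ok in auto)
  also have "... = infsum (%E. (osc fst E)^2) B.holes"
   by (rule infsum_reindex_bij_betw[OF holes_bij[OF S]])
  also have "... <= 1" using B.l2_side_holes(2) unfolding ns_def .
  finally show ?thesis .
 qed
 have OCm: "(0, y) \<in> A.F" "(1, y) \<in> A.F" if "0 < y" "y < 1" for y
 proof -
  have "(0, y) \<in> A.OC" "(1, y) \<in> A.OC" using that unfolding A.OC_iff by auto
  thus "(0, y) \<in> A.F" "(1, y) \<in> A.F" using A.OC_F by blast+
 qed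
 let ?H = "{E \<in> A.holes. E \<subseteq> {real 0 / real n ^ 0 .. real 1 / real n ^ 0} \<times> {real 0 / real n ^ 0 .. (real 0 + 1) / real n ^ 0}}"
 have TH: "?H = A.holes"
  using A.holes_unit by auto
 \<comment> \<open>The line lemma for the whole unit square, as a single row of level 0.\<close>
 have "1 / real n ^ 0 <= infsum (%E. osc fst E * osc k E) ?H"
 proof (rule A.line_lemma[OF tk])
  show "l2 ?H (osc k)"
   unfolding TH by (rule lkh)
  fix y assume "real 0 < y * real n ^ 0" "y * real n ^ 0 < real 0 + 1"
  hence y: "0 < y" "y < 1" by simp_all
  show "(real 0 / real n ^ 0, y) \<in> A.F & (real 1 / real n ^ 0, y) \<in> A.F & 1 <= k (real 1 / real n ^ 0, y) - k (real 0 / real n ^ 0, y)"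
   using OCm[OF y] lr[OF y] unfolding k_def by simp
 qed auto
 hence one: "1 <= infsum (%E. osc fst E * osc k E) A.holes" unfolding TH by simp
 \<comment> \<open>The squared distance of the two vectors of sides is at most 1 - 2 + 1 =
   0.\<close>
 have eqs: "osc k E = osc fst E" if E: "E \<in> A.holes" for E
 proof -
  have l1: "l2 A.holes (osc fst)" by (rule A.l2_side_holes(1))
  have lm: "l2 A.holes (%E. - 1 * osc k E)" by (rule l2_cmult[OF lkh])
  have "ns A.holes (%E. osc fst E + - 1 * osc k E) = ns A.holes (osc fst) + 2 * infsum (%E. osc fst E * (- 1 * osc k E)) A.holes + ns A.holes (%E. - 1 * osc k E)"
   by (rule ns_add_expand[OF l1 lm])
  also have "infsum (%E. osc fst E * (- 1 * osc k E)) A.holes = - infsum (%E. osc fst E * osc k E) A.holes"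
   by (simp add: infsum_uminus)
  also have "ns A.holes (%E. - 1 * osc k E) = ns A.holes (osc k)" unfolding ns_cmult by simp
  finally have "ns A.holes (%E. osc fst E + - 1 * osc k E) <= 0" using one nk A.l2_side_holes(2) by linarith
  hence "(osc fst E + - 1 * osc k E)^2 <= 0" using point_le_ns[OF l2_add[OF l1 lm] E] by linarith
  thus ?thesis by simp
 qed
 have cmh: "A.cm False False \<in> A.holes" unfolding A.holes_def using A.cm_circle A.cm_OC by blast
 have "osc fst (B.cm False False) = osc fst (A.cm False False)"
  using eqs[OF cmh] ok[OF A.cm_circle[of False False]] unfolding f(3) by simp
 hence "1 / real n' = 1 / real n" unfolding A.cm_def B.cm_def A.osc_circ(1) B.osc_circ(1) by simp
 hence nn: "n = n'" using A.n5 B.n5 by simp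
 \<comment> \<open>The row between the left side and the lower left circle. Across it k grows by at
   least p' / n'; as both sides of each hole agree, the sum from the line lemma is a sum of areas,
   at most the area (p / n) * (1 / n) of the row.\<close>
 let ?T = "{E \<in> A.holes. E \<subseteq> {real 0 / real n ^ 1 .. real p / real n ^ 1} \<times> {real p / real n ^ 1 .. (real p + 1) / real n ^ 1}}"
 define T where "T = ?T"
 have TH': "T \<subseteq> A.holes" unfolding T_def by blast
 have lT: "l2 T (osc k)" by (rule l2_subset[OF lkh TH'])
 have "(real p' / real n') / real n ^ 1 <= infsum (%E. osc fst E * osc k E) T"
  unfolding T_def
 proof (rule A.line_lemma[OF tk])
  show "l2 ?T (osc k)"
   using lT unfolding T_def .
  show "p < n ^ 1" "p <= n ^ 1" "0 <= p" using A.p2 by auto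
  fix c assume c: "0 <= c" "c < p"
  hence "~ hdig n p c" "c < n" using A.p2 unfolding hdig_def by auto
  thus "A.cl 1 c p | A.hl 1 c p" using A.p2 by (simp add: One_nat_def)
 next
  fix y assume y: "real p < y * real n ^ 1" "y * real n ^ 1 < real p + 1"
  have pn: "p < n ^ 1" using A.p2 by simp
  have y01: "0 < y" "y < 1" using A.row_unit[OF pn y] by auto
  have "(real p / real n ^ 1, y) \<in> circ n 1 p p" unfolding circ_def gsq_def gbx_def using y A.nR by simp
  hence c: "(real p / real n ^ 1, y) \<in> A.cm False False" unfolding A.cm_def A.dg_def by simp
  hence "f (real p / real n ^ 1, y) \<in> B.cm False False" using f(3)[of False False] by blast
  hence "real p' / real n' <= k (real p / real n ^ 1, y)" unfolding k_def using cmv by simp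
  moreover have "k (real 0 / real n ^ 1, y) = 0" unfolding k_def using lr[OF y01] by simp
  ultimately show "(real 0 / real n ^ 1, y) \<in> A.F & (real p / real n ^ 1, y) \<in> A.F &
    real p' / real n' <= k (real p / real n ^ 1, y) - k (real 0 / real n ^ 1, y)"
   using OCm(1)[OF y01] c A.cm_sub by auto
 qed
 also have "... = ns T (osc fst)" unfolding ns_def
  by (rule infsum_cong) (use TH' eqs in "auto simp: power2_eq_square")
 also have "... <= (real p / real n ^ 1 - real 0 / real n ^ 1) * ((real p + 1) / real n ^ 1 - real p / real n ^ 1)"
 proof (rule ns_le[OF l2_subset[OF A.l2_side_holes(1) TH']])
  fix U assume U: "finite U" "U \<subseteq> T"
  show "(\<Sum>E\<in>U. (osc fst E)^2) <= (real p / real n ^ 1 - real 0 / real n ^ 1) * ((real p + 1) / real n ^ 1 - real p / real n ^ 1)"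
   by (rule A.area_bound[OF U(1)]) (use U(2) A.nR in "auto simp: T_def divide_right_mono")
 qed
 also have "... = (real p / real n) * (1 / real n)" by (simp add: diff_divide_distrib[symmetric])
 finally have "real p' * (1 / (real n * real n)) <= real p * (1 / (real n * real n))" unfolding nn[symmetric] by simp
 moreover have "0 < 1 / (real n * real n)" using A.nR by simp
 ultimately have "real p' <= real p" by (simp only: mult_le_cancel_right_pos)
 thus ?thesis using nn by simp
qed

lemma normal_sym:
 assumes S: "normal f g"
 shows "carpet_pair.normal n' p' n p g f"
proof -
 interpret I: carpet_pair n' p' n p by unfold_locales
 note f = normalD[OF S]
 have q: "qsi B.F A.F g f" by (rule qsi_sym[OF f(1)])
 have "g ` f ` M = M" if "M \<subseteq> A.F" for M by (rule homeomorphism_image_inv[OF qsi_homeo[OF f(1)] that])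
 hence "g ` B.OC = A.OC" "!!s t. g ` B.cm s t = A.cm s t" using f(2,3) A.OC_F A.cm_sub by metis+
 thus ?thesis unfolding I.normal_def using q by blast
qed

end

theorem theorem3:
 fixes n n' p p' :: nat
 assumes "n \<ge> 5" and "n' \<ge> 5"
  and "1 \<le> p" and "real p < real n / 2 - 1"
  and "1 \<le> p'" and "real p' < real n' / 2 - 1"
 shows "quasisymmetrically_equivalent (carpet n p) (carpet n' p') \<longleftrightarrow> (n, p) = (n', p')"
proof
 have "2 * p + 2 < n" "2 * p' + 2 < n'" using assms(4,6) by linarith+
 then interpret carpet_pair n p n' p' using assms by unfold_locales auto
 interpret I: carpet_pair n' p' n p by unfold_locales
 assume "quasisymmetrically_equivalent (carpet n p) (carpet n' p')"
 then obtain f g where f: "qsi (carpet n p) (carpet n' p') f g"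
  unfolding quasisymmetrically_equivalent_def using quasisymmetric_imp_qsi by blast
 \<comment> \<open>\<open>normal_exists\<close> requires \<open>m0\<close> of the target to be at
   most \<open>m0\<close> of the source; this holds in one of the two directions, and normal maps
   can be inverted.\<close>
 have "\<exists>f g. normal f g"
 using normal_exists[OF f] I.normal_exists[OF qsi_sym[OF f]] I.normal_sym by force
 then obtain f g where N: "normal f g" by blast
 have "n = n' & p' <= p" by (rule normal_le[OF N])
 moreover have "n' = n & p <= p'" by (rule I.normal_le[OF normal_sym[OF N]])
 ultimately show "(n, p) = (n', p')" by simp
next
 assume e: "(n, p) = (n', p')"
 have "homeomorphism X X (%x. x) (%x. x)" for X :: "'a::metric_space set" by (simp add: homeomorphism_def)
 hence "quasisymmetric (carpet n p) (carpet n p) (%x. x)"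
  unfolding quasisymmetric_def by (intro conjI exI[of _ "%x. x"]) (simp_all add: homeomorphism_def)
 thus "quasisymmetrically_equivalent (carpet n p) (carpet n' p')"
  unfolding quasisymmetrically_equivalent_def using e by auto
qed

end
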